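(* Let $k$ be a field, $H$ a Hopf algebra over $k$ with bijective antipode $S$, $A$ an $H$-module algebra over $k$, and $B=A\# H$ the smash product. Let $\mathcal{D}=(A\otimes A^{op})\,\delta(H)$, a subalgebra of $B^e=B\otimes B^{op}$, where $\delta:H\to H\otimes H^{op}$ is given by $\delta(h)=h_1\otimes S(h_2)$. Let $M$ be a $B$-bimodule. Then $$\mathrm{HH}^*(B,M)\cong \mathrm{Ext}^*_{\mathcal{D}}(A,M)$$ as graded vector spaces.
   Context: $\otimes=\otimes_k$, and Sweedler notation is $\Delta(h)=h_1\otimes h_2$. $A$ is an $H$-module algebra: $A$ is an $H$-module with action $h\otimes a\mapsto {}^h a$ satisfying ${}^h(ab)=({}^{h_1}a)({}^{h_2}b)$ and ${}^h1=\varepsilon(h)1$. The smash product $B=A\# H$ is $A\otimes H$ as a vector space with multiplication $(a\otimes h)(b\otimes l)=a({}^{h_1}b)\otimes h_2l$; one writes $ah$ for $a\otimes h$, and $A$, $H$ are regarded as subalgebras of $B$. Then $\mathcal{D}$ is the set of sums of products in $B^e$ of elements of $A\otimes A^{op}$ with elements of $\delta(H)$; it is closed under multiplication. $B$-bimodules are identified with left $B^e$-modules, and $M$ is a $\mathcal{D}$-module by restriction. $A$ is a $\mathcal{D}$-module under left and right multiplication inside $B$, i.e. $b\otimes c\in\mathcal{D}$ acts by $a\mapsto bac$; in particular $\delta(h)$ acts by $a\mapsto h_1aS(h_2)={}^ha\in A$. The Hochschild cohomology is $\mathrm{HH}^*(B,M):=\mathrm{Ext}^*_{B^e}(B,M)$.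 *)

theory Defs
  imports "HOL-Algebra.Module" "HOL-Algebra.QuotRing"
begin

section \<open>Modules, quotients and free modules\<close>

text \<open>
  Modules over rings that need not be commutative are left modules. They are represented by the record
  \<^type>\<open>module\<close>; where only the module structure matters, the fields \<open>mult\<close> and \<open>one\<close> are
  \<^const>\<open>undefined\<close>.
\<close>

definition module_hom :: "('r, 'x) ring_scheme \<Rightarrow> ('r, 'm, 'y) module_scheme \<Rightarrow>
    ('r, 'n, 'z) module_scheme \<Rightarrow> ('m \<Rightarrow> 'n) set"
  where "module_hom R M N = {f \<in> carrier M \<rightarrow> carrier N.
     (\<forall>x\<in>carrier M. \<forall>y\<in>carrier M. f (x \<oplus>\<^bsub>M\<^esub> y) = f x \<oplus>\<^bsub>N\<^esub> f y) \<and>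
     (\<forall>r\<in>carrier R. \<forall>x\<in>carrier M. f (r \<odot>\<^bsub>M\<^esub> x) = r \<odot>\<^bsub>N\<^esub> f x)}"

definition is_module_iso :: "('r, 'x) ring_scheme \<Rightarrow> ('r, 'm, 'y) module_scheme \<Rightarrow>
    ('r, 'n, 'z) module_scheme \<Rightarrow> bool"
  where "is_module_iso R M N \<longleftrightarrow> (\<exists>f\<in>module_hom R M N. bij_betw f (carrier M) (carrier N))"

definition quot_module :: "('r, 'm, 'y) module_scheme \<Rightarrow> 'm set \<Rightarrow> ('r, 'm set) module"
  where "quot_module M N =
    \<lparr>carrier = a_rcosets\<^bsub>M\<^esub> N, mult = undefined, one = undefined, zero = N, add = set_add M,
     smult = (\<lambda>r X. \<Union>x\<in>X. N +>\<^bsub>M\<^esub> (r \<odot>\<^bsub>M\<^esub> x))\<rparr>"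

definition gen_submodule :: "('r, 'x) ring_scheme \<Rightarrow> ('r, 'm, 'y) module_scheme \<Rightarrow> 'm set \<Rightarrow> 'm set"
  where "gen_submodule R M S = \<Inter>{N. submodule N R M \<and> S \<subseteq> N}"

definition free_module :: "('r, 'x) ring_scheme \<Rightarrow> 'i set \<Rightarrow> ('r, 'i \<Rightarrow> 'r) module"
  where "free_module R X =
    \<lparr>carrier = {f \<in> UNIV \<rightarrow> carrier R. finite {x. f x \<noteq> \<zero>\<^bsub>R\<^esub>} \<and> {x. f x \<noteq> \<zero>\<^bsub>R\<^esub>} \<subseteq> X},
     mult = undefined, one = undefined,
     zero = (\<lambda>x. \<zero>\<^bsub>R\<^esub>), add = (\<lambda>f g x. f x \<oplus>\<^bsub>R\<^esub> g x), smult = (\<lambda>r f x. r \<otimes>\<^bsub>R\<^esub> f x)\<rparr>"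

definition free_gen :: "('r, 'x) ring_scheme \<Rightarrow> 'i \<Rightarrow> 'i \<Rightarrow> 'r"
  where "free_gen R x = (\<lambda>y. if y = x then \<one>\<^bsub>R\<^esub> else \<zero>\<^bsub>R\<^esub>)"

text \<open>The linear extension to a free module of a map \<open>b\<close> defined on its generators.\<close>

definition free_ext :: "('r, 'x) ring_scheme \<Rightarrow> ('r, 'm, 'y) module_scheme \<Rightarrow> ('i \<Rightarrow> 'm) \<Rightarrow>
    ('i \<Rightarrow> 'r) \<Rightarrow> 'm"
  where "free_ext R M b f = (\<Oplus>\<^bsub>M\<^esub>x\<in>{x. f x \<noteq> \<zero>\<^bsub>R\<^esub>}. f x \<odot>\<^bsub>M\<^esub> b x)"


section \<open>Tensor products over the base field\<close>

type_synonym ('k, 'v, 'w) tensor = "('v \<times> 'w \<Rightarrow> 'k) set"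

definition tensor_rels :: "'k ring \<Rightarrow> ('k, 'v) module \<Rightarrow> ('k, 'w) module \<Rightarrow> ('v \<times> 'w \<Rightarrow> 'k) set"
  where "tensor_rels K V W =
    (let F = free_module K (carrier V \<times> carrier W); e = (\<lambda>v w. free_gen K (v, w)) in
      {e (v \<oplus>\<^bsub>V\<^esub> v') w \<ominus>\<^bsub>F\<^esub> (e v w \<oplus>\<^bsub>F\<^esub> e v' w) | v v' w.
         v \<in> carrier V \<and> v' \<in> carrier V \<and> w \<in> carrier W} \<union>
      {e v (w \<oplus>\<^bsub>W\<^esub> w') \<ominus>\<^bsub>F\<^esub> (e v w \<oplus>\<^bsub>F\<^esub> e v w') | v w w'.
         v \<in> carrier V \<and> w \<in> carrier W \<and> w' \<in> carrier W} \<union>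
      {e (c \<odot>\<^bsub>V\<^esub> v) w \<ominus>\<^bsub>F\<^esub> c \<odot>\<^bsub>F\<^esub> e v w | c v w.
         c \<in> carrier K \<and> v \<in> carrier V \<and> w \<in> carrier W} \<union>
      {e v (c \<odot>\<^bsub>W\<^esub> w) \<ominus>\<^bsub>F\<^esub> c \<odot>\<^bsub>F\<^esub> e v w | c v w.
         c \<in> carrier K \<and> v \<in> carrier V \<and> w \<in> carrier W})"

definition tensor_kernel :: "'k ring \<Rightarrow> ('k, 'v) module \<Rightarrow> ('k, 'w) module \<Rightarrow> ('v \<times> 'w \<Rightarrow> 'k) set"
  where "tensor_kernel K V W =
    gen_submodule K (free_module K (carrier V \<times> carrier W)) (tensor_rels K V W)"

definition tensor_space :: "'k ring \<Rightarrow> ('k, 'v) module \<Rightarrow> ('k, 'w) module \<Rightarrow>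
    ('k, ('k, 'v, 'w) tensor) module"
  where "tensor_space K V W =
    quot_module (free_module K (carrier V \<times> carrier W)) (tensor_kernel K V W)"

text \<open>The pure tensor of \<open>v\<close> and \<open>w\<close>.\<close>

definition pure_tensor :: "'k ring \<Rightarrow> ('k, 'v) module \<Rightarrow> ('k, 'w) module \<Rightarrow> 'v \<Rightarrow> 'w \<Rightarrow>
    ('k, 'v, 'w) tensor"
  where "pure_tensor K V W v w =
    tensor_kernel K V W +>\<^bsub>free_module K (carrier V \<times> carrier W)\<^esub> free_gen K (v, w)"

text \<open>
  The linear map out of the tensor product of \<open>V\<close> and \<open>W\<close> induced by a \<open>K\<close>-bilinear map \<open>\<beta>\<close> into \<open>U\<close>;
  it is only meaningful for bilinear \<open>\<beta>\<close>. A Sweedler expression such as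
  \<open>h\<^sub>1 x \<otimes> y h\<^sub>2\<close> is such an induced map, applied to the comultiplication of \<open>h\<close>.
\<close>

definition tensor_lift :: "'k ring \<Rightarrow> ('k, 'v) module \<Rightarrow> ('k, 'w) module \<Rightarrow> ('k, 'u) module \<Rightarrow>
    ('v \<Rightarrow> 'w \<Rightarrow> 'u) \<Rightarrow> ('k, 'v, 'w) tensor \<Rightarrow> 'u"
  where "tensor_lift K V W U \<beta> t = the_elem (free_ext K U (\<lambda>(v, w). \<beta> v w) ` t)"

text \<open>The tensor product of two algebras, with componentwise multiplication.\<close>

definition tensor_alg :: "'k ring \<Rightarrow> ('k, 'v) module \<Rightarrow> ('k, 'w) module \<Rightarrow>
    ('k, ('k, 'v, 'w) tensor) module"
  where "tensor_alg K V W = (tensor_space K V W)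
    \<lparr>mult := (\<lambda>s t. tensor_lift K V W (tensor_space K V W) (\<lambda>v w.
                tensor_lift K V W (tensor_space K V W) (\<lambda>v' w'.
                  pure_tensor K V W (v \<otimes>\<^bsub>V\<^esub> v') (w \<otimes>\<^bsub>W\<^esub> w')) t) s),
     one := pure_tensor K V W \<one>\<^bsub>V\<^esub> \<one>\<^bsub>W\<^esub>\<rparr>"

text \<open>The tensor product of two linear maps.\<close>

definition tensor_map :: "'k ring \<Rightarrow> ('k, 'v) module \<Rightarrow> ('k, 'w) module \<Rightarrow>
    ('k, 'v2) module \<Rightarrow> ('k, 'w2) module \<Rightarrow> ('v \<Rightarrow> 'v2) \<Rightarrow> ('w \<Rightarrow> 'w2) \<Rightarrow>
    ('k, 'v, 'w) tensor \<Rightarrow> ('k, 'v2, 'w2) tensor"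
  where "tensor_map K V W V' W' f g =
    tensor_lift K V W (tensor_space K V' W') (\<lambda>v w. pure_tensor K V' W' (f v) (g w))"

text \<open>The associativity map \<open>(U \<otimes> V) \<otimes> W \<rightarrow> U \<otimes> (V \<otimes> W)\<close>.\<close>

definition tensor_assoc :: "'k ring \<Rightarrow> ('k, 'u) module \<Rightarrow> ('k, 'v) module \<Rightarrow> ('k, 'w) module \<Rightarrow>
    ('k, ('k, 'u, 'v) tensor, 'w) tensor \<Rightarrow> ('k, 'u, ('k, 'v, 'w) tensor) tensor"
  where "tensor_assoc K U V W =
    (let T = tensor_space K U (tensor_space K V W) in
      tensor_lift K (tensor_space K U V) W T (\<lambda>s w.
        tensor_lift K U V T (\<lambda>u v.
          pure_tensor K U (tensor_space K V W) u (pure_tensor K V W v w)) s))"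


section \<open>Algebras, Hopf algebras, module algebras\<close>

locale assoc_algebra = module K A + A?: ring A
  for K :: "'k ring" and A :: "('k, 'a) module" +
  assumes smult_mult_left: "\<lbrakk>c \<in> carrier K; x \<in> carrier A; y \<in> carrier A\<rbrakk> \<Longrightarrow>
      (c \<odot>\<^bsub>A\<^esub> x) \<otimes>\<^bsub>A\<^esub> y = c \<odot>\<^bsub>A\<^esub> (x \<otimes>\<^bsub>A\<^esub> y)"
    and smult_mult_right: "\<lbrakk>c \<in> carrier K; x \<in> carrier A; y \<in> carrier A\<rbrakk> \<Longrightarrow>
      x \<otimes>\<^bsub>A\<^esub> (c \<odot>\<^bsub>A\<^esub> y) = c \<odot>\<^bsub>A\<^esub> (x \<otimes>\<^bsub>A\<^esub> y)"

definition op_alg :: "('k, 'a) module \<Rightarrow> ('k, 'a) module"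
  where "op_alg A = A\<lparr>mult := (\<lambda>x y. y \<otimes>\<^bsub>A\<^esub> x)\<rparr>"

definition env_alg :: "'k ring \<Rightarrow> ('k, 'a) module \<Rightarrow> ('k, ('k, 'a, 'a) tensor) module"
  where "env_alg K A = tensor_alg K A (op_alg A)"

locale hopf_algebra = assoc_algebra K H
  for K :: "'k ring" and H :: "('k, 'h) module"
    and \<Delta> :: "'h \<Rightarrow> ('k, 'h, 'h) tensor" and \<epsilon> :: "'h \<Rightarrow> 'k" and S :: "'h \<Rightarrow> 'h" +
  assumes comult_linear: "\<Delta> \<in> module_hom K H (tensor_space K H H)"
    and comult_ring_hom: "\<Delta> \<in> ring_hom H (tensor_alg K H H)"
    and counit_linear: "\<lbrakk>c \<in> carrier K; x \<in> carrier H\<rbrakk> \<Longrightarrow> \<epsilon> (c \<odot>\<^bsub>H\<^esub> x) = c \<otimes>\<^bsub>K\<^esub> \<epsilon> x"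
    and counit_ring_hom: "\<epsilon> \<in> ring_hom H K"
    and antipode_linear: "S \<in> module_hom K H H"
    and coassoc: "x \<in> carrier H \<Longrightarrow>
      tensor_assoc K H H H (tensor_map K H H (tensor_space K H H) H \<Delta> (\<lambda>y. y) (\<Delta> x)) =
      tensor_map K H H H (tensor_space K H H) (\<lambda>y. y) \<Delta> (\<Delta> x)"
    and counit_left: "x \<in> carrier H \<Longrightarrow> tensor_lift K H H H (\<lambda>y z. \<epsilon> y \<odot>\<^bsub>H\<^esub> z) (\<Delta> x) = x"
    and counit_right: "x \<in> carrier H \<Longrightarrow> tensor_lift K H H H (\<lambda>y z. \<epsilon> z \<odot>\<^bsub>H\<^esub> y) (\<Delta> x) = x"
    and antipode_left: "x \<in> carrier H \<Longrightarrow>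
      tensor_lift K H H H (\<lambda>y z. S y \<otimes>\<^bsub>H\<^esub> z) (\<Delta> x) = \<epsilon> x \<odot>\<^bsub>H\<^esub> \<one>\<^bsub>H\<^esub>"
    and antipode_right: "x \<in> carrier H \<Longrightarrow>
      tensor_lift K H H H (\<lambda>y z. y \<otimes>\<^bsub>H\<^esub> S z) (\<Delta> x) = \<epsilon> x \<odot>\<^bsub>H\<^esub> \<one>\<^bsub>H\<^esub>"

locale module_algebra = H: hopf_algebra K H \<Delta> \<epsilon> S + A: assoc_algebra K A
  for K :: "'k ring" and H :: "('k, 'h) module"
    and \<Delta> :: "'h \<Rightarrow> ('k, 'h, 'h) tensor" and \<epsilon> :: "'h \<Rightarrow> 'k" and S :: "'h \<Rightarrow> 'h"
    and A :: "('k, 'a) module" and act :: "'h \<Rightarrow> 'a \<Rightarrow> 'a" +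
  assumes act_linear: "h \<in> carrier H \<Longrightarrow> act h \<in> module_hom K A A"
    and act_add: "\<lbrakk>h \<in> carrier H; l \<in> carrier H; a \<in> carrier A\<rbrakk> \<Longrightarrow>
      act (h \<oplus>\<^bsub>H\<^esub> l) a = act h a \<oplus>\<^bsub>A\<^esub> act l a"
    and act_smult: "\<lbrakk>c \<in> carrier K; h \<in> carrier H; a \<in> carrier A\<rbrakk> \<Longrightarrow>
      act (c \<odot>\<^bsub>H\<^esub> h) a = c \<odot>\<^bsub>A\<^esub> act h a"
    and act_mult: "\<lbrakk>h \<in> carrier H; l \<in> carrier H; a \<in> carrier A\<rbrakk> \<Longrightarrow>
      act (h \<otimes>\<^bsub>H\<^esub> l) a = act h (act l a)"
    and act_one: "a \<in> carrier A \<Longrightarrow> act \<one>\<^bsub>H\<^esub> a = a"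
    and act_on_mult: "\<lbrakk>h \<in> carrier H; a \<in> carrier A; b \<in> carrier A\<rbrakk> \<Longrightarrow>
      act h (a \<otimes>\<^bsub>A\<^esub> b) = tensor_lift K H H A (\<lambda>h\<^sub>1 h\<^sub>2. act h\<^sub>1 a \<otimes>\<^bsub>A\<^esub> act h\<^sub>2 b) (\<Delta> h)"
    and act_on_one: "h \<in> carrier H \<Longrightarrow> act h \<one>\<^bsub>A\<^esub> = \<epsilon> h \<odot>\<^bsub>A\<^esub> \<one>\<^bsub>A\<^esub>"

text \<open>The smash product, \<open>(a \<otimes> h)(b \<otimes> l) = a (h\<^sub>1 b) \<otimes> h\<^sub>2 l\<close>.\<close>

definition smash :: "'k ring \<Rightarrow> ('k, 'h) module \<Rightarrow> ('h \<Rightarrow> ('k, 'h, 'h) tensor) \<Rightarrow>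
    ('k, 'a) module \<Rightarrow> ('h \<Rightarrow> 'a \<Rightarrow> 'a) \<Rightarrow> ('k, ('k, 'a, 'h) tensor) module"
  where "smash K H \<Delta> A act =
    (let T = tensor_space K A H in
      T\<lparr>mult := (\<lambda>s t.
           tensor_lift K A H T (\<lambda>a h.
             tensor_lift K A H T (\<lambda>b l.
               tensor_lift K H H T (\<lambda>h\<^sub>1 h\<^sub>2.
                 pure_tensor K A H (a \<otimes>\<^bsub>A\<^esub> act h\<^sub>1 b) (h\<^sub>2 \<otimes>\<^bsub>H\<^esub> l)) (\<Delta> h)) t) s),
        one := pure_tensor K A H \<one>\<^bsub>A\<^esub> \<one>\<^bsub>H\<^esub>\<rparr>)"


section \<open>Bimodules\<close>

text \<open>Bimodules over a \<open>K\<close>-algebra; \<open>K\<close> acts in the same way from both sides.\<close>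

locale bimodule = B: assoc_algebra K B + module K M
  for K :: "'k ring" and B :: "('k, 'b) module" and M :: "('k, 'm) module"
    and lact :: "'b \<Rightarrow> 'm \<Rightarrow> 'm" and ract :: "'m \<Rightarrow> 'b \<Rightarrow> 'm" +
  assumes lact_linear: "b \<in> carrier B \<Longrightarrow> lact b \<in> module_hom K M M"
    and lact_linear_scalar: "m \<in> carrier M \<Longrightarrow> (\<lambda>b. lact b m) \<in> module_hom K B M"
    and lact_mult: "\<lbrakk>b \<in> carrier B; c \<in> carrier B; m \<in> carrier M\<rbrakk> \<Longrightarrow>
      lact (b \<otimes>\<^bsub>B\<^esub> c) m = lact b (lact c m)"
    and lact_one: "m \<in> carrier M \<Longrightarrow> lact \<one>\<^bsub>B\<^esub> m = m"
    and ract_linear: "b \<in> carrier B \<Longrightarrow> (\<lambda>m. ract m b) \<in> module_hom K M M"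
    and ract_linear_scalar: "m \<in> carrier M \<Longrightarrow> ract m \<in> module_hom K B M"
    and ract_mult: "\<lbrakk>b \<in> carrier B; c \<in> carrier B; m \<in> carrier M\<rbrakk> \<Longrightarrow>
      ract m (b \<otimes>\<^bsub>B\<^esub> c) = ract (ract m b) c"
    and ract_one: "m \<in> carrier M \<Longrightarrow> ract m \<one>\<^bsub>B\<^esub> = m"
    and lact_ract: "\<lbrakk>b \<in> carrier B; c \<in> carrier B; m \<in> carrier M\<rbrakk> \<Longrightarrow>
      ract (lact b m) c = lact b (ract m c)"

text \<open>A \<open>B\<close>-bimodule as a left module over the enveloping algebra: \<open>(b \<otimes> c) m = b m c\<close>.\<close>

definition env_module :: "'k ring \<Rightarrow> ('k, 'b) module \<Rightarrow> ('k, 'm) module \<Rightarrow>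
    ('b \<Rightarrow> 'm \<Rightarrow> 'm) \<Rightarrow> ('m \<Rightarrow> 'b \<Rightarrow> 'm) \<Rightarrow> (('k, 'b, 'b) tensor, 'm) module"
  where "env_module K B M lact ract =
    \<lparr>carrier = carrier M, mult = undefined, one = undefined, zero = \<zero>\<^bsub>M\<^esub>, add = add M,
     smult = (\<lambda>t m. tensor_lift K B (op_alg B) M (\<lambda>b c. lact b (ract m c)) t)\<rparr>"

text \<open>The algebra itself as a bimodule under left and right multiplication.\<close>

definition regular_env_module :: "'k ring \<Rightarrow> ('k, 'b) module \<Rightarrow> (('k, 'b, 'b) tensor, 'b) module"
  where "regular_env_module K B = env_module K B B (mult B) (mult B)"


section \<open>Ext\<close>

text \<open>
  \<open>Ext\<^sup>n\<^bsub>R\<^esub>(M, N)\<close> is the cohomology of \<open>Hom\<^bsub>R\<^esub>(F\<^sub>\<bullet>, N)\<close> for a functorial free resolution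
  \<open>F\<^sub>\<bullet>\<close> of \<open>M\<close>, built by repeatedly covering kernels with free modules. The generators of \<open>F\<^sub>0\<close> are
  \<open>Gen m\<close> for all elements \<open>m\<close> of \<open>M\<close>, mapped to \<open>m\<close>. The generators of \<open>F\<^sub>n\<^sub>+\<^sub>1\<close> are \<open>Rel xs\<close> for all
  formal linear combinations \<open>xs\<close> of generators of \<open>F\<^sub>n\<close> (lists of pairs of a coefficient and a
  generator) whose value in \<open>F\<^sub>n\<close> lies in the kernel of \<open>F\<^sub>n \<rightarrow> F\<^sub>n\<^sub>-\<^sub>1\<close> (for \<open>n = 0\<close>, of
  \<open>F\<^sub>0 \<rightarrow> M\<close>); \<open>Rel xs\<close> is mapped to that value. Since every kernel element is such a value, the
  complex is exact. The recursive type of generators keeps all \<open>F\<^sub>n\<close> inside one type.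
\<close>

datatype ('r, 'm) res_gen = Gen 'm | Rel "('r \<times> ('r, 'm) res_gen) list"

definition lincomb :: "('r, 'm, 'y) module_scheme \<Rightarrow> ('i \<Rightarrow> 'm) \<Rightarrow> ('r \<times> 'i) list \<Rightarrow> 'm"
  where "lincomb M b xs = foldr (\<lambda>(r, x) s. (r \<odot>\<^bsub>M\<^esub> b x) \<oplus>\<^bsub>M\<^esub> s) xs \<zero>\<^bsub>M\<^esub>"

primrec gen_aug :: "('r, 'm) res_gen \<Rightarrow> 'm"
  where "gen_aug (Gen m) = m"
  | "gen_aug (Rel xs) = undefined"

primrec gen_bd :: "('r, 'x) ring_scheme \<Rightarrow> ('r, 'm) res_gen \<Rightarrow> ('r, 'm) res_gen \<Rightarrow> 'r"
  where "gen_bd R (Gen m) = undefined"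
  | "gen_bd R (Rel xs) = lincomb (free_module R UNIV) (free_gen R) xs"

fun res_gens :: "('r, 'x) ring_scheme \<Rightarrow> ('r, 'm, 'y) module_scheme \<Rightarrow> nat \<Rightarrow> ('r, 'm) res_gen set"
  where "res_gens R M 0 = Gen ` carrier M"
  | "res_gens R M (Suc 0) = {Rel xs | xs. set xs \<subseteq> carrier R \<times> res_gens R M 0 \<and>
       lincomb M gen_aug xs = \<zero>\<^bsub>M\<^esub>}"
  | "res_gens R M (Suc (Suc n)) = {Rel xs | xs. set xs \<subseteq> carrier R \<times> res_gens R M (Suc n) \<and>
       lincomb (free_module R (res_gens R M n)) (gen_bd R) xs = \<zero>\<^bsub>free_module R (res_gens R M n)\<^esub>}"

definition res_module :: "('r, 'x) ring_scheme \<Rightarrow> ('r, 'm, 'y) module_scheme \<Rightarrow> nat \<Rightarrow>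
    ('r, ('r, 'm) res_gen \<Rightarrow> 'r) module"
  where "res_module R M n = free_module R (res_gens R M n)"

definition res_bd :: "('r, 'x) ring_scheme \<Rightarrow> ('r, 'm, 'y) module_scheme \<Rightarrow> nat \<Rightarrow>
    (('r, 'm) res_gen \<Rightarrow> 'r) \<Rightarrow> (('r, 'm) res_gen \<Rightarrow> 'r)"
  where "res_bd R M n = free_ext R (res_module R M n) (gen_bd R)"

text \<open>
  \<open>Hom\<^bsub>R\<^esub>(M, N)\<close> for modules over a \<open>K\<close>-algebra \<open>R\<close>, as a vector space over \<open>K\<close>, where \<open>K\<close> acts on \<open>N\<close>
  through \<open>K \<rightarrow> R\<close>.
\<close>

definition Hom_space :: "('k, 'r) module \<Rightarrow> ('r, 'm) module \<Rightarrow> ('r, 'n) module \<Rightarrow>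
    ('k, 'm \<Rightarrow> 'n) module"
  where "Hom_space R M N =
    \<lparr>carrier = module_hom R M N \<inter> extensional (carrier M), mult = undefined, one = undefined,
     zero = (\<lambda>x\<in>carrier M. \<zero>\<^bsub>N\<^esub>),
     add = (\<lambda>f g. \<lambda>x\<in>carrier M. f x \<oplus>\<^bsub>N\<^esub> g x),
     smult = (\<lambda>c f. \<lambda>x\<in>carrier M. (c \<odot>\<^bsub>R\<^esub> \<one>\<^bsub>R\<^esub>) \<odot>\<^bsub>N\<^esub> f x)\<rparr>"

definition Ext_cochain :: "('k, 'r) module \<Rightarrow> ('r, 'm) module \<Rightarrow> ('r, 'n) module \<Rightarrow> nat \<Rightarrow>
    ('k, (('r, 'm) res_gen \<Rightarrow> 'r) \<Rightarrow> 'n) module"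
  where "Ext_cochain R M N n = Hom_space R (res_module R M n) N"

definition Ext_diff :: "('k, 'r) module \<Rightarrow> ('r, 'm) module \<Rightarrow> nat \<Rightarrow>
    ((('r, 'm) res_gen \<Rightarrow> 'r) \<Rightarrow> 'n) \<Rightarrow> (('r, 'm) res_gen \<Rightarrow> 'r) \<Rightarrow> 'n"
  where "Ext_diff R M n f = (\<lambda>x\<in>carrier (res_module R M (Suc n)). f (res_bd R M n x))"

definition Ext_cocycles :: "('k, 'r) module \<Rightarrow> ('r, 'm) module \<Rightarrow> ('r, 'n) module \<Rightarrow> nat \<Rightarrow>
    ((('r, 'm) res_gen \<Rightarrow> 'r) \<Rightarrow> 'n) set"
  where "Ext_cocycles R M N n =
    {f \<in> carrier (Ext_cochain R M N n). Ext_diff R M n f = \<zero>\<^bsub>Ext_cochain R M N (Suc n)\<^esub>}"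

primrec Ext_coboundaries :: "('k, 'r) module \<Rightarrow> ('r, 'm) module \<Rightarrow> ('r, 'n) module \<Rightarrow> nat \<Rightarrow>
    ((('r, 'm) res_gen \<Rightarrow> 'r) \<Rightarrow> 'n) set"
  where "Ext_coboundaries R M N 0 = {\<zero>\<^bsub>Ext_cochain R M N 0\<^esub>}"
  | "Ext_coboundaries R M N (Suc n) = Ext_diff R M n ` carrier (Ext_cochain R M N n)"

definition Ext :: "('k, 'r) module \<Rightarrow> ('r, 'm) module \<Rightarrow> ('r, 'n) module \<Rightarrow> nat \<Rightarrow>
    ('k, ((('r, 'm) res_gen \<Rightarrow> 'r) \<Rightarrow> 'n) set) module"
  where "Ext R M N n =
    quot_module ((Ext_cochain R M N n)\<lparr>carrier := Ext_cocycles R M N n\<rparr>) (Ext_coboundaries R M N n)"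

text \<open>Hochschild cohomology with coefficients in a bimodule given as a module over \<open>env_alg K B\<close>.\<close>

definition HH :: "'k ring \<Rightarrow> ('k, 'b) module \<Rightarrow> (('k, 'b, 'b) tensor, 'm) module \<Rightarrow> nat \<Rightarrow>
    ('k, (((('k, 'b, 'b) tensor, 'b) res_gen \<Rightarrow> ('k, 'b, 'b) tensor) \<Rightarrow> 'm) set) module"
  where "HH K B M n = Ext (env_alg K B) (regular_env_module K B) M n"


section \<open>The subalgebra \<open>(A \<otimes> A\<^sup>o\<^sup>p) \<delta>(H)\<close>\<close>

definition smash_incl_alg :: "'k ring \<Rightarrow> ('k, 'h) module \<Rightarrow> ('k, 'a) module \<Rightarrow>
    'a \<Rightarrow> ('k, 'a, 'h) tensor"
  where "smash_incl_alg K H A a = pure_tensor K A H a \<one>\<^bsub>H\<^esub>"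

definition smash_incl_hopf :: "'k ring \<Rightarrow> ('k, 'h) module \<Rightarrow> ('k, 'a) module \<Rightarrow>
    'h \<Rightarrow> ('k, 'a, 'h) tensor"
  where "smash_incl_hopf K H A h = pure_tensor K A H \<one>\<^bsub>A\<^esub> h"

text \<open>\<open>\<delta>(h) = h\<^sub>1 \<otimes> S(h\<^sub>2)\<close>, an element of \<open>H \<otimes> H\<^sup>o\<^sup>p\<close>.\<close>

definition delta :: "'k ring \<Rightarrow> ('k, 'h) module \<Rightarrow> ('h \<Rightarrow> ('k, 'h, 'h) tensor) \<Rightarrow> ('h \<Rightarrow> 'h) \<Rightarrow>
    'h \<Rightarrow> ('k, 'h, 'h) tensor"
  where "delta K H \<Delta> S h = tensor_map K H H H (op_alg H) (\<lambda>x. x) S (\<Delta> h)"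

text \<open>
  The sums of products of elements of the images of \<open>A \<otimes> A\<^sup>o\<^sup>p\<close> and of \<open>\<delta>(H) \<subseteq> H \<otimes> H\<^sup>o\<^sup>p\<close> in the
  enveloping algebra of the smash product.
\<close>

definition D_set :: "'k ring \<Rightarrow> ('k, 'h) module \<Rightarrow> ('h \<Rightarrow> ('k, 'h, 'h) tensor) \<Rightarrow> ('h \<Rightarrow> 'h) \<Rightarrow>
    ('k, 'a) module \<Rightarrow> ('h \<Rightarrow> 'a \<Rightarrow> 'a) \<Rightarrow>
    ('k, ('k, 'a, 'h) tensor, ('k, 'a, 'h) tensor) tensor set"
  where "D_set K H \<Delta> S A act =
    (let B = smash K H \<Delta> A act; Be = env_alg K B;
         \<iota> = smash_incl_alg K H A; \<eta> = smash_incl_hopf K H A;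
         Ae = tensor_map K A (op_alg A) B (op_alg B) \<iota> \<iota> ` carrier (env_alg K A);
         \<delta>H = tensor_map K H (op_alg H) B (op_alg B) \<eta> \<eta> ` delta K H \<Delta> S ` carrier H
     in {(\<Oplus>\<^bsub>Be\<^esub>i\<in>{..<n}. u i \<otimes>\<^bsub>Be\<^esub> v i) | (n::nat) u v. u \<in> {..<n} \<rightarrow> Ae \<and> v \<in> {..<n} \<rightarrow> \<delta>H})"

definition D_alg :: "'k ring \<Rightarrow> ('k, 'h) module \<Rightarrow> ('h \<Rightarrow> ('k, 'h, 'h) tensor) \<Rightarrow> ('h \<Rightarrow> 'h) \<Rightarrow>
    ('k, 'a) module \<Rightarrow> ('h \<Rightarrow> 'a \<Rightarrow> 'a) \<Rightarrow>
    ('k, ('k, ('k, 'a, 'h) tensor, ('k, 'a, 'h) tensor) tensor) module"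
  where "D_alg K H \<Delta> S A act =
    (env_alg K (smash K H \<Delta> A act))\<lparr>carrier := D_set K H \<Delta> S A act\<rparr>"

text \<open>
  \<open>A\<close> as a module over \<^const>\<open>D_alg\<close>: the copy of \<open>A\<close> inside \<open>B\<close>, with the scalar multiplication
  inherited from the regular bimodule \<open>B\<close>, that is \<open>(b \<otimes> c) a = b a c\<close>.
\<close>

definition D_module_alg :: "'k ring \<Rightarrow> ('k, 'h) module \<Rightarrow> ('h \<Rightarrow> ('k, 'h, 'h) tensor) \<Rightarrow>
    ('k, 'a) module \<Rightarrow> ('h \<Rightarrow> 'a \<Rightarrow> 'a) \<Rightarrow>
    (('k, ('k, 'a, 'h) tensor, ('k, 'a, 'h) tensor) tensor, ('k, 'a, 'h) tensor) module"
  where "D_module_alg K H \<Delta> A act =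
    (regular_env_module K (smash K H \<Delta> A act))\<lparr>carrier := smash_incl_alg K H A ` carrier A\<rparr>"

end

(*
  Write Be for the enveloping algebra of B = A # H. The map  ah (x) y |-> a h1 (x) S(h2) y  on B (x) B is
  invertible, with inverse  ah (x) y |-> a h1 (x) h2 y, and carries B (x) A onto D and right multiplication of
  the second factor by l in H to left multiplication by 1 (x) l. Hence for a basis (h_j) of H over k
  the algebra Be is the direct sum of the (1 (x) h_j) D, and likewise B is the direct sum of the
  (1 (x) h_j) A. Therefore the free resolution of A over D that defines Ext_D(A, M), read over Be with the same
  generators and the same boundary matrices, is a free resolution of B. A cochain is a function from the
  generators to M, so the cochain complex does not change, and the comparison theorem identifies its
  cohomology with Ext over Be.
*)
theory Submission
  imports Defs
begin

section \<open>Left modules over rings that need not be commutative\<close>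

text \<open>Induction from \<open>D\<close> would call for tensor products over a ring that need not
  be commutative; none is formed. \<open>D_alg\<close> differs from the enveloping algebra only in
  its carrier, so a matrix over \<open>D\<close> already is a matrix over the larger ring. The role
  of an induced module is played by two properties of the translates by 1 (x) h_j: every element is
  a finite sum of translates of elements of the smaller module, and such a sum vanishes only if each
  term does. The first makes the enlarged augmentation surjective; both together split a cycle into
  translates of cycles, and these bound over \<open>D\<close>.

  The Hopf structure enters through three facts. The antipode is the convolution inverse of the
  identity, which inverts the map on B (x) B. It reverses products, and h1 b S(h2) is the action of
  h on b; hence \<open>D\<close> is closed under multiplication and acts on A. Coordinates for a
  basis of H are linear functionals, and these detect single translates.

  \<open>Ext\<close> is bound to one chosen resolution, so the resolution carried over from
  \<open>D\<close> is not the one defining \<open>HH\<close>; this is why a comparison theorem is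
  needed.\<close>

lemma (in abelian_group_hom) hom_finsum:
  "finite A \<Longrightarrow> f \<in> A \<rightarrow> carrier G \<Longrightarrow> h (finsum G f A) = finsum H (\<lambda>x. h (f x)) A"
proof (induction A rule: finite_induct)
  case (insert x F)
  then have "(\<lambda>x. h (f x)) \<in> F \<rightarrow> carrier H" "h (f x) \<in> carrier H" "f \<in> F \<rightarrow> carrier G" "f x \<in> carrier G"
    by (auto simp: Pi_iff)
  with insert show ?case by simp
qed simp

text \<open>Enveloping algebras and \<open>D\<close> need not be commutative, while
  \<open>module\<close> requires a \<open>cring\<close> of scalars.\<close>

locale lmod = R: ring R + M: abelian_group M
  for R :: "('r, 'x) ring_scheme" and M :: "('r, 'm, 'y) module_scheme" +
  assumes smult_closed [simp, intro]:
      "\<lbrakk>a \<in> carrier R; x \<in> carrier M\<rbrakk> \<Longrightarrow> a \<odot>\<^bsub>M\<^esub> x \<in> carrier M"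
    and smult_l_distr: "\<lbrakk>a \<in> carrier R; b \<in> carrier R; x \<in> carrier M\<rbrakk> \<Longrightarrow>
      (a \<oplus>\<^bsub>R\<^esub> b) \<odot>\<^bsub>M\<^esub> x = a \<odot>\<^bsub>M\<^esub> x \<oplus>\<^bsub>M\<^esub> b \<odot>\<^bsub>M\<^esub> x"
    and smult_r_distr: "\<lbrakk>a \<in> carrier R; x \<in> carrier M; y \<in> carrier M\<rbrakk> \<Longrightarrow>
      a \<odot>\<^bsub>M\<^esub> (x \<oplus>\<^bsub>M\<^esub> y) = a \<odot>\<^bsub>M\<^esub> x \<oplus>\<^bsub>M\<^esub> a \<odot>\<^bsub>M\<^esub> y"
    and smult_assoc: "\<lbrakk>a \<in> carrier R; b \<in> carrier R; x \<in> carrier M\<rbrakk> \<Longrightarrow>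
      (a \<otimes>\<^bsub>R\<^esub> b) \<odot>\<^bsub>M\<^esub> x = a \<odot>\<^bsub>M\<^esub> (b \<odot>\<^bsub>M\<^esub> x)"
    and smult_one [simp]: "x \<in> carrier M \<Longrightarrow> \<one>\<^bsub>R\<^esub> \<odot>\<^bsub>M\<^esub> x = x"
begin

lemma smult_hom: "a \<in> carrier R \<Longrightarrow> abelian_group_hom M M (\<lambda>x. a \<odot>\<^bsub>M\<^esub> x)"
  by (intro abelian_group_homI group_hom.intro group_hom_axioms.intro M.abelian_group_axioms M.a_group)
    (auto simp: hom_def smult_r_distr)

lemma smult_r_null [simp]: "a \<in> carrier R \<Longrightarrow> a \<odot>\<^bsub>M\<^esub> \<zero>\<^bsub>M\<^esub> = \<zero>\<^bsub>M\<^esub>"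
  using abelian_group_hom.hom_zero[OF smult_hom] .

lemma smult_l_null [simp]:
  assumes "x \<in> carrier M" shows "\<zero>\<^bsub>R\<^esub> \<odot>\<^bsub>M\<^esub> x = \<zero>\<^bsub>M\<^esub>"
proof -
  have "\<zero>\<^bsub>R\<^esub> \<odot>\<^bsub>M\<^esub> x = (\<zero>\<^bsub>R\<^esub> \<oplus>\<^bsub>R\<^esub> \<zero>\<^bsub>R\<^esub>) \<odot>\<^bsub>M\<^esub> x"
    by simp
  also have "\<dots> = \<zero>\<^bsub>R\<^esub> \<odot>\<^bsub>M\<^esub> x \<oplus>\<^bsub>M\<^esub> \<zero>\<^bsub>R\<^esub> \<odot>\<^bsub>M\<^esub> x"
    using assms by (simp only: smult_l_distr R.zero_closed)
  finally show ?thesis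
    using assms by (metis M.add.r_cancel_one' R.zero_closed smult_closed)
qed

lemma smult_finsum: "finite A \<Longrightarrow> a \<in> carrier R \<Longrightarrow> f \<in> A \<rightarrow> carrier M \<Longrightarrow>
    a \<odot>\<^bsub>M\<^esub> finsum M f A = finsum M (\<lambda>x. a \<odot>\<^bsub>M\<^esub> f x) A"
  using abelian_group_hom.hom_finsum[OF smult_hom] .

lemma minus_eq_smult:
  assumes "x \<in> carrier M" shows "\<ominus>\<^bsub>M\<^esub> x = (\<ominus>\<^bsub>R\<^esub> \<one>\<^bsub>R\<^esub>) \<odot>\<^bsub>M\<^esub> x"
proof -
  have "(\<ominus>\<^bsub>R\<^esub> \<one>\<^bsub>R\<^esub>) \<odot>\<^bsub>M\<^esub> x \<oplus>\<^bsub>M\<^esub> x = ((\<ominus>\<^bsub>R\<^esub> \<one>\<^bsub>R\<^esub>) \<oplus>\<^bsub>R\<^esub> \<one>\<^bsub>R\<^esub>) \<odot>\<^bsub>M\<^esub> x"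
    using assms by (subst smult_l_distr) auto
  also have "\<dots> = \<zero>\<^bsub>M\<^esub>"
    using assms by (simp add: R.l_neg)
  finally show ?thesis
    using assms by (intro M.minus_equality) auto
qed

lemma lmod: "lmod R M" ..

end

text \<open>Lets vector spaces, which are handled as \<open>module\<close>, use the results on free
  modules that are proved for arbitrary rings.\<close>

lemma (in module) is_lmod: "lmod R M"
  by unfold_locales (auto simp: smult_l_distr smult_r_distr smult_assoc1)

lemma module_homD:
  assumes "f \<in> module_hom R M N"
  shows "x \<in> carrier M \<Longrightarrow> f x \<in> carrier N"
    and "x \<in> carrier M \<Longrightarrow> y \<in> carrier M \<Longrightarrow> f (x \<oplus>\<^bsub>M\<^esub> y) = f x \<oplus>\<^bsub>N\<^esub> f y"
    and "r \<in> carrier R \<Longrightarrow> x \<in> carrier M \<Longrightarrow> f (r \<odot>\<^bsub>M\<^esub> x) = r \<odot>\<^bsub>N\<^esub> f x"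
  using assms by (auto simp: module_hom_def)

lemma module_homI:
  assumes "\<And>x. x \<in> carrier M \<Longrightarrow> f x \<in> carrier N"
    and "\<And>x y. x \<in> carrier M \<Longrightarrow> y \<in> carrier M \<Longrightarrow> f (x \<oplus>\<^bsub>M\<^esub> y) = f x \<oplus>\<^bsub>N\<^esub> f y"
    and "\<And>r x. r \<in> carrier R \<Longrightarrow> x \<in> carrier M \<Longrightarrow> f (r \<odot>\<^bsub>M\<^esub> x) = r \<odot>\<^bsub>N\<^esub> f x"
  shows "f \<in> module_hom R M N"
  using assms by (auto simp: module_hom_def)

lemma module_hom_id: "(\<lambda>x. x) \<in> module_hom R M M"
  by (auto simp: module_hom_def)

lemma module_hom_comp:
  assumes "f \<in> module_hom R M N" "g \<in> module_hom R N L"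
  shows "(\<lambda>x. g (f x)) \<in> module_hom R M L"
  using assms by (auto intro!: module_homI simp: module_homD)

lemma module_hom_group:
  assumes "f \<in> module_hom R M N" "abelian_group M" "abelian_group N"
  shows "abelian_group_hom M N f"
proof -
  interpret M: abelian_group M by fact
  interpret N: abelian_group N by fact
  show ?thesis
    using assms by (intro abelian_group_homI group_hom.intro group_hom_axioms.intro M.a_group N.a_group)
      (auto simp: hom_def module_hom_def)
qed

lemma module_hom_zero:
  assumes "f \<in> module_hom R M N" "abelian_group M" "abelian_group N"
  shows "f \<zero>\<^bsub>M\<^esub> = \<zero>\<^bsub>N\<^esub>"
  using abelian_group_hom.hom_zero[OF module_hom_group[OF assms]] .

lemma module_hom_finsum:
  assumes "h \<in> module_hom R M N" "abelian_group M" "abelian_group N"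
    and "finite A" "f \<in> A \<rightarrow> carrier M"
  shows "h (finsum M f A) = finsum N (\<lambda>x. h (f x)) A"
  using abelian_group_hom.hom_finsum[OF module_hom_group[OF assms(1-3)] assms(4,5)] .

lemma module_hom_minus:
  assumes "f \<in> module_hom R M N" "abelian_group M" "abelian_group N" "x \<in> carrier M" "y \<in> carrier M"
  shows "f (x \<ominus>\<^bsub>M\<^esub> y) = f x \<ominus>\<^bsub>N\<^esub> f y"
proof -
  interpret abelian_group_hom M N f
    by (rule module_hom_group) (fact assms)+
  show ?thesis
    using assms by (simp add: a_minus_def)
qed


section \<open>Free modules\<close>

lemma free_carrier: "f \<in> carrier (free_module R X) \<longleftrightarrow>
    (\<forall>x. f x \<in> carrier R) \<and> finite {x. f x \<noteq> \<zero>\<^bsub>R\<^esub>} \<and> {x. f x \<noteq> \<zero>\<^bsub>R\<^esub>} \<subseteq> X"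
  by (auto simp: free_module_def)

lemma free_simps:
  "\<zero>\<^bsub>free_module R X\<^esub> = (\<lambda>x. \<zero>\<^bsub>R\<^esub>)"
  "f \<oplus>\<^bsub>free_module R X\<^esub> g = (\<lambda>x. f x \<oplus>\<^bsub>R\<^esub> g x)"
  "r \<odot>\<^bsub>free_module R X\<^esub> f = (\<lambda>x. r \<otimes>\<^bsub>R\<^esub> f x)"
  by (simp_all add: free_module_def)

context ring
begin

lemma free_add_closed:
  assumes "f \<in> carrier (free_module R X)" "g \<in> carrier (free_module R X)"
  shows "(\<lambda>x. f x \<oplus> g x) \<in> carrier (free_module R X)"
proof -
  have "{x. f x \<oplus> g x \<noteq> \<zero>} \<subseteq> {x. f x \<noteq> \<zero>} \<union> {x. g x \<noteq> \<zero>}"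
    by auto
  then show ?thesis
    using assms finite_subset[of "{x. f x \<oplus> g x \<noteq> \<zero>}" "{x. f x \<noteq> \<zero>} \<union> {x. g x \<noteq> \<zero>}"]
    unfolding free_carrier by blast
qed

lemma free_smult_closed:
  assumes "f \<in> carrier (free_module R X)" "r \<in> carrier R"
  shows "(\<lambda>x. r \<otimes> f x) \<in> carrier (free_module R X)"
proof -
  have "{x. r \<otimes> f x \<noteq> \<zero>} \<subseteq> {x. f x \<noteq> \<zero>}"
    using assms by auto
  then show ?thesis
    using assms finite_subset[of "{x. r \<otimes> f x \<noteq> \<zero>}" "{x. f x \<noteq> \<zero>}"]
    unfolding free_carrier by blast
qed

lemma free_lmod: "lmod R (free_module R X)"
proof -
  have c: "f x \<in> carrier R" if "f \<in> carrier (free_module R X)" for f x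
    using that by (simp add: free_carrier)
  have z: "(\<lambda>x. \<zero>) \<in> carrier (free_module R X)"
    by (simp add: free_carrier)
  have "abelian_group (free_module R X)"
  proof (intro abelian_groupI)
    fix f assume f: "f \<in> carrier (free_module R X)"
    have "(\<ominus> \<one>) \<otimes> f x \<oplus> f x = \<zero>" for x
      using c[OF f, of x] by (simp add: l_minus l_neg)
    with f show "\<exists>g\<in>carrier (free_module R X). g \<oplus>\<^bsub>free_module R X\<^esub> f = \<zero>\<^bsub>free_module R X\<^esub>"
      by (intro bexI[of _ "\<lambda>x. (\<ominus> \<one>) \<otimes> f x"]) (simp_all add: free_simps free_smult_closed)
  qed (simp_all add: free_simps free_add_closed z c a_assoc, simp add: a_comm c)
  then show ?thesis
    by (intro lmod.intro lmod_axioms.intro ring_axioms)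
      (simp_all add: free_simps free_smult_closed c l_distr r_distr m_assoc)
qed

lemma free_gen_closed [simp]: "x \<in> X \<Longrightarrow> free_gen R x \<in> carrier (free_module R X)"
  by (auto simp: free_carrier free_gen_def)

lemma free_induct [consumes 1, case_names zero add]:
  assumes "f \<in> carrier (free_module R X)"
    and zero: "P (\<lambda>x. \<zero>)"
    and add: "\<And>r x f. r \<in> carrier R \<Longrightarrow> x \<in> X \<Longrightarrow> f \<in> carrier (free_module R X) \<Longrightarrow> P f \<Longrightarrow>
      P (r \<odot>\<^bsub>free_module R X\<^esub> free_gen R x \<oplus>\<^bsub>free_module R X\<^esub> f)"
  shows "P f"
proof -
  \<comment> \<open>The induction is over a finite set that contains the support, not over the
    support itself, so that erasing one coefficient leaves a statement of the same form.\<close>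
  have "finite Y \<Longrightarrow> Y \<subseteq> X \<Longrightarrow> {x. f x \<noteq> \<zero>} \<subseteq> Y \<Longrightarrow> (\<And>x. f x \<in> carrier R) \<Longrightarrow> P f" for Y f
  proof (induction Y arbitrary: f rule: finite_induct)
    case empty
    then have "f = (\<lambda>x. \<zero>)" by auto
    then show ?case by (simp add: zero)
  next
    case (insert y Y)
    let ?g = "f(y := \<zero>)"
    have g: "P ?g" by (rule insert.IH) (use insert.prems in auto)
    have "{x. ?g x \<noteq> \<zero>} \<subseteq> Y" using insert.prems by auto
    then have gc: "?g \<in> carrier (free_module R X)"
      using insert.prems insert.hyps finite_subset[of _ Y] by (auto simp: free_carrier)
    have "f = f y \<odot>\<^bsub>free_module R X\<^esub> free_gen R y \<oplus>\<^bsub>free_module R X\<^esub> ?g"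
      using insert.prems by (auto simp: free_simps free_gen_def fun_eq_iff)
    then show ?case
      using add[of "f y" y ?g] insert.prems gc g by auto
  qed
  from this[of "{x. f x \<noteq> \<zero>}" f] assms(1) show ?thesis
    by (auto simp: free_carrier)
qed

end

context lmod
begin

text \<open>The defining sum runs over the support, which changes with the function. A common finite
  index set is what allows the sums of two functions to be added or compared.\<close>

lemma free_ext_on:
  assumes "f \<in> carrier (free_module R X)" "finite Y" "{x. f x \<noteq> \<zero>\<^bsub>R\<^esub>} \<subseteq> Y" "b \<in> Y \<rightarrow> carrier M"
  shows "free_ext R M b f = (\<Oplus>\<^bsub>M\<^esub>x\<in>Y. f x \<odot>\<^bsub>M\<^esub> b x)"
  unfolding free_ext_def using assms
  by (intro M.add.finprod_mono_neutral_cong_left) (auto simp: free_carrier Pi_iff)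

lemma free_ext_hom:
  assumes b: "b \<in> X \<rightarrow> carrier M"
  shows "free_ext R M b \<in> module_hom R (free_module R X) M"
proof (rule module_homI)
  fix f assume f: "f \<in> carrier (free_module R X)"
  then show "free_ext R M b f \<in> carrier M"
    using b by (auto simp: free_ext_def free_carrier intro!: M.finsum_closed)
  { fix r assume r: "r \<in> carrier R"
    have "free_ext R M b (r \<odot>\<^bsub>free_module R X\<^esub> f)
        = (\<Oplus>\<^bsub>M\<^esub>x\<in>{x. f x \<noteq> \<zero>\<^bsub>R\<^esub>}. (r \<otimes>\<^bsub>R\<^esub> f x) \<odot>\<^bsub>M\<^esub> b x)"
      unfolding free_simps
      by (subst free_ext_on[OF R.free_smult_closed[OF f r], where Y = "{x. f x \<noteq> \<zero>\<^bsub>R\<^esub>}"]) (use f r b in \<open>auto simp: free_carrier\<close>)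
    also have "\<dots> = (\<Oplus>\<^bsub>M\<^esub>x\<in>{x. f x \<noteq> \<zero>\<^bsub>R\<^esub>}. r \<odot>\<^bsub>M\<^esub> (f x \<odot>\<^bsub>M\<^esub> b x))"
      using f r b by (intro M.finsum_cong') (auto simp: free_carrier smult_assoc subset_iff Pi_iff)
    also have "\<dots> = r \<odot>\<^bsub>M\<^esub> free_ext R M b f"
      unfolding free_ext_def
      by (rule smult_finsum[symmetric]) (use f r b in \<open>auto simp: free_carrier\<close>)
    finally show "free_ext R M b (r \<odot>\<^bsub>free_module R X\<^esub> f) = r \<odot>\<^bsub>M\<^esub> free_ext R M b f" .
  }
  fix g assume g: "g \<in> carrier (free_module R X)"
  let ?Y = "{x. f x \<noteq> \<zero>\<^bsub>R\<^esub>} \<union> {x. g x \<noteq> \<zero>\<^bsub>R\<^esub>}"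
  have Y: "finite ?Y" "b \<in> ?Y \<rightarrow> carrier M" "\<And>x. f x \<in> carrier R" "\<And>x. g x \<in> carrier R"
    using f g b by (auto simp: free_carrier)
  have "free_ext R M b (f \<oplus>\<^bsub>free_module R X\<^esub> g) = (\<Oplus>\<^bsub>M\<^esub>x\<in>?Y. (f x \<oplus>\<^bsub>R\<^esub> g x) \<odot>\<^bsub>M\<^esub> b x)"
    unfolding free_simps
    by (subst free_ext_on[OF R.free_add_closed[OF f g] Y(1)]) (use Y in auto)
  also have "\<dots> = (\<Oplus>\<^bsub>M\<^esub>x\<in>?Y. f x \<odot>\<^bsub>M\<^esub> b x \<oplus>\<^bsub>M\<^esub> g x \<odot>\<^bsub>M\<^esub> b x)"
    by (intro M.finsum_cong') (use Y in \<open>auto simp: smult_l_distr Pi_iff\<close>)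
  also have "\<dots> = (\<Oplus>\<^bsub>M\<^esub>x\<in>?Y. f x \<odot>\<^bsub>M\<^esub> b x) \<oplus>\<^bsub>M\<^esub> (\<Oplus>\<^bsub>M\<^esub>x\<in>?Y. g x \<odot>\<^bsub>M\<^esub> b x)"
    by (rule M.finsum_addf) (use Y in \<open>auto simp: Pi_iff\<close>)
  also have "\<dots> = free_ext R M b f \<oplus>\<^bsub>M\<^esub> free_ext R M b g"
    by (subst free_ext_on[OF f Y(1)]; (subst free_ext_on[OF g Y(1)])?) (use Y in auto)
  finally show "free_ext R M b (f \<oplus>\<^bsub>free_module R X\<^esub> g) = free_ext R M b f \<oplus>\<^bsub>M\<^esub> free_ext R M b g" .
qed

lemma free_ext_gen:
  assumes "b x \<in> carrier M" shows "free_ext R M b (free_gen R x) = b x"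
proof -
  have "free_ext R M b (free_gen R x) = (\<Oplus>\<^bsub>M\<^esub>y\<in>{x}. free_gen R x y \<odot>\<^bsub>M\<^esub> b y)"
    by (rule free_ext_on[where X = "{x}"]) (use assms in \<open>auto simp: free_gen_def free_carrier\<close>)
  then show ?thesis
    using assms by (simp add: free_gen_def)
qed

lemma free_hom_ext:
  assumes g: "g \<in> module_hom R (free_module R X) M" and h: "h \<in> module_hom R (free_module R X) M"
    and eq: "\<And>x. x \<in> X \<Longrightarrow> g (free_gen R x) = h (free_gen R x)"
    and "f \<in> carrier (free_module R X)"
  shows "g f = h f"
proof -
  interpret F: lmod R "free_module R X" by (rule R.free_lmod)
  show ?thesis
    using assms(4)
  proof (induction f rule: R.free_induct)
    case zero
    have "g \<zero>\<^bsub>free_module R X\<^esub> = h \<zero>\<^bsub>free_module R X\<^esub>"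
      using module_hom_zero[OF g] module_hom_zero[OF h] F.M.abelian_group_axioms M.abelian_group_axioms by simp
    then show ?case by (simp add: free_simps)
  next
    case (add r x f)
    then show ?case by (simp add: module_homD(2,3)[OF g] module_homD(2,3)[OF h] eq)
  qed
qed

text \<open>Linear maps out of a free module are recovered from their values on generators; this is
  how a cochain becomes a function on generators.\<close>

lemma free_hom_eq_free_ext:
  assumes g: "g \<in> module_hom R (free_module R X) M" and f: "f \<in> carrier (free_module R X)"
  shows "g f = free_ext R M (\<lambda>x. g (free_gen R x)) f"
proof -
  have gen: "g (free_gen R x) \<in> carrier M" if "x \<in> X" for x
    using g that by (simp add: module_homD)
  show ?thesis
    by (rule free_hom_ext[OF g free_ext_hom _ f]) (auto simp: free_ext_gen gen)
qed

lemma free_ext_closed: "b \<in> X \<rightarrow> carrier M \<Longrightarrow> f \<in> carrier (free_module R X) \<Longrightarrow>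
    free_ext R M b f \<in> carrier M"
  using module_homD(1)[OF free_ext_hom] .

lemma free_ext_cong:
  assumes "b \<in> X \<rightarrow> carrier M" "\<And>x. x \<in> X \<Longrightarrow> b x = c x" "f \<in> carrier (free_module R X)"
  shows "free_ext R M b f = free_ext R M c f"
  unfolding free_ext_def using assms
  by (intro M.finsum_cong') (auto simp: free_carrier subset_iff Pi_iff)

text \<open>A linear map commutes with linear combinations. When \<open>M\<close> is free as well,
  \<open>b\<close> is a matrix and this is the associativity of composition, from which the
  computations with chain maps and homotopies below are assembled.\<close>

lemma free_ext_comp:
  assumes "lmod R N" and b: "b \<in> X \<rightarrow> carrier M" and h: "h \<in> module_hom R M N"
    and f: "f \<in> carrier (free_module R X)"
  shows "h (free_ext R M b f) = free_ext R N (\<lambda>x. h (b x)) f"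
proof -
  interpret N: lmod R N by fact
  have "h (b x) \<in> carrier N" if "x \<in> X" for x
    using b h that by (auto simp: module_homD Pi_iff)
  then show ?thesis
    by (intro N.free_hom_ext[OF module_hom_comp[OF free_ext_hom[OF b] h] N.free_ext_hom _ f])
      (use b in \<open>auto simp: free_ext_gen N.free_ext_gen Pi_iff\<close>)
qed

lemma free_ext_add:
  assumes "b \<in> X \<rightarrow> carrier M" "c \<in> X \<rightarrow> carrier M" "f \<in> carrier (free_module R X)"
  shows "free_ext R M (\<lambda>x. b x \<oplus>\<^bsub>M\<^esub> c x) f = free_ext R M b f \<oplus>\<^bsub>M\<^esub> free_ext R M c f"
proof -
  have "free_ext R M (\<lambda>x. b x \<oplus>\<^bsub>M\<^esub> c x) f
      = (\<Oplus>\<^bsub>M\<^esub>x\<in>{x. f x \<noteq> \<zero>\<^bsub>R\<^esub>}. f x \<odot>\<^bsub>M\<^esub> b x \<oplus>\<^bsub>M\<^esub> f x \<odot>\<^bsub>M\<^esub> c x)"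
    unfolding free_ext_def using assms
    by (intro M.finsum_cong') (auto simp: free_carrier smult_r_distr subset_iff Pi_iff)
  also have "\<dots> = free_ext R M b f \<oplus>\<^bsub>M\<^esub> free_ext R M c f"
    unfolding free_ext_def using assms
    by (intro M.finsum_addf) (auto simp: free_carrier subset_iff Pi_iff)
  finally show ?thesis .
qed

text \<open>Over a noncommutative ring a scalar can be moved past the coefficients
  \<open>f x\<close> only if it commutes with them; the scalars coming from the base field are
  central.\<close>

lemma free_ext_smult_central:
  assumes b: "b \<in> X \<rightarrow> carrier M" and f: "f \<in> carrier (free_module R X)" and c: "c \<in> carrier R"
    and central: "\<And>r. r \<in> carrier R \<Longrightarrow> r \<otimes>\<^bsub>R\<^esub> c = c \<otimes>\<^bsub>R\<^esub> r"
  shows "free_ext R M (\<lambda>x. c \<odot>\<^bsub>M\<^esub> b x) f = c \<odot>\<^bsub>M\<^esub> free_ext R M b f"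
proof -
  have "f x \<odot>\<^bsub>M\<^esub> (c \<odot>\<^bsub>M\<^esub> b x) = c \<odot>\<^bsub>M\<^esub> (f x \<odot>\<^bsub>M\<^esub> b x)" if "x \<in> X" for x
    using b f c that by (simp add: smult_assoc[symmetric] central free_carrier Pi_iff)
  then have "free_ext R M (\<lambda>x. c \<odot>\<^bsub>M\<^esub> b x) f
      = (\<Oplus>\<^bsub>M\<^esub>x\<in>{x. f x \<noteq> \<zero>\<^bsub>R\<^esub>}. c \<odot>\<^bsub>M\<^esub> (f x \<odot>\<^bsub>M\<^esub> b x))"
    unfolding free_ext_def using assms
    by (intro M.finsum_cong') (auto simp: free_carrier subset_iff Pi_iff)
  also have "\<dots> = c \<odot>\<^bsub>M\<^esub> free_ext R M b f"
    unfolding free_ext_def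
    by (rule smult_finsum[symmetric]) (use b f c in \<open>auto simp: free_carrier subset_iff Pi_iff\<close>)
  finally show ?thesis .
qed

lemma free_ext_zero:
  assumes "f \<in> carrier (free_module R X)"
  shows "free_ext R M (\<lambda>x. \<zero>\<^bsub>M\<^esub>) f = \<zero>\<^bsub>M\<^esub>"
  unfolding free_ext_def using assms by (intro M.add.finprod_one_eqI) (auto simp: free_carrier)

lemma lincomb_simps:
  "lincomb M b [] = \<zero>\<^bsub>M\<^esub>"
  "lincomb M b ((r, x) # xs) = (r \<odot>\<^bsub>M\<^esub> b x) \<oplus>\<^bsub>M\<^esub> lincomb M b xs"
  by (simp_all add: lincomb_def)

lemma lincomb_closed:
  assumes "b \<in> X \<rightarrow> carrier M" "set xs \<subseteq> carrier R \<times> X"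
  shows "lincomb M b xs \<in> carrier M"
  using assms(2) by (induction xs) (use assms(1) in \<open>auto simp: lincomb_simps Pi_iff\<close>)

lemma lincomb_hom:
  assumes "lmod R N" "h \<in> module_hom R M N" "b \<in> X \<rightarrow> carrier M" "set xs \<subseteq> carrier R \<times> X"
  shows "h (lincomb M b xs) = lincomb N (\<lambda>x. h (b x)) xs"
proof -
  interpret N: lmod R N by fact
  show ?thesis
    using assms(4)
  proof (induction xs)
    case Nil
    then show ?case
      using module_hom_zero[OF assms(2) M.abelian_group_axioms N.M.abelian_group_axioms]
      by (simp add: lincomb_simps N.lincomb_simps)
  next
    case (Cons p xs)
    obtain r x where p: "p = (r, x)" by force
    then have "b x \<in> carrier M" "lincomb M b xs \<in> carrier M"
      using Cons.prems assms(3) by (auto intro: lincomb_closed[OF assms(3)])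
    then show ?case
      using Cons p by (simp add: lincomb_simps N.lincomb_simps module_homD[OF assms(2)])
  qed
qed

end

text \<open>The operations of \<open>free_module\<close> do not refer to the set of generators. So
  \<open>gen_bd\<close>, which is evaluated over \<open>UNIV\<close>, may be read in any single term
  of a resolution.\<close>

lemma (in ring) lincomb_free:
  "lincomb (free_module R X) b xs = lincomb (free_module R Y) b xs"
  by (simp add: lincomb_def free_simps)

text \<open>Serves exactness of the standard resolution: every cycle is the value of some formal
  combination \<open>xs\<close> and is therefore named by a generator \<open>Rel xs\<close>.\<close>

lemma (in ring) free_lincomb_ex:
  assumes "f \<in> carrier (free_module R X)"
  shows "\<exists>xs. set xs \<subseteq> carrier R \<times> X \<and> lincomb (free_module R UNIV) (free_gen R) xs = f"
  using assms
proof (induction f rule: free_induct)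
  case zero
  have "lincomb (free_module R UNIV) (free_gen R) [] = (\<lambda>x. \<zero>)"
    by (simp add: lincomb_def free_simps)
  then show ?case by (intro exI[of _ "[]"]) auto
next
  case (add r x f)
  then obtain xs where "set xs \<subseteq> carrier R \<times> X" "lincomb (free_module R UNIV) (free_gen R) xs = f"
    by blast
  then show ?case
    using add by (intro exI[of _ "(r, x) # xs"]) (auto simp: lincomb_def free_simps)
qed

section \<open>Free resolutions and their comparison\<close>

lemma (in abelian_group) minus_zeroD:
  assumes "a \<ominus>\<^bsub>G\<^esub> b = \<zero>\<^bsub>G\<^esub>" "a \<in> carrier G" "b \<in> carrier G"
  shows "a = b"
proof -
  have "a = (a \<ominus>\<^bsub>G\<^esub> b) \<oplus>\<^bsub>G\<^esub> b"
    using assms(2,3) by (simp add: a_minus_def a_assoc l_neg)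
  then show ?thesis using assms by simp
qed

lemma (in abelian_group) minus_minus_cancel:
  assumes "a \<in> carrier G" "b \<in> carrier G"
  shows "a \<ominus>\<^bsub>G\<^esub> (a \<ominus>\<^bsub>G\<^esub> b) = b"
proof -
  have "a \<ominus>\<^bsub>G\<^esub> (a \<ominus>\<^bsub>G\<^esub> b) = (a \<oplus>\<^bsub>G\<^esub> \<ominus>\<^bsub>G\<^esub> a) \<oplus>\<^bsub>G\<^esub> b"
    using assms by (simp add: a_minus_def minus_add a_assoc)
  then show ?thesis using assms by (simp add: r_neg)
qed

context lmod
begin

lemma free_ext_minus:
  assumes b: "b \<in> X \<rightarrow> carrier M" and c: "c \<in> X \<rightarrow> carrier M" and f: "f \<in> carrier (free_module R X)"
  shows "free_ext R M (\<lambda>x. b x \<ominus>\<^bsub>M\<^esub> c x) f = free_ext R M b f \<ominus>\<^bsub>M\<^esub> free_ext R M c f"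
proof -
  have bc: "(\<lambda>x. b x \<ominus>\<^bsub>M\<^esub> c x) \<in> X \<rightarrow> carrier M"
    using b c by (auto simp: Pi_iff)
  have "free_ext R M (\<lambda>x. b x \<ominus>\<^bsub>M\<^esub> c x) f \<oplus>\<^bsub>M\<^esub> free_ext R M c f
      = free_ext R M (\<lambda>x. (b x \<ominus>\<^bsub>M\<^esub> c x) \<oplus>\<^bsub>M\<^esub> c x) f"
    by (rule free_ext_add[OF bc c f, symmetric])
  also have "\<dots> = free_ext R M b f"
    by (rule free_ext_cong[OF _ _ f])
      (use b c in \<open>auto simp: Pi_iff a_minus_def M.a_assoc M.l_neg\<close>)
  finally show ?thesis
    using free_ext_closed[OF b f] free_ext_closed[OF c f] free_ext_closed[OF bc f]
    by (metis M.add.inv_solve_right a_minus_def)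
qed

end

text \<open>In degree 0 the augmentation stands in for the missing boundary map; with this
  convention exactness at the lowest term and at all higher terms is one and the same
  statement.\<close>

definition res_cycles :: "('r, 'x) ring_scheme \<Rightarrow> ('r, 'm, 'y) module_scheme \<Rightarrow> (nat \<Rightarrow> 'i set) \<Rightarrow>
    ('i \<Rightarrow> 'i \<Rightarrow> 'r) \<Rightarrow> ('i \<Rightarrow> 'm) \<Rightarrow> nat \<Rightarrow> ('i \<Rightarrow> 'r) set"
  where "res_cycles R M X bd aug n = {z \<in> carrier (free_module R (X n)).
    case n of 0 \<Rightarrow> free_ext R M aug z = \<zero>\<^bsub>M\<^esub>
      | Suc m \<Rightarrow> free_ext R (free_module R (X m)) bd z = \<zero>\<^bsub>free_module R (X m)\<^esub>}"

text \<open>Boundary and augmentation are given on generators only. One function \<open>bd\<close>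
  serves all degrees: the sets \<open>X n\<close> determine where its values are read.\<close>

locale free_resolution = lmod R M
  for R :: "('r, 'x) ring_scheme" and M :: "('r, 'm, 'y) module_scheme"
    and X :: "nat \<Rightarrow> 'i set" and bd :: "'i \<Rightarrow> 'i \<Rightarrow> 'r" and aug :: "'i \<Rightarrow> 'm" +
  assumes aug: "aug \<in> X 0 \<rightarrow> carrier M"
    and bd: "x \<in> X (Suc n) \<Longrightarrow> bd x \<in> res_cycles R M X bd aug n"
    and aug_surj: "m \<in> carrier M \<Longrightarrow> \<exists>z\<in>carrier (free_module R (X 0)). free_ext R M aug z = m"
    and exact: "z \<in> res_cycles R M X bd aug n \<Longrightarrow>
      \<exists>w\<in>carrier (free_module R (X (Suc n))). free_ext R (free_module R (X n)) bd w = z"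
begin

abbreviation "F n \<equiv> free_module R (X n)"

abbreviation "cyc \<equiv> res_cycles R M X bd aug"

sublocale F: lmod R "F n" for n
  by (rule R.free_lmod)

lemma cyc_closed: "z \<in> cyc n \<Longrightarrow> z \<in> carrier (F n)"
  by (simp add: res_cycles_def)

lemma cyc_0: "z \<in> cyc 0 \<longleftrightarrow> z \<in> carrier (F 0) \<and> free_ext R M aug z = \<zero>\<^bsub>M\<^esub>"
  by (simp add: res_cycles_def)

lemma cyc_Suc: "z \<in> cyc (Suc n) \<longleftrightarrow> z \<in> carrier (F (Suc n)) \<and> free_ext R (F n) bd z = \<zero>\<^bsub>F n\<^esub>"
  by (simp add: res_cycles_def)

lemma bd_closed: "bd \<in> X (Suc n) \<rightarrow> carrier (F n)"
  using bd cyc_closed by blast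

end

definition chain_map :: "('r, 'x) ring_scheme \<Rightarrow> (nat \<Rightarrow> 'i set) \<Rightarrow> ('i \<Rightarrow> 'i \<Rightarrow> 'r) \<Rightarrow>
    (nat \<Rightarrow> 'j set) \<Rightarrow> ('j \<Rightarrow> 'j \<Rightarrow> 'r) \<Rightarrow> (nat \<Rightarrow> 'i \<Rightarrow> 'j \<Rightarrow> 'r) \<Rightarrow> bool"
  where "chain_map R X bd Y bd' f \<longleftrightarrow> (\<forall>n. f n \<in> X n \<rightarrow> carrier (free_module R (Y n))) \<and>
    (\<forall>n. \<forall>x\<in>X (Suc n). free_ext R (free_module R (Y n)) bd' (f (Suc n) x) =
      free_ext R (free_module R (Y n)) (f n) (bd x))"

definition lifts_id :: "('r, 'x) ring_scheme \<Rightarrow> ('r, 'm, 'y) module_scheme \<Rightarrow>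
    (nat \<Rightarrow> 'i set) \<Rightarrow> ('i \<Rightarrow> 'm) \<Rightarrow> (nat \<Rightarrow> 'j set) \<Rightarrow> ('j \<Rightarrow> 'm) \<Rightarrow> (nat \<Rightarrow> 'i \<Rightarrow> 'j \<Rightarrow> 'r) \<Rightarrow> bool"
  where "lifts_id R M X aug Y aug' f \<longleftrightarrow> (\<forall>x\<in>X 0. free_ext R M aug' (f 0 x) = aug x)"

text \<open>Only the values of a cochain on the generators are kept, and values outside
  \<open>X n\<close> are unconstrained. The ring is involved solely through \<open>free_ext\<close>,
  so the same predicate can later be compared for two rings.\<close>

definition gen_cocycle :: "('r, 'x) ring_scheme \<Rightarrow> ('r, 'n, 'y) module_scheme \<Rightarrow>
    (nat \<Rightarrow> 'i set) \<Rightarrow> ('i \<Rightarrow> 'i \<Rightarrow> 'r) \<Rightarrow> nat \<Rightarrow> ('i \<Rightarrow> 'n) \<Rightarrow> bool"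
  where "gen_cocycle R N X bd n \<phi> \<longleftrightarrow>
    \<phi> \<in> X n \<rightarrow> carrier N \<and> (\<forall>x\<in>X (Suc n). free_ext R N \<phi> (bd x) = \<zero>\<^bsub>N\<^esub>)"

text \<open>In degree 0 there is no lower cochain to bound from, so only a function that vanishes on
  all generators counts.\<close>

definition gen_cobound :: "('r, 'x) ring_scheme \<Rightarrow> ('r, 'n, 'y) module_scheme \<Rightarrow>
    (nat \<Rightarrow> 'i set) \<Rightarrow> ('i \<Rightarrow> 'i \<Rightarrow> 'r) \<Rightarrow> nat \<Rightarrow> ('i \<Rightarrow> 'n) \<Rightarrow> bool"
  where "gen_cobound R N X bd n \<phi> \<longleftrightarrow> (case n of 0 \<Rightarrow> \<forall>x\<in>X 0. \<phi> x = \<zero>\<^bsub>N\<^esub>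
    | Suc m \<Rightarrow> \<exists>\<psi>\<in>X m \<rightarrow> carrier N. \<forall>x\<in>X n. \<phi> x = free_ext R N \<psi> (bd x))"

lemma gen_cobound_cong:
  assumes "\<And>x. x \<in> X n \<Longrightarrow> \<phi> x = \<psi> x"
  shows "gen_cobound R N X bd n \<phi> \<longleftrightarrow> gen_cobound R N X bd n \<psi>"
  using assms by (cases n) (auto simp: gen_cobound_def)

locale two_resolutions = X: free_resolution R M X bd aug + Y: free_resolution R M Y bd' aug'
  for R :: "('r, 'x) ring_scheme" and M :: "('r, 'm, 'y) module_scheme"
    and X :: "nat \<Rightarrow> 'i set" and bd :: "'i \<Rightarrow> 'i \<Rightarrow> 'r" and aug :: "'i \<Rightarrow> 'm"
    and Y :: "nat \<Rightarrow> 'j set" and bd' :: "'j \<Rightarrow> 'j \<Rightarrow> 'r" and aug' :: "'j \<Rightarrow> 'm"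
begin

text \<open>The values on generators are chosen degree by degree: exactness of the target resolution
  lifts the image of \<open>bd x\<close>, provided that this image is a cycle.\<close>

lemma comparison_exists: "\<exists>f. chain_map R X bd Y bd' f \<and> lifts_id R M X aug Y aug' f"
proof -
  \<comment> \<open>\<open>P\<close> therefore carries along that cycles go to cycles, which is
    exactly what the next choice needs; \<open>Q\<close> is the chain map equation between
    neighbouring degrees.\<close>
  define P where "P n f \<longleftrightarrow> f \<in> X n \<rightarrow> carrier (Y.F n) \<and>
      (\<forall>z\<in>X.cyc n. free_ext R (Y.F n) f z \<in> Y.cyc n) \<and>
      (n = 0 \<longrightarrow> (\<forall>x\<in>X 0. free_ext R M aug' (f x) = aug x))" for n :: nat and f :: "'i \<Rightarrow> 'j \<Rightarrow> 'r"
  define Q where "Q n f g \<longleftrightarrow> (\<forall>x\<in>X (Suc n). free_ext R (Y.F n) bd' (g x) = free_ext R (Y.F n) f (bd x))"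
    for n :: nat and f g :: "'i \<Rightarrow> 'j \<Rightarrow> 'r"
  have "\<exists>f. \<forall>n. P n (f n) \<and> Q n (f n) (f (Suc n))"
  proof (rule dependent_nat_choice)
    have "\<forall>x\<in>X 0. \<exists>z\<in>carrier (Y.F 0). free_ext R M aug' z = aug x"
      using Y.aug_surj X.aug by blast
    then obtain f where f: "\<And>x. x \<in> X 0 \<Longrightarrow> f x \<in> carrier (Y.F 0)"
        "\<And>x. x \<in> X 0 \<Longrightarrow> free_ext R M aug' (f x) = aug x"
      by metis
    have "free_ext R (Y.F 0) f z \<in> Y.cyc 0" if z: "z \<in> X.cyc 0" for z
    proof -
      have fz: "f \<in> X 0 \<rightarrow> carrier (Y.F 0)" "z \<in> carrier (X.F 0)" using f z X.cyc_closed by auto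
      have "free_ext R M aug' (free_ext R (Y.F 0) f z) = free_ext R M (\<lambda>x. free_ext R M aug' (f x)) z"
        by (rule Y.F.free_ext_comp[OF X.lmod fz(1) X.free_ext_hom[OF Y.aug] fz(2)])
      also have "\<dots> = free_ext R M aug z"
        by (rule X.free_ext_cong[symmetric, OF X.aug _ fz(2)]) (use f in auto)
      also have "\<dots> = \<zero>\<^bsub>M\<^esub>" using z by (simp add: X.cyc_0)
      finally show ?thesis using Y.F.free_ext_closed[OF fz] by (simp add: Y.cyc_0)
    qed
    with f show "\<exists>f. P 0 f" unfolding P_def by blast
  next
    fix f n assume "P n f"
    then have f: "f \<in> X n \<rightarrow> carrier (Y.F n)" "\<And>z. z \<in> X.cyc n \<Longrightarrow> free_ext R (Y.F n) f z \<in> Y.cyc n"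
      by (auto simp: P_def)
    have "\<forall>x\<in>X (Suc n). \<exists>w\<in>carrier (Y.F (Suc n)).
        free_ext R (Y.F n) bd' w = free_ext R (Y.F n) f (bd x)"
      using X.bd f(2) Y.exact by blast
    then obtain g where g: "\<And>x. x \<in> X (Suc n) \<Longrightarrow> g x \<in> carrier (Y.F (Suc n))"
        "\<And>x. x \<in> X (Suc n) \<Longrightarrow> free_ext R (Y.F n) bd' (g x) = free_ext R (Y.F n) f (bd x)"
      by metis
    have "free_ext R (Y.F (Suc n)) g z \<in> Y.cyc (Suc n)" if z: "z \<in> X.cyc (Suc n)" for z
    proof -
      have gz: "g \<in> X (Suc n) \<rightarrow> carrier (Y.F (Suc n))" "z \<in> carrier (X.F (Suc n))"
        using g z X.cyc_closed by auto
      have "free_ext R (Y.F n) bd' (free_ext R (Y.F (Suc n)) g z)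
          = free_ext R (Y.F n) (\<lambda>x. free_ext R (Y.F n) bd' (g x)) z"
        by (rule Y.F.free_ext_comp[OF Y.F.lmod gz(1) Y.F.free_ext_hom[OF Y.bd_closed] gz(2)])
      also have "\<dots> = free_ext R (Y.F n) (\<lambda>x. free_ext R (Y.F n) f (bd x)) z"
        by (rule Y.F.free_ext_cong[OF _ _ gz(2)])
          (use g Y.F.free_ext_closed[OF f(1)] X.bd_closed in \<open>auto simp: Pi_iff\<close>)
      also have "\<dots> = free_ext R (Y.F n) f (free_ext R (X.F n) bd z)"
        by (rule X.F.free_ext_comp[symmetric, OF Y.F.lmod X.bd_closed Y.F.free_ext_hom[OF f(1)] gz(2)])
      also have "\<dots> = \<zero>\<^bsub>Y.F n\<^esub>"
        using z module_hom_zero[OF Y.F.free_ext_hom[OF f(1)] X.F.M.abelian_group_axioms Y.F.M.abelian_group_axioms]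
        by (simp add: X.cyc_Suc)
      finally show ?thesis using Y.F.free_ext_closed[OF gz] by (simp add: Y.cyc_Suc)
    qed
    with g show "\<exists>g. P (Suc n) g \<and> Q n f g" unfolding P_def Q_def by blast
  qed
  then obtain f where "\<And>n. P n (f n)" "\<And>n. Q n (f n) (f (Suc n))" by blast
  then have "chain_map R X bd Y bd' f \<and> lifts_id R M X aug Y aug' f"
    unfolding chain_map_def lifts_id_def P_def Q_def by blast
  then show ?thesis by blast
qed

text \<open>A chain map that covers the zero map has the form \<open>e = bd' s + s bd\<close>. As
  for lifts, the maps \<open>s n\<close> are built recursively from exactness of the target.\<close>

lemma null_homotopy:
  assumes "chain_map R X bd Y bd' e" and e0: "\<And>x. x \<in> X 0 \<Longrightarrow> free_ext R M aug' (e 0 x) = \<zero>\<^bsub>M\<^esub>"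
  obtains s where "\<And>n. s n \<in> X n \<rightarrow> carrier (Y.F (Suc n))"
    and "\<And>x. x \<in> X 0 \<Longrightarrow> free_ext R (Y.F 0) bd' (s 0 x) = e 0 x"
    and "\<And>n x. x \<in> X (Suc n) \<Longrightarrow> free_ext R (Y.F (Suc n)) bd' (s (Suc n) x) =
      e (Suc n) x \<ominus>\<^bsub>Y.F (Suc n)\<^esub> free_ext R (Y.F (Suc n)) (s n) (bd x)"
proof -
  have e: "e n \<in> X n \<rightarrow> carrier (Y.F n)" for n
    using assms(1) by (simp add: chain_map_def)
  have ebd: "free_ext R (Y.F n) bd' (e (Suc n) x) = free_ext R (Y.F n) (e n) (bd x)"
    if "x \<in> X (Suc n)" for n x
    using assms(1) that by (simp add: chain_map_def)
  \<comment> \<open>The invariant says that \<open>bd' s\<close> agrees with \<open>e\<close> on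
    cycles. Applied to the cycle \<open>bd x\<close> it shows that the right-hand side of
    \<open>Q\<close> is a cycle, hence a boundary.\<close>
  define P where "P n s \<longleftrightarrow> s \<in> X n \<rightarrow> carrier (Y.F (Suc n)) \<and>
      (\<forall>z\<in>X.cyc n. free_ext R (Y.F n) bd' (free_ext R (Y.F (Suc n)) s z) = free_ext R (Y.F n) (e n) z) \<and>
      (n = 0 \<longrightarrow> (\<forall>x\<in>X 0. free_ext R (Y.F 0) bd' (s x) = e 0 x))" for n :: nat and s :: "'i \<Rightarrow> 'j \<Rightarrow> 'r"
  define Q where "Q n s t \<longleftrightarrow> (\<forall>x\<in>X (Suc n). free_ext R (Y.F (Suc n)) bd' (t x) =
      e (Suc n) x \<ominus>\<^bsub>Y.F (Suc n)\<^esub> free_ext R (Y.F (Suc n)) s (bd x))"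
    for n :: nat and s t :: "'i \<Rightarrow> 'j \<Rightarrow> 'r"
  have "\<exists>s. \<forall>n. P n (s n) \<and> Q n (s n) (s (Suc n))"
  proof (rule dependent_nat_choice)
    have "\<forall>x\<in>X 0. \<exists>w\<in>carrier (Y.F (Suc 0)). free_ext R (Y.F 0) bd' w = e 0 x"
      using Y.exact e e0 by (auto simp: Y.cyc_0 Pi_iff)
    then obtain s where s: "\<And>x. x \<in> X 0 \<Longrightarrow> s x \<in> carrier (Y.F (Suc 0))"
        "\<And>x. x \<in> X 0 \<Longrightarrow> free_ext R (Y.F 0) bd' (s x) = e 0 x"
      by metis
    have "free_ext R (Y.F 0) bd' (free_ext R (Y.F (Suc 0)) s z) = free_ext R (Y.F 0) (e 0) z"
      if z: "z \<in> X.cyc 0" for z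
    proof -
      have sz: "s \<in> X 0 \<rightarrow> carrier (Y.F (Suc 0))" "z \<in> carrier (X.F 0)"
        using s z X.cyc_closed by auto
      have "free_ext R (Y.F 0) bd' (free_ext R (Y.F (Suc 0)) s z)
          = free_ext R (Y.F 0) (\<lambda>x. free_ext R (Y.F 0) bd' (s x)) z"
        by (rule Y.F.free_ext_comp[OF Y.F.lmod sz(1) Y.F.free_ext_hom[OF Y.bd_closed] sz(2)])
      also have "\<dots> = free_ext R (Y.F 0) (e 0) z"
        by (rule Y.F.free_ext_cong[symmetric, OF e _ sz(2)]) (simp add: s)
      finally show ?thesis .
    qed
    with s show "\<exists>s. P 0 s" unfolding P_def by blast
  next
    fix s n assume "P n s"
    then have s: "s \<in> X n \<rightarrow> carrier (Y.F (Suc n))"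
        "\<And>z. z \<in> X.cyc n \<Longrightarrow>
          free_ext R (Y.F n) bd' (free_ext R (Y.F (Suc n)) s z) = free_ext R (Y.F n) (e n) z"
      by (auto simp: P_def)
    note hom_bd = Y.F.free_ext_hom[OF Y.bd_closed]
    have sb: "(\<lambda>x. free_ext R (Y.F (Suc n)) s (bd x)) \<in> X (Suc n) \<rightarrow> carrier (Y.F (Suc n))"
      using Y.F.free_ext_closed[OF s(1)] X.bd_closed by (auto simp: Pi_iff)
    have "\<exists>w\<in>carrier (Y.F (Suc (Suc n))). free_ext R (Y.F (Suc n)) bd' w =
        e (Suc n) x \<ominus>\<^bsub>Y.F (Suc n)\<^esub> free_ext R (Y.F (Suc n)) s (bd x)" if x: "x \<in> X (Suc n)" for x
    proof (rule Y.exact)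
      have c: "e (Suc n) x \<in> carrier (Y.F (Suc n))" "free_ext R (Y.F (Suc n)) s (bd x) \<in> carrier (Y.F (Suc n))"
        using e sb x by (auto simp: Pi_iff)
      have c2: "free_ext R (Y.F n) (e n) (bd x) \<in> carrier (Y.F n)"
        using Y.F.free_ext_closed[OF e] X.bd_closed x by (auto simp: Pi_iff)
      have "free_ext R (Y.F n) bd' (e (Suc n) x \<ominus>\<^bsub>Y.F (Suc n)\<^esub> free_ext R (Y.F (Suc n)) s (bd x))
          = free_ext R (Y.F n) bd' (e (Suc n) x) \<ominus>\<^bsub>Y.F n\<^esub>
            free_ext R (Y.F n) bd' (free_ext R (Y.F (Suc n)) s (bd x))"
        by (rule module_hom_minus[OF hom_bd Y.F.M.abelian_group_axioms Y.F.M.abelian_group_axioms c])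
      also have "\<dots> = \<zero>\<^bsub>Y.F n\<^esub>"
        using ebd[OF x] s(2)[OF X.bd[OF x]] c2 by (simp add: Y.F.M.r_neg a_minus_def)
      finally show "e (Suc n) x \<ominus>\<^bsub>Y.F (Suc n)\<^esub> free_ext R (Y.F (Suc n)) s (bd x) \<in> Y.cyc (Suc n)"
        using c by (simp add: Y.cyc_Suc)
    qed
    then obtain t where t: "\<And>x. x \<in> X (Suc n) \<Longrightarrow> t x \<in> carrier (Y.F (Suc (Suc n)))"
        "\<And>x. x \<in> X (Suc n) \<Longrightarrow> free_ext R (Y.F (Suc n)) bd' (t x) =
          e (Suc n) x \<ominus>\<^bsub>Y.F (Suc n)\<^esub> free_ext R (Y.F (Suc n)) s (bd x)"
      by metis
    have "free_ext R (Y.F (Suc n)) bd' (free_ext R (Y.F (Suc (Suc n))) t z) =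
        free_ext R (Y.F (Suc n)) (e (Suc n)) z" if z: "z \<in> X.cyc (Suc n)" for z
    proof -
      have tz: "t \<in> X (Suc n) \<rightarrow> carrier (Y.F (Suc (Suc n)))" "z \<in> carrier (X.F (Suc n))"
        using t z X.cyc_closed by auto
      have "free_ext R (Y.F (Suc n)) bd' (free_ext R (Y.F (Suc (Suc n))) t z)
          = free_ext R (Y.F (Suc n)) (\<lambda>x. free_ext R (Y.F (Suc n)) bd' (t x)) z"
        by (rule Y.F.free_ext_comp[OF Y.F.lmod tz(1) hom_bd tz(2)])
      also have "\<dots> = free_ext R (Y.F (Suc n))
          (\<lambda>x. e (Suc n) x \<ominus>\<^bsub>Y.F (Suc n)\<^esub> free_ext R (Y.F (Suc n)) s (bd x)) z"
        by (rule Y.F.free_ext_cong[OF _ _ tz(2)])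
          (use t e sb in \<open>auto simp: Pi_iff\<close>)
      also have "\<dots> = free_ext R (Y.F (Suc n)) (e (Suc n)) z \<ominus>\<^bsub>Y.F (Suc n)\<^esub>
          free_ext R (Y.F (Suc n)) (\<lambda>x. free_ext R (Y.F (Suc n)) s (bd x)) z"
        by (rule Y.F.free_ext_minus[OF e sb tz(2)])
      also have "free_ext R (Y.F (Suc n)) (\<lambda>x. free_ext R (Y.F (Suc n)) s (bd x)) z =
          free_ext R (Y.F (Suc n)) s (free_ext R (X.F n) bd z)"
        by (rule X.F.free_ext_comp[symmetric, OF Y.F.lmod X.bd_closed Y.F.free_ext_hom[OF s(1)] tz(2)])
      also have "\<dots> = \<zero>\<^bsub>Y.F (Suc n)\<^esub>"
        using z module_hom_zero[OF Y.F.free_ext_hom[OF s(1)] X.F.M.abelian_group_axioms Y.F.M.abelian_group_axioms]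
        by (simp add: X.cyc_Suc)
      finally show ?thesis using Y.F.free_ext_closed[OF e tz(2)] by (simp add: a_minus_def)
    qed
    with t show "\<exists>t. P (Suc n) t \<and> Q n s t" unfolding P_def Q_def by blast
  qed
  then obtain s where s: "\<And>n. P n (s n)" "\<And>n. Q n (s n) (s (Suc n))" by blast
  show thesis
    by (rule that[of s]) (use s in \<open>unfold P_def Q_def, blast+\<close>)
qed

lemma chain_mapD:
  assumes "chain_map R X bd Y bd' f"
  shows "f n \<in> X n \<rightarrow> carrier (Y.F n)"
    and "x \<in> X (Suc n) \<Longrightarrow> free_ext R (Y.F n) bd' (f (Suc n) x) = free_ext R (Y.F n) (f n) (bd x)"
  using assms by (simp_all add: chain_map_def)

lemma chain_map_minus:
  assumes f: "chain_map R X bd Y bd' f" and g: "chain_map R X bd Y bd' g"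
  shows "chain_map R X bd Y bd' (\<lambda>n x. f n x \<ominus>\<^bsub>Y.F n\<^esub> g n x)"
  unfolding chain_map_def
proof (intro conjI allI ballI)
  fix n
  show "(\<lambda>x. f n x \<ominus>\<^bsub>Y.F n\<^esub> g n x) \<in> X n \<rightarrow> carrier (Y.F n)"
    using chain_mapD(1)[OF f] chain_mapD(1)[OF g] by (auto simp: Pi_iff)
  fix x assume x: "x \<in> X (Suc n)"
  have b: "bd x \<in> carrier (X.F n)" using x X.bd_closed by auto
  have c: "f (Suc n) x \<in> carrier (Y.F (Suc n))" "g (Suc n) x \<in> carrier (Y.F (Suc n))"
    using chain_mapD(1)[OF f] chain_mapD(1)[OF g] x by (auto simp: Pi_iff)
  show "free_ext R (Y.F n) bd' (f (Suc n) x \<ominus>\<^bsub>Y.F (Suc n)\<^esub> g (Suc n) x) =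
      free_ext R (Y.F n) (\<lambda>x. f n x \<ominus>\<^bsub>Y.F n\<^esub> g n x) (bd x)"
    using chain_mapD(2)[OF f x] chain_mapD(2)[OF g x]
      Y.F.free_ext_minus[OF chain_mapD(1)[OF f] chain_mapD(1)[OF g] b]
      module_hom_minus[OF Y.F.free_ext_hom[OF Y.bd_closed] Y.F.M.abelian_group_axioms
        Y.F.M.abelian_group_axioms c]
    by simp
qed

end

section \<open>Pulling cochains back along chain maps\<close>

locale two_resolutions_coeff = two_resolutions R M X bd aug Y bd' aug' + N: lmod R N
  for R :: "('r, 'x) ring_scheme" and M :: "('r, 'm, 'y) module_scheme"
    and X :: "nat \<Rightarrow> 'i set" and bd :: "'i \<Rightarrow> 'i \<Rightarrow> 'r" and aug :: "'i \<Rightarrow> 'm"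
    and Y :: "nat \<Rightarrow> 'j set" and bd' :: "'j \<Rightarrow> 'j \<Rightarrow> 'r" and aug' :: "'j \<Rightarrow> 'm"
    and N :: "('r, 'n, 'z) module_scheme"
begin

lemma pull_closed:
  assumes f: "chain_map R X bd Y bd' f" and p: "\<phi> \<in> Y n \<rightarrow> carrier N"
  shows "(\<lambda>x. free_ext R N \<phi> (f n x)) \<in> X n \<rightarrow> carrier N"
  using N.free_ext_closed[OF p] chain_mapD(1)[OF f] by (auto simp: Pi_iff)

lemma pull_bd:
  assumes f: "chain_map R X bd Y bd' f" and p: "\<phi> \<in> Y n \<rightarrow> carrier N" and x: "x \<in> X (Suc n)"
  shows "free_ext R N (\<lambda>x. free_ext R N \<phi> (f n x)) (bd x) =
    free_ext R N (\<lambda>y. free_ext R N \<phi> (bd' y)) (f (Suc n) x)"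
proof -
  have b: "bd x \<in> carrier (X.F n)" "f (Suc n) x \<in> carrier (Y.F (Suc n))"
    using x X.bd_closed chain_mapD(1)[OF f] by (auto simp: Pi_iff)
  have "free_ext R N (\<lambda>x. free_ext R N \<phi> (f n x)) (bd x) = free_ext R N \<phi> (free_ext R (Y.F n) (f n) (bd x))"
    by (rule Y.F.free_ext_comp[symmetric, OF N.lmod chain_mapD(1)[OF f] N.free_ext_hom[OF p] b(1)])
  also have "\<dots> = free_ext R N \<phi> (free_ext R (Y.F n) bd' (f (Suc n) x))"
    using chain_mapD(2)[OF f x] by simp
  also have "\<dots> = free_ext R N (\<lambda>y. free_ext R N \<phi> (bd' y)) (f (Suc n) x)"
    by (rule Y.F.free_ext_comp[OF N.lmod Y.bd_closed N.free_ext_hom[OF p] b(2)])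
  finally show ?thesis .
qed

lemma cocycle_bd_zero:
  assumes p: "gen_cocycle R N Y bd' n \<phi>" and z: "z \<in> carrier (Y.F (Suc n))"
  shows "free_ext R N (\<lambda>y. free_ext R N \<phi> (bd' y)) z = \<zero>\<^bsub>N\<^esub>"
proof -
  have "free_ext R N (\<lambda>y. free_ext R N \<phi> (bd' y)) z = free_ext R N (\<lambda>y. \<zero>\<^bsub>N\<^esub>) z"
    by (rule N.free_ext_cong[OF _ _ z]) (use p in \<open>auto simp: gen_cocycle_def\<close>)
  with N.free_ext_zero[OF z] show ?thesis by simp
qed

lemma pull_cocycle:
  assumes f: "chain_map R X bd Y bd' f" and p: "gen_cocycle R N Y bd' n \<phi>"
  shows "gen_cocycle R N X bd n (\<lambda>x. free_ext R N \<phi> (f n x))"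
proof -
  have pc: "\<phi> \<in> Y n \<rightarrow> carrier N" using p by (simp add: gen_cocycle_def)
  have "f (Suc n) x \<in> carrier (Y.F (Suc n))" if "x \<in> X (Suc n)" for x
    using chain_mapD(1)[OF f] that by (auto simp: Pi_iff)
  then show ?thesis
    unfolding gen_cocycle_def
    by (intro conjI pull_closed[OF f pc] ballI) (simp add: pull_bd[OF f pc] cocycle_bd_zero[OF p])
qed

lemma pull_cobound:
  assumes f: "chain_map R X bd Y bd' f" and p: "gen_cobound R N Y bd' n \<phi>"
  shows "gen_cobound R N X bd n (\<lambda>x. free_ext R N \<phi> (f n x))"
proof (cases n)
  case 0
  have "free_ext R N \<phi> (f 0 x) = \<zero>\<^bsub>N\<^esub>" if "x \<in> X 0" for x
  proof -
    have z: "f 0 x \<in> carrier (Y.F 0)" using chain_mapD(1)[OF f, of 0] that by (auto simp: Pi_iff)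
    have "free_ext R N \<phi> (f 0 x) = free_ext R N (\<lambda>y. \<zero>\<^bsub>N\<^esub>) (f 0 x)"
      by (rule N.free_ext_cong[symmetric, OF _ _ z]) (use p 0 in \<open>auto simp: gen_cobound_def\<close>)
    with N.free_ext_zero[OF z] show ?thesis by simp
  qed
  with 0 show ?thesis by (simp add: gen_cobound_def)
next
  case (Suc m)
  then obtain \<psi> where q: "\<psi> \<in> Y m \<rightarrow> carrier N" "\<And>y. y \<in> Y n \<Longrightarrow> \<phi> y = free_ext R N \<psi> (bd' y)"
    using p by (auto simp: gen_cobound_def)
  have "free_ext R N \<phi> (f n x) = free_ext R N (\<lambda>x. free_ext R N \<psi> (f m x)) (bd x)" if "x \<in> X n" for x
  proof -
    have z: "f (Suc m) x \<in> carrier (Y.F (Suc m))"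
      using chain_mapD(1)[OF f, of n] that Suc by (auto simp: Pi_iff)
    show ?thesis
      using pull_bd[OF f q(1)] that q(2) Suc N.free_ext_closed[OF q(1)] Y.bd_closed
      by (auto simp: Pi_iff intro!: N.free_ext_cong[OF _ _ z])
  qed
  then show ?thesis
    using pull_closed[OF f q(1)] Suc by (auto simp: gen_cobound_def)
qed

text \<open>With \<open>e = bd' s + s bd\<close> the summand \<open>\<phi> bd' s\<close> vanishes
  because \<open>\<phi>\<close> is a cocycle, and what remains is the coboundary of
  \<open>\<phi> s\<close>.\<close>

lemma pull_null_homotopic:
  assumes e: "chain_map R X bd Y bd' e" and e0: "\<And>x. x \<in> X 0 \<Longrightarrow> free_ext R M aug' (e 0 x) = \<zero>\<^bsub>M\<^esub>"
    and p: "gen_cocycle R N Y bd' n \<phi>"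
  shows "gen_cobound R N X bd n (\<lambda>x. free_ext R N \<phi> (e n x))"
proof -
  have pc: "\<phi> \<in> Y n \<rightarrow> carrier N" using p by (simp add: gen_cocycle_def)
  obtain s where s: "\<And>n. s n \<in> X n \<rightarrow> carrier (Y.F (Suc n))"
    and s0: "\<And>x. x \<in> X 0 \<Longrightarrow> free_ext R (Y.F 0) bd' (s 0 x) = e 0 x"
    and sS: "\<And>n x. x \<in> X (Suc n) \<Longrightarrow> free_ext R (Y.F (Suc n)) bd' (s (Suc n) x) =
      e (Suc n) x \<ominus>\<^bsub>Y.F (Suc n)\<^esub> free_ext R (Y.F (Suc n)) (s n) (bd x)"
    using null_homotopy[OF e e0] by blast
  have z: "free_ext R N \<phi> (free_ext R (Y.F n) bd' (s n x)) = \<zero>\<^bsub>N\<^esub>" if "x \<in> X n" for x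
  proof -
    have c: "s n x \<in> carrier (Y.F (Suc n))" using s that by (auto simp: Pi_iff)
    show ?thesis
      using Y.F.free_ext_comp[OF N.lmod Y.bd_closed N.free_ext_hom[OF pc] c] cocycle_bd_zero[OF p c]
      by simp
  qed
  show ?thesis
  proof (cases n)
    case 0
    then show ?thesis using z s0 by (simp add: gen_cobound_def)
  next
    case (Suc m)
    have sm: "s m \<in> X m \<rightarrow> carrier (Y.F n)" using s[of m] Suc by simp
    let ?\<psi> = "\<lambda>x. free_ext R N \<phi> (s m x)"
    have "?\<psi> \<in> X m \<rightarrow> carrier N"
      using sm N.free_ext_closed[OF pc] by (auto simp: Pi_iff)
    moreover have "free_ext R N \<phi> (e n x) = free_ext R N ?\<psi> (bd x)" if x: "x \<in> X n" for x
    proof -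
      have b: "bd x \<in> carrier (X.F m)" using x X.bd_closed Suc by auto
      have c: "e n x \<in> carrier (Y.F n)" "free_ext R (Y.F n) (s m) (bd x) \<in> carrier (Y.F n)"
        using chain_mapD(1)[OF e] x Y.F.free_ext_closed[OF sm b] by (auto simp: Pi_iff)
      have d: "free_ext R N \<phi> (e n x) \<in> carrier N"
          "free_ext R N \<phi> (free_ext R (Y.F n) (s m) (bd x)) \<in> carrier N"
        using N.free_ext_closed[OF pc] c by auto
      have eq: "free_ext R (Y.F n) bd' (s n x) = e n x \<ominus>\<^bsub>Y.F n\<^esub> free_ext R (Y.F n) (s m) (bd x)"
        using sS[of x m] x unfolding Suc by blast
      have "free_ext R N \<phi> (e n x) \<ominus>\<^bsub>N\<^esub> free_ext R N \<phi> (free_ext R (Y.F n) (s m) (bd x)) = \<zero>\<^bsub>N\<^esub>"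
        using z[OF x, unfolded eq]
          module_hom_minus[OF N.free_ext_hom[OF pc] Y.F.M.abelian_group_axioms N.M.abelian_group_axioms c]
        by (rule trans[rotated, OF _ sym])
      then have "free_ext R N \<phi> (e n x) = free_ext R N \<phi> (free_ext R (Y.F n) (s m) (bd x))"
        using d by (rule N.M.minus_zeroD)
      also have "\<dots> = free_ext R N ?\<psi> (bd x)"
        by (rule Y.F.free_ext_comp[OF N.lmod sm N.free_ext_hom[OF pc] b])
      finally show ?thesis .
    qed
    ultimately show ?thesis using Suc by (auto simp: gen_cobound_def)
  qed
qed

text \<open>The difference of two lifts of the identity covers zero, so it is
  null-homotopic.\<close>

lemma pull_lifts_cobound:
  assumes f: "chain_map R X bd Y bd' f" "lifts_id R M X aug Y aug' f"
    and g: "chain_map R X bd Y bd' g" "lifts_id R M X aug Y aug' g"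
    and p: "gen_cocycle R N Y bd' n \<phi>"
  shows "gen_cobound R N X bd n (\<lambda>x. free_ext R N \<phi> (f n x) \<ominus>\<^bsub>N\<^esub> free_ext R N \<phi> (g n x))"
proof -
  have pc: "\<phi> \<in> Y n \<rightarrow> carrier N" using p by (simp add: gen_cocycle_def)
  have c: "f n x \<in> carrier (Y.F n)" "g n x \<in> carrier (Y.F n)" if "x \<in> X n" for n x
    using chain_mapD(1)[OF f(1)] chain_mapD(1)[OF g(1)] that by (auto simp: Pi_iff)
  have "gen_cobound R N X bd n (\<lambda>x. free_ext R N \<phi> (f n x \<ominus>\<^bsub>Y.F n\<^esub> g n x))"
  proof (rule pull_null_homotopic[OF chain_map_minus[OF f(1) g(1)] _ p])
    fix x assume x: "x \<in> X 0"
    then have "aug x \<in> carrier M" using X.aug by auto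
    then show "free_ext R M aug' (f 0 x \<ominus>\<^bsub>Y.F 0\<^esub> g 0 x) = \<zero>\<^bsub>M\<^esub>"
      using f(2) g(2) x module_hom_minus[OF X.free_ext_hom[OF Y.aug] Y.F.M.abelian_group_axioms
        X.M.abelian_group_axioms c[OF x]]
      by (simp add: lifts_id_def a_minus_def X.M.r_neg)
  qed
  moreover have "free_ext R N \<phi> (f n x \<ominus>\<^bsub>Y.F n\<^esub> g n x) =
      free_ext R N \<phi> (f n x) \<ominus>\<^bsub>N\<^esub> free_ext R N \<phi> (g n x)" if "x \<in> X n" for x
    by (rule module_hom_minus[OF N.free_ext_hom[OF pc] Y.F.M.abelian_group_axioms
      N.M.abelian_group_axioms c[OF that]])
  ultimately show ?thesis
    by (simp cong: gen_cobound_cong)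
qed

end

context free_resolution
begin

text \<open>\<open>free_gen\<close> is the identity matrix.\<close>

lemma chain_map_id: "chain_map R X bd X bd (\<lambda>n. free_gen R)" "lifts_id R M X aug X aug (\<lambda>n. free_gen R)"
proof -
  have "free_ext R (F n) bd (free_gen R x) = free_ext R (F n) (free_gen R) (bd x)" if "x \<in> X (Suc n)" for n x
  proof -
    have b: "bd x \<in> carrier (F n)" using bd_closed that by auto
    have "(\<lambda>f. f) \<in> module_hom R (F n) (F n)" by (auto intro: module_homI)
    from F.free_hom_eq_free_ext[OF this b] F.free_ext_gen[of bd x n, OF b] show ?thesis by simp
  qed
  then show "chain_map R X bd X bd (\<lambda>n. free_gen R)"
    by (auto simp: chain_map_def)
  show "lifts_id R M X aug X aug (\<lambda>n. free_gen R)"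
    using aug by (auto simp: lifts_id_def Pi_iff free_ext_gen)
qed

end

context two_resolutions
begin

lemma chain_map_comp:
  assumes f: "chain_map R X bd Y bd' f" "lifts_id R M X aug Y aug' f"
    and g: "chain_map R Y bd' X bd g" "lifts_id R M Y aug' X aug g"
  shows "chain_map R X bd X bd (\<lambda>n x. free_ext R (X.F n) (g n) (f n x))"
    "lifts_id R M X aug X aug (\<lambda>n x. free_ext R (X.F n) (g n) (f n x))"
proof -
  interpret YX: two_resolutions R M Y bd' aug' X bd aug ..
  note gc = YX.chain_mapD(1)[OF g(1)]
  have c: "f n x \<in> carrier (Y.F n)" if "x \<in> X n" for n x
    using chain_mapD(1)[OF f(1)] that by (auto simp: Pi_iff)
  have "free_ext R (X.F n) bd (free_ext R (X.F (Suc n)) (g (Suc n)) (f (Suc n) x)) =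
      free_ext R (X.F n) (\<lambda>x. free_ext R (X.F n) (g n) (f n x)) (bd x)" if x: "x \<in> X (Suc n)" for n x
  proof -
    have b: "bd x \<in> carrier (X.F n)" using x X.bd_closed by auto
    have "free_ext R (X.F n) bd (free_ext R (X.F (Suc n)) (g (Suc n)) (f (Suc n) x)) =
        free_ext R (X.F n) (\<lambda>y. free_ext R (X.F n) bd (g (Suc n) y)) (f (Suc n) x)"
      by (rule X.F.free_ext_comp[OF X.F.lmod gc X.F.free_ext_hom[OF X.bd_closed] c[OF x]])
    also have "\<dots> = free_ext R (X.F n) (\<lambda>y. free_ext R (X.F n) (g n) (bd' y)) (f (Suc n) x)"
      by (rule X.F.free_ext_cong[OF _ _ c[OF x]])
        (use X.F.free_ext_closed[OF gc] Y.bd_closed YX.chain_mapD(2)[OF g(1)] in \<open>auto simp: Pi_iff\<close>)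
    also have "\<dots> = free_ext R (X.F n) (g n) (free_ext R (Y.F n) bd' (f (Suc n) x))"
      by (rule Y.F.free_ext_comp[symmetric, OF X.F.lmod Y.bd_closed X.F.free_ext_hom[OF gc] c[OF x]])
    also have "\<dots> = free_ext R (X.F n) (g n) (free_ext R (Y.F n) (f n) (bd x))"
      using chain_mapD(2)[OF f(1) x] by simp
    also have "\<dots> = free_ext R (X.F n) (\<lambda>x. free_ext R (X.F n) (g n) (f n x)) (bd x)"
      by (rule Y.F.free_ext_comp[OF X.F.lmod chain_mapD(1)[OF f(1)] X.F.free_ext_hom[OF gc] b])
    finally show ?thesis .
  qed
  then show "chain_map R X bd X bd (\<lambda>n x. free_ext R (X.F n) (g n) (f n x))"
    using X.F.free_ext_closed[OF gc] c by (auto simp: chain_map_def)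
  have "free_ext R M aug (free_ext R (X.F 0) (g 0) (f 0 x)) = aug x" if x: "x \<in> X 0" for x
  proof -
    have "free_ext R M aug (free_ext R (X.F 0) (g 0) (f 0 x)) =
        free_ext R M (\<lambda>y. free_ext R M aug (g 0 y)) (f 0 x)"
      by (rule X.F.free_ext_comp[OF X.lmod gc X.free_ext_hom[OF X.aug] c[OF x]])
    also have "\<dots> = free_ext R M aug' (f 0 x)"
      by (rule X.free_ext_cong[symmetric, OF Y.aug _ c[OF x]]) (use g(2) in \<open>auto simp: lifts_id_def\<close>)
    finally show ?thesis using f(2) x by (simp add: lifts_id_def)
  qed
  then show "lifts_id R M X aug X aug (\<lambda>n x. free_ext R (X.F n) (g n) (f n x))"
    by (simp add: lifts_id_def)
qed

end

context two_resolutions_coeff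
begin

text \<open>The composite of the two comparison maps and the identity are both lifts of the
  identity, so their pullbacks differ by a coboundary.\<close>

lemma pull_comp_cobound:
  assumes f: "chain_map R X bd Y bd' f" "lifts_id R M X aug Y aug' f"
    and g: "chain_map R Y bd' X bd g" "lifts_id R M Y aug' X aug g"
    and p: "gen_cocycle R N X bd n \<phi>"
  shows "gen_cobound R N X bd n
    (\<lambda>x. free_ext R N (\<lambda>y. free_ext R N \<phi> (g n y)) (f n x) \<ominus>\<^bsub>N\<^esub> \<phi> x)"
proof -
  interpret XX: two_resolutions_coeff R M X bd aug X bd aug N ..
  interpret YX: two_resolutions R M Y bd' aug' X bd aug ..
  have pc: "\<phi> \<in> X n \<rightarrow> carrier N" using p by (simp add: gen_cocycle_def)
  have "free_ext R N (\<lambda>y. free_ext R N \<phi> (g n y)) (f n x) \<ominus>\<^bsub>N\<^esub> \<phi> x =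
      free_ext R N \<phi> (free_ext R (X.F n) (g n) (f n x)) \<ominus>\<^bsub>N\<^esub> free_ext R N \<phi> (free_gen R x)"
    if "x \<in> X n" for x
  proof -
    have c: "f n x \<in> carrier (Y.F n)" using chain_mapD(1)[OF f(1)] that by (auto simp: Pi_iff)
    show ?thesis
      using X.F.free_ext_comp[OF N.lmod YX.chain_mapD(1)[OF g(1)] N.free_ext_hom[OF pc] c] pc that
      by (auto simp: N.free_ext_gen Pi_iff)
  qed
  then show ?thesis
    using XX.pull_lifts_cobound[OF chain_map_comp[OF f g] X.chain_map_id p]
    by (simp cong: gen_cobound_cong)
qed

text \<open>Coboundaries are closed under differences, and
  \<open>\<psi> = \<phi> - (\<phi> - \<psi>)\<close>.\<close>

lemma gen_cobound_minusD:
  assumes "gen_cobound R N X bd n (\<lambda>x. \<phi> x \<ominus>\<^bsub>N\<^esub> \<psi> x)" "gen_cobound R N X bd n \<phi>"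
    and pc: "\<phi> \<in> X n \<rightarrow> carrier N" and qc: "\<psi> \<in> X n \<rightarrow> carrier N"
  shows "gen_cobound R N X bd n \<psi>"
proof (cases n)
  case 0
  then show ?thesis using assms by (auto simp: gen_cobound_def Pi_iff a_minus_def)
next
  case (Suc m)
  obtain a b where a: "a \<in> X m \<rightarrow> carrier N" "\<And>x. x \<in> X n \<Longrightarrow> \<phi> x \<ominus>\<^bsub>N\<^esub> \<psi> x = free_ext R N a (bd x)"
    and b: "b \<in> X m \<rightarrow> carrier N" "\<And>x. x \<in> X n \<Longrightarrow> \<phi> x = free_ext R N b (bd x)"
    using assms(1,2) unfolding gen_cobound_def Suc nat.case by (elim bexE) blast
  have "\<psi> x = free_ext R N (\<lambda>x. b x \<ominus>\<^bsub>N\<^esub> a x) (bd x)" if x: "x \<in> X n" for x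
  proof -
    have d: "bd x \<in> carrier (X.F m)" using x X.bd_closed Suc by auto
    have c: "\<phi> x \<in> carrier N" "\<psi> x \<in> carrier N" using pc qc x by auto
    have "free_ext R N (\<lambda>x. b x \<ominus>\<^bsub>N\<^esub> a x) (bd x) = \<phi> x \<ominus>\<^bsub>N\<^esub> (\<phi> x \<ominus>\<^bsub>N\<^esub> \<psi> x)"
      by (simp only: N.free_ext_minus[OF b(1) a(1) d] a(2)[OF x, symmetric] b(2)[OF x, symmetric])
    also have "\<dots> = \<psi> x"
      by (rule N.M.minus_minus_cancel[OF c])
    finally show ?thesis by simp
  qed
  moreover have "(\<lambda>x. b x \<ominus>\<^bsub>N\<^esub> a x) \<in> X m \<rightarrow> carrier N"
    using a b by (auto simp: Pi_iff)
  ultimately show ?thesis using Suc by (auto simp: gen_cobound_def)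
qed

text \<open>There is a comparison map in each direction, and both composites are homotopic to
  identities. The result is phrased by cocycles and coboundaries rather than by quotients, because
  the cochains on the second set of generators will be reread over a smaller ring before the
  quotient is taken.\<close>

theorem comparison_cohomology:
  obtains g where "\<And>n. g n \<in> Y n \<rightarrow> carrier (X.F n)"
    and "\<And>n \<phi>. gen_cocycle R N X bd n \<phi> \<Longrightarrow> gen_cocycle R N Y bd' n (\<lambda>y. free_ext R N \<phi> (g n y))"
    and "\<And>n \<phi>. gen_cocycle R N X bd n \<phi> \<Longrightarrow>
      gen_cobound R N Y bd' n (\<lambda>y. free_ext R N \<phi> (g n y)) \<longleftrightarrow> gen_cobound R N X bd n \<phi>"
    and "\<And>n \<psi>. gen_cocycle R N Y bd' n \<psi> \<Longrightarrow> \<exists>\<phi>. gen_cocycle R N X bd n \<phi> \<and>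
      gen_cobound R N Y bd' n (\<lambda>y. free_ext R N \<phi> (g n y) \<ominus>\<^bsub>N\<^esub> \<psi> y)"
proof -
  interpret YX: two_resolutions_coeff R M Y bd' aug' X bd aug N ..
  obtain f where f: "chain_map R X bd Y bd' f" "lifts_id R M X aug Y aug' f"
    using comparison_exists by blast
  obtain g where g: "chain_map R Y bd' X bd g" "lifts_id R M Y aug' X aug g"
    using YX.comparison_exists by blast
  show thesis
  proof (rule that[of g])
    show "g n \<in> Y n \<rightarrow> carrier (X.F n)" for n
      by (rule YX.chain_mapD(1)[OF g(1)])
    fix n \<phi> assume p: "gen_cocycle R N X bd n \<phi>"
    then have pc: "\<phi> \<in> X n \<rightarrow> carrier N" by (simp add: gen_cocycle_def)
    show "gen_cocycle R N Y bd' n (\<lambda>y. free_ext R N \<phi> (g n y))"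
      by (rule YX.pull_cocycle[OF g(1) p])
    show "gen_cobound R N Y bd' n (\<lambda>y. free_ext R N \<phi> (g n y)) \<longleftrightarrow> gen_cobound R N X bd n \<phi>"
    proof
      assume "gen_cobound R N Y bd' n (\<lambda>y. free_ext R N \<phi> (g n y))"
      \<comment> \<open>Pulled back along \<open>f\<close>, the given coboundary becomes the
        pullback along the composite, which differs from \<open>\<phi>\<close> by a
        coboundary.\<close>
      from pull_cobound[OF f(1) this] show "gen_cobound R N X bd n \<phi>"
        by (rule gen_cobound_minusD[OF pull_comp_cobound[OF f g p] _ pull_closed[OF f(1) YX.pull_closed[OF g(1) pc]] pc])
    qed (rule YX.pull_cobound[OF g(1)])
  next
    fix n \<psi> assume q: "gen_cocycle R N Y bd' n \<psi>"
    show "\<exists>\<phi>. gen_cocycle R N X bd n \<phi> \<and>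
        gen_cobound R N Y bd' n (\<lambda>y. free_ext R N \<phi> (g n y) \<ominus>\<^bsub>N\<^esub> \<psi> y)"
      using pull_cocycle[OF f(1) q] YX.pull_comp_cobound[OF g f q] by blast
  qed
qed

end

section \<open>Quotient modules and Ext\<close>

context module
begin

context
  fixes N assumes N: "submodule N R M"
begin

lemma submodule_abelian_subgroup: "abelian_subgroup N M"
  by (intro abelian_subgroupI3 additive_subgroup.intro submodule.axioms(1)[OF N] M.abelian_group_axioms)

lemma quot_carrier: "carrier (quot_module M N) = (\<lambda>x. N +>\<^bsub>M\<^esub> x) ` carrier M"
  by (auto simp: quot_module_def A_RCOSETS_def')

lemma quot_eq_iff:
  assumes "x \<in> carrier M" "y \<in> carrier M"
  shows "N +>\<^bsub>M\<^esub> x = N +>\<^bsub>M\<^esub> y \<longleftrightarrow> x \<ominus>\<^bsub>M\<^esub> y \<in> N"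
proof -
  interpret abelian_subgroup N M by (rule submodule_abelian_subgroup)
  show ?thesis
    using assms a_rcos_self[of x] a_repr_independence'[of x y] a_rcos_module[of y x] M.abelian_group_axioms
    by (metis a_minus_def)
qed

lemma quot_add:
  assumes "x \<in> carrier M" "y \<in> carrier M"
  shows "(N +>\<^bsub>M\<^esub> x) \<oplus>\<^bsub>quot_module M N\<^esub> (N +>\<^bsub>M\<^esub> y) = N +>\<^bsub>M\<^esub> (x \<oplus>\<^bsub>M\<^esub> y)"
  using abelian_subgroup.a_rcos_sum[OF submodule_abelian_subgroup assms] by (simp add: quot_module_def)

text \<open>Scalar multiplication in \<open>quot_module\<close>, and the maps out of quotients
  below, are written as unions over all representatives; such a union is harmless once every
  representative contributes the same set.\<close>

lemma quot_Union:
  assumes x: "x \<in> carrier M"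
    and f: "\<And>y. y \<in> carrier M \<Longrightarrow> y \<ominus>\<^bsub>M\<^esub> x \<in> N \<Longrightarrow> f y = c"
  shows "(\<Union>y\<in>N +>\<^bsub>M\<^esub> x. f y) = c"
proof -
  interpret abelian_subgroup N M by (rule submodule_abelian_subgroup)
  have "f y = c" if y: "y \<in> N +>\<^bsub>M\<^esub> x" for y
  proof -
    have yc: "y \<in> carrier M" by (rule a_elemrcos_carrier[OF x y])
    show ?thesis
      using y by (intro f yc) (simp add: a_rcos_module[OF x yc] a_minus_def)
  qed
  with a_rcos_self[OF x] show ?thesis by blast
qed

lemma quot_smult:
  assumes r: "r \<in> carrier R" and x: "x \<in> carrier M"
  shows "r \<odot>\<^bsub>quot_module M N\<^esub> (N +>\<^bsub>M\<^esub> x) = N +>\<^bsub>M\<^esub> (r \<odot>\<^bsub>M\<^esub> x)"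
proof -
  have "(\<Union>y\<in>N +>\<^bsub>M\<^esub> x. N +>\<^bsub>M\<^esub> (r \<odot>\<^bsub>M\<^esub> y)) = N +>\<^bsub>M\<^esub> (r \<odot>\<^bsub>M\<^esub> x)"
  proof (rule quot_Union[OF x])
    fix y assume y: "y \<in> carrier M" "y \<ominus>\<^bsub>M\<^esub> x \<in> N"
    have "r \<odot>\<^bsub>M\<^esub> y \<ominus>\<^bsub>M\<^esub> r \<odot>\<^bsub>M\<^esub> x = r \<odot>\<^bsub>M\<^esub> (y \<ominus>\<^bsub>M\<^esub> x)"
      using r x y by (simp add: a_minus_def smult_r_distr smult_r_minus)
    then show "N +>\<^bsub>M\<^esub> (r \<odot>\<^bsub>M\<^esub> y) = N +>\<^bsub>M\<^esub> (r \<odot>\<^bsub>M\<^esub> x)"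
      using r x y submodule.smult_closed[OF N] by (simp add: quot_eq_iff)
  qed
  then show ?thesis by (simp add: quot_module_def)
qed

lemma quot_zero: "\<zero>\<^bsub>quot_module M N\<^esub> = N +>\<^bsub>M\<^esub> \<zero>\<^bsub>M\<^esub>"
  using submoduleE(1)[OF N] by (simp add: quot_module_def)

lemma quot_module_module: "module R (quot_module M N)"
proof (rule moduleI)
  show "abelian_group (quot_module M N)"
  proof (rule abelian_groupI)
    fix X assume "X \<in> carrier (quot_module M N)"
    then obtain x where "x \<in> carrier M" "X = N +>\<^bsub>M\<^esub> x" by (auto simp: quot_carrier)
    then show "\<exists>Y\<in>carrier (quot_module M N). Y \<oplus>\<^bsub>quot_module M N\<^esub> X = \<zero>\<^bsub>quot_module M N\<^esub>"
      by (intro bexI[of _ "N +>\<^bsub>M\<^esub> (\<ominus>\<^bsub>M\<^esub> x)"]) (auto simp: quot_carrier quot_add quot_zero M.l_neg)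
  qed (auto simp: quot_carrier quot_add quot_zero M.a_ac)
qed (auto simp: quot_carrier quot_add quot_smult smult_l_distr smult_r_distr smult_assoc1 R.cring_axioms)

lemma quot_hom: "(\<lambda>x. N +>\<^bsub>M\<^esub> x) \<in> module_hom R M (quot_module M N)"
  by (auto intro!: module_homI simp: quot_carrier quot_add quot_smult)

end

lemma gen_submodule_submodule:
  assumes "S \<subseteq> carrier M"
  shows "submodule (gen_submodule R M S) R M"
proof (rule submoduleI)
  show "gen_submodule R M S \<subseteq> carrier M"
    using carrier_is_submodule assms by (auto simp: gen_submodule_def)
qed (auto simp: gen_submodule_def dest: submoduleE(3,4,5) subgroup.one_closed[OF submodule.axioms(1)])

lemma kernel_submodule:
  assumes W: "module R W" and h: "h \<in> module_hom R M W"
  shows "submodule {v \<in> carrier M. h v = \<zero>\<^bsub>W\<^esub>} R M"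
proof -
  interpret W: module R W by fact
  interpret h: abelian_group_hom M W h
    by (rule module_hom_group[OF h M.abelian_group_axioms W.M.abelian_group_axioms])
  show ?thesis by (rule submoduleI) (auto simp: module_homD(3)[OF h])
qed

lemma image_submodule:
  assumes W: "module R W" and h: "h \<in> module_hom R M W"
  shows "submodule (h ` carrier M) R W"
proof -
  interpret W: module R W by fact
  interpret h: abelian_group_hom M W h
    by (rule module_hom_group[OF h M.abelian_group_axioms W.M.abelian_group_axioms])
  show ?thesis
  proof (rule W.submoduleI)
    show "\<zero>\<^bsub>W\<^esub> \<in> h ` carrier M" by (rule image_eqI[of _ _ "\<zero>\<^bsub>M\<^esub>"]) auto
    show "\<ominus>\<^bsub>W\<^esub> a \<in> h ` carrier M" if "a \<in> h ` carrier M" for a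
      using that h.hom_a_inv by (metis (no_types, lifting) M.a_inv_closed image_iff)
    show "a \<oplus>\<^bsub>W\<^esub> b \<in> h ` carrier M" if "a \<in> h ` carrier M" "b \<in> h ` carrier M" for a b
      using that h.hom_add by (metis (no_types, lifting) M.a_closed image_iff)
    show "r \<odot>\<^bsub>W\<^esub> a \<in> h ` carrier M" if "r \<in> carrier R" "a \<in> h ` carrier M" for r a
      using that module_homD(3)[OF h] by (metis (no_types, lifting) smult_closed image_iff)
  qed (auto simp: module_homD[OF h])
qed

lemma smult_module_hom: "c \<in> carrier R \<Longrightarrow> (\<lambda>x. c \<odot>\<^bsub>M\<^esub> x) \<in> module_hom R M M"
  by (intro module_homI) (simp_all add: smult_r_distr smult_assoc1[symmetric] R.m_comm)

lemma zero_submodule: "submodule {\<zero>\<^bsub>M\<^esub>} R M"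
  by (rule submoduleI) auto

lemma submodule_restrict:
  assumes "submodule B R M" "submodule Z R M" "B \<subseteq> Z"
  shows "submodule B R (M\<lparr>carrier := Z\<rparr>)"
proof -
  have "submodule Z R M" by fact
  then have "module R (M\<lparr>carrier := Z\<rparr>)"
    using submodule.submodule_is_module module_axioms by blast
  then interpret Z: module R "M\<lparr>carrier := Z\<rparr>" .
  \<comment> \<open>\<open>a_inv\<close> is a description over the carrier, so its value has to be
    compared when the carrier is restricted.\<close>
  have inv: "\<ominus>\<^bsub>M\<lparr>carrier := Z\<rparr>\<^esub> a = \<ominus>\<^bsub>M\<^esub> a" if "a \<in> B" for a
  proof -
    have "a \<in> Z" "\<ominus>\<^bsub>M\<^esub> a \<in> Z" "a \<in> carrier M"
      using that assms submoduleE[OF assms(2)] by auto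
    then show ?thesis
      by (intro Z.M.minus_equality) (simp_all add: M.l_neg)
  qed
  show ?thesis
    by (rule Z.submoduleI) (use assms submoduleE[OF assms(1)] inv
        subgroup.one_closed[OF submodule.axioms(1)[OF assms(1)]] in auto)
qed

end

text \<open>The map \<open>h\<close> itself may fail to be bijective: it only has to match
  membership in the two denominators and to reach every class of the target. This is what a
  comparison map of resolutions provides.\<close>

lemma quot_module_iso:
  assumes V: "module K V" and B: "submodule B K V" and W: "module K W" and C: "submodule C K W"
    and h: "h \<in> module_hom K V W"
    and inj: "\<And>v. v \<in> carrier V \<Longrightarrow> h v \<in> C \<longleftrightarrow> v \<in> B"
    and surj: "\<And>w. w \<in> carrier W \<Longrightarrow> \<exists>v\<in>carrier V. h v \<ominus>\<^bsub>W\<^esub> w \<in> C"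
  shows "is_module_iso K (quot_module V B) (quot_module W C)"
proof -
  interpret V: module K V by fact
  interpret W: module K W by fact
  define g where "g X = (\<Union>x\<in>X. C +>\<^bsub>W\<^esub> h x)" for X
  have minus: "h (x \<ominus>\<^bsub>V\<^esub> y) = h x \<ominus>\<^bsub>W\<^esub> h y" if "x \<in> carrier V" "y \<in> carrier V" for x y
    by (rule module_hom_minus[OF h V.M.abelian_group_axioms W.M.abelian_group_axioms that])
  have g: "g (B +>\<^bsub>V\<^esub> x) = C +>\<^bsub>W\<^esub> h x" if x: "x \<in> carrier V" for x
    unfolding g_def
  proof (rule V.quot_Union[OF B x])
    fix y assume y: "y \<in> carrier V" "y \<ominus>\<^bsub>V\<^esub> x \<in> B"
    then have "h y \<ominus>\<^bsub>W\<^esub> h x \<in> C"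
      using x inj[of "y \<ominus>\<^bsub>V\<^esub> x"] minus by simp
    then show "C +>\<^bsub>W\<^esub> h y = C +>\<^bsub>W\<^esub> h x"
      using x y by (simp add: W.quot_eq_iff[OF C] module_homD[OF h])
  qed
  have "g \<in> module_hom K (quot_module V B) (quot_module W C)"
    by (rule module_homI)
      (auto simp: V.quot_carrier[OF B] W.quot_carrier[OF C] V.quot_add[OF B] V.quot_smult[OF B]
        W.quot_add[OF C] W.quot_smult[OF C] g module_homD[OF h])
  moreover have "inj_on g (carrier (quot_module V B))"
  proof (rule inj_onI)
    fix X Y assume "X \<in> carrier (quot_module V B)" "Y \<in> carrier (quot_module V B)" and eq: "g X = g Y"
    then obtain x y where xy: "x \<in> carrier V" "X = B +>\<^bsub>V\<^esub> x" "y \<in> carrier V" "Y = B +>\<^bsub>V\<^esub> y"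
      by (auto simp: V.quot_carrier[OF B])
    then have "h (x \<ominus>\<^bsub>V\<^esub> y) \<in> C"
      using eq g W.quot_eq_iff[OF C, of "h x" "h y"] minus by (simp add: module_homD[OF h])
    then show "X = Y" using xy inj by (simp add: V.quot_eq_iff[OF B])
  qed
  moreover have "g ` carrier (quot_module V B) = carrier (quot_module W C)"
  proof
    show "g ` carrier (quot_module V B) \<subseteq> carrier (quot_module W C)"
      by (auto simp: V.quot_carrier[OF B] W.quot_carrier[OF C] g module_homD[OF h])
    show "carrier (quot_module W C) \<subseteq> g ` carrier (quot_module V B)"
    proof
      fix Y assume "Y \<in> carrier (quot_module W C)"
      then obtain w where w: "w \<in> carrier W" "Y = C +>\<^bsub>W\<^esub> w" by (auto simp: W.quot_carrier[OF C])
      with surj obtain v where v: "v \<in> carrier V" "h v \<ominus>\<^bsub>W\<^esub> w \<in> C" by blast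
      then have "Y = g (B +>\<^bsub>V\<^esub> v)"
        using w W.quot_eq_iff[OF C, of "h v" w] by (simp add: g module_homD[OF h])
      then show "Y \<in> g ` carrier (quot_module V B)"
        using v by (auto simp: V.quot_carrier[OF B])
    qed
  qed
  ultimately show ?thesis
    unfolding is_module_iso_def bij_betw_def by blast
qed

text \<open>Above degree 0 this is \<open>bd bd = 0\<close>, which is contained in the requirement
  that \<open>bd x\<close> be a cycle.\<close>

lemma (in free_resolution) gen_cobound_cocycle:
  assumes N: "lmod R N" and p: "gen_cobound R N X bd n \<phi>" and pc: "\<phi> \<in> X n \<rightarrow> carrier N"
  shows "gen_cocycle R N X bd n \<phi>"
proof -
  interpret N: lmod R N by fact
  have "free_ext R N \<phi> (bd x) = \<zero>\<^bsub>N\<^esub>" if x: "x \<in> X (Suc n)" for x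
  proof -
    have b: "bd x \<in> carrier (F n)" "bd x \<in> cyc n" using x bd_closed bd by auto
    show ?thesis
    proof (cases n)
      case 0
      have "free_ext R N \<phi> (bd x) = free_ext R N (\<lambda>y. \<zero>\<^bsub>N\<^esub>) (bd x)"
        by (rule N.free_ext_cong[OF pc _ b(1)]) (use p 0 in \<open>auto simp: gen_cobound_def\<close>)
      with N.free_ext_zero[OF b(1)] show ?thesis by simp
    next
      case (Suc m)
      then obtain \<psi> where q: "\<psi> \<in> X m \<rightarrow> carrier N" "\<And>y. y \<in> X n \<Longrightarrow> \<phi> y = free_ext R N \<psi> (bd y)"
        using p by (auto simp: gen_cobound_def)
      have b': "bd \<in> X n \<rightarrow> carrier (F m)" "bd x \<in> carrier (F n)" using bd_closed[of m] b Suc by auto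
      have "free_ext R N \<phi> (bd x) = free_ext R N (\<lambda>y. free_ext R N \<psi> (bd y)) (bd x)"
        by (rule N.free_ext_cong[OF pc q(2) b(1)])
      also have "\<dots> = free_ext R N \<psi> (free_ext R (F m) bd (bd x))"
        by (rule F.free_ext_comp[symmetric, OF N.lmod b'(1) N.free_ext_hom[OF q(1)] b'(2)])
      also have "free_ext R (F m) bd (bd x) = \<zero>\<^bsub>F m\<^esub>"
        using b(2) cyc_Suc Suc by blast
      also have "free_ext R N \<psi> \<zero>\<^bsub>F m\<^esub> = \<zero>\<^bsub>N\<^esub>"
        by (rule module_hom_zero[OF N.free_ext_hom[OF q(1)] F.M.abelian_group_axioms N.M.abelian_group_axioms])
      finally show ?thesis .
    qed
  qed
  with pc show ?thesis by (simp add: gen_cocycle_def)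
qed

section \<open>The standard free resolution\<close>

lemma (in lmod) lincomb_cong:
  assumes "\<And>x. x \<in> X \<Longrightarrow> b x = c x" "set xs \<subseteq> carrier R \<times> X"
  shows "lincomb M b xs = lincomb M c xs"
  using assms(2) by (induction xs) (auto simp: lincomb_simps assms(1))

lemma (in lmod) free_ext_lincomb:
  assumes b: "b \<in> X \<rightarrow> carrier M" and xs: "set xs \<subseteq> carrier R \<times> X"
  shows "free_ext R M b (lincomb (free_module R X) (free_gen R) xs) = lincomb M b xs"
proof -
  interpret F: lmod R "free_module R X" by (rule R.free_lmod)
  have "free_ext R M b (lincomb (free_module R X) (free_gen R) xs)
      = lincomb M (\<lambda>x. free_ext R M b (free_gen R x)) xs"
    by (rule F.lincomb_hom[OF lmod free_ext_hom[OF b] _ xs]) auto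
  also have "\<dots> = lincomb M b xs"
    by (rule lincomb_cong[OF _ xs]) (use b in \<open>auto simp: free_ext_gen Pi_iff\<close>)
  finally show ?thesis .
qed

lemma (in lmod) standard_resolution:
  "free_resolution R M (res_gens R M) (gen_bd R) gen_aug"
proof -
  let ?X = "res_gens R M" and ?F = "\<lambda>n. free_module R (res_gens R M n)"
  have F: "lmod R (?F n)" for n by (rule R.free_lmod)
  have aug: "gen_aug \<in> ?X 0 \<rightarrow> carrier M" by auto
  have bd_eq: "gen_bd R (Rel xs) = lincomb (?F n) (free_gen R) xs" for xs n
    using R.lincomb_free[of UNIV "free_gen R" xs] by simp
  have bd_in: "gen_bd R (Rel xs) \<in> carrier (?F n)" if "set xs \<subseteq> carrier R \<times> ?X n" for xs n
    unfolding bd_eq[of xs n] by (rule lmod.lincomb_closed[OF F _ that]) auto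
  have Rel_Suc: "\<exists>xs. x = Rel xs \<and> set xs \<subseteq> carrier R \<times> ?X n" if "x \<in> ?X (Suc n)" for x n
    using that by (cases n) auto
  have bd_c: "gen_bd R \<in> ?X (Suc n) \<rightarrow> carrier (?F n)" for n
    using Rel_Suc bd_in by blast
  \<comment> \<open>The side conditions in \<open>res_gens\<close> evaluate the augmentation or the
    boundary termwise on \<open>xs\<close>; by linearity this is its value on the element that
    \<open>xs\<close> denotes.\<close>
  have cyc_iff: "gen_bd R (Rel xs) \<in> res_cycles R M ?X (gen_bd R) gen_aug n \<longleftrightarrow> Rel xs \<in> ?X (Suc n)"
    if xs: "set xs \<subseteq> carrier R \<times> ?X n" for xs n
  proof (cases n)
    case 0
    then show ?thesis
      using bd_in[of xs 0] xs free_ext_lincomb[OF aug, of xs] bd_eq[of xs 0] by (auto simp: res_cycles_def)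
  next
    case (Suc m)
    then show ?thesis
      using bd_in[of xs n] xs lmod.free_ext_lincomb[OF F bd_c, of xs m] bd_eq[of xs "Suc m"]
      by (auto simp: res_cycles_def)
  qed
  show ?thesis
  proof (intro free_resolution.intro free_resolution_axioms.intro lmod aug)
    fix x n assume "x \<in> ?X (Suc n)"
    with Rel_Suc cyc_iff show "gen_bd R x \<in> res_cycles R M ?X (gen_bd R) gen_aug n" by blast
  next
    fix m assume m: "m \<in> carrier M"
    then have "free_ext R M gen_aug (free_gen R (Gen m)) = m"
      by (subst free_ext_gen) auto
    with m show "\<exists>z\<in>carrier (?F 0). free_ext R M gen_aug z = m"
      by (intro bexI[of _ "free_gen R (Gen m)"]) auto
  next
    fix z n assume z: "z \<in> res_cycles R M ?X (gen_bd R) gen_aug n"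
    then have zc: "z \<in> carrier (?F n)" by (simp add: res_cycles_def)
    with R.free_lincomb_ex[OF zc] obtain xs where xs: "set xs \<subseteq> carrier R \<times> ?X n" "gen_bd R (Rel xs) = z"
      by auto
    have R: "Rel xs \<in> ?X (Suc n)" using z[folded xs(2)] cyc_iff[OF xs(1)] by blast
    have "free_ext R (?F n) (gen_bd R) (free_gen R (Rel xs)) = z"
      by (subst lmod.free_ext_gen[OF F]) (use xs zc in auto)
    with R show "\<exists>w\<in>carrier (?F (Suc n)). free_ext R (?F n) (gen_bd R) w = z"
      by (intro bexI[of _ "free_gen R (Rel xs)"]) auto
  qed
qed

lemma (in assoc_algebra) scal_closed [simp]: "c \<in> carrier K \<Longrightarrow> c \<odot>\<^bsub>A\<^esub> \<one>\<^bsub>A\<^esub> \<in> carrier A"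
  by simp

text \<open>Centrality of the image of \<open>K\<close> is what makes a scalar multiple of a linear
  map over the algebra linear again, so that Hom over a noncommutative algebra is still a module
  over \<open>K\<close>.\<close>

lemma (in assoc_algebra) scal_central:
  "c \<in> carrier K \<Longrightarrow> r \<in> carrier A \<Longrightarrow> r \<otimes>\<^bsub>A\<^esub> (c \<odot>\<^bsub>A\<^esub> \<one>\<^bsub>A\<^esub>) = (c \<odot>\<^bsub>A\<^esub> \<one>\<^bsub>A\<^esub>) \<otimes>\<^bsub>A\<^esub> r"
  by (simp add: smult_mult_left smult_mult_right)

section \<open>Hom spaces of modules over a \<open>K\<close>-algebra\<close>

locale hom_setting = alg: assoc_algebra K R + M: lmod R M + N: lmod R N
  for K :: "'k ring" and R :: "('k, 'r) module" and M :: "('r, 'm) module" and N :: "('r, 'n) module"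
begin

lemma Hom_carrier: "f \<in> carrier (Hom_space R M N) \<longleftrightarrow> f \<in> module_hom R M N \<and> f \<in> extensional (carrier M)"
  by (simp add: Hom_space_def)

lemma Hom_simps:
  "\<zero>\<^bsub>Hom_space R M N\<^esub> = (\<lambda>x\<in>carrier M. \<zero>\<^bsub>N\<^esub>)"
  "f \<oplus>\<^bsub>Hom_space R M N\<^esub> g = (\<lambda>x\<in>carrier M. f x \<oplus>\<^bsub>N\<^esub> g x)"
  "c \<odot>\<^bsub>Hom_space R M N\<^esub> f = (\<lambda>x\<in>carrier M. (c \<odot>\<^bsub>R\<^esub> \<one>\<^bsub>R\<^esub>) \<odot>\<^bsub>N\<^esub> f x)"
  by (simp_all add: Hom_space_def)

lemma Hom_add_closed:
  assumes "f \<in> carrier (Hom_space R M N)" "g \<in> carrier (Hom_space R M N)"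
  shows "(\<lambda>x\<in>carrier M. f x \<oplus>\<^bsub>N\<^esub> g x) \<in> carrier (Hom_space R M N)"
proof -
  have f: "f \<in> module_hom R M N" and g: "g \<in> module_hom R M N"
    using assms by (auto simp: Hom_carrier)
  show ?thesis
    by (auto simp: Hom_carrier module_homD[OF f] module_homD[OF g] N.M.a_ac N.smult_r_distr
      intro!: module_homI)
qed

lemma Hom_smult_closed:
  assumes "f \<in> carrier (Hom_space R M N)" and c: "c \<in> carrier K"
  shows "(\<lambda>x\<in>carrier M. (c \<odot>\<^bsub>R\<^esub> \<one>\<^bsub>R\<^esub>) \<odot>\<^bsub>N\<^esub> f x) \<in> carrier (Hom_space R M N)"
proof -
  have f: "f \<in> module_hom R M N"
    using assms by (auto simp: Hom_carrier)
  have "(c \<odot>\<^bsub>R\<^esub> \<one>\<^bsub>R\<^esub>) \<odot>\<^bsub>N\<^esub> (r \<odot>\<^bsub>N\<^esub> f x) = r \<odot>\<^bsub>N\<^esub> ((c \<odot>\<^bsub>R\<^esub> \<one>\<^bsub>R\<^esub>) \<odot>\<^bsub>N\<^esub> f x)"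
    if "r \<in> carrier R" "x \<in> carrier M" for r x
    using alg.scal_central[OF c, of r] that c module_homD(1)[OF f]
      N.smult_assoc[symmetric, of "c \<odot>\<^bsub>R\<^esub> \<one>\<^bsub>R\<^esub>" r "f x"] N.smult_assoc[symmetric, of r "c \<odot>\<^bsub>R\<^esub> \<one>\<^bsub>R\<^esub>" "f x"]
    by simp
  then show ?thesis
    by (auto simp: Hom_carrier module_homD[OF f] N.smult_r_distr c intro!: module_homI)
qed

lemma Hom_ext:
  assumes "f \<in> carrier (Hom_space R M N)" "g \<in> carrier (Hom_space R M N)"
    and "\<And>x. x \<in> carrier M \<Longrightarrow> f x = g x"
  shows "f = g"
  using assms by (auto simp: Hom_carrier intro: extensionalityI)

lemma Hom_module: "module K (Hom_space R M N)"
proof -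
  have z: "(\<lambda>x\<in>carrier M. \<zero>\<^bsub>N\<^esub>) \<in> carrier (Hom_space R M N)"
    by (auto simp: Hom_carrier intro!: module_homI)
  have c: "f x \<in> carrier N" if "f \<in> carrier (Hom_space R M N)" "x \<in> carrier M" for f x
    using that by (auto simp: Hom_carrier module_homD)
  have e: "(\<lambda>x\<in>carrier M. f x) = f" if "f \<in> carrier (Hom_space R M N)" for f
    using that by (auto simp: Hom_carrier extensional_restrict)
  have neg: "\<exists>g\<in>carrier (Hom_space R M N). g \<oplus>\<^bsub>Hom_space R M N\<^esub> f = \<zero>\<^bsub>Hom_space R M N\<^esub>"
    if f: "f \<in> carrier (Hom_space R M N)" for f
  proof -
    have "((\<ominus>\<^bsub>K\<^esub> \<one>\<^bsub>K\<^esub>) \<odot>\<^bsub>R\<^esub> \<one>\<^bsub>R\<^esub>) \<odot>\<^bsub>N\<^esub> f x \<oplus>\<^bsub>N\<^esub> f x = \<zero>\<^bsub>N\<^esub>" if "x \<in> carrier M" for x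
      using c[OF f that] by (simp add: alg.smult_l_minus N.minus_eq_smult[symmetric] N.M.l_neg)
    then show ?thesis
      by (intro bexI[OF _ Hom_smult_closed[OF f, of "\<ominus>\<^bsub>K\<^esub> \<one>\<^bsub>K\<^esub>"]]) (auto simp: Hom_simps)
  qed
  have ab: "abelian_group (Hom_space R M N)"
  proof (rule abelian_groupI)
    fix f assume f: "f \<in> carrier (Hom_space R M N)"
    then show "\<exists>g\<in>carrier (Hom_space R M N). g \<oplus>\<^bsub>Hom_space R M N\<^esub> f = \<zero>\<^bsub>Hom_space R M N\<^esub>"
      by (rule neg)
    show "\<zero>\<^bsub>Hom_space R M N\<^esub> \<oplus>\<^bsub>Hom_space R M N\<^esub> f = f"
      using e[OF f] c[OF f] by (simp add: Hom_simps cong: restrict_cong)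
  qed (simp_all add: Hom_simps Hom_add_closed z c N.M.a_assoc cong: restrict_cong,
    simp add: N.M.a_comm c cong: restrict_cong)
  show ?thesis
  proof (rule moduleI)
    fix f assume f: "f \<in> carrier (Hom_space R M N)"
    show "\<one>\<^bsub>K\<^esub> \<odot>\<^bsub>Hom_space R M N\<^esub> f = f"
      using e[OF f] c[OF f] by (simp add: Hom_simps cong: restrict_cong)
    fix a b assume ab: "a \<in> carrier K" "b \<in> carrier K"
    have "(a \<otimes>\<^bsub>K\<^esub> b) \<odot>\<^bsub>R\<^esub> \<one>\<^bsub>R\<^esub> = (a \<odot>\<^bsub>R\<^esub> \<one>\<^bsub>R\<^esub>) \<otimes>\<^bsub>R\<^esub> (b \<odot>\<^bsub>R\<^esub> \<one>\<^bsub>R\<^esub>)"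
      using ab by (simp add: alg.smult_mult_left alg.smult_assoc1)
    then show "(a \<otimes>\<^bsub>K\<^esub> b) \<odot>\<^bsub>Hom_space R M N\<^esub> f = a \<odot>\<^bsub>Hom_space R M N\<^esub> (b \<odot>\<^bsub>Hom_space R M N\<^esub> f)"
      using ab c[OF f] by (simp add: Hom_simps N.smult_assoc cong: restrict_cong)
    show "(a \<oplus>\<^bsub>K\<^esub> b) \<odot>\<^bsub>Hom_space R M N\<^esub> f =
        (a \<odot>\<^bsub>Hom_space R M N\<^esub> f) \<oplus>\<^bsub>Hom_space R M N\<^esub> (b \<odot>\<^bsub>Hom_space R M N\<^esub> f)"
      using ab c[OF f] by (simp add: Hom_simps alg.smult_l_distr N.smult_l_distr cong: restrict_cong)
    show "a \<odot>\<^bsub>Hom_space R M N\<^esub> f \<in> carrier (Hom_space R M N)"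
      using Hom_smult_closed[OF f ab(1)] by (simp add: Hom_simps)
    fix g assume g: "g \<in> carrier (Hom_space R M N)"
    show "a \<odot>\<^bsub>Hom_space R M N\<^esub> (f \<oplus>\<^bsub>Hom_space R M N\<^esub> g) =
        (a \<odot>\<^bsub>Hom_space R M N\<^esub> f) \<oplus>\<^bsub>Hom_space R M N\<^esub> (a \<odot>\<^bsub>Hom_space R M N\<^esub> g)"
      using ab c[OF f] c[OF g] by (simp add: Hom_simps N.smult_r_distr cong: restrict_cong)
  qed (use ab alg.R.cring_axioms in auto)
qed

end

declare res_gens.simps [simp del]

lemma (in free_resolution) gen_cocycle_cong:
  assumes "lmod R N" and eq: "\<And>x. x \<in> X n \<Longrightarrow> \<phi> x = \<psi> x"
  shows "gen_cocycle R N X bd n \<phi> \<longleftrightarrow> gen_cocycle R N X bd n \<psi>"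
proof -
  interpret N: lmod R N by fact
  have "free_ext R N \<phi> (bd x) = free_ext R N \<psi> (bd x)" if "\<phi> \<in> X n \<rightarrow> carrier N" "x \<in> X (Suc n)" for x
    using bd_closed that by (intro N.free_ext_cong[OF that(1) eq]) auto
  then show ?thesis
    using eq by (auto simp: gen_cocycle_def Pi_iff)
qed

section \<open>Ext in terms of values on generators\<close>

locale ext_setting = hom_setting K R M N
  for K :: "'k ring" and R :: "('k, 'r) module" and M :: "('r, 'm) module" and N :: "('r, 'n) module"
begin

abbreviation "X \<equiv> res_gens R M"

sublocale S: free_resolution R M X "gen_bd R" gen_aug
  by (rule M.standard_resolution)

lemma H: "hom_setting K R (S.F n) N"
  by (intro hom_setting.intro alg.assoc_algebra_axioms S.F.lmod N.lmod)

sublocale H: hom_setting K R "S.F n" N for n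
  by (rule H)

abbreviation "C n \<equiv> Hom_space R (S.F n) N"

lemma cochain_eq: "Ext_cochain R M N n = C n"
  by (simp add: Ext_cochain_def res_module_def)

lemma res_bd_eq: "res_bd R M n = free_ext R (S.F n) (gen_bd R)"
  by (simp add: res_bd_def res_module_def)

lemma res_bd_hom: "res_bd R M n \<in> module_hom R (S.F (Suc n)) (S.F n)"
  unfolding res_bd_eq by (rule S.F.free_ext_hom[OF S.bd_closed])

lemma res_bd_gen: "x \<in> X (Suc n) \<Longrightarrow> res_bd R M n (free_gen R x) = gen_bd R x"
  unfolding res_bd_eq using S.bd_closed[of n] by (auto simp: Pi_iff S.F.free_ext_gen)

lemma cochain_gen:
  assumes "f \<in> carrier (C n)"
  shows "(\<lambda>x. f (free_gen R x)) \<in> X n \<rightarrow> carrier N"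
proof -
  have f: "f \<in> module_hom R (S.F n) N" using assms by (simp add: H.Hom_carrier)
  show ?thesis by (auto simp: module_homD(1)[OF f])
qed

lemma cochain_eq_free_ext:
  assumes "f \<in> carrier (C n)" "z \<in> carrier (S.F n)"
  shows "f z = free_ext R N (\<lambda>x. f (free_gen R x)) z"
  using assms by (intro N.free_hom_eq_free_ext) (auto simp: H.Hom_carrier)

lemma cochain_ext:
  assumes f: "f \<in> carrier (C n)" and g: "g \<in> carrier (C n)"
    and eq: "\<And>x. x \<in> X n \<Longrightarrow> f (free_gen R x) = g (free_gen R x)"
  shows "f = g"
proof (rule H.Hom_ext[OF f g])
  fix z assume z: "z \<in> carrier (S.F n)"
  show "f z = g z"
    using f g eq z by (intro N.free_hom_ext[of f "X n" g z]) (auto simp: H.Hom_carrier)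
qed

lemma free_ext_cochain:
  assumes "\<phi> \<in> X n \<rightarrow> carrier N"
  shows "(\<lambda>z\<in>carrier (S.F n). free_ext R N \<phi> z) \<in> carrier (C n)"
proof -
  have h: "free_ext R N \<phi> \<in> module_hom R (S.F n) N" by (rule N.free_ext_hom[OF assms])
  show ?thesis
    by (auto simp: H.Hom_carrier module_homD[OF h] intro!: module_homI)
qed

lemma free_ext_cochain_gen:
  assumes "\<phi> \<in> X n \<rightarrow> carrier N" "x \<in> X n"
  shows "(\<lambda>z\<in>carrier (S.F n). free_ext R N \<phi> z) (free_gen R x) = \<phi> x"
  using assms by (auto simp: N.free_ext_gen Pi_iff)

lemma Ext_diff_eq: "Ext_diff R M n f = (\<lambda>z\<in>carrier (S.F (Suc n)). f (res_bd R M n z))"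
  by (simp add: Ext_diff_def res_module_def)

lemma Ext_diff_hom: "Ext_diff R M n \<in> module_hom K (C n) (C (Suc n))"
proof (rule module_homI)
  note b = module_homD(1)[OF res_bd_hom]
  fix f assume f: "f \<in> carrier (C n)"
  then have fh: "f \<in> module_hom R (S.F n) N" by (simp add: H.Hom_carrier)
  have "(\<lambda>z. f (res_bd R M n z)) \<in> module_hom R (S.F (Suc n)) N"
    by (rule module_hom_comp[OF res_bd_hom fh])
  from module_homD[OF this] show "Ext_diff R M n f \<in> carrier (C (Suc n))"
    by (auto simp: H.Hom_carrier Ext_diff_eq intro!: module_homI)
  { fix g assume "g \<in> carrier (C n)"
    show "Ext_diff R M n (f \<oplus>\<^bsub>C n\<^esub> g) = Ext_diff R M n f \<oplus>\<^bsub>C (Suc n)\<^esub> Ext_diff R M n g"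
      using b by (simp add: Ext_diff_eq H.Hom_simps cong: restrict_cong) }
  fix c assume "c \<in> carrier K"
  show "Ext_diff R M n (c \<odot>\<^bsub>C n\<^esub> f) = c \<odot>\<^bsub>C (Suc n)\<^esub> Ext_diff R M n f"
    using b by (simp add: Ext_diff_eq H.Hom_simps cong: restrict_cong)
qed

lemma Ext_diff_gen:
  assumes f: "f \<in> carrier (C n)" and x: "x \<in> X (Suc n)"
  shows "Ext_diff R M n f (free_gen R x) = free_ext R N (\<lambda>x. f (free_gen R x)) (gen_bd R x)"
proof -
  have "gen_bd R x \<in> carrier (S.F n)" using S.bd_closed x by auto
  then show ?thesis
    using x by (simp add: Ext_diff_eq res_bd_gen cochain_eq_free_ext[OF f])
qed

text \<open>The coboundary of \<open>f\<close> is again a linear map on a free module, so its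
  vanishing is tested on generators.\<close>

lemma cocycles_iff:
  "f \<in> Ext_cocycles R M N n \<longleftrightarrow>
    f \<in> carrier (C n) \<and> gen_cocycle R N X (gen_bd R) n (\<lambda>x. f (free_gen R x))"
proof -
  have "Ext_diff R M n f = \<zero>\<^bsub>C (Suc n)\<^esub> \<longleftrightarrow>
      (\<forall>x\<in>X (Suc n). free_ext R N (\<lambda>x. f (free_gen R x)) (gen_bd R x) = \<zero>\<^bsub>N\<^esub>)"
    if f: "f \<in> carrier (C n)"
  proof
    interpret HS: module K "C (Suc n)" by (rule H.Hom_module)
    show "\<forall>x\<in>X (Suc n). free_ext R N (\<lambda>x. f (free_gen R x)) (gen_bd R x) = \<zero>\<^bsub>N\<^esub>"
      if "Ext_diff R M n f = \<zero>\<^bsub>C (Suc n)\<^esub>"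
      using that Ext_diff_gen[OF f, symmetric] by (simp add: H.Hom_simps)
    show "Ext_diff R M n f = \<zero>\<^bsub>C (Suc n)\<^esub>"
      if "\<forall>x\<in>X (Suc n). free_ext R N (\<lambda>x. f (free_gen R x)) (gen_bd R x) = \<zero>\<^bsub>N\<^esub>"
      by (rule cochain_ext[OF module_homD(1)[OF Ext_diff_hom f] HS.M.zero_closed])
        (use that in \<open>simp add: Ext_diff_gen[OF f] H.Hom_simps\<close>)
  qed
  then show ?thesis
    using cochain_gen by (auto simp: Ext_cocycles_def cochain_eq gen_cocycle_def)
qed

text \<open>Any function on generators extends to a cochain, so a bounding cochain exists as soon as
  its values on generators do.\<close>

lemma coboundaries_iff:
  assumes f: "f \<in> carrier (C n)"
  shows "f \<in> Ext_coboundaries R M N n \<longleftrightarrow> gen_cobound R N X (gen_bd R) n (\<lambda>x. f (free_gen R x))"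
proof (cases n)
  case 0
  interpret H0: module K "C 0" by (rule H.Hom_module)
  have "f = \<zero>\<^bsub>C 0\<^esub>" if "\<forall>x\<in>X 0. f (free_gen R x) = \<zero>\<^bsub>N\<^esub>"
    by (rule cochain_ext[OF _ H0.M.zero_closed]) (use that f 0 in \<open>auto simp: H.Hom_simps\<close>)
  then show ?thesis
    using 0 by (auto simp: gen_cobound_def cochain_eq H.Hom_simps)
next
  case (Suc m)
  show ?thesis
  proof
    assume "f \<in> Ext_coboundaries R M N n"
    then obtain g where g: "g \<in> carrier (C m)" "f = Ext_diff R M m g"
      using Suc by (auto simp: cochain_eq)
    show "gen_cobound R N X (gen_bd R) n (\<lambda>x. f (free_gen R x))"
      unfolding gen_cobound_def Suc nat.case
      by (rule bexI[OF _ cochain_gen[OF g(1)]]) (simp add: g(2) Ext_diff_gen[OF g(1)])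
  next
    assume "gen_cobound R N X (gen_bd R) n (\<lambda>x. f (free_gen R x))"
    then obtain \<psi> where q: "\<psi> \<in> X m \<rightarrow> carrier N"
        "\<And>x. x \<in> X (Suc m) \<Longrightarrow> f (free_gen R x) = free_ext R N \<psi> (gen_bd R x)"
      unfolding gen_cobound_def Suc nat.case by blast
    let ?g = "\<lambda>z\<in>carrier (S.F m). free_ext R N \<psi> z"
    note g = free_ext_cochain[OF q(1)]
    have "f = Ext_diff R M m ?g"
    proof (rule cochain_ext)
      show "f \<in> carrier (C (Suc m))" using f Suc by simp
      show "Ext_diff R M m ?g \<in> carrier (C (Suc m))" by (rule module_homD(1)[OF Ext_diff_hom g])
      fix x assume x: "x \<in> X (Suc m)"
      have b: "gen_bd R x \<in> carrier (S.F m)" using S.bd_closed x by auto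
      show "f (free_gen R x) = Ext_diff R M m ?g (free_gen R x)"
        using b x by (simp add: q(2)[OF x] Ext_diff_eq res_bd_gen)
    qed
    with g show "f \<in> Ext_coboundaries R M N n"
      using Suc by (auto simp: cochain_eq)
  qed
qed

lemma coboundaries_closed: "Ext_coboundaries R M N n \<subseteq> carrier (C n)"
proof (cases n)
  case 0
  interpret H0: module K "C 0" by (rule H.Hom_module)
  show ?thesis using 0 by (simp add: cochain_eq)
next
  case (Suc m)
  then show ?thesis using module_homD(1)[OF Ext_diff_hom] by (auto simp: cochain_eq)
qed

lemma coboundaries_cocycles: "Ext_coboundaries R M N n \<subseteq> Ext_cocycles R M N n"
  using coboundaries_closed coboundaries_iff cocycles_iff S.gen_cobound_cocycle[OF N.lmod] cochain_gen
  by blast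

lemma cocycles_submodule: "submodule (Ext_cocycles R M N n) K (C n)"
  unfolding Ext_cocycles_def cochain_eq
  by (rule module.kernel_submodule[OF H.Hom_module H.Hom_module Ext_diff_hom])

lemma coboundaries_submodule: "submodule (Ext_coboundaries R M N n) K (C n)"
proof (cases n)
  case 0
  then show ?thesis using module.zero_submodule[OF H.Hom_module] by (simp add: cochain_eq)
next
  case (Suc m)
  then show ?thesis
    using module.image_submodule[OF H.Hom_module H.Hom_module Ext_diff_hom] by (simp add: cochain_eq)
qed

definition cocycle_space :: "nat \<Rightarrow> ('k, (('r, 'm) res_gen \<Rightarrow> 'r) \<Rightarrow> 'n) module"
  where "cocycle_space n = (C n)\<lparr>carrier := Ext_cocycles R M N n\<rparr>"

lemma Ext_eq: "Ext R M N n = quot_module (cocycle_space n) (Ext_coboundaries R M N n)"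
  by (simp add: Ext_def cochain_eq cocycle_space_def)

lemma cocycle_space_module: "module K (cocycle_space n)"
  unfolding cocycle_space_def
  by (rule submodule.submodule_is_module[OF cocycles_submodule H.Hom_module])

lemma cocycle_space_coboundaries: "submodule (Ext_coboundaries R M N n) K (cocycle_space n)"
  unfolding cocycle_space_def
  by (rule module.submodule_restrict[OF H.Hom_module coboundaries_submodule cocycles_submodule
      coboundaries_cocycles])

text \<open>Only addition has an explicit formula in the record of cocycles; the value of the
  difference \<open>d\<close> is obtained by solving \<open>f = d + g\<close> on generators.\<close>

lemma cocycle_space_minus:
  assumes f: "f \<in> Ext_cocycles R M N n" and g: "g \<in> Ext_cocycles R M N n" and x: "x \<in> X n"
  shows "(f \<ominus>\<^bsub>cocycle_space n\<^esub> g) (free_gen R x) = f (free_gen R x) \<ominus>\<^bsub>N\<^esub> g (free_gen R x)"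
proof -
  interpret Z: module K "cocycle_space n" by (rule cocycle_space_module)
  have fg: "f \<in> carrier (cocycle_space n)" "g \<in> carrier (cocycle_space n)"
    using f g by (simp_all add: cocycle_space_def)
  let ?d = "f \<ominus>\<^bsub>cocycle_space n\<^esub> g"
  have "?d \<in> carrier (cocycle_space n)" using fg by simp
  then have d: "?d \<in> carrier (C n)" using cocycles_iff by (simp add: cocycle_space_def)
  have "f = ?d \<oplus>\<^bsub>cocycle_space n\<^esub> g"
    using fg by (simp add: a_minus_def Z.M.a_assoc Z.M.l_neg)
  then have "f = (\<lambda>z\<in>carrier (S.F n). ?d z \<oplus>\<^bsub>N\<^esub> g z)"
    by (simp add: cocycle_space_def H.Hom_simps(2))
  from fun_cong[OF this, of "free_gen R x"]
  have "f (free_gen R x) = ?d (free_gen R x) \<oplus>\<^bsub>N\<^esub> g (free_gen R x)"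
    using x by simp
  moreover have "?d (free_gen R x) \<in> carrier N" "g (free_gen R x) \<in> carrier N"
    using cochain_gen[OF d] cochain_gen[of g] g x cocycles_iff by auto
  ultimately show ?thesis
    by (simp add: a_minus_def N.M.a_assoc N.M.r_neg)
qed

end

text \<open>
  Cochains on a free module are functions on the generators, and the base ring only enters through
  the boundary matrices; so one family of generators can serve for modules over two rings.
\<close>

locale ext_transfer = R: ext_setting K R M N + D: ext_setting K D M' N
  for K :: "'k ring" and R :: "('k, 'r) module" and M :: "('r, 'm) module"
    and D :: "('k, 'r) module" and M' :: "('r, 'l) module" and N :: "('r, 'n) module" +
  fixes aug' :: "('r, 'l) res_gen \<Rightarrow> 'm"
  assumes zero_eq: "\<zero>\<^bsub>D\<^esub> = \<zero>\<^bsub>R\<^esub>"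
    and scal_eq: "\<And>c. c \<in> carrier K \<Longrightarrow> c \<odot>\<^bsub>D\<^esub> \<one>\<^bsub>D\<^esub> = c \<odot>\<^bsub>R\<^esub> \<one>\<^bsub>R\<^esub>"
    and res: "free_resolution R M (res_gens D M') (gen_bd D) aug'"
begin

text \<open>\<open>free_ext\<close> consults the ring only for the zero that delimits the
  support.\<close>

lemma free_ext_eq: "free_ext D N = free_ext R N"
  by (intro ext) (simp add: free_ext_def zero_eq)

lemma gen_eq:
  "gen_cocycle D N X bd n \<phi> \<longleftrightarrow> gen_cocycle R N X bd n \<phi>"
  "gen_cobound D N X bd n \<phi> \<longleftrightarrow> gen_cobound R N X bd n \<phi>"
  unfolding gen_cocycle_def gen_cobound_def free_ext_eq by (rule refl)+

text \<open>Through \<open>res\<close> the generators and matrices of \<open>M'\<close> over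
  \<open>D\<close> also resolve \<open>M\<close> over \<open>R\<close>. The comparison with the
  standard resolution of \<open>M\<close> takes place over \<open>R\<close>; the passage to
  \<open>D\<close> then changes no condition on values at generators.\<close>

theorem Ext_iso: "is_module_iso K (Ext R M N n) (Ext D M' N n)"
proof -
  interpret res: free_resolution R M "res_gens D M'" "gen_bd D" aug' by (rule res)
  interpret T: two_resolutions_coeff R M R.X "gen_bd R" gen_aug D.X "gen_bd D" aug' N
    by (intro two_resolutions_coeff.intro two_resolutions.intro R.S.free_resolution_axioms res R.N.lmod)
  obtain g where g: "\<And>n. g n \<in> D.X n \<rightarrow> carrier (R.S.F n)"
    and coc: "\<And>n \<phi>. gen_cocycle R N R.X (gen_bd R) n \<phi> \<Longrightarrow>
      gen_cocycle R N D.X (gen_bd D) n (\<lambda>y. free_ext R N \<phi> (g n y))"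
    and cob: "\<And>n \<phi>. gen_cocycle R N R.X (gen_bd R) n \<phi> \<Longrightarrow>
      gen_cobound R N D.X (gen_bd D) n (\<lambda>y. free_ext R N \<phi> (g n y)) \<longleftrightarrow>
      gen_cobound R N R.X (gen_bd R) n \<phi>"
    and surj: "\<And>n \<psi>. gen_cocycle R N D.X (gen_bd D) n \<psi> \<Longrightarrow> \<exists>\<phi>. gen_cocycle R N R.X (gen_bd R) n \<phi> \<and>
      gen_cobound R N D.X (gen_bd D) n (\<lambda>y. free_ext R N \<phi> (g n y) \<ominus>\<^bsub>N\<^esub> \<psi> y)"
    by (rule T.comparison_cohomology) (rule that)
  \<comment> \<open>\<open>pull f\<close> is the function on the generators of the second resolution
    obtained by composing with the comparison map; \<open>\<theta>\<close> extends it linearly, now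
    over \<open>D\<close>.\<close>
  define pull where "pull f = (\<lambda>y. free_ext R N (\<lambda>x. f (free_gen R x)) (g n y))" for f :: "(('r, 'm) res_gen \<Rightarrow> 'r) \<Rightarrow> 'n"
  define \<theta> where "\<theta> f = (\<lambda>z\<in>carrier (D.S.F n). free_ext D N (pull f) z)" for f
  have pc: "pull f \<in> D.X n \<rightarrow> carrier N" if "f \<in> carrier (R.C n)" for f
    using R.N.free_ext_closed[OF R.cochain_gen[OF that]] g by (auto simp: pull_def Pi_iff)
  have \<theta>_gen: "\<theta> f (free_gen D y) = pull f y" if "f \<in> carrier (R.C n)" "y \<in> D.X n" for f y
    using D.free_ext_cochain_gen[OF pc] that by (simp add: \<theta>_def)
  have \<theta>_closed: "\<theta> f \<in> carrier (D.C n)" if "f \<in> carrier (R.C n)" for f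
    using D.free_ext_cochain[OF pc[OF that]] by (simp add: \<theta>_def)
  have \<theta>_coc: "\<theta> f \<in> Ext_cocycles D M' N n" if f: "f \<in> Ext_cocycles R M N n" for f
  proof -
    have fc: "f \<in> carrier (R.C n)" and z: "gen_cocycle R N R.X (gen_bd R) n (\<lambda>x. f (free_gen R x))"
      using f R.cocycles_iff by auto
    have "gen_cocycle R N D.X (gen_bd D) n (pull f)" using coc[OF z] by (simp add: pull_def)
    then have "gen_cocycle D N D.X (gen_bd D) n (\<lambda>y. \<theta> f (free_gen D y))"
      unfolding gen_eq by (subst res.gen_cocycle_cong[OF R.N.lmod \<theta>_gen[OF fc]])
    then show ?thesis using \<theta>_closed[OF fc] D.cocycles_iff by blast
  qed
  have \<theta>_hom: "\<theta> \<in> module_hom K (R.cocycle_space n) (D.cocycle_space n)"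
  proof (rule module_homI)
    fix f assume "f \<in> carrier (R.cocycle_space n)"
    then have f: "f \<in> Ext_cocycles R M N n" by (simp add: R.cocycle_space_def)
    then have fc: "f \<in> carrier (R.C n)" using R.cocycles_iff by auto
    show "\<theta> f \<in> carrier (D.cocycle_space n)" using \<theta>_coc[OF f] by (simp add: D.cocycle_space_def)
    { fix h assume "h \<in> carrier (R.cocycle_space n)"
      then have hc: "h \<in> carrier (R.C n)" using R.cocycles_iff by (simp add: R.cocycle_space_def)
      have "pull (f \<oplus>\<^bsub>R.C n\<^esub> h) y = pull f y \<oplus>\<^bsub>N\<^esub> pull h y" if y: "y \<in> D.X n" for y
      proof -
        have gy: "g n y \<in> carrier (R.S.F n)" using g y by auto
        have "pull (f \<oplus>\<^bsub>R.C n\<^esub> h) y =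
            free_ext R N (\<lambda>x. f (free_gen R x) \<oplus>\<^bsub>N\<^esub> h (free_gen R x)) (g n y)"
          unfolding pull_def R.H.Hom_simps
          by (rule R.N.free_ext_cong[symmetric, OF _ _ gy])
            (use R.cochain_gen[OF fc] R.cochain_gen[OF hc] in \<open>auto simp: Pi_iff\<close>)
        then show ?thesis
          using R.N.free_ext_add[OF R.cochain_gen[OF fc] R.cochain_gen[OF hc] gy] by (simp add: pull_def)
      qed
      moreover have "f \<oplus>\<^bsub>R.C n\<^esub> h \<in> carrier (R.C n)"
        using fc hc module.axioms(2)[OF R.H.Hom_module] by (simp add: abelian_group.axioms abelian_monoid.a_closed)
      ultimately have "\<theta> (f \<oplus>\<^bsub>R.C n\<^esub> h) = \<theta> f \<oplus>\<^bsub>D.C n\<^esub> \<theta> h"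
        using \<theta>_closed[OF fc] \<theta>_closed[OF hc] \<theta>_gen[OF fc] \<theta>_gen[OF hc] D.H.Hom_add_closed
        by (intro D.cochain_ext[OF \<theta>_closed]) (simp_all add: \<theta>_gen D.H.Hom_simps)
      then show "\<theta> (f \<oplus>\<^bsub>R.cocycle_space n\<^esub> h) = \<theta> f \<oplus>\<^bsub>D.cocycle_space n\<^esub> \<theta> h"
        by (simp add: R.cocycle_space_def D.cocycle_space_def) }
    fix c assume c: "c \<in> carrier K"
    have "pull (c \<odot>\<^bsub>R.C n\<^esub> f) y = (c \<odot>\<^bsub>R\<^esub> \<one>\<^bsub>R\<^esub>) \<odot>\<^bsub>N\<^esub> pull f y" if y: "y \<in> D.X n" for y
    proof -
      have gy: "g n y \<in> carrier (R.S.F n)" using g y by auto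
      have "pull (c \<odot>\<^bsub>R.C n\<^esub> f) y = free_ext R N (\<lambda>x. (c \<odot>\<^bsub>R\<^esub> \<one>\<^bsub>R\<^esub>) \<odot>\<^bsub>N\<^esub> f (free_gen R x)) (g n y)"
        unfolding pull_def R.H.Hom_simps
        by (rule R.N.free_ext_cong[symmetric, OF _ _ gy])
          (use R.cochain_gen[OF fc] c in \<open>auto simp: Pi_iff\<close>)
      then show ?thesis
        using R.N.free_ext_smult_central[OF R.cochain_gen[OF fc] gy R.alg.scal_closed[OF c] R.alg.scal_central[OF c]]
        by (simp add: pull_def)
    qed
    moreover have "c \<odot>\<^bsub>R.C n\<^esub> f \<in> carrier (R.C n)"
      using fc c module.smult_closed[OF R.H.Hom_module] by blast
    ultimately have "\<theta> (c \<odot>\<^bsub>R.C n\<^esub> f) = c \<odot>\<^bsub>D.C n\<^esub> \<theta> f"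
      using \<theta>_closed[OF fc] \<theta>_gen[OF fc] D.H.Hom_smult_closed[OF _ c]
      by (intro D.cochain_ext[OF \<theta>_closed]) (simp_all add: \<theta>_gen D.H.Hom_simps scal_eq c)
    then show "\<theta> (c \<odot>\<^bsub>R.cocycle_space n\<^esub> f) = c \<odot>\<^bsub>D.cocycle_space n\<^esub> \<theta> f"
      by (simp add: R.cocycle_space_def D.cocycle_space_def)
  qed
  show ?thesis
    unfolding R.Ext_eq D.Ext_eq
  proof (rule quot_module_iso[OF R.cocycle_space_module R.cocycle_space_coboundaries
        D.cocycle_space_module D.cocycle_space_coboundaries \<theta>_hom])
    fix f assume "f \<in> carrier (R.cocycle_space n)"
    then have fc: "f \<in> carrier (R.C n)" and z: "gen_cocycle R N R.X (gen_bd R) n (\<lambda>x. f (free_gen R x))"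
      using R.cocycles_iff by (auto simp: R.cocycle_space_def)
    have "\<theta> f \<in> Ext_coboundaries D M' N n \<longleftrightarrow> gen_cobound D N D.X (gen_bd D) n (\<lambda>y. \<theta> f (free_gen D y))"
      by (rule D.coboundaries_iff[OF \<theta>_closed[OF fc]])
    also have "\<dots> \<longleftrightarrow> gen_cobound R N D.X (gen_bd D) n (pull f)"
      unfolding gen_eq by (rule gen_cobound_cong[OF \<theta>_gen[OF fc]])
    also have "\<dots> \<longleftrightarrow> f \<in> Ext_coboundaries R M N n"
      using cob[OF z] R.coboundaries_iff[OF fc] by (simp add: pull_def)
    finally show "\<theta> f \<in> Ext_coboundaries D M' N n \<longleftrightarrow> f \<in> Ext_coboundaries R M N n" .
  next
    fix h assume "h \<in> carrier (D.cocycle_space n)"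
    then have h: "h \<in> Ext_cocycles D M' N n" by (simp add: D.cocycle_space_def)
    then have "gen_cocycle R N D.X (gen_bd D) n (\<lambda>y. h (free_gen D y))"
      using D.cocycles_iff by (simp add: gen_eq)
    from surj[OF this] obtain \<phi> where p: "gen_cocycle R N R.X (gen_bd R) n \<phi>"
      and pb: "gen_cobound R N D.X (gen_bd D) n (\<lambda>y. free_ext R N \<phi> (g n y) \<ominus>\<^bsub>N\<^esub> h (free_gen D y))"
      by blast
    have pcl: "\<phi> \<in> R.X n \<rightarrow> carrier N" using p by (simp add: gen_cocycle_def)
    \<comment> \<open>\<open>\<phi>\<close> is only a function on generators; its linear extension
      is the cochain that maps to the class of \<open>h\<close>.\<close>
    define f where "f = (\<lambda>z\<in>carrier (R.S.F n). free_ext R N \<phi> z)"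
    have fc: "f \<in> carrier (R.C n)" using R.free_ext_cochain[OF pcl] by (simp add: f_def)
    have fg: "f (free_gen R x) = \<phi> x" if "x \<in> R.X n" for x
      using R.free_ext_cochain_gen[OF pcl that] by (simp add: f_def)
    have "gen_cocycle R N R.X (gen_bd R) n (\<lambda>x. f (free_gen R x))"
      using p by (subst R.S.gen_cocycle_cong[OF R.N.lmod fg])
    with fc have f: "f \<in> Ext_cocycles R M N n" using R.cocycles_iff by blast
    have pf: "pull f y = free_ext R N \<phi> (g n y)" if "y \<in> D.X n" for y
      unfolding pull_def
      by (rule R.N.free_ext_cong[symmetric, OF pcl fg[symmetric]]) (use g that in auto)
    have "(\<theta> f \<ominus>\<^bsub>D.cocycle_space n\<^esub> h) (free_gen D y) = free_ext R N \<phi> (g n y) \<ominus>\<^bsub>N\<^esub> h (free_gen D y)"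
      if "y \<in> D.X n" for y
      using D.cocycle_space_minus[OF \<theta>_coc[OF f] h that] \<theta>_gen[OF fc that] pf[OF that] by simp
    then have "gen_cobound D N D.X (gen_bd D) n (\<lambda>y. (\<theta> f \<ominus>\<^bsub>D.cocycle_space n\<^esub> h) (free_gen D y))"
      using pb unfolding gen_eq by (simp cong: gen_cobound_cong)
    moreover have "\<theta> f \<ominus>\<^bsub>D.cocycle_space n\<^esub> h \<in> carrier (D.C n)"
    proof -
      interpret Z: module K "D.cocycle_space n" by (rule D.cocycle_space_module)
      have "\<theta> f \<ominus>\<^bsub>D.cocycle_space n\<^esub> h \<in> carrier (D.cocycle_space n)"
        using \<theta>_coc[OF f] h by (intro Z.M.minus_closed) (simp_all add: D.cocycle_space_def)
      then show ?thesis using D.cocycles_iff by (simp add: D.cocycle_space_def)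
    qed
    ultimately have "\<theta> f \<ominus>\<^bsub>D.cocycle_space n\<^esub> h \<in> Ext_coboundaries D M' N n"
      using D.coboundaries_iff by blast
    then show "\<exists>v\<in>carrier (R.cocycle_space n). \<theta> v \<ominus>\<^bsub>D.cocycle_space n\<^esub> h \<in> Ext_coboundaries D M' N n"
      using f by (intro bexI[of _ f]) (simp_all add: R.cocycle_space_def)
  qed
qed

end

section \<open>Tensor products\<close>

definition bilinear :: "'k ring \<Rightarrow> ('k, 'v) module \<Rightarrow> ('k, 'w) module \<Rightarrow> ('k, 'u) module \<Rightarrow>
    ('v \<Rightarrow> 'w \<Rightarrow> 'u) \<Rightarrow> bool"
  where "bilinear K V W U \<beta> \<longleftrightarrow>
    (\<forall>w\<in>carrier W. (\<lambda>v. \<beta> v w) \<in> module_hom K V U) \<and> (\<forall>v\<in>carrier V. \<beta> v \<in> module_hom K W U)"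

lemma bilinearI:
  assumes "\<And>w. w \<in> carrier W \<Longrightarrow> (\<lambda>v. \<beta> v w) \<in> module_hom K V U"
    and "\<And>v. v \<in> carrier V \<Longrightarrow> \<beta> v \<in> module_hom K W U"
  shows "bilinear K V W U \<beta>"
  using assms by (auto simp: bilinear_def)

lemma bilinearD:
  assumes "bilinear K V W U \<beta>"
  shows "v \<in> carrier V \<Longrightarrow> w \<in> carrier W \<Longrightarrow> \<beta> v w \<in> carrier U"
    and "v \<in> carrier V \<Longrightarrow> v' \<in> carrier V \<Longrightarrow> w \<in> carrier W \<Longrightarrow>
      \<beta> (v \<oplus>\<^bsub>V\<^esub> v') w = \<beta> v w \<oplus>\<^bsub>U\<^esub> \<beta> v' w"
    and "v \<in> carrier V \<Longrightarrow> w \<in> carrier W \<Longrightarrow> w' \<in> carrier W \<Longrightarrow>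
      \<beta> v (w \<oplus>\<^bsub>W\<^esub> w') = \<beta> v w \<oplus>\<^bsub>U\<^esub> \<beta> v w'"
    and "c \<in> carrier K \<Longrightarrow> v \<in> carrier V \<Longrightarrow> w \<in> carrier W \<Longrightarrow>
      \<beta> (c \<odot>\<^bsub>V\<^esub> v) w = c \<odot>\<^bsub>U\<^esub> \<beta> v w"
    and "c \<in> carrier K \<Longrightarrow> v \<in> carrier V \<Longrightarrow> w \<in> carrier W \<Longrightarrow>
      \<beta> v (c \<odot>\<^bsub>W\<^esub> w) = c \<odot>\<^bsub>U\<^esub> \<beta> v w"
  using assms unfolding bilinear_def by (auto dest: module_homD)

lemma bilinear_comp_args:
  assumes "bilinear K V W U \<beta>" "f \<in> module_hom K V' V" "g \<in> module_hom K W' W"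
  shows "bilinear K V' W' U (\<lambda>v w. \<beta> (f v) (g w))"
  using assms unfolding bilinear_def
  by (auto intro: module_hom_comp[of f _ _ V] module_hom_comp[of g _ _ W] simp: module_homD)

lemma (in cring) free_module_module: "module R (free_module R X)"
proof -
  interpret F: lmod R "free_module R X" by (rule free_lmod)
  show ?thesis
    by unfold_locales (auto simp: F.smult_l_distr F.smult_r_distr F.smult_assoc)
qed

text \<open>A list rather than a finite set of pairs, because a decomposition into pure tensors may
  repeat a pair.\<close>

definition tsum :: "('k, 'u) module \<Rightarrow> ('v \<Rightarrow> 'w \<Rightarrow> 'u) \<Rightarrow> ('v \<times> 'w) list \<Rightarrow> 'u"
  where "tsum U \<beta> xs = foldr (\<lambda>(v, w) s. \<beta> v w \<oplus>\<^bsub>U\<^esub> s) xs \<zero>\<^bsub>U\<^esub>"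

lemma tsum_simps [simp]:
  "tsum U \<beta> [] = \<zero>\<^bsub>U\<^esub>"
  "tsum U \<beta> ((v, w) # xs) = \<beta> v w \<oplus>\<^bsub>U\<^esub> tsum U \<beta> xs"
  by (simp_all add: tsum_def)

lemma tsum_cong:
  assumes "\<And>v w. (v, w) \<in> set xs \<Longrightarrow> \<beta> v w = \<gamma> v w"
  shows "tsum U \<beta> xs = tsum U \<gamma> xs"
  using assms by (induction xs) auto

locale tensor = V: module K V + W: module K W
  for K :: "'k ring" and V :: "('k, 'v) module" and W :: "('k, 'w) module"
begin

abbreviation "F \<equiv> free_module K (carrier V \<times> carrier W)"
abbreviation "T \<equiv> tensor_space K V W"
abbreviation pure (infixl "\<otimes>\<otimes>" 72) where "pure \<equiv> pure_tensor K V W"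

lemma F_module: "module K F"
  by (rule V.R.free_module_module)

lemma rels_closed: "tensor_rels K V W \<subseteq> carrier F"
proof -
  interpret F: module K F by (rule F_module)
  show ?thesis
    unfolding tensor_rels_def Let_def
    by (auto intro!: F.M.minus_closed F.M.a_closed F.smult_closed V.R.free_gen_closed)
qed

lemma kernel_submodule: "submodule (tensor_kernel K V W) K F"
  unfolding tensor_kernel_def by (rule module.gen_submodule_submodule[OF F_module rels_closed])

lemma rels_kernel: "tensor_rels K V W \<subseteq> tensor_kernel K V W"
  unfolding tensor_kernel_def gen_submodule_def by auto

sublocale T: module K T
  unfolding tensor_space_def by (rule module.quot_module_module[OF F_module kernel_submodule])

lemma pure_closed [simp, intro]:
  assumes "v \<in> carrier V" "w \<in> carrier W" shows "v \<otimes>\<otimes> w \<in> carrier T"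
proof -
  interpret F: module K F by (rule F_module)
  show ?thesis
    using assms by (auto simp: tensor_space_def pure_tensor_def F.quot_carrier[OF kernel_submodule])
qed

lemma pure_bilinear: "bilinear K V W T (\<otimes>\<otimes>)"
proof -
  interpret F: module K F by (rule F_module)
  note quot = F.quot_eq_iff[OF kernel_submodule, symmetric] F.quot_add[OF kernel_submodule]
    F.quot_smult[OF kernel_submodule]
  have e: "free_gen K (v, w) \<in> carrier F" if "v \<in> carrier V" "w \<in> carrier W" for v w
    using that by simp
  have al: "(v \<oplus>\<^bsub>V\<^esub> v') \<otimes>\<otimes> w = (v \<otimes>\<otimes> w) \<oplus>\<^bsub>T\<^esub> (v' \<otimes>\<otimes> w)"
    if v: "v \<in> carrier V" "v' \<in> carrier V" "w \<in> carrier W" for v v' w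
  proof -
    have "free_gen K (v \<oplus>\<^bsub>V\<^esub> v', w) \<ominus>\<^bsub>F\<^esub> (free_gen K (v, w) \<oplus>\<^bsub>F\<^esub> free_gen K (v', w)) \<in> tensor_kernel K V W"
      by (rule subsetD[OF rels_kernel]) (use v in \<open>unfold tensor_rels_def Let_def, blast\<close>)
    then show ?thesis
      using v by (simp add: tensor_space_def pure_tensor_def quot e)
  qed
  have ar: "v \<otimes>\<otimes> (w \<oplus>\<^bsub>W\<^esub> w') = (v \<otimes>\<otimes> w) \<oplus>\<^bsub>T\<^esub> (v \<otimes>\<otimes> w')"
    if v: "v \<in> carrier V" "w \<in> carrier W" "w' \<in> carrier W" for v w w'
  proof -
    have "free_gen K (v, w \<oplus>\<^bsub>W\<^esub> w') \<ominus>\<^bsub>F\<^esub> (free_gen K (v, w) \<oplus>\<^bsub>F\<^esub> free_gen K (v, w')) \<in> tensor_kernel K V W"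
      by (rule subsetD[OF rels_kernel]) (use v in \<open>unfold tensor_rels_def Let_def, blast\<close>)
    then show ?thesis
      using v by (simp add: tensor_space_def pure_tensor_def quot e)
  qed
  have sl: "(c \<odot>\<^bsub>V\<^esub> v) \<otimes>\<otimes> w = c \<odot>\<^bsub>T\<^esub> (v \<otimes>\<otimes> w)"
    if v: "c \<in> carrier K" "v \<in> carrier V" "w \<in> carrier W" for c v w
  proof -
    have "free_gen K (c \<odot>\<^bsub>V\<^esub> v, w) \<ominus>\<^bsub>F\<^esub> c \<odot>\<^bsub>F\<^esub> free_gen K (v, w) \<in> tensor_kernel K V W"
      by (rule subsetD[OF rels_kernel]) (use v in \<open>unfold tensor_rels_def Let_def, blast\<close>)
    then show ?thesis
      using v by (simp add: tensor_space_def pure_tensor_def quot e)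
  qed
  have sr: "v \<otimes>\<otimes> (c \<odot>\<^bsub>W\<^esub> w) = c \<odot>\<^bsub>T\<^esub> (v \<otimes>\<otimes> w)"
    if v: "c \<in> carrier K" "v \<in> carrier V" "w \<in> carrier W" for c v w
  proof -
    have "free_gen K (v, c \<odot>\<^bsub>W\<^esub> w) \<ominus>\<^bsub>F\<^esub> c \<odot>\<^bsub>F\<^esub> free_gen K (v, w) \<in> tensor_kernel K V W"
      by (rule subsetD[OF rels_kernel]) (use v in \<open>unfold tensor_rels_def Let_def, blast\<close>)
    then show ?thesis
      using v by (simp add: tensor_space_def pure_tensor_def quot e)
  qed
  show ?thesis
    by (intro bilinearI module_homI) (simp_all add: al ar sl sr)
qed

lemmas pure_add_left = bilinearD(2)[OF pure_bilinear]
lemmas pure_add_right = bilinearD(3)[OF pure_bilinear]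
lemmas pure_smult_left = bilinearD(4)[OF pure_bilinear]
lemmas pure_smult_right = bilinearD(5)[OF pure_bilinear]

text \<open>A scalar coefficient can be absorbed into the first factor, so plain sums of pure
  tensors exhaust the tensor product.\<close>

lemma tensor_induct [consumes 1, case_names zero add]:
  assumes t: "t \<in> carrier T"
    and zero: "P \<zero>\<^bsub>T\<^esub>"
    and add: "\<And>v w t. v \<in> carrier V \<Longrightarrow> w \<in> carrier W \<Longrightarrow> t \<in> carrier T \<Longrightarrow> P t \<Longrightarrow> P ((v \<otimes>\<otimes> w) \<oplus>\<^bsub>T\<^esub> t)"
  shows "P t"
proof -
  interpret F: module K F by (rule F_module)
  let ?q = "\<lambda>z. tensor_kernel K V W +>\<^bsub>F\<^esub> z"
  have q: "?q \<in> module_hom K F T"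
    unfolding tensor_space_def by (rule F.quot_hom[OF kernel_submodule])
  have "P (?q z)" if "z \<in> carrier F" for z
    using that
  proof (induction z rule: V.R.free_induct)
    case zero
    have "?q \<zero>\<^bsub>F\<^esub> = \<zero>\<^bsub>T\<^esub>" by (rule module_hom_zero[OF q F.M.abelian_group_axioms T.M.abelian_group_axioms])
    then show ?case using assms(2) by (simp add: free_simps)
  next
    case (add r x f)
    then obtain v w where x: "x = (v, w)" "v \<in> carrier V" "w \<in> carrier W" by auto
    have "?q (r \<odot>\<^bsub>F\<^esub> free_gen K x \<oplus>\<^bsub>F\<^esub> f) = (r \<odot>\<^bsub>T\<^esub> (v \<otimes>\<otimes> w)) \<oplus>\<^bsub>T\<^esub> ?q f"
      using add x by (simp add: module_homD[OF q] pure_tensor_def)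
    also have "\<dots> = ((r \<odot>\<^bsub>V\<^esub> v) \<otimes>\<otimes> w) \<oplus>\<^bsub>T\<^esub> ?q f"
      using add x by (simp add: pure_smult_left)
    finally show ?case
      using add x by (simp add: assms(3) module_homD(1)[OF q])
  qed
  moreover obtain z where "z \<in> carrier F" "t = ?q z"
    using t by (auto simp: tensor_space_def F.quot_carrier[OF kernel_submodule])
  ultimately show ?thesis by simp
qed

lemma hom_ext:
  assumes "abelian_group U" and f: "f \<in> module_hom K T U" and g: "g \<in> module_hom K T U"
    and eq: "\<And>v w. v \<in> carrier V \<Longrightarrow> w \<in> carrier W \<Longrightarrow> f (v \<otimes>\<otimes> w) = g (v \<otimes>\<otimes> w)"
    and "t \<in> carrier T"
  shows "f t = g t"
  using assms(5)
proof (induction t rule: tensor_induct)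
  case zero
  show ?case
    using module_hom_zero[OF f T.M.abelian_group_axioms assms(1)]
      module_hom_zero[OF g T.M.abelian_group_axioms assms(1)] by simp
qed (simp add: module_homD[OF f] module_homD[OF g] eq)

context
  fixes U :: "('k, 'u) module" and \<beta>
  assumes U: "module K U" and \<beta>: "bilinear K V W U \<beta>"
begin

text \<open>The kernel of the linear extension of \<open>\<beta>\<close> is a submodule, so it
  suffices that it contains the defining relations, and these vanish by bilinearity.\<close>

lemma lift_rels: "tensor_kernel K V W \<subseteq> {z \<in> carrier F. free_ext K U (\<lambda>(v, w). \<beta> v w) z = \<zero>\<^bsub>U\<^esub>}"
proof -
  interpret F: module K F by (rule F_module)
  interpret U: module K U by (rule U)
  interpret UL: lmod K U by (rule U.is_lmod)
  let ?b = "\<lambda>(v, w). \<beta> v w"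
  have b: "?b \<in> carrier V \<times> carrier W \<rightarrow> carrier U" using bilinearD(1)[OF \<beta>] by auto
  note L = UL.free_ext_hom[OF b]
  interpret L: abelian_group_hom F U "free_ext K U ?b"
    by (rule module_hom_group[OF L F.M.abelian_group_axioms U.M.abelian_group_axioms])
  have g: "free_ext K U ?b (free_gen K (v, w)) = \<beta> v w" if "v \<in> carrier V" "w \<in> carrier W" for v w
    using that bilinearD(1)[OF \<beta>] by (simp add: UL.free_ext_gen)
  have "tensor_rels K V W \<subseteq> {z \<in> carrier F. free_ext K U ?b z = \<zero>\<^bsub>U\<^esub>}"
  proof
    fix z assume z: "z \<in> tensor_rels K V W"
    then have zc: "z \<in> carrier F" using rels_closed by auto
    from z have "free_ext K U ?b z = \<zero>\<^bsub>U\<^esub>"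
      unfolding tensor_rels_def Let_def
      by (auto simp: a_minus_def g bilinearD[OF \<beta>] U.M.r_neg module_homD(3)[OF L])
    with zc show "z \<in> {z \<in> carrier F. free_ext K U ?b z = \<zero>\<^bsub>U\<^esub>}" by simp
  qed
  with F.kernel_submodule[OF U L] show ?thesis
    unfolding tensor_kernel_def gen_submodule_def by blast
qed

text \<open>Vanishing on \<open>tensor_kernel\<close> makes the image of a coset a singleton, so
  \<open>the_elem\<close> returns its member.\<close>

lemma tensor_lift_coset:
  assumes z: "z \<in> carrier F"
  shows "tensor_lift K V W U \<beta> (tensor_kernel K V W +>\<^bsub>F\<^esub> z) = free_ext K U (\<lambda>(v, w). \<beta> v w) z"
proof -
  interpret F: module K F by (rule F_module)
  interpret U: module K U by (rule U)
  interpret UL: lmod K U by (rule U.is_lmod)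
  let ?b = "\<lambda>(v, w). \<beta> v w"
  have b: "?b \<in> carrier V \<times> carrier W \<rightarrow> carrier U" using bilinearD(1)[OF \<beta>] by auto
  note L = UL.free_ext_hom[OF b]
  have "(\<Union>y\<in>tensor_kernel K V W +>\<^bsub>F\<^esub> z. {free_ext K U ?b y}) = {free_ext K U ?b z}"
  proof (rule F.quot_Union[OF kernel_submodule z])
    fix y assume y: "y \<in> carrier F" "y \<ominus>\<^bsub>F\<^esub> z \<in> tensor_kernel K V W"
    then have "free_ext K U ?b y \<ominus>\<^bsub>U\<^esub> free_ext K U ?b z = \<zero>\<^bsub>U\<^esub>"
      using lift_rels module_hom_minus[OF L F.M.abelian_group_axioms U.M.abelian_group_axioms y(1) z] by auto
    then show "{free_ext K U ?b y} = {free_ext K U ?b z}"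
      using U.M.minus_zeroD UL.free_ext_closed[OF b] y(1) z by blast
  qed
  then have "free_ext K U ?b ` (tensor_kernel K V W +>\<^bsub>F\<^esub> z) = {free_ext K U ?b z}"
    by (simp add: image_def) blast
  then show ?thesis by (simp add: tensor_lift_def)
qed

lemma tensor_lift_hom: "tensor_lift K V W U \<beta> \<in> module_hom K T U"
proof -
  interpret F: module K F by (rule F_module)
  interpret U: module K U by (rule U)
  interpret UL: lmod K U by (rule U.is_lmod)
  have b: "(\<lambda>(v, w). \<beta> v w) \<in> carrier V \<times> carrier W \<rightarrow> carrier U" using bilinearD(1)[OF \<beta>] by auto
  note L = UL.free_ext_hom[OF b]
  show ?thesis
    unfolding tensor_space_def
    by (rule module_homI) (auto simp: F.quot_carrier[OF kernel_submodule] F.quot_add[OF kernel_submodule]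
      F.quot_smult[OF kernel_submodule] tensor_lift_coset module_homD[OF L])
qed

lemma tensor_lift_pure:
  assumes "v \<in> carrier V" "w \<in> carrier W"
  shows "tensor_lift K V W U \<beta> (v \<otimes>\<otimes> w) = \<beta> v w"
proof -
  interpret U: module K U by (rule U)
  interpret UL: lmod K U by (rule U.is_lmod)
  show ?thesis
    using assms bilinearD(1)[OF \<beta>]
    by (simp add: pure_tensor_def tensor_lift_coset UL.free_ext_gen)
qed

end

lemma tensor_rep_ex: "t \<in> carrier T \<Longrightarrow> \<exists>xs. set xs \<subseteq> carrier V \<times> carrier W \<and> tsum T (\<otimes>\<otimes>) xs = t"
proof (induction t rule: tensor_induct)
  case zero
  show ?case by (intro exI[of _ "[]"]) auto
next
  case (add v w t)
  then obtain xs where "set xs \<subseteq> carrier V \<times> carrier W" "tsum T (\<otimes>\<otimes>) xs = t" by blast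
  with add show ?case by (intro exI[of _ "(v, w) # xs"]) auto
qed

end

lemma tsum_closed:
  assumes "module K U" "\<And>v w. (v, w) \<in> set xs \<Longrightarrow> \<beta> v w \<in> carrier U"
  shows "tsum U \<beta> xs \<in> carrier U"
proof -
  interpret U: module K U by fact
  show ?thesis using assms(2) by (induction xs) auto
qed

lemma tsum_hom:
  assumes "module K U" "module K U'" and h: "h \<in> module_hom K U U'"
    and "\<And>v w. (v, w) \<in> set xs \<Longrightarrow> \<beta> v w \<in> carrier U"
  shows "h (tsum U \<beta> xs) = tsum U' (\<lambda>v w. h (\<beta> v w)) xs"
proof -
  interpret U: module K U by fact
  interpret U': module K U' by fact
  show ?thesis using assms(4)
  proof (induction xs)
    case Nil
    show ?case using module_hom_zero[OF h U.M.abelian_group_axioms U'.M.abelian_group_axioms] by simp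
  next
    case (Cons p xs)
    then show ?case
      using tsum_closed[OF assms(1), of xs \<beta>] by (cases p) (simp add: module_homD(2)[OF h])
  qed
qed

lemma tsum_add:
  assumes "module K U" "\<And>v w. (v, w) \<in> set xs \<Longrightarrow> \<beta> v w \<in> carrier U"
    "\<And>v w. (v, w) \<in> set xs \<Longrightarrow> \<gamma> v w \<in> carrier U"
  shows "tsum U (\<lambda>v w. \<beta> v w \<oplus>\<^bsub>U\<^esub> \<gamma> v w) xs = tsum U \<beta> xs \<oplus>\<^bsub>U\<^esub> tsum U \<gamma> xs"
proof -
  interpret U: module K U by fact
  show ?thesis using assms(2,3)
  proof (induction xs)
    case (Cons p xs)
    then show ?case
      using tsum_closed[OF assms(1), of xs \<beta>] tsum_closed[OF assms(1), of xs \<gamma>]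
      by (cases p) (simp add: U.M.a_ac)
  qed simp
qed

lemma tsum_zero: "module K U \<Longrightarrow> tsum U (\<lambda>v w. \<zero>\<^bsub>U\<^esub>) xs = \<zero>\<^bsub>U\<^esub>"
proof -
  assume "module K U"
  then interpret U: module K U .
  show ?thesis by (induction xs) auto
qed

lemma tsum_swap:
  assumes "module K U"
    and "\<And>a b c d. (a, b) \<in> set xs \<Longrightarrow> (c, d) \<in> set ys \<Longrightarrow> \<tau> a b c d \<in> carrier U"
  shows "tsum U (\<lambda>a b. tsum U (\<lambda>c d. \<tau> a b c d) ys) xs = tsum U (\<lambda>c d. tsum U (\<lambda>a b. \<tau> a b c d) xs) ys"
  using assms(2)
proof (induction xs)
  case Nil
  then show ?case by (simp add: tsum_zero[OF assms(1)])
next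
  case (Cons p xs)
  obtain a b where p: "p = (a, b)" by force
  have "tsum U (\<lambda>c d. tsum U (\<lambda>a b. \<tau> a b c d) (p # xs)) ys =
      tsum U (\<lambda>c d. \<tau> a b c d) ys \<oplus>\<^bsub>U\<^esub> tsum U (\<lambda>c d. tsum U (\<lambda>a b. \<tau> a b c d) xs) ys"
    unfolding p tsum_simps
    by (rule tsum_add[OF assms(1)]) (use Cons.prems p in \<open>auto intro!: tsum_closed[OF assms(1)]\<close>)
  then show ?case using Cons p by simp
qed

lemma (in tensor) tensor_lift_tsum:
  assumes U: "module K U" and \<beta>: "bilinear K V W U \<beta>" and xs: "set xs \<subseteq> carrier V \<times> carrier W"
  shows "tensor_lift K V W U \<beta> (tsum T (\<otimes>\<otimes>) xs) = tsum U \<beta> xs"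
proof -
  have "tensor_lift K V W U \<beta> (tsum T (\<otimes>\<otimes>) xs) = tsum U (\<lambda>v w. tensor_lift K V W U \<beta> (v \<otimes>\<otimes> w)) xs"
    by (rule tsum_hom[OF T.module_axioms U tensor_lift_hom[OF U \<beta>]]) (use xs in auto)
  also have "\<dots> = tsum U \<beta> xs"
    by (rule tsum_cong) (use xs in \<open>auto simp: tensor_lift_pure[OF U \<beta>]\<close>)
  finally show ?thesis .
qed

text \<open>Needed for nested lifts: to lift in an outer variable, the inner lift must be linear in
  it. A single decomposition of \<open>t\<close> serves for all parameters \<open>y\<close>.\<close>

lemma (in tensor) tensor_lift_param:
  assumes U: "module K U" and P: "module K P"
    and bil: "\<And>y. y \<in> carrier P \<Longrightarrow> bilinear K V W U (\<beta> y)"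
    and lin: "\<And>v w. v \<in> carrier V \<Longrightarrow> w \<in> carrier W \<Longrightarrow> (\<lambda>y. \<beta> y v w) \<in> module_hom K P U"
    and t: "t \<in> carrier T"
  shows "(\<lambda>y. tensor_lift K V W U (\<beta> y) t) \<in> module_hom K P U"
proof -
  interpret U: module K U by fact
  interpret P: module K P by fact
  obtain xs where xs: "set xs \<subseteq> carrier V \<times> carrier W" "tsum T (\<otimes>\<otimes>) xs = t"
    using tensor_rep_ex[OF t] by blast
  have eq: "tensor_lift K V W U (\<beta> y) t = tsum U (\<beta> y) xs" if "y \<in> carrier P" for y
    using tensor_lift_tsum[OF U bil[OF that] xs(1)] xs(2) by simp
  have vw: "v \<in> carrier V" "w \<in> carrier W" if "(v, w) \<in> set xs" for v w
    using xs that by auto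
  note c = bilinearD(1)[OF bil]
  show ?thesis
  proof (rule module_homI)
    fix x assume x: "x \<in> carrier P"
    then show "tensor_lift K V W U (\<beta> x) t \<in> carrier U"
      unfolding eq[OF x] by (intro tsum_closed[OF U] c vw)
    { fix y assume y: "y \<in> carrier P"
      have "tsum U (\<beta> (x \<oplus>\<^bsub>P\<^esub> y)) xs = tsum U (\<lambda>v w. \<beta> x v w \<oplus>\<^bsub>U\<^esub> \<beta> y v w) xs"
        by (intro tsum_cong module_homD(2)[OF lin] vw x y)
      also have "\<dots> = tsum U (\<beta> x) xs \<oplus>\<^bsub>U\<^esub> tsum U (\<beta> y) xs"
        by (intro tsum_add[OF U] c vw x y)
      finally show "tensor_lift K V W U (\<beta> (x \<oplus>\<^bsub>P\<^esub> y)) t =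
          tensor_lift K V W U (\<beta> x) t \<oplus>\<^bsub>U\<^esub> tensor_lift K V W U (\<beta> y) t"
        using x y by (simp add: eq) }
    fix r assume r: "r \<in> carrier K"
    have "tsum U (\<beta> (r \<odot>\<^bsub>P\<^esub> x)) xs = tsum U (\<lambda>v w. r \<odot>\<^bsub>U\<^esub> \<beta> x v w) xs"
      by (intro tsum_cong module_homD(3)[OF lin] vw x r)
    also have "\<dots> = r \<odot>\<^bsub>U\<^esub> tsum U (\<beta> x) xs"
      by (rule tsum_hom[OF U U U.smult_module_hom[OF r], symmetric]) (intro c vw x)
    finally show "tensor_lift K V W U (\<beta> (r \<odot>\<^bsub>P\<^esub> x)) t = r \<odot>\<^bsub>U\<^esub> tensor_lift K V W U (\<beta> x) t"
      using x r by (simp add: eq)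
  qed
qed

section \<open>Tensor products of algebras\<close>

lemma assoc_algebraI:
  assumes "module K A" "monoid A"
    and l_distr: "\<And>x y z. x \<in> carrier A \<Longrightarrow> y \<in> carrier A \<Longrightarrow> z \<in> carrier A \<Longrightarrow>
      (x \<oplus>\<^bsub>A\<^esub> y) \<otimes>\<^bsub>A\<^esub> z = x \<otimes>\<^bsub>A\<^esub> z \<oplus>\<^bsub>A\<^esub> y \<otimes>\<^bsub>A\<^esub> z"
    and r_distr: "\<And>x y z. x \<in> carrier A \<Longrightarrow> y \<in> carrier A \<Longrightarrow> z \<in> carrier A \<Longrightarrow>
      z \<otimes>\<^bsub>A\<^esub> (x \<oplus>\<^bsub>A\<^esub> y) = z \<otimes>\<^bsub>A\<^esub> x \<oplus>\<^bsub>A\<^esub> z \<otimes>\<^bsub>A\<^esub> y"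
    and "\<And>c x y. c \<in> carrier K \<Longrightarrow> x \<in> carrier A \<Longrightarrow> y \<in> carrier A \<Longrightarrow>
      (c \<odot>\<^bsub>A\<^esub> x) \<otimes>\<^bsub>A\<^esub> y = c \<odot>\<^bsub>A\<^esub> (x \<otimes>\<^bsub>A\<^esub> y)"
    and "\<And>c x y. c \<in> carrier K \<Longrightarrow> x \<in> carrier A \<Longrightarrow> y \<in> carrier A \<Longrightarrow>
      x \<otimes>\<^bsub>A\<^esub> (c \<odot>\<^bsub>A\<^esub> y) = c \<odot>\<^bsub>A\<^esub> (x \<otimes>\<^bsub>A\<^esub> y)"
  shows "assoc_algebra K A"
  using assms
  by (intro assoc_algebra.intro assoc_algebra_axioms.intro ring.intro ring_axioms.intro)
    (auto dest: module.axioms)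

lemma (in assoc_algebra) mult_left_hom: "x \<in> carrier A \<Longrightarrow> (\<lambda>y. x \<otimes>\<^bsub>A\<^esub> y) \<in> module_hom K A A"
  by (intro module_homI) (simp_all add: A.r_distr smult_mult_right)

lemma (in assoc_algebra) mult_right_hom: "y \<in> carrier A \<Longrightarrow> (\<lambda>x. x \<otimes>\<^bsub>A\<^esub> y) \<in> module_hom K A A"
  by (intro module_homI) (simp_all add: A.l_distr smult_mult_left)

lemma op_alg_simps [simp]:
  "carrier (op_alg A) = carrier A" "x \<otimes>\<^bsub>op_alg A\<^esub> y = y \<otimes>\<^bsub>A\<^esub> x" "\<one>\<^bsub>op_alg A\<^esub> = \<one>\<^bsub>A\<^esub>"
  "\<zero>\<^bsub>op_alg A\<^esub> = \<zero>\<^bsub>A\<^esub>" "x \<oplus>\<^bsub>op_alg A\<^esub> y = x \<oplus>\<^bsub>A\<^esub> y" "c \<odot>\<^bsub>op_alg A\<^esub> x = c \<odot>\<^bsub>A\<^esub> x"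
  by (simp_all add: op_alg_def)

lemma (in module) update_module:
  assumes "carrier M' = carrier M" "add M' = add M" "\<zero>\<^bsub>M'\<^esub> = \<zero>\<^bsub>M\<^esub>" "smult M' = smult M"
  shows "module R M'"
proof (rule moduleI[OF R.cring_axioms])
  show "abelian_group M'"
    by (rule abelian_groupI) (use assms M.l_neg in \<open>auto simp: M.a_ac\<close>)
qed (simp_all add: assms smult_l_distr smult_r_distr smult_assoc1)

lemma (in assoc_algebra) op_algebra: "assoc_algebra K (op_alg A)"
proof (rule assoc_algebraI)
  show "module K (op_alg A)" by (rule update_module) (simp_all add: op_alg_def)
  show "monoid (op_alg A)" by (rule monoidI) (simp_all add: A.m_assoc)
qed (simp_all add: A.l_distr A.r_distr smult_mult_left smult_mult_right)

text \<open>
  The value \<open>m v w v' w'\<close> is the product of \<open>v \<otimes> w\<close> and \<open>v' \<otimes> w'\<close>. The tensor product of algebras and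
  the smash product are both of this form.
\<close>

locale tensor_mult = tensor K V W
  for K :: "'k ring" and V :: "('k, 'v) module" and W :: "('k, 'w) module" +
  fixes m :: "'v \<Rightarrow> 'w \<Rightarrow> 'v \<Rightarrow> 'w \<Rightarrow> ('k, 'v, 'w) tensor"
  assumes bil_right: "v \<in> carrier V \<Longrightarrow> w \<in> carrier W \<Longrightarrow> bilinear K V W T (m v w)"
    and bil_left: "v' \<in> carrier V \<Longrightarrow> w' \<in> carrier W \<Longrightarrow> bilinear K V W T (\<lambda>v w. m v w v' w')"
begin

text \<open>Left multiplication by the pure tensor of \<open>v\<close> and \<open>w\<close>.\<close>

definition inner :: "'v \<Rightarrow> 'w \<Rightarrow> ('k, 'v, 'w) tensor \<Rightarrow> ('k, 'v, 'w) tensor"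
  where "inner v w = tensor_lift K V W T (m v w)"

definition tmult :: "('k, 'v, 'w) tensor \<Rightarrow> ('k, 'v, 'w) tensor \<Rightarrow> ('k, 'v, 'w) tensor" (infixl "**" 70)
  where "s ** t = tensor_lift K V W T (\<lambda>v w. tensor_lift K V W T (m v w) t) s"

lemma inner_hom: "v \<in> carrier V \<Longrightarrow> w \<in> carrier W \<Longrightarrow> inner v w \<in> module_hom K T T"
  unfolding inner_def by (rule tensor_lift_hom[OF T.module_axioms bil_right])

lemma inner_pure: "v \<in> carrier V \<Longrightarrow> w \<in> carrier W \<Longrightarrow> v' \<in> carrier V \<Longrightarrow> w' \<in> carrier W \<Longrightarrow>
    inner v w (v' \<otimes>\<otimes> w') = m v w v' w'"
  unfolding inner_def by (rule tensor_lift_pure[OF T.module_axioms bil_right])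

lemma inner_bilinear:
  assumes t: "t \<in> carrier T" shows "bilinear K V W T (\<lambda>v w. inner v w t)"
  unfolding inner_def
  by (intro bilinearI tensor_lift_param[OF T.module_axioms _ bil_right _ t] V.module_axioms W.module_axioms)
    (use bil_left in \<open>auto simp: bilinear_def\<close>)

lemma tmult_eq: "s ** t = tensor_lift K V W T (\<lambda>v w. inner v w t) s"
  by (simp add: tmult_def inner_def)

lemma tmult_right_hom: "t \<in> carrier T \<Longrightarrow> (\<lambda>s. s ** t) \<in> module_hom K T T"
  unfolding tmult_eq by (rule tensor_lift_hom[OF T.module_axioms inner_bilinear])

lemma tmult_pure_left: "v \<in> carrier V \<Longrightarrow> w \<in> carrier W \<Longrightarrow> t \<in> carrier T \<Longrightarrow>
    (v \<otimes>\<otimes> w) ** t = inner v w t"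
  unfolding tmult_eq by (rule tensor_lift_pure[OF T.module_axioms inner_bilinear])

lemma tmult_pure: "v \<in> carrier V \<Longrightarrow> w \<in> carrier W \<Longrightarrow> v' \<in> carrier V \<Longrightarrow> w' \<in> carrier W \<Longrightarrow>
    (v \<otimes>\<otimes> w) ** (v' \<otimes>\<otimes> w') = m v w v' w'"
  by (simp add: tmult_pure_left inner_pure)

lemma tmult_zero_left: "t \<in> carrier T \<Longrightarrow> \<zero>\<^bsub>T\<^esub> ** t = \<zero>\<^bsub>T\<^esub>"
  by (rule module_hom_zero[OF tmult_right_hom T.M.abelian_group_axioms T.M.abelian_group_axioms])

lemma tmult_closed: "s \<in> carrier T \<Longrightarrow> t \<in> carrier T \<Longrightarrow> s ** t \<in> carrier T"
  by (rule module_homD(1)[OF tmult_right_hom])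

text \<open>The product is built as a lift in its left factor, so linearity on that side is
  immediate; on the right it is shown by decomposing the left factor.\<close>

lemma tmult_left_hom:
  assumes "s \<in> carrier T" shows "(\<lambda>t. s ** t) \<in> module_hom K T T"
  using assms
proof (induction s rule: tensor_induct)
  case zero
  show ?case by (rule module_homI) (simp_all add: tmult_zero_left)
next
  case (add v w s)
  then show ?case
    by (intro module_homI)
      (simp_all add: module_homD(2)[OF tmult_right_hom] tmult_pure_left module_homD[OF inner_hom]
        module_homD[OF add.IH] T.M.a_ac T.smult_r_distr)
qed

lemma tmult_zero_right: "s \<in> carrier T \<Longrightarrow> s ** \<zero>\<^bsub>T\<^esub> = \<zero>\<^bsub>T\<^esub>"
  by (rule module_hom_zero[OF tmult_left_hom T.M.abelian_group_axioms T.M.abelian_group_axioms])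

lemma m_closed: "v \<in> carrier V \<Longrightarrow> w \<in> carrier W \<Longrightarrow> v' \<in> carrier V \<Longrightarrow> w' \<in> carrier W \<Longrightarrow>
    m v w v' w' \<in> carrier T"
  by (rule bilinearD(1)[OF bil_right])

text \<open>Both sides are linear in each of the three factors, which reduces the claim to pure
  tensors.\<close>

lemma tmult_assoc:
  assumes pure_assoc: "\<And>v w v' w' x y. v \<in> carrier V \<Longrightarrow> w \<in> carrier W \<Longrightarrow> v' \<in> carrier V \<Longrightarrow>
      w' \<in> carrier W \<Longrightarrow> x \<in> carrier V \<Longrightarrow> y \<in> carrier W \<Longrightarrow>
      m v w v' w' ** (x \<otimes>\<otimes> y) = (v \<otimes>\<otimes> w) ** m v' w' x y"
    and "s \<in> carrier T" "t \<in> carrier T" "u \<in> carrier T"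
  shows "(s ** t) ** u = s ** (t ** u)"
  using assms(2)
proof (induction s rule: tensor_induct)
  case zero
  show ?case using assms by (simp add: tmult_zero_left tmult_closed)
next
  case (add v w s)
  have "((v \<otimes>\<otimes> w) ** t) ** u = (v \<otimes>\<otimes> w) ** (t ** u)"
    using assms(3)
  proof (induction t rule: tensor_induct)
    case zero
    show ?case using add assms by (simp add: tmult_zero_left tmult_zero_right)
  next
    case add1: (add v' w' t)
    have "((v \<otimes>\<otimes> w) ** (v' \<otimes>\<otimes> w')) ** u = (v \<otimes>\<otimes> w) ** ((v' \<otimes>\<otimes> w') ** u)"
      using assms(4)
    proof (induction u rule: tensor_induct)
      case zero
      show ?case using add add1 by (simp add: tmult_zero_right tmult_closed)
    next
      case add2: (add v2 w2 u)
      show ?case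
        using add(1-3) add1(1-3) add2
        by (simp add: module_homD(2)[OF tmult_left_hom] tmult_closed tmult_pure m_closed pure_assoc)
    qed
    then show ?case
      using add(1-3) add1 assms(4)
      by (simp add: module_homD(2)[OF tmult_left_hom] module_homD(2)[OF tmult_right_hom] tmult_closed)
  qed
  then show ?case
    using add assms(3,4) by (simp add: module_homD(2)[OF tmult_right_hom] tmult_closed)
qed

text \<open>\<open>R\<close> is only required to agree with the tensor space in its linear fields
  and to carry this product and unit, so the records \<open>tensor_alg\<close> and
  \<open>smash\<close> both qualify.\<close>

lemma tmult_algebra:
  assumes R: "carrier R = carrier T" "add R = add T" "\<zero>\<^bsub>R\<^esub> = \<zero>\<^bsub>T\<^esub>" "smult R = smult T"
    "mult R = tmult" "\<one>\<^bsub>R\<^esub> = e \<otimes>\<otimes> f"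
    and ef: "e \<in> carrier V" "f \<in> carrier W"
    and unit: "\<And>v w. v \<in> carrier V \<Longrightarrow> w \<in> carrier W \<Longrightarrow> m e f v w = v \<otimes>\<otimes> w"
      "\<And>v w. v \<in> carrier V \<Longrightarrow> w \<in> carrier W \<Longrightarrow> m v w e f = v \<otimes>\<otimes> w"
    and pure_assoc: "\<And>v w v' w' x y. v \<in> carrier V \<Longrightarrow> w \<in> carrier W \<Longrightarrow> v' \<in> carrier V \<Longrightarrow>
      w' \<in> carrier W \<Longrightarrow> x \<in> carrier V \<Longrightarrow> y \<in> carrier W \<Longrightarrow>
      m v w v' w' ** (x \<otimes>\<otimes> y) = (v \<otimes>\<otimes> w) ** m v' w' x y"
  shows "assoc_algebra K R"
proof (rule assoc_algebraI)
  show "module K R" by (rule T.update_module) (simp_all add: R)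
  have l: "(e \<otimes>\<otimes> f) ** t = t" if "t \<in> carrier T" for t
    using that
    by (induction t rule: tensor_induct)
      (simp_all add: tmult_zero_right module_homD(2)[OF tmult_left_hom] tmult_pure ef unit)
  have r: "t ** (e \<otimes>\<otimes> f) = t" if "t \<in> carrier T" for t
    using that
    by (induction t rule: tensor_induct)
      (simp_all add: tmult_zero_left module_homD(2)[OF tmult_right_hom] tmult_pure ef unit)
  show "monoid R"
    by (rule monoidI) (simp_all add: R l r ef tmult_closed tmult_assoc[OF pure_assoc])
qed (simp_all add: R module_homD[OF tmult_left_hom] module_homD[OF tmult_right_hom])

end

locale tensor_algebra = tensor K V W + V: assoc_algebra K V + W: assoc_algebra K W
  for K :: "'k ring" and V :: "('k, 'v) module" and W :: "('k, 'w) module"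
begin

abbreviation "TA \<equiv> tensor_alg K V W"

lemma TA_simps [simp]:
  "carrier TA = carrier T" "add TA = add T" "\<zero>\<^bsub>TA\<^esub> = \<zero>\<^bsub>T\<^esub>" "smult TA = smult T"
  "\<one>\<^bsub>TA\<^esub> = \<one>\<^bsub>V\<^esub> \<otimes>\<otimes> \<one>\<^bsub>W\<^esub>"
  by (simp_all add: tensor_alg_def)

sublocale TM: tensor_mult K V W "\<lambda>v w v' w'. (v \<otimes>\<^bsub>V\<^esub> v') \<otimes>\<otimes> (w \<otimes>\<^bsub>W\<^esub> w')"
  by unfold_locales
    (rule bilinear_comp_args[OF pure_bilinear V.mult_left_hom W.mult_left_hom]
      bilinear_comp_args[OF pure_bilinear V.mult_right_hom W.mult_right_hom]; assumption)+

lemma mult_eq: "mult TA = TM.tmult"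
  by (intro ext) (simp add: tensor_alg_def TM.tmult_def)

lemmas mult_right_hom = TM.tmult_right_hom[folded mult_eq]
lemmas mult_left_hom = TM.tmult_left_hom[folded mult_eq]
lemmas mult_pure = TM.tmult_pure[folded mult_eq]
lemmas mult_closed = TM.tmult_closed[folded mult_eq]
lemmas mult_zero_left = TM.tmult_zero_left[folded mult_eq]
lemmas mult_zero_right = TM.tmult_zero_right[folded mult_eq]

lemma TA_algebra: "assoc_algebra K TA"
  by (rule TM.tmult_algebra[where e = "\<one>\<^bsub>V\<^esub>" and f = "\<one>\<^bsub>W\<^esub>"])
    (simp_all add: mult_eq TM.tmult_pure V.A.m_assoc W.A.m_assoc)

end

sublocale tensor_algebra \<subseteq> TA: assoc_algebra K TA
  by (rule TA_algebra)

section \<open>Bimodules as modules over the enveloping algebra\<close>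

context bimodule
begin

lemma env_tensor: "tensor_algebra K B (op_alg B)"
  by (intro tensor_algebra.intro tensor.intro B.assoc_algebra_axioms B.op_algebra B.module_axioms
    assoc_algebra.axioms(1)[OF B.op_algebra])

lemma env_bilinear:
  assumes "m \<in> carrier M" shows "bilinear K B (op_alg B) M (\<lambda>b c. lact b (ract m c))"
  using assms
  by (intro bilinearI module_homI)
    (auto simp: module_homD[OF lact_linear] module_homD[OF ract_linear_scalar] module_homD[OF lact_linear_scalar])

lemma env_smult_hom:
  "m \<in> carrier M \<Longrightarrow> (\<lambda>t. t \<odot>\<^bsub>env_module K B M lact ract\<^esub> m) \<in> module_hom K (tensor_space K B (op_alg B)) M"
  using tensor.tensor_lift_hom[OF tensor_algebra.axioms(1)[OF env_tensor] module_axioms env_bilinear]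
  by (simp add: env_module_def)

lemma env_smult_pure:
  "b \<in> carrier B \<Longrightarrow> c \<in> carrier B \<Longrightarrow> m \<in> carrier M \<Longrightarrow>
    pure_tensor K B (op_alg B) b c \<odot>\<^bsub>env_module K B M lact ract\<^esub> m = lact b (ract m c)"
  using tensor.tensor_lift_pure[OF tensor_algebra.axioms(1)[OF env_tensor] module_axioms env_bilinear]
  by (simp add: env_module_def)

lemma env_simps [simp]:
  "carrier (env_module K B M lact ract) = carrier M" "\<zero>\<^bsub>env_module K B M lact ract\<^esub> = \<zero>\<^bsub>M\<^esub>"
  "add (env_module K B M lact ract) = add M"
  by (simp_all add: env_module_def)

text \<open>The opposite multiplication in the second factor turns the right action into a left one,
  and the two actions commute; everything else is linear extension from pure tensors.\<close>

lemma env_lmod: "lmod (env_alg K B) (env_module K B M lact ract)"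
proof -
  interpret E: tensor_algebra K B "op_alg B" by (rule env_tensor)
  let ?N = "env_module K B M lact ract"
  note hom = env_smult_hom
  have c: "t \<odot>\<^bsub>?N\<^esub> m \<in> carrier M" if "t \<in> carrier E.T" "m \<in> carrier M" for t m
    using module_homD(1)[OF hom] that by simp
  have z: "\<zero>\<^bsub>E.T\<^esub> \<odot>\<^bsub>?N\<^esub> m = \<zero>\<^bsub>M\<^esub>" if "m \<in> carrier M" for m
    by (rule module_hom_zero[OF hom[OF that] E.T.M.abelian_group_axioms M.abelian_group_axioms])
  have radd: "t \<odot>\<^bsub>?N\<^esub> (m \<oplus>\<^bsub>M\<^esub> m') = t \<odot>\<^bsub>?N\<^esub> m \<oplus>\<^bsub>M\<^esub> t \<odot>\<^bsub>?N\<^esub> m'"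
    if "t \<in> carrier E.T" "m \<in> carrier M" "m' \<in> carrier M" for t m m'
    using that
  proof (induction t rule: E.tensor_induct)
    case (add v w t)
    then show ?case
      by (simp add: module_homD(2)[OF hom] env_smult_pure c M.a_ac module_homD[OF lact_linear]
        module_homD[OF ract_linear])
  qed (simp add: z)
  have pa: "(E.pure b b' \<otimes>\<^bsub>E.TA\<^esub> t) \<odot>\<^bsub>?N\<^esub> m = E.pure b b' \<odot>\<^bsub>?N\<^esub> (t \<odot>\<^bsub>?N\<^esub> m)"
    if "b \<in> carrier B" "b' \<in> carrier B" "t \<in> carrier E.T" "m \<in> carrier M" for b b' t m
    using that(3)
  proof (induction t rule: E.tensor_induct)
    case zero
    show ?case using that radd[of "E.pure b b'" "\<zero>\<^bsub>M\<^esub>" "\<zero>\<^bsub>M\<^esub>"] c[of "E.pure b b'" "\<zero>\<^bsub>M\<^esub>"]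
      by (simp add: z E.mult_zero_right)
  next
    case (add v w t)
    \<comment> \<open>\<open>w\<close> comes before \<open>b'\<close> because the second factor is
      multiplied in the opposite order.\<close>
    have "lact (b \<otimes>\<^bsub>B\<^esub> v) (ract m (w \<otimes>\<^bsub>B\<^esub> b')) = lact b (ract (lact v (ract m w)) b')"
      using add that by (simp add: lact_mult ract_mult lact_ract module_homD[OF ract_linear] module_homD[OF lact_linear])
    then show ?case
      using add that
      by (simp add: module_homD(2)[OF E.mult_left_hom] module_homD(2)[OF hom] radd
        c E.mult_closed E.mult_pure env_smult_pure module_homD[OF lact_linear] module_homD[OF ract_linear])
  qed
  have assoc: "(s \<otimes>\<^bsub>E.TA\<^esub> t) \<odot>\<^bsub>?N\<^esub> m = s \<odot>\<^bsub>?N\<^esub> (t \<odot>\<^bsub>?N\<^esub> m)"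
    if "s \<in> carrier E.T" "t \<in> carrier E.T" "m \<in> carrier M" for s t m
    using that
  proof (induction s rule: E.tensor_induct)
    case (add v w s)
    then show ?case
      by (simp add: module_homD(2)[OF E.mult_right_hom] module_homD(2)[OF hom] c E.mult_closed pa)
  qed (simp add: z c E.mult_zero_left)
  have ab: "abelian_group ?N"
    by (rule abelian_groupI) (use M.l_neg in \<open>auto simp: M.a_ac\<close>)
  show ?thesis
    unfolding env_alg_def
    by (intro lmod.intro lmod_axioms.intro E.TA.ring_axioms ab)
      (simp_all add: c radd assoc module_homD(2)[OF hom] env_smult_pure lact_one ract_one)
qed

end

lemma (in assoc_algebra) regular_bimodule: "bimodule K A A (mult A) (mult A)"
  by (intro bimodule.intro bimodule_axioms.intro assoc_algebra_axioms module_axioms mult_left_hom mult_right_hom)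
    (simp_all add: A.m_assoc)

section \<open>Sweedler sums\<close>

text \<open>Only the summation condition depends on \<open>t\<close> being a tensor; the entries lie
  in the carriers in any case, so closure and congruence of Sweedler sums need no assumption on the
  element.\<close>

definition tensor_rep :: "'k ring \<Rightarrow> ('k, 'v) module \<Rightarrow> ('k, 'w) module \<Rightarrow> ('k, 'v, 'w) tensor \<Rightarrow> ('v \<times> 'w) list"
  where "tensor_rep K V W t = (SOME xs. set xs \<subseteq> carrier V \<times> carrier W \<and>
    (t \<in> carrier (tensor_space K V W) \<longrightarrow> tsum (tensor_space K V W) (pure_tensor K V W) xs = t))"

lemma (in tensor) tensor_rep:
  "set (tensor_rep K V W t) \<subseteq> carrier V \<times> carrier W"
  "t \<in> carrier T \<Longrightarrow> tsum T (\<otimes>\<otimes>) (tensor_rep K V W t) = t"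
proof -
  have "\<exists>xs. set xs \<subseteq> carrier V \<times> carrier W \<and> (t \<in> carrier T \<longrightarrow> tsum T (\<otimes>\<otimes>) xs = t)"
  proof (cases "t \<in> carrier T")
    case True
    then show ?thesis using tensor_rep_ex by blast
  next
    case False
    then show ?thesis by (intro exI[of _ "[]"]) auto
  qed
  from someI_ex[OF this]
  show "set (tensor_rep K V W t) \<subseteq> carrier V \<times> carrier W"
    "t \<in> carrier T \<Longrightarrow> tsum T (\<otimes>\<otimes>) (tensor_rep K V W t) = t"
    unfolding tensor_rep_def by auto
qed

text \<open>
  The Sweedler sum \<open>\<Sum> \<beta> h\<^sub>1 h\<^sub>2\<close> in \<open>U\<close>, taken over one chosen decomposition of \<open>\<Delta> h\<close> into pure tensors.
  Only for bilinear \<open>\<beta>\<close> is it independent of that choice; linearity in \<open>\<beta>\<close> and congruence hold for all \<open>\<beta>\<close>.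
\<close>

definition sweedler :: "'k ring \<Rightarrow> ('k, 'h) module \<Rightarrow> ('h \<Rightarrow> ('k, 'h, 'h) tensor) \<Rightarrow> ('k, 'u) module \<Rightarrow>
    'h \<Rightarrow> ('h \<Rightarrow> 'h \<Rightarrow> 'u) \<Rightarrow> 'u"
  where "sweedler K H \<Delta> U h \<beta> = tsum U \<beta> (tensor_rep K H H (\<Delta> h))"

context hopf_algebra
begin

abbreviation "Sw \<equiv> sweedler K H \<Delta>"

sublocale HH: tensor_algebra K H H
  by (intro tensor_algebra.intro tensor.intro assoc_algebra_axioms module_axioms)

lemma comult_closed [simp]: "h \<in> carrier H \<Longrightarrow> \<Delta> h \<in> carrier HH.T"
  using comult_linear by (rule module_homD)

lemma sw_rep: "(x, y) \<in> set (tensor_rep K H H (\<Delta> h)) \<Longrightarrow> x \<in> carrier H \<and> y \<in> carrier H"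
  using HH.tensor_rep(1) by blast

text \<open>As a congruence rule it hands the simplifier the membership of both components in
  \<open>H\<close> while it rewrites under the binders.\<close>

lemma sw_cong [cong]:
  assumes "h = h'" "\<And>x y. x \<in> carrier H \<Longrightarrow> y \<in> carrier H \<Longrightarrow> \<beta> x y = \<gamma> x y"
  shows "Sw U h \<beta> = Sw U h' \<gamma>"
  unfolding sweedler_def assms(1) by (rule tsum_cong) (rule assms(2); drule sw_rep; simp)

lemma sw_closed [simp]:
  assumes "module K U" "\<And>x y. x \<in> carrier H \<Longrightarrow> y \<in> carrier H \<Longrightarrow> \<beta> x y \<in> carrier U"
  shows "Sw U h \<beta> \<in> carrier U"
  unfolding sweedler_def by (rule tsum_closed[OF assms(1)]) (rule assms(2); drule sw_rep; simp)

lemma sw_hom: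
  assumes "module K U" "module K U'" "f \<in> module_hom K U U'"
    and "\<And>x y. x \<in> carrier H \<Longrightarrow> y \<in> carrier H \<Longrightarrow> \<beta> x y \<in> carrier U"
  shows "f (Sw U h \<beta>) = Sw U' h (\<lambda>x y. f (\<beta> x y))"
  unfolding sweedler_def by (rule tsum_hom[OF assms(1-3)]) (rule assms(4); drule sw_rep; simp)

lemma sw_add:
  assumes "module K U" "\<And>x y. x \<in> carrier H \<Longrightarrow> y \<in> carrier H \<Longrightarrow> \<beta> x y \<in> carrier U"
    "\<And>x y. x \<in> carrier H \<Longrightarrow> y \<in> carrier H \<Longrightarrow> \<gamma> x y \<in> carrier U"
  shows "Sw U h (\<lambda>x y. \<beta> x y \<oplus>\<^bsub>U\<^esub> \<gamma> x y) = Sw U h \<beta> \<oplus>\<^bsub>U\<^esub> Sw U h \<gamma>"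
  unfolding sweedler_def by (rule tsum_add[OF assms(1)]) ((rule assms(2) assms(3); drule sw_rep; simp)+)

lemma sw_smult:
  assumes "module K U" "c \<in> carrier K" "\<And>x y. x \<in> carrier H \<Longrightarrow> y \<in> carrier H \<Longrightarrow> \<beta> x y \<in> carrier U"
  shows "Sw U h (\<lambda>x y. c \<odot>\<^bsub>U\<^esub> \<beta> x y) = c \<odot>\<^bsub>U\<^esub> Sw U h \<beta>"
proof -
  have "(\<lambda>x. c \<odot>\<^bsub>U\<^esub> x) \<in> module_hom K U U"
    by (rule module.smult_module_hom[OF assms(1,2)])
  from sw_hom[OF assms(1,1) this assms(3)] show ?thesis by simp
qed

lemma sw_swap:
  assumes "module K U"
    and "\<And>a b c d. a \<in> carrier H \<Longrightarrow> b \<in> carrier H \<Longrightarrow> c \<in> carrier H \<Longrightarrow> d \<in> carrier H \<Longrightarrow> \<tau> a b c d \<in> carrier U"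
  shows "Sw U h (\<lambda>a b. Sw U l (\<lambda>c d. \<tau> a b c d)) = Sw U l (\<lambda>c d. Sw U h (\<lambda>a b. \<tau> a b c d))"
  unfolding sweedler_def by (rule tsum_swap[OF assms(1)]) (rule assms(2); (drule sw_rep)+; simp)

text \<open>Connects the lifts in the Hopf algebra axioms with explicit sums. Bilinearity makes the
  value independent of the chosen decomposition.\<close>

lemma sw_lift:
  assumes "module K U" "bilinear K H H U \<beta>" "h \<in> carrier H"
  shows "tensor_lift K H H U \<beta> (\<Delta> h) = Sw U h \<beta>"
proof -
  have "tensor_lift K H H U \<beta> (\<Delta> h) = tensor_lift K H H U \<beta> (tsum HH.T HH.pure (tensor_rep K H H (\<Delta> h)))"
    using assms(3) by (simp add: HH.tensor_rep(2))
  also have "\<dots> = Sw U h \<beta>"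
    unfolding sweedler_def by (rule HH.tensor_lift_tsum[OF assms(1,2) HH.tensor_rep(1)])
  finally show ?thesis .
qed

text \<open>Not visible from the sum, since the chosen decompositions of \<open>\<Delta> h\<close>
  need not depend linearly on \<open>h\<close>; the lift through the tensor product does.\<close>

lemma sw_linear:
  assumes "module K U" "bilinear K H H U \<beta>"
  shows "(\<lambda>h. Sw U h \<beta>) \<in> module_hom K H U"
proof -
  have "(\<lambda>h. tensor_lift K H H U \<beta> (\<Delta> h)) \<in> module_hom K H U"
    by (rule module_hom_comp[OF comult_linear HH.tensor_lift_hom[OF assms]])
  then show ?thesis
    unfolding module_hom_def using sw_lift[OF assms] by (auto simp: Pi_iff)
qed

lemma sw_comult: "h \<in> carrier H \<Longrightarrow> Sw HH.T h HH.pure = \<Delta> h"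
  by (simp add: sweedler_def HH.tensor_rep(2))

end

section \<open>Coassociativity, counit and antipode for iterated sums\<close>

definition trilinear :: "'k ring \<Rightarrow> ('k, 'v) module \<Rightarrow> ('k, 'w) module \<Rightarrow> ('k, 'x) module \<Rightarrow> ('k, 'u) module \<Rightarrow>
    ('v \<Rightarrow> 'w \<Rightarrow> 'x \<Rightarrow> 'u) \<Rightarrow> bool"
  where "trilinear K V W X U \<tau> \<longleftrightarrow> (\<forall>x\<in>carrier X. bilinear K V W U (\<lambda>v w. \<tau> v w x)) \<and>
    (\<forall>v\<in>carrier V. bilinear K W X U (\<tau> v))"

lemma trilinearD:
  assumes "trilinear K V W X U \<tau>"
  shows "x \<in> carrier X \<Longrightarrow> bilinear K V W U (\<lambda>v w. \<tau> v w x)"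
    and "v \<in> carrier V \<Longrightarrow> bilinear K W X U (\<tau> v)"
  using assms by (auto simp: trilinear_def)

lemma trilinearI:
  assumes "\<And>w x. w \<in> carrier W \<Longrightarrow> x \<in> carrier X \<Longrightarrow> (\<lambda>v. \<tau> v w x) \<in> module_hom K V U"
    and "\<And>v x. v \<in> carrier V \<Longrightarrow> x \<in> carrier X \<Longrightarrow> (\<lambda>w. \<tau> v w x) \<in> module_hom K W U"
    and "\<And>v w. v \<in> carrier V \<Longrightarrow> w \<in> carrier W \<Longrightarrow> (\<lambda>x. \<tau> v w x) \<in> module_hom K X U"
  shows "trilinear K V W X U \<tau>"
  using assms by (auto simp: trilinear_def bilinear_def)

context hopf_algebra
begin

text \<open>The axiom equates two elements of the triple tensor product. Both are written as
  Sweedler sums, and the linear map induced by \<open>\<tau>\<close> is applied to them.\<close>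

lemma sw_coassoc:
  assumes U: "module K U" and \<tau>: "trilinear K H H H U \<tau>" and h: "h \<in> carrier H"
  shows "Sw U h (\<lambda>x y. Sw U x (\<lambda>u v. \<tau> u v y)) = Sw U h (\<lambda>x y. Sw U y (\<lambda>u v. \<tau> x u v))"
proof -
  interpret U: module K U by (rule U)
  interpret L: tensor K HH.T H by (intro tensor.intro HH.T.module_axioms module_axioms)
  interpret R: tensor K H HH.T by (intro tensor.intro HH.T.module_axioms module_axioms)
  note t1 = trilinearD(1)[OF \<tau>] and t2 = trilinearD(2)[OF \<tau>]
  have q: "bilinear K H H R.T (\<lambda>u v. R.pure u (HH.pure v w))" if "w \<in> carrier H" for w
    using that by (intro bilinearI module_homI) (simp_all add: R.pure_add_left R.pure_add_right
      R.pure_smult_left R.pure_smult_right HH.pure_add_left HH.pure_smult_left)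
  have q': "bilinear K HH.T H R.T (\<lambda>s w. tensor_lift K H H R.T (\<lambda>u v. R.pure u (HH.pure v w)) s)"
    by (intro bilinearI HH.tensor_lift_hom[OF R.T.module_axioms q]
        HH.tensor_lift_param[OF R.T.module_axioms module_axioms q] module_homI)
      (simp_all add: R.pure_add_right HH.pure_add_right HH.pure_smult_right R.pure_smult_right)
  let ?\<alpha> = "tensor_assoc K H H H"
  have \<alpha>_hom: "?\<alpha> \<in> module_hom K L.T R.T"
    unfolding tensor_assoc_def Let_def by (rule L.tensor_lift_hom[OF R.T.module_axioms q'])
  have \<alpha>: "?\<alpha> (L.pure (\<Delta> x) y) = Sw R.T x (\<lambda>u v. R.pure u (HH.pure v y))"
    if "x \<in> carrier H" "y \<in> carrier H" for x y
    using that unfolding tensor_assoc_def Let_def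
    by (simp add: L.tensor_lift_pure[OF R.T.module_axioms q'] sw_lift[OF R.T.module_axioms q])
  have m1: "bilinear K H H L.T (\<lambda>x y. L.pure (\<Delta> x) y)"
    by (intro bilinearI module_homI) (simp_all add: L.pure_add_left L.pure_add_right
      L.pure_smult_left L.pure_smult_right module_homD[OF comult_linear])
  have m2: "bilinear K H H R.T (\<lambda>x y. R.pure x (\<Delta> y))"
    by (intro bilinearI module_homI) (simp_all add: R.pure_add_left R.pure_add_right
      R.pure_smult_left R.pure_smult_right module_homD[OF comult_linear])
  have eq: "Sw R.T h (\<lambda>x y. Sw R.T x (\<lambda>u v. R.pure u (HH.pure v y))) = Sw R.T h (\<lambda>x y. R.pure x (\<Delta> y))"
    using coassoc[OF h] unfolding tensor_map_def
    by (simp add: sw_lift[OF _ m1] sw_lift[OF _ m2] h L.T.module_axioms R.T.module_axioms \<alpha>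
      sw_hom[OF L.T.module_axioms R.T.module_axioms \<alpha>_hom])
  have b: "bilinear K H HH.T U (\<lambda>x t. tensor_lift K H H U (\<tau> x) t)"
    by (intro bilinearI HH.tensor_lift_hom[OF U t2] HH.tensor_lift_param[OF U module_axioms t2] module_homI)
      (simp_all add: bilinearD[OF t1])
  \<comment> \<open>The map on \<open>H \<otimes> (H \<otimes> H)\<close> induced by
    \<open>\<tau>\<close>, as a lift of lifts.\<close>
  let ?L = "tensor_lift K H HH.T U (\<lambda>x t. tensor_lift K H H U (\<tau> x) t)"
  have L: "?L \<in> module_hom K R.T U" by (rule R.tensor_lift_hom[OF U b])
  have "?L (Sw R.T h (\<lambda>x y. Sw R.T x (\<lambda>u v. R.pure u (HH.pure v y)))) =
      Sw U h (\<lambda>x y. Sw U x (\<lambda>u v. \<tau> u v y))"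
    by (simp add: sw_hom[OF R.T.module_axioms U L] R.T.module_axioms R.tensor_lift_pure[OF U b]
      HH.tensor_lift_pure[OF U t2])
  moreover have "?L (Sw R.T h (\<lambda>x y. R.pure x (\<Delta> y))) = Sw U h (\<lambda>x y. Sw U y (\<lambda>u v. \<tau> x u v))"
    by (simp add: sw_hom[OF R.T.module_axioms U L] R.T.module_axioms R.tensor_lift_pure[OF U b]
      sw_lift[OF U t2])
  ultimately show ?thesis using eq by simp
qed

lemma counit_simps:
  "x \<in> carrier H \<Longrightarrow> \<epsilon> x \<in> carrier K"
  "x \<in> carrier H \<Longrightarrow> y \<in> carrier H \<Longrightarrow> \<epsilon> (x \<oplus>\<^bsub>H\<^esub> y) = \<epsilon> x \<oplus>\<^bsub>K\<^esub> \<epsilon> y"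
  "x \<in> carrier H \<Longrightarrow> y \<in> carrier H \<Longrightarrow> \<epsilon> (x \<otimes>\<^bsub>H\<^esub> y) = \<epsilon> x \<otimes>\<^bsub>K\<^esub> \<epsilon> y"
  "\<epsilon> \<one>\<^bsub>H\<^esub> = \<one>\<^bsub>K\<^esub>"
  using counit_ring_hom by (auto simp: ring_hom_def)

lemma antipode_simps:
  "x \<in> carrier H \<Longrightarrow> S x \<in> carrier H"
  "x \<in> carrier H \<Longrightarrow> y \<in> carrier H \<Longrightarrow> S (x \<oplus>\<^bsub>H\<^esub> y) = S x \<oplus>\<^bsub>H\<^esub> S y"
  "c \<in> carrier K \<Longrightarrow> x \<in> carrier H \<Longrightarrow> S (c \<odot>\<^bsub>H\<^esub> x) = c \<odot>\<^bsub>H\<^esub> S x"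
  using module_homD[OF antipode_linear] by auto

lemma sw_counit_left:
  assumes U: "module K U" and f: "f \<in> module_hom K H U" and h: "h \<in> carrier H"
  shows "Sw U h (\<lambda>x y. \<epsilon> x \<odot>\<^bsub>U\<^esub> f y) = f h"
proof -
  have b: "bilinear K H H H (\<lambda>y z. \<epsilon> y \<odot>\<^bsub>H\<^esub> z)"
    by (intro bilinearI module_homI) (simp_all add: counit_simps counit_linear smult_l_distr smult_r_distr
      smult_assoc1[symmetric] R.m_comm)
  have "Sw H h (\<lambda>y z. \<epsilon> y \<odot>\<^bsub>H\<^esub> z) = h"
    using counit_left[OF h] sw_lift[OF module_axioms b h] by simp
  then have "f h = f (Sw H h (\<lambda>y z. \<epsilon> y \<odot>\<^bsub>H\<^esub> z))" by simp
  also have "\<dots> = Sw U h (\<lambda>x y. \<epsilon> x \<odot>\<^bsub>U\<^esub> f y)"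
    by (simp add: sw_hom[OF module_axioms U f] counit_simps module_homD[OF f])
  finally show ?thesis ..
qed

lemma sw_counit_right:
  assumes U: "module K U" and f: "f \<in> module_hom K H U" and h: "h \<in> carrier H"
  shows "Sw U h (\<lambda>x y. \<epsilon> y \<odot>\<^bsub>U\<^esub> f x) = f h"
proof -
  have b: "bilinear K H H H (\<lambda>y z. \<epsilon> z \<odot>\<^bsub>H\<^esub> y)"
    by (intro bilinearI module_homI) (simp_all add: counit_simps counit_linear smult_l_distr smult_r_distr
      smult_assoc1[symmetric] R.m_comm)
  have "Sw H h (\<lambda>y z. \<epsilon> z \<odot>\<^bsub>H\<^esub> y) = h"
    using counit_right[OF h] sw_lift[OF module_axioms b h] by simp
  then have "f h = f (Sw H h (\<lambda>y z. \<epsilon> z \<odot>\<^bsub>H\<^esub> y))" by simp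
  also have "\<dots> = Sw U h (\<lambda>x y. \<epsilon> y \<odot>\<^bsub>U\<^esub> f x)"
    by (simp add: sw_hom[OF module_axioms U f] counit_simps module_homD[OF f])
  finally show ?thesis ..
qed

lemma sw_antipode_left:
  assumes h: "h \<in> carrier H"
  shows "Sw H h (\<lambda>x y. S x \<otimes>\<^bsub>H\<^esub> y) = \<epsilon> h \<odot>\<^bsub>H\<^esub> \<one>\<^bsub>H\<^esub>"
proof -
  have "bilinear K H H H (\<lambda>x y. S x \<otimes>\<^bsub>H\<^esub> y)"
    by (intro bilinearI module_homI) (simp_all add: antipode_simps A.l_distr A.r_distr smult_mult_left smult_mult_right)
  from sw_lift[OF module_axioms this h] antipode_left[OF h] show ?thesis by simp
qed

lemma sw_antipode_right:
  assumes h: "h \<in> carrier H"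
  shows "Sw H h (\<lambda>x y. x \<otimes>\<^bsub>H\<^esub> S y) = \<epsilon> h \<odot>\<^bsub>H\<^esub> \<one>\<^bsub>H\<^esub>"
proof -
  have "bilinear K H H H (\<lambda>x y. x \<otimes>\<^bsub>H\<^esub> S y)"
    by (intro bilinearI module_homI) (simp_all add: antipode_simps A.l_distr A.r_distr smult_mult_left smult_mult_right)
  from sw_lift[OF module_axioms this h] antipode_right[OF h] show ?thesis by simp
qed

lemma sw_one:
  assumes U: "module K U" and b: "bilinear K H H U \<beta>"
  shows "Sw U \<one>\<^bsub>H\<^esub> \<beta> = \<beta> \<one>\<^bsub>H\<^esub> \<one>\<^bsub>H\<^esub>"
proof -
  have "\<Delta> \<one>\<^bsub>H\<^esub> = HH.pure \<one>\<^bsub>H\<^esub> \<one>\<^bsub>H\<^esub>"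
    using comult_ring_hom by (auto simp: ring_hom_def)
  then show ?thesis
    using sw_lift[OF U b A.one_closed] HH.tensor_lift_pure[OF U b] by simp
qed

text \<open>Multiplicativity of \<open>\<Delta>\<close>, in the form
  \<open>(hl)_1 \<otimes> (hl)_2 = h_1 l_1 \<otimes> h_2 l_2\<close>.\<close>

lemma sw_mult:
  assumes U: "module K U" and b: "bilinear K H H U \<beta>" and h: "h \<in> carrier H" and l: "l \<in> carrier H"
  shows "Sw U (h \<otimes>\<^bsub>H\<^esub> l) \<beta> =
    Sw U h (\<lambda>h1 h2. Sw U l (\<lambda>l1 l2. \<beta> (h1 \<otimes>\<^bsub>H\<^esub> l1) (h2 \<otimes>\<^bsub>H\<^esub> l2)))"
proof -
  note L = HH.tensor_lift_hom[OF U b] and TM = HH.T.module_axioms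
  have "Sw U (h \<otimes>\<^bsub>H\<^esub> l) \<beta> = tensor_lift K H H U \<beta> (\<Delta> h \<otimes>\<^bsub>HH.TA\<^esub> \<Delta> l)"
    using sw_lift[OF U b, of "h \<otimes>\<^bsub>H\<^esub> l"] comult_ring_hom h l by (simp add: ring_hom_def)
  also have "\<Delta> h \<otimes>\<^bsub>HH.TA\<^esub> \<Delta> l = Sw HH.T h HH.pure \<otimes>\<^bsub>HH.TA\<^esub> \<Delta> l"
    using h by (simp only: sw_comult)
  also have "\<dots> = Sw HH.T h (\<lambda>h1 h2. HH.pure h1 h2 \<otimes>\<^bsub>HH.TA\<^esub> \<Delta> l)"
    by (rule sw_hom[OF TM TM HH.mult_right_hom]) (use l in auto)
  also have "\<dots> = Sw HH.T h (\<lambda>h1 h2. HH.pure h1 h2 \<otimes>\<^bsub>HH.TA\<^esub> Sw HH.T l HH.pure)"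
    using l by (simp only: sw_comult)
  also have "\<dots> = Sw HH.T h (\<lambda>h1 h2. Sw HH.T l (\<lambda>l1 l2. HH.pure h1 h2 \<otimes>\<^bsub>HH.TA\<^esub> HH.pure l1 l2))"
    by (intro sw_cong refl sw_hom[OF TM TM HH.mult_left_hom]) auto
  also have "tensor_lift K H H U \<beta> \<dots> =
      Sw U h (\<lambda>h1 h2. Sw U l (\<lambda>l1 l2. \<beta> (h1 \<otimes>\<^bsub>H\<^esub> l1) (h2 \<otimes>\<^bsub>H\<^esub> l2)))"
    by (simp add: sw_hom[OF TM U L] TM HH.mult_pure HH.tensor_lift_pure[OF U b])
  finally show ?thesis .
qed

end

section \<open>The antipode reverses products\<close>

context hopf_algebra
begin

lemma antipode_one: "S \<one>\<^bsub>H\<^esub> = \<one>\<^bsub>H\<^esub>"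
proof -
  have b: "bilinear K H H H (\<lambda>x y. S x \<otimes>\<^bsub>H\<^esub> y)"
    by (intro bilinearI module_homI) (simp_all add: antipode_simps A.l_distr A.r_distr smult_mult_left smult_mult_right)
  show ?thesis
    using sw_antipode_left[OF A.one_closed] sw_one[OF module_axioms b] by (simp add: antipode_simps counit_simps)
qed

lemmas H_linear = A.l_distr A.r_distr smult_mult_left smult_mult_right antipode_simps
  sw_add[OF module_axioms] sw_smult[OF module_axioms] smult_l_distr smult_r_distr
  counit_simps counit_linear

text \<open>
  Both sides equal \<open>\<Sum> S(h\<^sub>1 l\<^sub>1) h\<^sub>2 l\<^sub>2 S(l\<^sub>3) S(h\<^sub>3)\<close>.
\<close>

lemma antipode_mult:
  assumes h: "h \<in> carrier H" and l: "l \<in> carrier H"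
  shows "S (h \<otimes>\<^bsub>H\<^esub> l) = S l \<otimes>\<^bsub>H\<^esub> S h"
proof -
  note M = module_axioms
  \<comment> \<open>The legs of \<open>h\<close> are \<open>a\<close>, \<open>c\<close>,
    \<open>d\<close> and those of \<open>l\<close> are \<open>p\<close>, \<open>r\<close>,
    \<open>s\<close>. The sum is evaluated twice, according to which legs are contracted
    first.\<close>
  define t where "t a c d p r s = S (a \<otimes>\<^bsub>H\<^esub> p) \<otimes>\<^bsub>H\<^esub> (c \<otimes>\<^bsub>H\<^esub> r) \<otimes>\<^bsub>H\<^esub> (S s \<otimes>\<^bsub>H\<^esub> S d)" for a c d p r s
  have tc: "t a c d p r s \<in> carrier H" if "a \<in> carrier H" "c \<in> carrier H" "d \<in> carrier H"
      "p \<in> carrier H" "r \<in> carrier H" "s \<in> carrier H" for a c d p r s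
    using that by (simp add: t_def antipode_simps)
  have tl: "trilinear K H H H H (\<lambda>p r s. t a c d p r s)"
    if "a \<in> carrier H" "c \<in> carrier H" "d \<in> carrier H" for a c d
    using that by (intro trilinearI module_homI) (simp_all add: t_def H_linear)
  have th: "trilinear K H H H H (\<lambda>a c d. Sw H l (\<lambda>q s. Sw H q (\<lambda>p r. t a c d p r s)))"
    by (intro trilinearI module_homI) (simp_all add: t_def H_linear M)
  \<comment> \<open>Contraction of the last two legs of \<open>l\<close>: the product
    \<open>r S(s)\<close> sums to the counit.\<close>
  have inner1: "Sw H l (\<lambda>q s. Sw H q (\<lambda>p r. t a c d p r s)) = S (a \<otimes>\<^bsub>H\<^esub> l) \<otimes>\<^bsub>H\<^esub> c \<otimes>\<^bsub>H\<^esub> S d"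
    if acd: "a \<in> carrier H" "c \<in> carrier H" "d \<in> carrier H" for a c d
  proof -
    have "Sw H l (\<lambda>q s. Sw H q (\<lambda>p r. t a c d p r s)) = Sw H l (\<lambda>p q. Sw H q (\<lambda>r s. t a c d p r s))"
      by (rule sw_coassoc[OF M tl[OF acd] l])
    also have "\<dots> = Sw H l (\<lambda>p q. \<epsilon> q \<odot>\<^bsub>H\<^esub> (S (a \<otimes>\<^bsub>H\<^esub> p) \<otimes>\<^bsub>H\<^esub> c \<otimes>\<^bsub>H\<^esub> S d))"
    proof (intro sw_cong refl)
      fix p q assume pq: "p \<in> carrier H" "q \<in> carrier H"
      have f: "(\<lambda>x. S (a \<otimes>\<^bsub>H\<^esub> p) \<otimes>\<^bsub>H\<^esub> c \<otimes>\<^bsub>H\<^esub> x \<otimes>\<^bsub>H\<^esub> S d) \<in> module_hom K H H"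
        using pq acd by (intro module_homI) (simp_all add: H_linear)
      have "Sw H q (\<lambda>r s. t a c d p r s) =
          Sw H q (\<lambda>r s. S (a \<otimes>\<^bsub>H\<^esub> p) \<otimes>\<^bsub>H\<^esub> c \<otimes>\<^bsub>H\<^esub> (r \<otimes>\<^bsub>H\<^esub> S s) \<otimes>\<^bsub>H\<^esub> S d)"
        using pq acd by (simp add: t_def A.m_assoc antipode_simps)
      also have "\<dots> = S (a \<otimes>\<^bsub>H\<^esub> p) \<otimes>\<^bsub>H\<^esub> c \<otimes>\<^bsub>H\<^esub> (\<epsilon> q \<odot>\<^bsub>H\<^esub> \<one>\<^bsub>H\<^esub>) \<otimes>\<^bsub>H\<^esub> S d"
        using pq by (subst sw_hom[OF M M f, symmetric]) (simp_all add: sw_antipode_right antipode_simps)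
      also have "\<dots> = \<epsilon> q \<odot>\<^bsub>H\<^esub> (S (a \<otimes>\<^bsub>H\<^esub> p) \<otimes>\<^bsub>H\<^esub> c \<otimes>\<^bsub>H\<^esub> S d)"
        using pq acd by (simp add: H_linear)
      finally show "Sw H q (\<lambda>r s. t a c d p r s) = \<epsilon> q \<odot>\<^bsub>H\<^esub> (S (a \<otimes>\<^bsub>H\<^esub> p) \<otimes>\<^bsub>H\<^esub> c \<otimes>\<^bsub>H\<^esub> S d)" .
    qed
    also have "\<dots> = S (a \<otimes>\<^bsub>H\<^esub> l) \<otimes>\<^bsub>H\<^esub> c \<otimes>\<^bsub>H\<^esub> S d"
      by (rule sw_counit_right[OF M _ l, of "\<lambda>p. S (a \<otimes>\<^bsub>H\<^esub> p) \<otimes>\<^bsub>H\<^esub> c \<otimes>\<^bsub>H\<^esub> S d"])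
        (use acd in \<open>intro module_homI; simp add: H_linear\<close>)
    finally show ?thesis .
  qed
  \<comment> \<open>With \<open>l\<close> contracted, \<open>c S(d)\<close> does the same for
    \<open>h\<close>, leaving \<open>S(hl)\<close>.\<close>
  have 1: "Sw H h (\<lambda>a b. Sw H b (\<lambda>c d. Sw H l (\<lambda>q s. Sw H q (\<lambda>p r. t a c d p r s)))) = S (h \<otimes>\<^bsub>H\<^esub> l)"
  proof -
    have "Sw H h (\<lambda>a b. Sw H b (\<lambda>c d. Sw H l (\<lambda>q s. Sw H q (\<lambda>p r. t a c d p r s)))) =
        Sw H h (\<lambda>a b. \<epsilon> b \<odot>\<^bsub>H\<^esub> S (a \<otimes>\<^bsub>H\<^esub> l))"
    proof (intro sw_cong refl)
      fix a b assume ab: "a \<in> carrier H" "b \<in> carrier H"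
      have f: "(\<lambda>x. S (a \<otimes>\<^bsub>H\<^esub> l) \<otimes>\<^bsub>H\<^esub> x) \<in> module_hom K H H"
        by (rule mult_left_hom) (use ab l in \<open>simp add: antipode_simps\<close>)
      have "Sw H b (\<lambda>c d. Sw H l (\<lambda>q s. Sw H q (\<lambda>p r. t a c d p r s))) =
          Sw H b (\<lambda>c d. S (a \<otimes>\<^bsub>H\<^esub> l) \<otimes>\<^bsub>H\<^esub> (c \<otimes>\<^bsub>H\<^esub> S d))"
        using ab l by (simp add: inner1 A.m_assoc antipode_simps)
      also have "\<dots> = S (a \<otimes>\<^bsub>H\<^esub> l) \<otimes>\<^bsub>H\<^esub> (\<epsilon> b \<odot>\<^bsub>H\<^esub> \<one>\<^bsub>H\<^esub>)"
        using ab by (subst sw_hom[OF M M f, symmetric]) (simp_all add: sw_antipode_right antipode_simps)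
      also have "\<dots> = \<epsilon> b \<odot>\<^bsub>H\<^esub> S (a \<otimes>\<^bsub>H\<^esub> l)"
        using ab l by (simp add: H_linear)
      finally show "Sw H b (\<lambda>c d. Sw H l (\<lambda>q s. Sw H q (\<lambda>p r. t a c d p r s))) = \<epsilon> b \<odot>\<^bsub>H\<^esub> S (a \<otimes>\<^bsub>H\<^esub> l)" .
    qed
    also have "\<dots> = S (h \<otimes>\<^bsub>H\<^esub> l)"
      by (rule sw_counit_right[OF M _ h, of "\<lambda>a. S (a \<otimes>\<^bsub>H\<^esub> l)"])
        (use l in \<open>intro module_homI; simp add: H_linear\<close>)
    finally show ?thesis .
  qed
  have sub: "bilinear K H H H (\<lambda>x y. S x \<otimes>\<^bsub>H\<^esub> y)"
    by (intro bilinearI module_homI) (simp_all add: H_linear)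
  \<comment> \<open>In the other evaluation \<open>a\<close> and \<open>c\<close> are split off a
    common leg \<open>b\<close>, and \<open>p\<close> and \<open>r\<close> off \<open>q\<close>; the
    part \<open>S(ap) cr\<close> is then contracted by the antipode axiom for the product
    \<open>bq\<close>.\<close>
  have "Sw H h (\<lambda>b d. Sw H b (\<lambda>a c. Sw H l (\<lambda>q s. Sw H q (\<lambda>p r. t a c d p r s)))) =
      Sw H h (\<lambda>b d. Sw H l (\<lambda>q s. Sw H b (\<lambda>a c. Sw H q (\<lambda>p r. t a c d p r s))))"
    by (intro sw_cong refl sw_swap[OF M]) (simp add: tc M)
  also have "\<dots> = Sw H h (\<lambda>b d. Sw H l (\<lambda>q s. (\<epsilon> b \<otimes>\<^bsub>K\<^esub> \<epsilon> q) \<odot>\<^bsub>H\<^esub> (S s \<otimes>\<^bsub>H\<^esub> S d)))"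
  proof (intro sw_cong refl)
    fix b d q s assume c: "b \<in> carrier H" "d \<in> carrier H" "q \<in> carrier H" "s \<in> carrier H"
    have f: "(\<lambda>x. x \<otimes>\<^bsub>H\<^esub> (S s \<otimes>\<^bsub>H\<^esub> S d)) \<in> module_hom K H H"
      by (rule mult_right_hom) (use c in \<open>simp add: antipode_simps\<close>)
    have "Sw H b (\<lambda>a c. Sw H q (\<lambda>p r. t a c d p r s)) =
        Sw H b (\<lambda>a c. Sw H q (\<lambda>p r. S (a \<otimes>\<^bsub>H\<^esub> p) \<otimes>\<^bsub>H\<^esub> (c \<otimes>\<^bsub>H\<^esub> r))) \<otimes>\<^bsub>H\<^esub> (S s \<otimes>\<^bsub>H\<^esub> S d)"
      unfolding t_def by (simp add: sw_hom[OF M M f] antipode_simps M)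
    also have "\<dots> = (\<epsilon> (b \<otimes>\<^bsub>H\<^esub> q) \<odot>\<^bsub>H\<^esub> \<one>\<^bsub>H\<^esub>) \<otimes>\<^bsub>H\<^esub> (S s \<otimes>\<^bsub>H\<^esub> S d)"
      using sw_mult[OF M sub c(1,3)] sw_antipode_left[of "b \<otimes>\<^bsub>H\<^esub> q"] c by simp
    also have "\<dots> = (\<epsilon> b \<otimes>\<^bsub>K\<^esub> \<epsilon> q) \<odot>\<^bsub>H\<^esub> (S s \<otimes>\<^bsub>H\<^esub> S d)"
      using c by (simp add: H_linear)
    finally show "Sw H b (\<lambda>a c. Sw H q (\<lambda>p r. t a c d p r s)) = (\<epsilon> b \<otimes>\<^bsub>K\<^esub> \<epsilon> q) \<odot>\<^bsub>H\<^esub> (S s \<otimes>\<^bsub>H\<^esub> S d)" .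
  qed
  also have "\<dots> = Sw H h (\<lambda>b d. \<epsilon> b \<odot>\<^bsub>H\<^esub> (S l \<otimes>\<^bsub>H\<^esub> S d))"
  proof (intro sw_cong refl)
    fix b d assume c: "b \<in> carrier H" "d \<in> carrier H"
    have f: "(\<lambda>s. \<epsilon> b \<odot>\<^bsub>H\<^esub> (S s \<otimes>\<^bsub>H\<^esub> S d)) \<in> module_hom K H H"
      using c by (intro module_homI) (simp_all add: H_linear smult_assoc1[symmetric] R.m_comm)
    have "Sw H l (\<lambda>q s. (\<epsilon> b \<otimes>\<^bsub>K\<^esub> \<epsilon> q) \<odot>\<^bsub>H\<^esub> (S s \<otimes>\<^bsub>H\<^esub> S d)) =
        Sw H l (\<lambda>q s. \<epsilon> q \<odot>\<^bsub>H\<^esub> (\<epsilon> b \<odot>\<^bsub>H\<^esub> (S s \<otimes>\<^bsub>H\<^esub> S d)))"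
      using c by (simp add: counit_simps antipode_simps smult_assoc1[symmetric] R.m_comm)
    with sw_counit_left[OF M f l]
    show "Sw H l (\<lambda>q s. (\<epsilon> b \<otimes>\<^bsub>K\<^esub> \<epsilon> q) \<odot>\<^bsub>H\<^esub> (S s \<otimes>\<^bsub>H\<^esub> S d)) = \<epsilon> b \<odot>\<^bsub>H\<^esub> (S l \<otimes>\<^bsub>H\<^esub> S d)"
      by simp
  qed
  also have "\<dots> = S l \<otimes>\<^bsub>H\<^esub> S h"
    by (rule sw_counit_left[OF M _ h, of "\<lambda>d. S l \<otimes>\<^bsub>H\<^esub> S d"])
      (use l in \<open>intro module_homI; simp add: H_linear\<close>)
  finally show ?thesis
    using sw_coassoc[OF M th h] 1 by simp
qed

end

section \<open>The smash product\<close>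

context module_algebra
begin

sublocale AH: tensor K A H
  by (intro tensor.intro A.module_axioms H.module_axioms)

definition smash_pure :: "'a \<Rightarrow> 'h \<Rightarrow> 'a \<Rightarrow> 'h \<Rightarrow> ('k, 'a, 'h) tensor"
  where "smash_pure a h b l =
    tensor_lift K H H AH.T (\<lambda>h1 h2. AH.pure (a \<otimes>\<^bsub>A\<^esub> act h1 b) (h2 \<otimes>\<^bsub>H\<^esub> l)) (\<Delta> h)"

lemmas act_simps = module_homD[OF act_linear] act_add act_smult

lemmas AH_linear = act_simps A.A.l_distr A.A.r_distr A.smult_mult_left A.smult_mult_right
  H.A.l_distr H.A.r_distr H.smult_mult_left H.smult_mult_right H.antipode_simps
  AH.pure_add_left AH.pure_add_right AH.pure_smult_left AH.pure_smult_right
  H.sw_add[OF AH.T.module_axioms] H.sw_smult[OF AH.T.module_axioms] AH.T.module_axioms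

lemma smash_pure_sw:
  assumes "a \<in> carrier A" "h \<in> carrier H" "b \<in> carrier A" "l \<in> carrier H"
  shows "smash_pure a h b l = H.Sw AH.T h (\<lambda>h1 h2. AH.pure (a \<otimes>\<^bsub>A\<^esub> act h1 b) (h2 \<otimes>\<^bsub>H\<^esub> l))"
proof -
  have "bilinear K H H AH.T (\<lambda>h1 h2. AH.pure (a \<otimes>\<^bsub>A\<^esub> act h1 b) (h2 \<otimes>\<^bsub>H\<^esub> l))"
    using assms by (intro bilinearI module_homI) (simp_all add: AH_linear)
  from H.sw_lift[OF AH.T.module_axioms this assms(2)] show ?thesis
    by (simp add: smash_pure_def)
qed

lemma smash_pure_hopf_linear:
  assumes "a \<in> carrier A" "b \<in> carrier A" "l \<in> carrier H"
  shows "(\<lambda>h. smash_pure a h b l) \<in> module_hom K H AH.T"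
proof -
  have "bilinear K H H AH.T (\<lambda>h1 h2. AH.pure (a \<otimes>\<^bsub>A\<^esub> act h1 b) (h2 \<otimes>\<^bsub>H\<^esub> l))"
    using assms by (intro bilinearI module_homI) (simp_all add: AH_linear)
  from H.sw_linear[OF AH.T.module_axioms this] show ?thesis
    using assms by (auto simp: module_hom_def smash_pure_sw Pi_iff)
qed

lemma smash_pure_bilinear:
  "a \<in> carrier A \<Longrightarrow> h \<in> carrier H \<Longrightarrow> bilinear K A H AH.T (smash_pure a h)"
  "b \<in> carrier A \<Longrightarrow> l \<in> carrier H \<Longrightarrow> bilinear K A H AH.T (\<lambda>a h. smash_pure a h b l)"
  by (intro bilinearI module_homI; simp add: smash_pure_sw AH_linear)
    (intro bilinearI smash_pure_hopf_linear; (intro module_homI)?; simp add: smash_pure_sw AH_linear)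

sublocale SM: tensor_mult K A H smash_pure
  by unfold_locales (fact smash_pure_bilinear)+

abbreviation "B \<equiv> smash K H \<Delta> A act"

lemma B_simps:
  "carrier B = carrier AH.T" "add B = add AH.T" "\<zero>\<^bsub>B\<^esub> = \<zero>\<^bsub>AH.T\<^esub>" "smult B = smult AH.T"
  "\<one>\<^bsub>B\<^esub> = AH.pure \<one>\<^bsub>A\<^esub> \<one>\<^bsub>H\<^esub>"
  by (simp_all add: smash_def Let_def)

lemma B_mult: "mult B = SM.tmult"
proof -
  have eq: "smash_pure a h = (\<lambda>b l. tensor_lift K H H AH.T
      (\<lambda>h1 h2. AH.pure (a \<otimes>\<^bsub>A\<^esub> act h1 b) (h2 \<otimes>\<^bsub>H\<^esub> l)) (\<Delta> h))" for a h
    by (intro ext) (simp add: smash_pure_def)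
  show ?thesis
    by (intro ext) (simp add: smash_def Let_def SM.tmult_def eq)
qed

text \<open>Both sides are the sum of \<open>a (h_1 b)(h_2 l_1 x) \<otimes> h_3 l_2 n\<close>. On
  the left this comes from multiplicativity of \<open>\<Delta>\<close>, on the right from the action
  on products; coassociativity identifies the legs of \<open>h\<close>.\<close>

lemma smash_pure_assoc:
  assumes c: "a \<in> carrier A" "h \<in> carrier H" "b \<in> carrier A" "l \<in> carrier H" "x \<in> carrier A" "n \<in> carrier H"
  shows "SM.tmult (smash_pure a h b l) (AH.pure x n) = SM.tmult (AH.pure a h) (smash_pure b l x n)"
proof -
  note TM = AH.T.module_axioms
  let ?\<tau> = "\<lambda>u v w. H.Sw AH.T l (\<lambda>p q. AH.pure (a \<otimes>\<^bsub>A\<^esub> (act u b \<otimes>\<^bsub>A\<^esub> act v (act p x))) (w \<otimes>\<^bsub>H\<^esub> (q \<otimes>\<^bsub>H\<^esub> n)))"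
  have tri: "trilinear K H H H AH.T ?\<tau>"
    using c by (intro trilinearI module_homI) (simp_all add: AH_linear)
  have "SM.tmult (smash_pure a h b l) (AH.pure x n) =
      H.Sw AH.T h (\<lambda>h1 h2. smash_pure (a \<otimes>\<^bsub>A\<^esub> act h1 b) (h2 \<otimes>\<^bsub>H\<^esub> l) x n)"
    using c by (simp add: smash_pure_sw[OF c(1-4)] H.sw_hom[OF TM TM SM.tmult_right_hom] SM.tmult_pure act_simps)
  also have "\<dots> = H.Sw AH.T h (\<lambda>u h2. H.Sw AH.T h2 (\<lambda>v w. ?\<tau> u v w))"
  proof (intro H.sw_cong refl)
    fix u h2 assume uh: "u \<in> carrier H" "h2 \<in> carrier H"
    have "bilinear K H H AH.T (\<lambda>p q. AH.pure (a \<otimes>\<^bsub>A\<^esub> act u b \<otimes>\<^bsub>A\<^esub> act p x) (q \<otimes>\<^bsub>H\<^esub> n))"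
      using c uh by (intro bilinearI module_homI) (simp_all add: AH_linear)
    from H.sw_mult[OF TM this uh(2) c(4)]
    show "smash_pure (a \<otimes>\<^bsub>A\<^esub> act u b) (h2 \<otimes>\<^bsub>H\<^esub> l) x n = H.Sw AH.T h2 (\<lambda>v w. ?\<tau> u v w)"
      using c uh by (simp add: smash_pure_sw act_simps A.A.m_assoc H.A.m_assoc act_mult)
  qed
  also have "\<dots> = H.Sw AH.T h (\<lambda>h1 w. H.Sw AH.T h1 (\<lambda>u v. ?\<tau> u v w))"
    by (rule H.sw_coassoc[OF TM tri c(2), symmetric])
  also have "\<dots> = H.Sw AH.T h (\<lambda>h1 w. H.Sw AH.T l (\<lambda>p q.
      AH.pure (a \<otimes>\<^bsub>A\<^esub> act h1 (b \<otimes>\<^bsub>A\<^esub> act p x)) (w \<otimes>\<^bsub>H\<^esub> (q \<otimes>\<^bsub>H\<^esub> n))))"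
  proof (rule H.sw_cong[OF refl])
    fix h1 w assume hw: "h1 \<in> carrier H" "w \<in> carrier H"
    have "H.Sw AH.T h1 (\<lambda>u v. ?\<tau> u v w) = H.Sw AH.T l (\<lambda>p q. H.Sw AH.T h1 (\<lambda>u v.
        AH.pure (a \<otimes>\<^bsub>A\<^esub> (act u b \<otimes>\<^bsub>A\<^esub> act v (act p x))) (w \<otimes>\<^bsub>H\<^esub> (q \<otimes>\<^bsub>H\<^esub> n))))"
      by (rule H.sw_swap[OF TM]) (use c hw in \<open>simp add: act_simps\<close>)
    also have "\<dots> = H.Sw AH.T l (\<lambda>p q. AH.pure (a \<otimes>\<^bsub>A\<^esub> act h1 (b \<otimes>\<^bsub>A\<^esub> act p x)) (w \<otimes>\<^bsub>H\<^esub> (q \<otimes>\<^bsub>H\<^esub> n)))"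
    proof (intro H.sw_cong refl)
      fix p q assume pq: "p \<in> carrier H" "q \<in> carrier H"
      have f: "(\<lambda>z. AH.pure (a \<otimes>\<^bsub>A\<^esub> z) (w \<otimes>\<^bsub>H\<^esub> (q \<otimes>\<^bsub>H\<^esub> n))) \<in> module_hom K A AH.T"
        using c hw pq by (intro module_homI) (simp_all add: AH_linear)
      have b': "bilinear K H H A (\<lambda>u v. act u b \<otimes>\<^bsub>A\<^esub> act v (act p x))"
        using c pq by (intro bilinearI module_homI) (simp_all add: AH_linear)
      have "act h1 (b \<otimes>\<^bsub>A\<^esub> act p x) = H.Sw A h1 (\<lambda>u v. act u b \<otimes>\<^bsub>A\<^esub> act v (act p x))"
        using act_on_mult[of h1 b "act p x"] c hw pq
        by (simp add: act_simps H.sw_lift[OF A.module_axioms b'])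
      then show "H.Sw AH.T h1 (\<lambda>u v. AH.pure (a \<otimes>\<^bsub>A\<^esub> (act u b \<otimes>\<^bsub>A\<^esub> act v (act p x))) (w \<otimes>\<^bsub>H\<^esub> (q \<otimes>\<^bsub>H\<^esub> n))) =
          AH.pure (a \<otimes>\<^bsub>A\<^esub> act h1 (b \<otimes>\<^bsub>A\<^esub> act p x)) (w \<otimes>\<^bsub>H\<^esub> (q \<otimes>\<^bsub>H\<^esub> n))"
        using c pq by (simp add: H.sw_hom[OF A.module_axioms TM f] act_simps)
    qed
    finally show "H.Sw AH.T h1 (\<lambda>u v. ?\<tau> u v w) = H.Sw AH.T l (\<lambda>p q.
      AH.pure (a \<otimes>\<^bsub>A\<^esub> act h1 (b \<otimes>\<^bsub>A\<^esub> act p x)) (w \<otimes>\<^bsub>H\<^esub> (q \<otimes>\<^bsub>H\<^esub> n)))" .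
  qed
  also have "\<dots> = H.Sw AH.T l (\<lambda>p q. H.Sw AH.T h (\<lambda>h1 w.
      AH.pure (a \<otimes>\<^bsub>A\<^esub> act h1 (b \<otimes>\<^bsub>A\<^esub> act p x)) (w \<otimes>\<^bsub>H\<^esub> (q \<otimes>\<^bsub>H\<^esub> n))))"
    by (rule H.sw_swap[OF TM]) (use c in \<open>simp add: act_simps\<close>)
  also have "\<dots> = SM.tmult (AH.pure a h) (smash_pure b l x n)"
  proof -
    have "SM.tmult (AH.pure a h) (smash_pure b l x n) =
        H.Sw AH.T l (\<lambda>p q. smash_pure a h (b \<otimes>\<^bsub>A\<^esub> act p x) (q \<otimes>\<^bsub>H\<^esub> n))"
      using c by (simp add: smash_pure_sw[OF c(3-6)] H.sw_hom[OF TM TM SM.tmult_left_hom] SM.tmult_pure act_simps)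
    also have "\<dots> = H.Sw AH.T l (\<lambda>p q. H.Sw AH.T h (\<lambda>h1 w.
        AH.pure (a \<otimes>\<^bsub>A\<^esub> act h1 (b \<otimes>\<^bsub>A\<^esub> act p x)) (w \<otimes>\<^bsub>H\<^esub> (q \<otimes>\<^bsub>H\<^esub> n))))"
      by (intro H.sw_cong refl smash_pure_sw) (use c in \<open>simp_all add: act_simps\<close>)
    finally show ?thesis ..
  qed
  finally show ?thesis .
qed

lemma smash_pure_one_left:
  assumes "a \<in> carrier A" "b \<in> carrier A" "l \<in> carrier H"
  shows "smash_pure a \<one>\<^bsub>H\<^esub> b l = AH.pure (a \<otimes>\<^bsub>A\<^esub> b) l"
proof -
  have "bilinear K H H AH.T (\<lambda>h1 h2. AH.pure (a \<otimes>\<^bsub>A\<^esub> act h1 b) (h2 \<otimes>\<^bsub>H\<^esub> l))"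
    using assms by (intro bilinearI module_homI) (simp_all add: AH_linear)
  from H.sw_one[OF AH.T.module_axioms this] show ?thesis
    using assms by (simp add: smash_pure_sw act_one)
qed

lemma smash_pure_one_right:
  assumes "a \<in> carrier A" "h \<in> carrier H" "l \<in> carrier H"
  shows "smash_pure a h \<one>\<^bsub>A\<^esub> l = AH.pure a (h \<otimes>\<^bsub>H\<^esub> l)"
proof -
  have f: "(\<lambda>y. AH.pure a (y \<otimes>\<^bsub>H\<^esub> l)) \<in> module_hom K H AH.T"
    using assms by (intro module_homI) (simp_all add: AH_linear)
  have "smash_pure a h \<one>\<^bsub>A\<^esub> l = H.Sw AH.T h (\<lambda>h1 h2. \<epsilon> h1 \<odot>\<^bsub>AH.T\<^esub> AH.pure a (h2 \<otimes>\<^bsub>H\<^esub> l))"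
    using assms by (simp add: smash_pure_sw act_on_one AH_linear H.counit_simps)
  then show ?thesis
    using H.sw_counit_left[OF AH.T.module_axioms f assms(2)] by simp
qed

lemma B_algebra: "assoc_algebra K B"
  by (rule SM.tmult_algebra[where e = "\<one>\<^bsub>A\<^esub>" and f = "\<one>\<^bsub>H\<^esub>"])
    (simp_all add: B_mult B_simps smash_pure_one_left smash_pure_one_right smash_pure_assoc)

sublocale B: assoc_algebra K B
  by (rule B_algebra)

text \<open>\<open>B\<close> and the tensor space are different records with the same linear
  structure; this carries the universal property over to \<open>B\<close>.\<close>

lemma B_hom_iff: "module_hom K B U = module_hom K AH.T U"
  by (simp add: module_hom_def B_simps)

lemma sw_B_iff: "H.Sw B = H.Sw AH.T"
  by (intro ext) (simp add: sweedler_def tsum_def B_simps)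

lemmas pure_closed_B [simp] = AH.pure_closed[folded B_simps]
lemmas pure_add_left = AH.pure_add_left[folded B_simps]
lemmas pure_add_right = AH.pure_add_right[folded B_simps]
lemmas pure_smult_left = AH.pure_smult_left[folded B_simps]
lemmas pure_smult_right = AH.pure_smult_right[folded B_simps]
lemmas B_hom_ext = AH.hom_ext[folded B_simps, folded B_hom_iff]
lemmas B_lift_hom = AH.tensor_lift_hom[folded B_hom_iff]
lemmas B_lift_param = AH.tensor_lift_param[folded B_simps]
lemmas B_one = B_simps(5)

section \<open>The copies of \<open>A\<close> and \<open>H\<close> inside the smash product\<close>

abbreviation "\<iota> \<equiv> smash_incl_alg K H A"
abbreviation "\<eta> \<equiv> smash_incl_hopf K H A"

lemma incl_closed [simp]:
  "a \<in> carrier A \<Longrightarrow> \<iota> a \<in> carrier B" "h \<in> carrier H \<Longrightarrow> \<eta> h \<in> carrier B"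
  by (simp_all add: smash_incl_alg_def smash_incl_hopf_def)

lemma iota_hom: "\<iota> \<in> module_hom K A B"
  by (rule module_homI) (simp_all add: smash_incl_alg_def pure_add_left pure_smult_left)

lemma eta_hom: "\<eta> \<in> module_hom K H B"
  by (rule module_homI) (simp_all add: smash_incl_hopf_def pure_add_right pure_smult_right)

lemmas incl_linear = module_homD(2,3)[OF iota_hom] module_homD(2,3)[OF eta_hom]

lemma mult_iota_pure:
  "a \<in> carrier A \<Longrightarrow> b \<in> carrier A \<Longrightarrow> l \<in> carrier H \<Longrightarrow> \<iota> a \<otimes>\<^bsub>B\<^esub> AH.pure b l = AH.pure (a \<otimes>\<^bsub>A\<^esub> b) l"
  by (simp add: smash_incl_alg_def B_mult SM.tmult_pure smash_pure_one_left)

lemma mult_pure_eta: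
  "a \<in> carrier A \<Longrightarrow> h \<in> carrier H \<Longrightarrow> l \<in> carrier H \<Longrightarrow> AH.pure a h \<otimes>\<^bsub>B\<^esub> \<eta> l = AH.pure a (h \<otimes>\<^bsub>H\<^esub> l)"
  by (simp add: smash_incl_hopf_def B_mult SM.tmult_pure smash_pure_one_right)

lemma mult_iota_eta: "a \<in> carrier A \<Longrightarrow> h \<in> carrier H \<Longrightarrow> \<iota> a \<otimes>\<^bsub>B\<^esub> \<eta> h = AH.pure a h"
  using mult_iota_pure[of a "\<one>\<^bsub>A\<^esub>" h] by (simp add: smash_incl_hopf_def)

lemma iota_mult: "a \<in> carrier A \<Longrightarrow> b \<in> carrier A \<Longrightarrow> \<iota> (a \<otimes>\<^bsub>A\<^esub> b) = \<iota> a \<otimes>\<^bsub>B\<^esub> \<iota> b"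
  using mult_iota_pure[of a b "\<one>\<^bsub>H\<^esub>"] by (simp add: smash_incl_alg_def)

lemma eta_mult: "h \<in> carrier H \<Longrightarrow> l \<in> carrier H \<Longrightarrow> \<eta> (h \<otimes>\<^bsub>H\<^esub> l) = \<eta> h \<otimes>\<^bsub>B\<^esub> \<eta> l"
  using mult_pure_eta[of "\<one>\<^bsub>A\<^esub>" h l] by (simp add: smash_incl_hopf_def)

lemma incl_one: "\<iota> \<one>\<^bsub>A\<^esub> = \<one>\<^bsub>B\<^esub>" "\<eta> \<one>\<^bsub>H\<^esub> = \<one>\<^bsub>B\<^esub>"
  by (simp_all add: smash_incl_alg_def smash_incl_hopf_def B_one)

lemma mult_eta_iota:
  assumes "h \<in> carrier H" "a \<in> carrier A"
  shows "\<eta> h \<otimes>\<^bsub>B\<^esub> \<iota> a = H.Sw B h (\<lambda>x y. \<iota> (act x a) \<otimes>\<^bsub>B\<^esub> \<eta> y)"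
  using assms
  by (simp add: smash_incl_hopf_def[of K H A h] smash_incl_alg_def[of K H A a] B_mult SM.tmult_pure
    smash_pure_sw sw_B_iff mult_iota_eta[unfolded B_mult] act_simps)

lemmas BM = B.module_axioms

lemmas B_linear = B.A.l_distr B.A.r_distr B.smult_mult_left B.smult_mult_right H.A.l_distr H.A.r_distr
  H.smult_mult_left H.smult_mult_right A.A.l_distr A.A.r_distr A.smult_mult_left A.smult_mult_right
  H.antipode_simps act_simps incl_linear H.sw_add[OF BM] H.sw_smult[OF BM]

text \<open>\<open>mult_eta_iota\<close> moves the first leg of \<open>g\<close> past
  \<open>b\<close>, and the remaining product \<open>g_2 S(g_3)\<close> contracts to the counit.
  Thus the action of \<open>H\<close> on \<open>A\<close> can be computed by multiplication inside
  \<open>B\<close>.\<close>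

lemma iota_act:
  assumes g: "g \<in> carrier H" and b: "b \<in> carrier A"
  shows "H.Sw B g (\<lambda>x y. \<eta> x \<otimes>\<^bsub>B\<^esub> \<iota> b \<otimes>\<^bsub>B\<^esub> \<eta> (S y)) = \<iota> (act g b)"
proof -
  let ?\<tau> = "\<lambda>x y z. \<iota> (act x b) \<otimes>\<^bsub>B\<^esub> \<eta> (y \<otimes>\<^bsub>H\<^esub> S z)"
  have tri: "trilinear K H H H B ?\<tau>"
    using b by (intro trilinearI module_homI) (simp_all add: B_linear)
  have "H.Sw B g (\<lambda>x y. \<eta> x \<otimes>\<^bsub>B\<^esub> \<iota> b \<otimes>\<^bsub>B\<^esub> \<eta> (S y)) = H.Sw B g (\<lambda>q z. H.Sw B q (\<lambda>x y. ?\<tau> x y z))"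
    using b by (simp add: mult_eta_iota H.sw_hom[OF BM BM B.mult_right_hom] B.A.m_assoc eta_mult act_simps
      H.antipode_simps)
  also have "\<dots> = H.Sw B g (\<lambda>x q. H.Sw B q (\<lambda>y z. ?\<tau> x y z))"
    by (rule H.sw_coassoc[OF BM tri g])
  also have "\<dots> = H.Sw B g (\<lambda>x q. \<epsilon> q \<odot>\<^bsub>B\<^esub> \<iota> (act x b))"
  proof (intro H.sw_cong refl)
    fix x q assume xq: "x \<in> carrier H" "q \<in> carrier H"
    have f: "(\<lambda>y. \<iota> (act x b) \<otimes>\<^bsub>B\<^esub> \<eta> y) \<in> module_hom K H B"
      using xq b by (intro module_homI) (simp_all add: B_linear)
    have "H.Sw B q (\<lambda>y z. ?\<tau> x y z) = \<iota> (act x b) \<otimes>\<^bsub>B\<^esub> \<eta> (\<epsilon> q \<odot>\<^bsub>H\<^esub> \<one>\<^bsub>H\<^esub>)"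
      using xq by (subst H.sw_hom[OF H.module_axioms BM f, symmetric])
        (simp_all add: H.sw_antipode_right H.antipode_simps)
    then show "H.Sw B q (\<lambda>y z. ?\<tau> x y z) = \<epsilon> q \<odot>\<^bsub>B\<^esub> \<iota> (act x b)"
      using xq b by (simp add: B_linear H.counit_simps incl_one)
  qed
  also have "\<dots> = \<iota> (act g b)"
    by (rule H.sw_counit_right[OF BM _ g, of "\<lambda>x. \<iota> (act x b)"])
      (use b in \<open>intro module_homI; simp add: B_linear\<close>)
  finally show ?thesis .
qed

text \<open>Writing the action by \<open>iota_act\<close> produces \<open>S(g_1) g_2\<close> in
  front, which contracts to the counit. The rule serves to bring an antipode to the left of an
  element of \<open>A\<close>.\<close>

lemma mult_iota_antipode:
  assumes g: "g \<in> carrier H" and b: "b \<in> carrier A"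
  shows "H.Sw B g (\<lambda>p q. \<eta> (S p) \<otimes>\<^bsub>B\<^esub> \<iota> (act q b)) = \<iota> b \<otimes>\<^bsub>B\<^esub> \<eta> (S g)"
proof -
  let ?\<tau> = "\<lambda>x y z. \<eta> (S x \<otimes>\<^bsub>H\<^esub> y) \<otimes>\<^bsub>B\<^esub> (\<iota> b \<otimes>\<^bsub>B\<^esub> \<eta> (S z))"
  have tri: "trilinear K H H H B ?\<tau>"
    using b by (intro trilinearI module_homI) (simp_all add: B_linear)
  have "H.Sw B g (\<lambda>p q. \<eta> (S p) \<otimes>\<^bsub>B\<^esub> \<iota> (act q b)) = H.Sw B g (\<lambda>x q. H.Sw B q (\<lambda>y z. ?\<tau> x y z))"
    using b by (simp add: iota_act[symmetric] H.sw_hom[OF BM BM B.mult_left_hom] B.A.m_assoc eta_mult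
      H.antipode_simps)
  also have "\<dots> = H.Sw B g (\<lambda>q z. H.Sw B q (\<lambda>x y. ?\<tau> x y z))"
    by (rule H.sw_coassoc[OF BM tri g, symmetric])
  also have "\<dots> = H.Sw B g (\<lambda>q z. \<epsilon> q \<odot>\<^bsub>B\<^esub> (\<iota> b \<otimes>\<^bsub>B\<^esub> \<eta> (S z)))"
  proof (intro H.sw_cong refl)
    fix q z assume qz: "q \<in> carrier H" "z \<in> carrier H"
    have f: "(\<lambda>y. \<eta> y \<otimes>\<^bsub>B\<^esub> (\<iota> b \<otimes>\<^bsub>B\<^esub> \<eta> (S z))) \<in> module_hom K H B"
      using qz b by (intro module_homI) (simp_all add: B_linear)
    have "H.Sw B q (\<lambda>x y. ?\<tau> x y z) = \<eta> (\<epsilon> q \<odot>\<^bsub>H\<^esub> \<one>\<^bsub>H\<^esub>) \<otimes>\<^bsub>B\<^esub> (\<iota> b \<otimes>\<^bsub>B\<^esub> \<eta> (S z))"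
      using qz by (subst H.sw_hom[OF H.module_axioms BM f, symmetric])
        (simp_all add: H.sw_antipode_left H.antipode_simps)
    then show "H.Sw B q (\<lambda>x y. ?\<tau> x y z) = \<epsilon> q \<odot>\<^bsub>B\<^esub> (\<iota> b \<otimes>\<^bsub>B\<^esub> \<eta> (S z))"
      using qz b by (simp add: B_linear H.counit_simps incl_one)
  qed
  also have "\<dots> = \<iota> b \<otimes>\<^bsub>B\<^esub> \<eta> (S g)"
    by (rule H.sw_counit_left[OF BM _ g, of "\<lambda>z. \<iota> b \<otimes>\<^bsub>B\<^esub> \<eta> (S z)"])
      (use b in \<open>intro module_homI; simp add: B_linear\<close>)
  finally show ?thesis .
qed

section \<open>The enveloping algebra of the smash product\<close>

sublocale E: tensor_algebra K B "op_alg B"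
  by (intro tensor_algebra.intro tensor.intro B_algebra B.op_algebra BM assoc_algebra.axioms(1)[OF B.op_algebra])

lemmas EM = E.T.module_axioms
lemmas Epure_closed [simp] = E.pure_closed[unfolded op_alg_simps]
lemmas Epure_linear = E.pure_add_left[unfolded op_alg_simps] E.pure_add_right[unfolded op_alg_simps]
  E.pure_smult_left[unfolded op_alg_simps] E.pure_smult_right[unfolded op_alg_simps]
lemmas Emult_pure = E.mult_pure[unfolded op_alg_simps]
lemmas E_linear = B_linear Epure_linear pure_add_left pure_add_right pure_smult_left pure_smult_right
  H.sw_add[OF EM] H.sw_smult[OF EM]

lemma Epure_hom_left: "y \<in> carrier B \<Longrightarrow> (\<lambda>u. E.pure u y) \<in> module_hom K B E.T"
  by (intro module_homI) (simp_all add: Epure_linear)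

lemma Epure_hom_right: "u \<in> carrier B \<Longrightarrow> (\<lambda>y. E.pure u y) \<in> module_hom K B E.T"
  by (intro module_homI) (simp_all add: Epure_linear)

lemma E_hom_ext:
  assumes "abelian_group U" "f \<in> module_hom K E.T U" "g \<in> module_hom K E.T U"
    and eq: "\<And>a h y. a \<in> carrier A \<Longrightarrow> h \<in> carrier H \<Longrightarrow> y \<in> carrier B \<Longrightarrow>
      f (E.pure (AH.pure a h) y) = g (E.pure (AH.pure a h) y)"
    and t: "t \<in> carrier E.T"
  shows "f t = g t"
proof (rule E.hom_ext[OF assms(1-3) _ t])
  fix u y assume u: "u \<in> carrier B" and "y \<in> carrier (op_alg B)"
  then have y: "y \<in> carrier B" by simp
  show "f (E.pure u y) = g (E.pure u y)"
    by (rule B_hom_ext[OF assms(1) module_hom_comp[OF Epure_hom_left[OF y] assms(2)]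
      module_hom_comp[OF Epure_hom_left[OF y] assms(3)] eq[OF _ _ y] u])
qed

text \<open>\<open>twist s\<close> is the map \<open>ah \<otimes> y \<mapsto> ah\<^sub>1 \<otimes> s(h\<^sub>2)y\<close>; composition corresponds to convolution of the
  maps \<open>s\<close>, so that \<open>twist S\<close> and \<open>twist id\<close> are inverse to each other.\<close>

definition twist1 :: "('h \<Rightarrow> 'h) \<Rightarrow> ('k, 'a, 'h) tensor \<Rightarrow> 'a \<Rightarrow> 'h \<Rightarrow>
    ('k, ('k, 'a, 'h) tensor, ('k, 'a, 'h) tensor) tensor"
  where "twist1 s y a h = H.Sw E.T h (\<lambda>h1 h2. E.pure (AH.pure a h1) (\<eta> (s h2) \<otimes>\<^bsub>B\<^esub> y))"

definition twist :: "('h \<Rightarrow> 'h) \<Rightarrow> ('k, ('k, 'a, 'h) tensor, ('k, 'a, 'h) tensor) tensor \<Rightarrow>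
    ('k, ('k, 'a, 'h) tensor, ('k, 'a, 'h) tensor) tensor"
  where "twist s = tensor_lift K B (op_alg B) E.T (\<lambda>u y. tensor_lift K A H E.T (twist1 s y) u)"

context
  fixes s assumes s: "s \<in> module_hom K H H"
begin

lemma twist1_hopf:
  assumes "a \<in> carrier A" "y \<in> carrier B"
  shows "twist1 s y a \<in> module_hom K H E.T"
proof -
  have "bilinear K H H E.T (\<lambda>h1 h2. E.pure (AH.pure a h1) (\<eta> (s h2) \<otimes>\<^bsub>B\<^esub> y))"
    using assms by (intro bilinearI module_homI) (simp_all add: E_linear module_homD[OF s])
  from H.sw_linear[OF EM this] show ?thesis by (simp add: twist1_def[abs_def])
qed

lemma twist1_bilinear: "y \<in> carrier B \<Longrightarrow> bilinear K A H E.T (twist1 s y)"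
  by (intro bilinearI twist1_hopf module_homI)
    (simp_all add: twist1_def E_linear module_homD[OF s] EM)

lemma twist2_bilinear: "bilinear K B (op_alg B) E.T (\<lambda>u y. tensor_lift K A H E.T (twist1 s y) u)"
proof (rule bilinearI)
  fix y assume "y \<in> carrier (op_alg B)"
  then show "(\<lambda>u. tensor_lift K A H E.T (twist1 s y) u) \<in> module_hom K B E.T"
    by (intro B_lift_hom[OF EM] twist1_bilinear) simp
next
  fix u assume u: "u \<in> carrier B"
  show "(\<lambda>y. tensor_lift K A H E.T (twist1 s y) u) \<in> module_hom K (op_alg B) E.T"
  proof (rule B_lift_param[OF EM _ _ _ u])
    show "module K (op_alg B)" by (rule assoc_algebra.axioms(1)[OF B.op_algebra])
    fix a h assume "a \<in> carrier A" "h \<in> carrier H"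
    then show "(\<lambda>y. twist1 s y a h) \<in> module_hom K (op_alg B) E.T"
      by (intro module_homI) (simp_all add: twist1_def E_linear module_homD[OF s] EM)
  qed (simp add: twist1_bilinear)
qed

lemma twist_hom: "twist s \<in> module_hom K E.T E.T"
  unfolding twist_def by (rule E.tensor_lift_hom[OF EM twist2_bilinear])

lemma twist_pure:
  assumes "a \<in> carrier A" "h \<in> carrier H" "y \<in> carrier B"
  shows "twist s (E.pure (AH.pure a h) y) = twist1 s y a h"
  using assms by (simp add: twist_def E.tensor_lift_pure[OF EM twist2_bilinear]
    AH.tensor_lift_pure[OF EM twist1_bilinear])

end

text \<open>The composite sends \<open>ah \<otimes> y\<close> to
  \<open>a h_1 \<otimes> s(h_2) r(h_3) y\<close>, so by coassociativity only the convolution product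
  of \<open>s\<close> and \<open>r\<close> matters, and this is the convolution unit by
  \<open>conv\<close>.\<close>

lemma twist_twist:
  assumes s: "s \<in> module_hom K H H" and r: "r \<in> module_hom K H H"
    and conv: "\<And>h. h \<in> carrier H \<Longrightarrow> H.Sw H h (\<lambda>x y. s x \<otimes>\<^bsub>H\<^esub> r y) = \<epsilon> h \<odot>\<^bsub>H\<^esub> \<one>\<^bsub>H\<^esub>"
    and t: "t \<in> carrier E.T"
  shows "twist s (twist r t) = t"
proof (rule E_hom_ext[OF E.T.M.abelian_group_axioms module_hom_comp[OF twist_hom[OF r] twist_hom[OF s]] _ _ t])
  show "(\<lambda>t. t) \<in> module_hom K E.T E.T" by (rule module_hom_id)
  fix a h y assume c: "a \<in> carrier A" "h \<in> carrier H" "y \<in> carrier B"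
  note sr = module_homD[OF s] module_homD[OF r]
  let ?\<tau> = "\<lambda>x y' z. E.pure (AH.pure a x) (\<eta> (s y' \<otimes>\<^bsub>H\<^esub> r z) \<otimes>\<^bsub>B\<^esub> y)"
  have tri: "trilinear K H H H E.T ?\<tau>"
    using c by (intro trilinearI module_homI) (simp_all add: E_linear sr)
  have "twist s (twist r (E.pure (AH.pure a h) y)) = H.Sw E.T h (\<lambda>x z. twist1 s (\<eta> (r z) \<otimes>\<^bsub>B\<^esub> y) a x)"
    using c by (simp add: twist_pure[OF r] twist1_def[of r] H.sw_hom[OF EM EM twist_hom[OF s]] twist_pure[OF s] sr)
  also have "\<dots> = H.Sw E.T h (\<lambda>q z. H.Sw E.T q (\<lambda>x y'. ?\<tau> x y' z))"
    using c by (simp add: twist1_def sr eta_mult B.A.m_assoc)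
  also have "\<dots> = H.Sw E.T h (\<lambda>x q. H.Sw E.T q (\<lambda>y' z. ?\<tau> x y' z))"
    by (rule H.sw_coassoc[OF EM tri c(2)])
  also have "\<dots> = H.Sw E.T h (\<lambda>x q. \<epsilon> q \<odot>\<^bsub>E.T\<^esub> E.pure (AH.pure a x) y)"
  proof (intro H.sw_cong refl)
    fix x q assume xq: "x \<in> carrier H" "q \<in> carrier H"
    have f: "(\<lambda>z. E.pure (AH.pure a x) (\<eta> z \<otimes>\<^bsub>B\<^esub> y)) \<in> module_hom K H E.T"
      using c xq by (intro module_homI) (simp_all add: E_linear)
    have "H.Sw E.T q (\<lambda>y' z. ?\<tau> x y' z) = E.pure (AH.pure a x) (\<eta> (\<epsilon> q \<odot>\<^bsub>H\<^esub> \<one>\<^bsub>H\<^esub>) \<otimes>\<^bsub>B\<^esub> y)"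
      using xq by (subst H.sw_hom[OF H.module_axioms EM f, symmetric]) (simp_all add: conv sr)
    then show "H.Sw E.T q (\<lambda>y' z. ?\<tau> x y' z) = \<epsilon> q \<odot>\<^bsub>E.T\<^esub> E.pure (AH.pure a x) y"
      using xq c by (simp add: E_linear H.counit_simps incl_one)
  qed
  also have "\<dots> = E.pure (AH.pure a h) y"
    by (rule H.sw_counit_right[OF EM _ c(2), of "\<lambda>x. E.pure (AH.pure a x) y"])
      (use c in \<open>intro module_homI; simp add: E_linear\<close>)
  finally show "twist s (twist r (E.pure (AH.pure a h) y)) = E.pure (AH.pure a h) y" .
qed

text \<open>The two antipode axioms say that \<open>S\<close> is a left and a right convolution
  inverse of the identity.\<close>

lemma twist_inverse: "t \<in> carrier E.T \<Longrightarrow> twist S (twist (\<lambda>x. x) t) = t"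
    "t \<in> carrier E.T \<Longrightarrow> twist (\<lambda>x. x) (twist S t) = t"
  using twist_twist[OF H.antipode_linear module_hom_id H.sw_antipode_left]
    twist_twist[OF module_hom_id H.antipode_linear H.sw_antipode_right] by auto

text \<open>The multiplication of the second tensor factor is that of the opposite algebra.\<close>

lemma mult_eta_twist:
  assumes s: "s \<in> module_hom K H H" and l: "l \<in> carrier H" and u: "u \<in> carrier B" and y: "y \<in> carrier B"
  shows "E.pure \<one>\<^bsub>B\<^esub> (\<eta> l) \<otimes>\<^bsub>E.TA\<^esub> twist s (E.pure u y) = twist s (E.pure u (y \<otimes>\<^bsub>B\<^esub> \<eta> l))"
proof (rule B_hom_ext[OF E.T.M.abelian_group_axioms _ _ _ u])
  have yl: "y \<otimes>\<^bsub>B\<^esub> \<eta> l \<in> carrier B" using y l by simp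
  have p: "E.pure \<one>\<^bsub>B\<^esub> (\<eta> l) \<in> carrier E.T" using l by simp
  show "(\<lambda>u. E.pure \<one>\<^bsub>B\<^esub> (\<eta> l) \<otimes>\<^bsub>E.TA\<^esub> twist s (E.pure u y)) \<in> module_hom K B E.T"
    by (intro module_hom_comp[OF _ E.mult_left_hom[OF p]] module_hom_comp[OF Epure_hom_left[OF y] twist_hom[OF s]])
  show "(\<lambda>u. twist s (E.pure u (y \<otimes>\<^bsub>B\<^esub> \<eta> l))) \<in> module_hom K B E.T"
    by (intro module_hom_comp[OF Epure_hom_left[OF yl] twist_hom[OF s]])
  fix a h assume ah: "a \<in> carrier A" "h \<in> carrier H"
  show "E.pure \<one>\<^bsub>B\<^esub> (\<eta> l) \<otimes>\<^bsub>E.TA\<^esub> twist s (E.pure (AH.pure a h) y) =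
      twist s (E.pure (AH.pure a h) (y \<otimes>\<^bsub>B\<^esub> \<eta> l))"
    using ah y l yl
    by (simp add: twist_pure[OF s] twist1_def H.sw_hom[OF EM EM E.mult_left_hom[OF p]] Emult_pure
      module_homD(1)[OF s] B.A.m_assoc)
qed

section \<open>The subalgebra of the enveloping algebra\<close>

sublocale AA: tensor_algebra K A "op_alg A"
  by (intro tensor_algebra.intro tensor.intro A.assoc_algebra_axioms A.op_algebra A.module_axioms
    assoc_algebra.axioms(1)[OF A.op_algebra])

sublocale HO: tensor_algebra K H "op_alg H"
  by (intro tensor_algebra.intro tensor.intro H.assoc_algebra_axioms H.op_algebra H.module_axioms
    assoc_algebra.axioms(1)[OF H.op_algebra])

abbreviation "incl2 \<equiv> tensor_map K A (op_alg A) B (op_alg B) \<iota> \<iota>"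
abbreviation "deltaB h \<equiv> tensor_map K H (op_alg H) B (op_alg B) \<eta> \<eta> (delta K H \<Delta> S h)"
abbreviation "D \<equiv> D_set K H \<Delta> S A act"

text \<open>The element \<open>a h_1 \<otimes> S(h_2) b\<close>, that is
  \<open>(a \<otimes> b) \<delta>(h)\<close>. Its definition by \<open>twist\<close> allows the
  inverse map to be applied to it at once.\<close>

definition dgen :: "'a \<Rightarrow> 'a \<Rightarrow> 'h \<Rightarrow> ('k, ('k, 'a, 'h) tensor, ('k, 'a, 'h) tensor) tensor"
  where "dgen a b h = twist S (E.pure (AH.pure a h) (\<iota> b))"

lemma dgen_sw:
  assumes "a \<in> carrier A" "b \<in> carrier A" "h \<in> carrier H"
  shows "dgen a b h = H.Sw E.T h (\<lambda>x y. E.pure (AH.pure a x) (\<eta> (S y) \<otimes>\<^bsub>B\<^esub> \<iota> b))"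
  using assms by (simp add: dgen_def twist_pure[OF H.antipode_linear] twist1_def)

lemma dgen_closed [simp]:
  "a \<in> carrier A \<Longrightarrow> b \<in> carrier A \<Longrightarrow> h \<in> carrier H \<Longrightarrow> dgen a b h \<in> carrier E.T"
  unfolding dgen_def by (rule module_homD(1)[OF twist_hom[OF H.antipode_linear]]) simp

lemma dgen_linear:
  assumes "a \<in> carrier A" "b \<in> carrier A" "h \<in> carrier H"
  shows "(\<lambda>a. dgen a b h) \<in> module_hom K A E.T"
    and "(\<lambda>b. dgen a b h) \<in> module_hom K A E.T"
    and "dgen a b \<in> module_hom K H E.T"
  unfolding dgen_def[abs_def]
  by ((rule module_hom_comp[OF _ twist_hom[OF H.antipode_linear]], rule module_homI;
    use assms in \<open>simp add: E_linear\<close>)+)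

lemma incl2_bilinear: "bilinear K A (op_alg A) E.T (\<lambda>v w. E.pure (\<iota> v) (\<iota> w))"
  by (intro bilinearI module_homI) (simp_all add: E_linear)

lemma incl2_hom: "incl2 \<in> module_hom K AA.T E.T"
  unfolding tensor_map_def by (rule AA.tensor_lift_hom[OF EM incl2_bilinear])

lemma incl2_pure: "a \<in> carrier A \<Longrightarrow> b \<in> carrier A \<Longrightarrow> incl2 (AA.pure a b) = E.pure (\<iota> a) (\<iota> b)"
  unfolding tensor_map_def by (simp add: AA.tensor_lift_pure[OF EM incl2_bilinear])

lemma deltaB_sw:
  assumes h: "h \<in> carrier H"
  shows "deltaB h = H.Sw E.T h (\<lambda>x y. E.pure (\<eta> x) (\<eta> (S y)))"
proof -
  note HM = HO.T.module_axioms
  have b1: "bilinear K H H HO.T (\<lambda>x y. HO.pure x (S y))"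
    by (intro bilinearI module_homI) (simp_all add: H.antipode_simps HO.pure_add_left HO.pure_smult_left
      HO.pure_add_right[unfolded op_alg_simps] HO.pure_smult_right[unfolded op_alg_simps])
  have b2: "bilinear K H (op_alg H) E.T (\<lambda>x y. E.pure (\<eta> x) (\<eta> y))"
    by (intro bilinearI module_homI) (simp_all add: E_linear)
  have "delta K H \<Delta> S h = H.Sw HO.T h (\<lambda>x y. HO.pure x (S y))"
    unfolding delta_def tensor_map_def by (rule H.sw_lift[OF HM b1 h])
  then show ?thesis
    unfolding tensor_map_def
    by (simp add: H.sw_hom[OF HM EM HO.tensor_lift_hom[OF EM b2]] HO.tensor_lift_pure[OF EM b2]
      H.antipode_simps)
qed

lemma deltaB_closed [simp]: "h \<in> carrier H \<Longrightarrow> deltaB h \<in> carrier E.T"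
  by (simp add: deltaB_sw EM H.antipode_simps)

text \<open>In the second factor the opposite multiplication puts \<open>b\<close> to the right of
  \<open>S(h_2)\<close>.\<close>

lemma pure_deltaB:
  assumes "a \<in> carrier A" "b \<in> carrier A" "h \<in> carrier H"
  shows "E.pure (\<iota> a) (\<iota> b) \<otimes>\<^bsub>E.TA\<^esub> deltaB h = dgen a b h"
proof -
  have p: "E.pure (\<iota> a) (\<iota> b) \<in> carrier E.T" using assms by simp
  show ?thesis
    using assms by (simp add: deltaB_sw dgen_sw H.sw_hom[OF EM EM E.mult_left_hom[OF p]] Emult_pure
      H.antipode_simps mult_iota_eta)
qed

lemma D_iff: "t \<in> D \<longleftrightarrow> (\<exists>(n::nat) u v. t = finsum E.TA (\<lambda>i. u i \<otimes>\<^bsub>E.TA\<^esub> v i) {..<n} \<and>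
    u \<in> {..<n} \<rightarrow> incl2 ` carrier AA.T \<and> v \<in> {..<n} \<rightarrow> deltaB ` carrier H)"
proof -
  have "deltaB ` carrier H = tensor_map K H (op_alg H) B (op_alg B) \<eta> \<eta> ` delta K H \<Delta> S ` carrier H"
    by (simp add: image_image)
  then show ?thesis
    unfolding D_set_def Let_def env_alg_def by (simp del: image_image)
qed

lemma incl2_deltaB_closed:
  assumes "u \<in> incl2 ` carrier AA.T" "v \<in> deltaB ` carrier H"
  shows "u \<otimes>\<^bsub>E.TA\<^esub> v \<in> carrier E.T"
  using assms module_homD(1)[OF incl2_hom] by (auto intro!: E.mult_closed)

lemma D_zero: "\<zero>\<^bsub>E.T\<^esub> \<in> D"
  unfolding D_iff by (intro exI[of _ 0]) auto

lemma D_closed: "t \<in> D \<Longrightarrow> t \<in> carrier E.T"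
  unfolding D_iff
  by (elim exE conjE) (auto simp: Pi_iff incl2_deltaB_closed intro!: E.TA.M.finsum_closed[unfolded E.TA_simps])

lemma finsum_prod_Suc:
  assumes "u \<in> {..<Suc n} \<rightarrow> incl2 ` carrier AA.T" "v \<in> {..<Suc n} \<rightarrow> deltaB ` carrier H"
  shows "finsum E.TA (\<lambda>i. u i \<otimes>\<^bsub>E.TA\<^esub> v i) {..<Suc n} =
    (u n \<otimes>\<^bsub>E.TA\<^esub> v n) \<oplus>\<^bsub>E.T\<^esub> finsum E.TA (\<lambda>i. u i \<otimes>\<^bsub>E.TA\<^esub> v i) {..<n}"
proof -
  have "(\<lambda>i. u i \<otimes>\<^bsub>E.TA\<^esub> v i) \<in> {..<n} \<rightarrow> carrier E.TA" "u n \<otimes>\<^bsub>E.TA\<^esub> v n \<in> carrier E.TA"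
    using assms incl2_deltaB_closed by (auto simp: Pi_iff)
  then show ?thesis
    unfolding lessThan_Suc using E.TA.M.finsum_insert[of "{..<n}" n] by simp
qed

lemma D_add_prod:
  assumes t: "t \<in> D" and u: "u \<in> incl2 ` carrier AA.T" and v: "v \<in> deltaB ` carrier H"
  shows "(u \<otimes>\<^bsub>E.TA\<^esub> v) \<oplus>\<^bsub>E.T\<^esub> t \<in> D"
proof -
  obtain n :: nat and u' v' where t': "t = finsum E.TA (\<lambda>i. u' i \<otimes>\<^bsub>E.TA\<^esub> v' i) {..<n}"
    and uv: "u' \<in> {..<n} \<rightarrow> incl2 ` carrier AA.T" "v' \<in> {..<n} \<rightarrow> deltaB ` carrier H"
    using t unfolding D_iff by blast
  let ?u = "u'(n := u)" and ?v = "v'(n := v)"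
  have uv': "?u \<in> {..<Suc n} \<rightarrow> incl2 ` carrier AA.T" "?v \<in> {..<Suc n} \<rightarrow> deltaB ` carrier H"
    using uv u v by (auto simp: Pi_iff less_Suc_eq)
  have "finsum E.TA (\<lambda>i. ?u i \<otimes>\<^bsub>E.TA\<^esub> ?v i) {..<n} = t"
    unfolding t' using uv incl2_deltaB_closed
    by (intro E.TA.M.finsum_cong') (auto simp: Pi_iff)
  then have "(u \<otimes>\<^bsub>E.TA\<^esub> v) \<oplus>\<^bsub>E.T\<^esub> t = finsum E.TA (\<lambda>i. ?u i \<otimes>\<^bsub>E.TA\<^esub> ?v i) {..<Suc n}"
    using finsum_prod_Suc[OF uv'] by simp
  with uv' show ?thesis unfolding D_iff by blast
qed

lemma D_add_dgen:
  "t \<in> D \<Longrightarrow> a \<in> carrier A \<Longrightarrow> b \<in> carrier A \<Longrightarrow> h \<in> carrier H \<Longrightarrow> dgen a b h \<oplus>\<^bsub>E.T\<^esub> t \<in> D"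
  using D_add_prod[OF _ imageI imageI, of t "AA.pure a b" h] by (simp add: incl2_pure pure_deltaB)

text \<open>Splitting the factors from \<open>A \<otimes> A\<close> into pure tensors turns each
  product into a sum of elements \<open>dgen a b h\<close>, so these span \<open>D\<close>
  additively.\<close>

lemma D_induct [consumes 1, case_names zero add]:
  assumes t: "t \<in> D" and P0: "P \<zero>\<^bsub>E.T\<^esub>"
    and Padd: "\<And>a b h t. a \<in> carrier A \<Longrightarrow> b \<in> carrier A \<Longrightarrow> h \<in> carrier H \<Longrightarrow> t \<in> D \<Longrightarrow> P t \<Longrightarrow>
      P (dgen a b h \<oplus>\<^bsub>E.T\<^esub> t)"
  shows "P t"
proof -
  \<comment> \<open>One further product is added by induction on its first factor. Membership in
    \<open>D\<close> is proved alongside because \<open>Padd\<close> asks for it.\<close>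
  have step: "P ((u \<otimes>\<^bsub>E.TA\<^esub> deltaB h) \<oplus>\<^bsub>E.T\<^esub> t) \<and> (u \<otimes>\<^bsub>E.TA\<^esub> deltaB h) \<oplus>\<^bsub>E.T\<^esub> t \<in> D"
    if u: "u = incl2 s" "s \<in> carrier AA.T" and h: "h \<in> carrier H" and t: "t \<in> D" "P t" for u s h t
    using u(2) t unfolding u(1)
  proof (induction s arbitrary: t rule: AA.tensor_induct)
    case zero
    have "incl2 \<zero>\<^bsub>AA.T\<^esub> = \<zero>\<^bsub>E.T\<^esub>"
      by (rule module_hom_zero[OF incl2_hom AA.T.M.abelian_group_axioms E.T.M.abelian_group_axioms])
    then show ?case using zero h D_closed by (simp add: E.mult_zero_left)
  next
    case (add a b s)
    then have ab: "a \<in> carrier A" "b \<in> carrier A" by simp_all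
    have c: "incl2 s \<in> carrier E.T" "t \<in> carrier E.T" "incl2 s \<otimes>\<^bsub>E.TA\<^esub> deltaB h \<in> carrier E.T"
      using add D_closed h module_homD(1)[OF incl2_hom] by (auto intro!: E.mult_closed)
    have "incl2 (AA.pure a b \<oplus>\<^bsub>AA.T\<^esub> s) \<otimes>\<^bsub>E.TA\<^esub> deltaB h \<oplus>\<^bsub>E.T\<^esub> t =
        dgen a b h \<oplus>\<^bsub>E.T\<^esub> ((incl2 s \<otimes>\<^bsub>E.TA\<^esub> deltaB h) \<oplus>\<^bsub>E.T\<^esub> t)"
      using ab add(3) h c by (simp add: module_homD(2)[OF incl2_hom] incl2_pure
        module_homD(2)[OF E.mult_right_hom] pure_deltaB E.T.M.a_assoc)
    with Padd[OF ab h] D_add_dgen[OF _ ab h] add.IH[OF add.prems] show ?case by simp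
  qed
  obtain n :: nat and u v where t': "t = finsum E.TA (\<lambda>i. u i \<otimes>\<^bsub>E.TA\<^esub> v i) {..<n}"
    and uv: "u \<in> {..<n} \<rightarrow> incl2 ` carrier AA.T" "v \<in> {..<n} \<rightarrow> deltaB ` carrier H"
    using t unfolding D_iff by blast
  have "P (finsum E.TA (\<lambda>i. u i \<otimes>\<^bsub>E.TA\<^esub> v i) {..<n}) \<and> finsum E.TA (\<lambda>i. u i \<otimes>\<^bsub>E.TA\<^esub> v i) {..<n} \<in> D"
    using uv
  proof (induction n)
    case 0
    show ?case using P0 D_zero by simp
  next
    case (Suc n)
    have "u n \<in> incl2 ` carrier AA.T" "v n \<in> deltaB ` carrier H"
      using Suc.prems by (simp_all add: Pi_iff)
    then obtain s h where sh: "u n = incl2 s" "s \<in> carrier AA.T" "v n = deltaB h" "h \<in> carrier H"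
      by blast
    have "P (finsum E.TA (\<lambda>i. u i \<otimes>\<^bsub>E.TA\<^esub> v i) {..<n}) \<and> finsum E.TA (\<lambda>i. u i \<otimes>\<^bsub>E.TA\<^esub> v i) {..<n} \<in> D"
      using Suc.prems by (intro Suc.IH) (simp_all add: Pi_iff)
    then show ?case
      unfolding finsum_prod_Suc[OF Suc.prems] sh(3) using step[OF sh(1,2,4)] by blast
  qed
  then show ?thesis using t' by simp
qed

section \<open>Closure properties of \<open>D\<close>\<close>

lemma D_dgen: "a \<in> carrier A \<Longrightarrow> b \<in> carrier A \<Longrightarrow> h \<in> carrier H \<Longrightarrow> dgen a b h \<in> D"
  using D_add_dgen[OF D_zero, of a b h] by simp

lemma D_add: "s \<in> D \<Longrightarrow> t \<in> D \<Longrightarrow> s \<oplus>\<^bsub>E.T\<^esub> t \<in> D"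
proof (induction s rule: D_induct)
  case (add a b h s)
  then show ?case using D_closed by (simp add: E.T.M.a_assoc D_add_dgen)
qed (simp add: D_closed)

lemma D_smult:
  assumes c: "c \<in> carrier K" and t: "t \<in> D"
  shows "c \<odot>\<^bsub>E.T\<^esub> t \<in> D"
  using t
proof (induction t rule: D_induct)
  case (add a b h t)
  have "c \<odot>\<^bsub>E.T\<^esub> (dgen a b h \<oplus>\<^bsub>E.T\<^esub> t) = dgen (c \<odot>\<^bsub>A\<^esub> a) b h \<oplus>\<^bsub>E.T\<^esub> c \<odot>\<^bsub>E.T\<^esub> t"
    using add c D_closed by (simp add: E.T.smult_r_distr module_homD(3)[OF dgen_linear(1)])
  then show ?case using add c by (simp add: D_add_dgen)
qed (simp add: c D_zero)

lemma D_minus: "t \<in> D \<Longrightarrow> \<ominus>\<^bsub>E.T\<^esub> t \<in> D"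
  using D_smult[of "\<ominus>\<^bsub>K\<^esub> \<one>\<^bsub>K\<^esub>" t] D_closed[of t] by (simp add: E.T.smult_l_minus)

lemma D_sw:
  assumes "\<And>x y. x \<in> carrier H \<Longrightarrow> y \<in> carrier H \<Longrightarrow> \<beta> x y \<in> D"
  shows "H.Sw E.T h \<beta> \<in> D"
proof -
  have "set xs \<subseteq> carrier H \<times> carrier H \<Longrightarrow> tsum E.T \<beta> xs \<in> D" for xs
    by (induction xs) (auto simp: D_zero intro!: D_add assms)
  then show ?thesis
    unfolding sweedler_def using H.HH.tensor_rep(1) by blast
qed

text \<open>\<open>S\<close> reverses products and so does the opposite algebra; the two reversals
  cancel.\<close>

lemma deltaB_mult:
  assumes h: "h \<in> carrier H" and l: "l \<in> carrier H"
  shows "deltaB h \<otimes>\<^bsub>E.TA\<^esub> deltaB l = deltaB (h \<otimes>\<^bsub>H\<^esub> l)"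
proof -
  have b: "bilinear K H H E.T (\<lambda>x y. E.pure (\<eta> x) (\<eta> (S y)))"
    by (intro bilinearI module_homI) (simp_all add: E_linear)
  have "deltaB h \<otimes>\<^bsub>E.TA\<^esub> deltaB l =
      H.Sw E.T h (\<lambda>x y. E.pure (\<eta> x) (\<eta> (S y)) \<otimes>\<^bsub>E.TA\<^esub> deltaB l)"
    using l by (simp add: deltaB_sw[OF h] H.sw_hom[OF EM EM E.mult_right_hom] H.antipode_simps)
  also have "\<dots> = H.Sw E.T h (\<lambda>x y. H.Sw E.T l (\<lambda>x' y'. E.pure (\<eta> (x \<otimes>\<^bsub>H\<^esub> x')) (\<eta> (S (y \<otimes>\<^bsub>H\<^esub> y')))))"
    by (simp add: deltaB_sw[OF l] H.sw_hom[OF EM EM E.mult_left_hom] H.antipode_simps Emult_pure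
      eta_mult H.antipode_mult)
  also have "\<dots> = deltaB (h \<otimes>\<^bsub>H\<^esub> l)"
    using h l by (simp add: deltaB_sw H.sw_mult[OF EM b])
  finally show ?thesis .
qed

text \<open>In the first factor \<open>h_1\<close> is moved past \<open>a\<close>; in the second
  \<open>mult_iota_antipode\<close> rewrites \<open>b S(h_2)\<close>. The outcome, with legs counted
  anew, is \<open>(h_1 a \<otimes> h_3 b) \<delta>(h_2)\<close>: it has the elements of
  \<open>A\<close> in front again, which is what closure under multiplication needs.\<close>

lemma deltaB_pure:
  assumes h: "h \<in> carrier H" and a: "a \<in> carrier A" and b: "b \<in> carrier A"
  shows "deltaB h \<otimes>\<^bsub>E.TA\<^esub> E.pure (\<iota> a) (\<iota> b) =
    H.Sw E.T h (\<lambda>x h'. H.Sw E.T h' (\<lambda>w q. dgen (act x a) (act q b) w))"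
proof -
  have p: "E.pure (\<iota> a) (\<iota> b) \<in> carrier E.T" using a b by simp
  \<comment> \<open>\<open>x\<close>, \<open>y\<close>, \<open>p\<close>, \<open>q\<close> will be
    four consecutive legs of \<open>h\<close>.\<close>
  let ?g = "\<lambda>x y p q. E.pure (AH.pure (act x a) y) (\<eta> (S p) \<otimes>\<^bsub>B\<^esub> \<iota> (act q b))"
  have t1: "trilinear K H H H E.T (\<lambda>x y z. H.Sw E.T z (\<lambda>p q. ?g x y p q))"
  proof (rule trilinearI)
    fix v w assume "v \<in> carrier H" "w \<in> carrier H"
    then show "(\<lambda>z. H.Sw E.T z (\<lambda>p q. ?g v w p q)) \<in> module_hom K H E.T"
      using a b by (intro H.sw_linear[OF EM] bilinearI module_homI) (simp_all add: E_linear)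
  qed (use a b in \<open>intro module_homI; simp add: E_linear EM\<close>)+
  have t2: "trilinear K H H H E.T (?g x)" if "x \<in> carrier H" for x
    using that a b by (intro trilinearI module_homI) (simp_all add: E_linear)
  have "deltaB h \<otimes>\<^bsub>E.TA\<^esub> E.pure (\<iota> a) (\<iota> b) =
      H.Sw E.T h (\<lambda>x z. E.pure (\<eta> x \<otimes>\<^bsub>B\<^esub> \<iota> a) (\<iota> b \<otimes>\<^bsub>B\<^esub> \<eta> (S z)))"
    using a b by (simp add: deltaB_sw[OF h] H.sw_hom[OF EM EM E.mult_right_hom[OF p]] H.antipode_simps Emult_pure)
  also have "\<dots> = H.Sw E.T h (\<lambda>h' z. H.Sw E.T h' (\<lambda>x y. H.Sw E.T z (\<lambda>p q. ?g x y p q)))"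
  proof (intro H.sw_cong refl)
    fix h' z assume c: "h' \<in> carrier H" "z \<in> carrier H"
    have i: "\<iota> b \<otimes>\<^bsub>B\<^esub> \<eta> (S z) \<in> carrier B" using b c by (simp add: H.antipode_simps)
    have "E.pure (\<eta> h' \<otimes>\<^bsub>B\<^esub> \<iota> a) (\<iota> b \<otimes>\<^bsub>B\<^esub> \<eta> (S z)) =
        H.Sw E.T h' (\<lambda>x y. E.pure (AH.pure (act x a) y) (\<iota> b \<otimes>\<^bsub>B\<^esub> \<eta> (S z)))"
      using a c by (simp add: mult_eta_iota H.sw_hom[OF BM EM Epure_hom_left[OF i]] act_simps mult_iota_eta)
    also have "\<dots> = H.Sw E.T h' (\<lambda>x y. H.Sw E.T z (\<lambda>p q. ?g x y p q))"
      using a b c by (simp add: mult_iota_antipode[symmetric] H.sw_hom[OF BM EM Epure_hom_right]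
        act_simps H.antipode_simps)
    finally show "E.pure (\<eta> h' \<otimes>\<^bsub>B\<^esub> \<iota> a) (\<iota> b \<otimes>\<^bsub>B\<^esub> \<eta> (S z)) =
        H.Sw E.T h' (\<lambda>x y. H.Sw E.T z (\<lambda>p q. ?g x y p q))" .
  qed
  also have "\<dots> = H.Sw E.T h (\<lambda>x h'. H.Sw E.T h' (\<lambda>y z. H.Sw E.T z (\<lambda>p q. ?g x y p q)))"
    by (rule H.sw_coassoc[OF EM t1 h])
  \<comment> \<open>The middle legs \<open>y\<close> and \<open>p\<close> are gathered into one leg
    \<open>w\<close>, so that the inner sum becomes a \<open>dgen\<close>.\<close>
  also have "\<dots> = H.Sw E.T h (\<lambda>x h'. H.Sw E.T h' (\<lambda>w q. H.Sw E.T w (\<lambda>y p. ?g x y p q)))"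
    by (intro H.sw_cong refl H.sw_coassoc[OF EM t2, symmetric])
  also have "\<dots> = H.Sw E.T h (\<lambda>x h'. H.Sw E.T h' (\<lambda>w q. dgen (act x a) (act q b) w))"
    by (intro H.sw_cong refl) (use a b in \<open>simp add: dgen_sw act_simps\<close>)
  finally show ?thesis .
qed

lemma D_pure_mult:
  assumes a: "a \<in> carrier A" and b: "b \<in> carrier A" and t: "t \<in> D"
  shows "E.pure (\<iota> a) (\<iota> b) \<otimes>\<^bsub>E.TA\<^esub> t \<in> D"
  using t
proof (induction t rule: D_induct)
  case zero
  show ?case using a b by (simp add: E.mult_zero_right D_zero)
next
  case (add a' b' h t)
  have p: "E.pure (\<iota> a) (\<iota> b) \<in> carrier E.T" using a b by simp
  have "E.pure (\<iota> a) (\<iota> b) \<otimes>\<^bsub>E.TA\<^esub> dgen a' b' h =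
      (E.pure (\<iota> a) (\<iota> b) \<otimes>\<^bsub>E.TA\<^esub> E.pure (\<iota> a') (\<iota> b')) \<otimes>\<^bsub>E.TA\<^esub> deltaB h"
    using add a b E.TA.A.m_assoc[of "E.pure (\<iota> a) (\<iota> b)" "E.pure (\<iota> a') (\<iota> b')" "deltaB h"]
    by (simp add: pure_deltaB[symmetric])
  also have "\<dots> = dgen (a \<otimes>\<^bsub>A\<^esub> a') (b' \<otimes>\<^bsub>A\<^esub> b) h"
    using add a b by (simp add: Emult_pure iota_mult[symmetric] pure_deltaB)
  finally show ?case
    using add a b D_closed by (simp add: module_homD(2)[OF E.mult_left_hom[OF p]] D_add_dgen)
qed

lemma D_mult_deltaB:
  assumes l: "l \<in> carrier H" and t: "t \<in> D"
  shows "t \<otimes>\<^bsub>E.TA\<^esub> deltaB l \<in> D"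
  using t
proof (induction t rule: D_induct)
  case zero
  show ?case using l by (simp add: E.mult_zero_left D_zero)
next
  case (add a b h t)
  have "dgen a b h \<otimes>\<^bsub>E.TA\<^esub> deltaB l = E.pure (\<iota> a) (\<iota> b) \<otimes>\<^bsub>E.TA\<^esub> (deltaB h \<otimes>\<^bsub>E.TA\<^esub> deltaB l)"
    using add l E.TA.A.m_assoc[of "E.pure (\<iota> a) (\<iota> b)" "deltaB h" "deltaB l"]
    by (simp add: pure_deltaB[symmetric])
  also have "\<dots> = dgen a b (h \<otimes>\<^bsub>H\<^esub> l)"
    using add l by (simp add: deltaB_mult pure_deltaB)
  finally show ?case
    using add l D_closed by (simp add: module_homD(2)[OF E.mult_right_hom] D_add_dgen)
qed

text \<open>Each \<open>dgen a b h\<close> is \<open>(a \<otimes> b) \<delta>(h)\<close>. Right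
  multiplication by \<open>a \<otimes> b\<close> is governed by \<open>deltaB_pure\<close>, right
  multiplication by \<open>\<delta>(h)\<close> by \<open>deltaB_mult\<close>.\<close>

lemma D_mult:
  assumes s: "s \<in> D" and t: "t \<in> D"
  shows "s \<otimes>\<^bsub>E.TA\<^esub> t \<in> D"
  using t
proof (induction t rule: D_induct)
  case zero
  show ?case using D_closed[OF s] by (simp add: E.mult_zero_right D_zero)
next
  case (add a b h t)
  then have ab: "a \<in> carrier A" "b \<in> carrier A" "h \<in> carrier H" by simp_all
  have sp: "s \<otimes>\<^bsub>E.TA\<^esub> E.pure (\<iota> a) (\<iota> b) \<in> D"
    using s
  proof (induction s rule: D_induct)
    case zero
    show ?case using ab by (simp add: E.mult_zero_left D_zero)
  next
    case inner: (add a' b' h' s)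
    have "dgen a' b' h' \<otimes>\<^bsub>E.TA\<^esub> E.pure (\<iota> a) (\<iota> b) =
        E.pure (\<iota> a') (\<iota> b') \<otimes>\<^bsub>E.TA\<^esub> (deltaB h' \<otimes>\<^bsub>E.TA\<^esub> E.pure (\<iota> a) (\<iota> b))"
      using inner ab E.TA.A.m_assoc[of "E.pure (\<iota> a') (\<iota> b')" "deltaB h'" "E.pure (\<iota> a) (\<iota> b)"]
      by (simp add: pure_deltaB[symmetric])
    also have "\<dots> \<in> D"
      unfolding deltaB_pure[OF inner(3) ab(1,2)]
      by (intro D_pure_mult D_sw D_dgen) (use inner ab in \<open>simp_all add: act_simps\<close>)
    finally show ?case
      using inner ab D_closed by (simp add: module_homD(2)[OF E.mult_right_hom] D_add)
  qed
  have "s \<otimes>\<^bsub>E.TA\<^esub> dgen a b h = (s \<otimes>\<^bsub>E.TA\<^esub> E.pure (\<iota> a) (\<iota> b)) \<otimes>\<^bsub>E.TA\<^esub> deltaB h"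
    using D_closed[OF s] ab E.TA.A.m_assoc[of s "E.pure (\<iota> a) (\<iota> b)" "deltaB h"]
    by (simp add: pure_deltaB[symmetric])
  then have "s \<otimes>\<^bsub>E.TA\<^esub> dgen a b h \<in> D" using D_mult_deltaB[OF ab(3) sp] by simp
  then show ?case
    using add ab D_closed[OF s] D_closed by (simp add: module_homD(2)[OF E.mult_left_hom] D_add)
qed

lemma D_one: "\<one>\<^bsub>E.TA\<^esub> \<in> D"
proof -
  have b: "bilinear K H H E.T (\<lambda>x y. E.pure (AH.pure \<one>\<^bsub>A\<^esub> x) (\<eta> (S y) \<otimes>\<^bsub>B\<^esub> \<iota> \<one>\<^bsub>A\<^esub>))"
    by (intro bilinearI module_homI) (simp_all add: E_linear)
  have "dgen \<one>\<^bsub>A\<^esub> \<one>\<^bsub>A\<^esub> \<one>\<^bsub>H\<^esub> =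
      E.pure (AH.pure \<one>\<^bsub>A\<^esub> \<one>\<^bsub>H\<^esub>) (\<eta> (S \<one>\<^bsub>H\<^esub>) \<otimes>\<^bsub>B\<^esub> \<iota> \<one>\<^bsub>A\<^esub>)"
    using H.sw_one[OF EM b] by (subst dgen_sw) simp_all
  then have "dgen \<one>\<^bsub>A\<^esub> \<one>\<^bsub>A\<^esub> \<one>\<^bsub>H\<^esub> = \<one>\<^bsub>E.TA\<^esub>"
    by (simp add: H.antipode_one incl_one B_one[symmetric])
  then show ?thesis using D_dgen[of "\<one>\<^bsub>A\<^esub>" "\<one>\<^bsub>A\<^esub>" "\<one>\<^bsub>H\<^esub>"] by simp
qed

end

section \<open>Bases of vector spaces\<close>

locale vector_space_record = field K + V: module K V
  for K :: "'k ring" and V :: "('k, 'v) module"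
begin

abbreviation "comb \<equiv> free_ext K V (\<lambda>x. x)"

definition indep :: "'v set \<Rightarrow> bool"
  where "indep L \<longleftrightarrow> L \<subseteq> carrier V \<and> (\<forall>f\<in>carrier (free_module K L). comb f = \<zero>\<^bsub>V\<^esub> \<longrightarrow> f = (\<lambda>_. \<zero>\<^bsub>K\<^esub>))"

lemma comb_hom: "L \<subseteq> carrier V \<Longrightarrow> comb \<in> module_hom K (free_module K L) V"
  by (rule lmod.free_ext_hom[OF V.is_lmod]) auto

text \<open>A linear relation has finite support, so a relation on the union of a chain already
  lives on one of its members; Zorn's lemma applies.\<close>

lemma maximal_indep: "\<exists>J. indep J \<and> (\<forall>L. indep L \<longrightarrow> J \<subseteq> L \<longrightarrow> L = J)"
proof -
  have "\<exists>J\<in>Collect indep. \<forall>L\<in>Collect indep. J \<subseteq> L \<longrightarrow> L = J"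
  proof (rule subset_Zorn_nonempty)
    have "indep {}" by (auto simp: indep_def free_carrier)
    then show "Collect indep \<noteq> {}" by blast
  next
    fix C assume C: "C \<noteq> {}" "subset.chain (Collect indep) C"
    then have ind: "indep L" if "L \<in> C" for L using that by (auto simp: subset.chain_def)
    have "f = (\<lambda>_. \<zero>\<^bsub>K\<^esub>)" if f: "f \<in> carrier (free_module K (\<Union>C))" "comb f = \<zero>\<^bsub>V\<^esub>" for f
    proof -
      have "finite {x. f x \<noteq> \<zero>\<^bsub>K\<^esub>}" "{x. f x \<noteq> \<zero>\<^bsub>K\<^esub>} \<subseteq> \<Union>C" using f by (auto simp: free_carrier)
      then obtain L where L: "L \<in> C" "{x. f x \<noteq> \<zero>\<^bsub>K\<^esub>} \<subseteq> L"
        using finite_subset_Union_chain[OF _ _ C] by blast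
      then have "f \<in> carrier (free_module K L)" using f by (auto simp: free_carrier)
      with ind[OF L(1)] f show ?thesis by (auto simp: indep_def)
    qed
    with ind show "\<Union>C \<in> Collect indep" by (auto simp: indep_def)
  qed
  then show ?thesis by blast
qed

text \<open>If \<open>x\<close> is not in \<open>J\<close>, adjoining it creates a relation, and
  independence of \<open>J\<close> forces the coefficient at \<open>x\<close> to be nonzero;
  dividing by it expresses \<open>x\<close> by elements of \<open>J\<close>.\<close>

lemma maximal_spans:
  assumes J: "indep J" and max: "\<And>L. indep L \<Longrightarrow> J \<subseteq> L \<Longrightarrow> L = J" and x: "x \<in> carrier V"
  shows "\<exists>f\<in>carrier (free_module K J). comb f = x"
proof (cases "x \<in> J")
  case True
  then show ?thesis
    using lmod.free_ext_gen[OF V.is_lmod, of "\<lambda>x. x" x] x by (intro bexI[of _ "free_gen K x"]) auto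
next
  case False
  let ?L = "insert x J" and ?F = "free_module K (insert x J)"
  have JV: "J \<subseteq> carrier V" and LV: "?L \<subseteq> carrier V" using J x by (auto simp: indep_def)
  have "\<not> indep ?L" using max[of ?L] False by blast
  then obtain f where f: "f \<in> carrier ?F" "comb f = \<zero>\<^bsub>V\<^esub>" "f \<noteq> (\<lambda>_. \<zero>\<^bsub>K\<^esub>)"
    using LV by (auto simp: indep_def)
  have fx: "f x \<noteq> \<zero>\<^bsub>K\<^esub>"
  proof
    assume "f x = \<zero>\<^bsub>K\<^esub>"
    then have "f \<in> carrier (free_module K J)" using f(1) by (auto simp: free_carrier)
    then show False using J f by (auto simp: indep_def)
  qed
  let ?c = "f x"
  have c: "?c \<in> carrier K" using f by (auto simp: free_carrier)
  then have unit: "?c \<in> Units K" using fx field_Units by blast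
  let ?g = "f(x := \<zero>\<^bsub>K\<^esub>)"
  have "finite {y. f y \<noteq> \<zero>\<^bsub>K\<^esub>}" using f(1) by (simp add: free_carrier)
  then have "finite {y. ?g y \<noteq> \<zero>\<^bsub>K\<^esub>}" by (rule rev_finite_subset) auto
  then have g: "?g \<in> carrier (free_module K J)" using f(1) by (auto simp: free_carrier)
  then have gL: "?g \<in> carrier ?F" unfolding free_carrier by blast
  interpret F: lmod K ?F by (rule free_lmod)
  have fe: "f = ?c \<odot>\<^bsub>?F\<^esub> free_gen K x \<oplus>\<^bsub>?F\<^esub> ?g"
    using f(1) by (auto simp: free_simps free_gen_def fun_eq_iff free_carrier)
  note h = comb_hom[OF LV]
  have "comb f = ?c \<odot>\<^bsub>V\<^esub> x \<oplus>\<^bsub>V\<^esub> comb ?g"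
    using gL c x lmod.free_ext_gen[OF V.is_lmod, of "\<lambda>x. x" x]
    by (subst fe) (simp add: module_homD[OF h] del: fun_upd_apply)
  then have e: "?c \<odot>\<^bsub>V\<^esub> x \<oplus>\<^bsub>V\<^esub> comb ?g = \<zero>\<^bsub>V\<^esub>" using f by simp
  have gc: "comb ?g \<in> carrier V" by (rule module_homD(1)[OF h gL])
  have "?c \<odot>\<^bsub>V\<^esub> x = \<ominus>\<^bsub>V\<^esub> comb ?g"
    using e c x gc by (intro V.M.minus_equality[symmetric]) auto
  then have "(inv\<^bsub>K\<^esub> ?c) \<odot>\<^bsub>V\<^esub> (?c \<odot>\<^bsub>V\<^esub> x) = (inv\<^bsub>K\<^esub> ?c) \<odot>\<^bsub>V\<^esub> (\<ominus>\<^bsub>V\<^esub> comb ?g)" by simp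
  then have "x = (\<ominus>\<^bsub>K\<^esub> (inv\<^bsub>K\<^esub> ?c)) \<odot>\<^bsub>V\<^esub> comb ?g"
    using c x unit gc by (simp add: V.smult_assoc1[symmetric] Units_l_inv V.smult_l_minus V.smult_r_minus)
  also have "\<dots> = comb ((\<ominus>\<^bsub>K\<^esub> (inv\<^bsub>K\<^esub> ?c)) \<odot>\<^bsub>free_module K J\<^esub> ?g)"
    using unit by (intro module_homD(3)[OF comb_hom[OF JV], symmetric] g) auto
  finally have "comb ((\<ominus>\<^bsub>K\<^esub> (inv\<^bsub>K\<^esub> ?c)) \<odot>\<^bsub>free_module K J\<^esub> ?g) = x" ..
  moreover have "(\<ominus>\<^bsub>K\<^esub> (inv\<^bsub>K\<^esub> ?c)) \<odot>\<^bsub>free_module K J\<^esub> ?g \<in> carrier (free_module K J)"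
    unfolding free_simps by (rule free_smult_closed[OF g]) (use unit in simp)
  ultimately show ?thesis by blast
qed

text \<open>Besides the spanning set \<open>J\<close> the linear functionals dual to it are
  provided, since independence of translates will be tested by applying them.\<close>

theorem basis_exists:
  obtains J and coord :: "'v \<Rightarrow> 'v \<Rightarrow> 'k"
  where "J \<subseteq> carrier V"
    and "\<And>x. x \<in> carrier V \<Longrightarrow> \<exists>f\<in>carrier (free_module K J). comb f = x"
    and "\<And>j x. x \<in> carrier V \<Longrightarrow> coord j x \<in> carrier K"
    and "\<And>j x y. x \<in> carrier V \<Longrightarrow> y \<in> carrier V \<Longrightarrow> coord j (x \<oplus>\<^bsub>V\<^esub> y) = coord j x \<oplus>\<^bsub>K\<^esub> coord j y"
    and "\<And>j c x. c \<in> carrier K \<Longrightarrow> x \<in> carrier V \<Longrightarrow> coord j (c \<odot>\<^bsub>V\<^esub> x) = c \<otimes>\<^bsub>K\<^esub> coord j x"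
    and "\<And>i j. j \<in> J \<Longrightarrow> coord i j = (if j = i then \<one>\<^bsub>K\<^esub> else \<zero>\<^bsub>K\<^esub>)"
proof -
  obtain J where J: "indep J" and max: "\<And>L. indep L \<Longrightarrow> J \<subseteq> L \<Longrightarrow> L = J"
    using maximal_indep by blast
  let ?F = "free_module K J"
  interpret F: module K ?F by (rule free_module_module)
  have JV: "J \<subseteq> carrier V" using J by (simp add: indep_def)
  note h = comb_hom[OF JV]
  have inj: "f = g" if "f \<in> carrier ?F" "g \<in> carrier ?F" "comb f = comb g" for f g
  proof -
    have "comb (f \<ominus>\<^bsub>?F\<^esub> g) = \<zero>\<^bsub>V\<^esub>"
      using module_hom_minus[OF h F.M.abelian_group_axioms V.M.abelian_group_axioms that(1,2)] that
        module_homD(1)[OF h that(2)] by (simp add: a_minus_def V.M.r_neg)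
    then have "f \<ominus>\<^bsub>?F\<^esub> g = \<zero>\<^bsub>?F\<^esub>"
      using J that F.M.minus_closed[OF that(1,2)] by (auto simp: indep_def free_simps)
    then show ?thesis using F.M.minus_zeroD that by blast
  qed
  have "\<forall>x\<in>carrier V. \<exists>f\<in>carrier ?F. comb f = x"
    using maximal_spans[OF J max] by blast
  then obtain cf where cf: "\<And>x. x \<in> carrier V \<Longrightarrow> cf x \<in> carrier ?F" "\<And>x. x \<in> carrier V \<Longrightarrow> comb (cf x) = x"
    by metis
  have add: "cf (x \<oplus>\<^bsub>V\<^esub> y) = cf x \<oplus>\<^bsub>?F\<^esub> cf y" if "x \<in> carrier V" "y \<in> carrier V" for x y
    by (rule inj) (use that in \<open>simp_all add: cf module_homD[OF h]\<close>)
  have smult: "cf (c \<odot>\<^bsub>V\<^esub> x) = c \<odot>\<^bsub>?F\<^esub> cf x" if "c \<in> carrier K" "x \<in> carrier V" for c x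
    by (rule inj) (use that in \<open>simp_all add: cf module_homD[OF h]\<close>)
  have gen: "cf j = free_gen K j" if "j \<in> J" for j
    by (rule inj) (use that JV lmod.free_ext_gen[OF V.is_lmod, of "\<lambda>x. x" j] in \<open>auto simp: cf\<close>)
  show thesis
  proof (rule that[of J "\<lambda>j x. cf x j"])
    show "x \<in> carrier V \<Longrightarrow> \<exists>f\<in>carrier (free_module K J). comb f = x" for x
      using cf by blast
    show "x \<in> carrier V \<Longrightarrow> cf x j \<in> carrier K" for j x
      using cf(1) by (auto simp: free_carrier)
  qed (use JV in \<open>simp_all add: add smult gen free_simps free_gen_def eq_commute\<close>)
qed

end

section \<open>Restricting and inducing along a free ring extension\<close>

text \<open>
  If every element of \<open>M\<close> is decomposed and the translates are independent, then \<open>M\<close> is the direct sum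
  of the \<open>e j M0\<close>. For \<open>M = R\<close> and \<open>M0\<close> a subring, \<open>e\<close> is then a basis of \<open>R\<close> as a right \<open>M0\<close>-module.
\<close>

definition decomposed :: "('r, 'm, 'y) module_scheme \<Rightarrow> 'm set \<Rightarrow> 'j set \<Rightarrow> ('j \<Rightarrow> 'r) \<Rightarrow> 'm set"
  where "decomposed M M0 J e = {x. \<exists>F z. finite F \<and> F \<subseteq> J \<and> z \<in> F \<rightarrow> M0 \<and>
    x = (\<Oplus>\<^bsub>M\<^esub>j\<in>F. e j \<odot>\<^bsub>M\<^esub> z j)}"

definition translates_indep :: "('r, 'm, 'y) module_scheme \<Rightarrow> 'm set \<Rightarrow> 'j set \<Rightarrow> ('j \<Rightarrow> 'r) \<Rightarrow> bool"
  where "translates_indep M M0 J e \<longleftrightarrow> (\<forall>F z. finite F \<longrightarrow> F \<subseteq> J \<longrightarrow> z \<in> F \<rightarrow> M0 \<longrightarrow>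
    (\<Oplus>\<^bsub>M\<^esub>j\<in>F. e j \<odot>\<^bsub>M\<^esub> z j) = \<zero>\<^bsub>M\<^esub> \<longrightarrow> (\<forall>j\<in>F. z j = \<zero>\<^bsub>M\<^esub>))"

context lmod
begin

context
  fixes M0 :: "'m set" and J :: "'j set" and e :: "'j \<Rightarrow> 'r"
  assumes M0: "M0 \<subseteq> carrier M" "\<zero>\<^bsub>M\<^esub> \<in> M0" "\<And>x y. x \<in> M0 \<Longrightarrow> y \<in> M0 \<Longrightarrow> x \<oplus>\<^bsub>M\<^esub> y \<in> M0"
    and e: "\<And>j. j \<in> J \<Longrightarrow> e j \<in> carrier R"
begin

lemma decomposed_zero: "\<zero>\<^bsub>M\<^esub> \<in> decomposed M M0 J e"
  unfolding decomposed_def by (intro CollectI exI[of _ "{}"]) auto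

lemma decomposed_single:
  assumes "j \<in> J" "z \<in> M0" shows "e j \<odot>\<^bsub>M\<^esub> z \<in> decomposed M M0 J e"
  unfolding decomposed_def
  by (intro CollectI exI[of _ "{j}"] exI[of _ "\<lambda>_. z"]) (use assms M0 e in auto)

lemma decomposed_add:
  assumes "x \<in> decomposed M M0 J e" "y \<in> decomposed M M0 J e"
  shows "x \<oplus>\<^bsub>M\<^esub> y \<in> decomposed M M0 J e"
proof -
  obtain F z where F: "finite F" "F \<subseteq> J" "z \<in> F \<rightarrow> M0" "x = (\<Oplus>\<^bsub>M\<^esub>j\<in>F. e j \<odot>\<^bsub>M\<^esub> z j)"
    using assms(1) by (auto simp: decomposed_def)
  obtain G w where G: "finite G" "G \<subseteq> J" "w \<in> G \<rightarrow> M0" "y = (\<Oplus>\<^bsub>M\<^esub>j\<in>G. e j \<odot>\<^bsub>M\<^esub> w j)"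
    using assms(2) by (auto simp: decomposed_def)
  \<comment> \<open>Both decompositions are padded by zeros to a common index set.\<close>
  let ?z = "\<lambda>j. if j \<in> F then z j else \<zero>\<^bsub>M\<^esub>" and ?w = "\<lambda>j. if j \<in> G then w j else \<zero>\<^bsub>M\<^esub>"
  have zw: "?z j \<in> M0" "?w j \<in> M0" for j using F G M0 by auto
  then have zwc: "?z j \<in> carrier M" "?w j \<in> carrier M" for j using M0 by blast+
  have ej: "e j \<in> carrier R" if "j \<in> F \<union> G" for j using that F G e by blast
  have x: "x = (\<Oplus>\<^bsub>M\<^esub>j\<in>F \<union> G. e j \<odot>\<^bsub>M\<^esub> ?z j)"
    unfolding F(4) using F G ej zwc M0
    by (intro M.add.finprod_mono_neutral_cong_left) (auto simp: Pi_iff)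
  have y: "y = (\<Oplus>\<^bsub>M\<^esub>j\<in>F \<union> G. e j \<odot>\<^bsub>M\<^esub> ?w j)"
    unfolding G(4) using F G ej zwc M0
    by (intro M.add.finprod_mono_neutral_cong_left) (auto simp: Pi_iff)
  have "x \<oplus>\<^bsub>M\<^esub> y = (\<Oplus>\<^bsub>M\<^esub>j\<in>F \<union> G. e j \<odot>\<^bsub>M\<^esub> ?z j \<oplus>\<^bsub>M\<^esub> e j \<odot>\<^bsub>M\<^esub> ?w j)"
    unfolding x y by (rule M.finsum_addf[symmetric]) (use ej zwc in \<open>auto simp: Pi_iff\<close>)
  also have "\<dots> = (\<Oplus>\<^bsub>M\<^esub>j\<in>F \<union> G. e j \<odot>\<^bsub>M\<^esub> (?z j \<oplus>\<^bsub>M\<^esub> ?w j))"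
    by (intro M.finsum_cong') (use ej zwc in \<open>auto simp: Pi_iff smult_r_distr\<close>)
  finally have sum: "x \<oplus>\<^bsub>M\<^esub> y = (\<Oplus>\<^bsub>M\<^esub>j\<in>F \<union> G. e j \<odot>\<^bsub>M\<^esub> (?z j \<oplus>\<^bsub>M\<^esub> ?w j))" .
  have "(\<lambda>j. ?z j \<oplus>\<^bsub>M\<^esub> ?w j) \<in> F \<union> G \<rightarrow> M0" by (intro Pi_I M0(3) zw)
  with sum F(1,2) G(1,2) show ?thesis
    unfolding decomposed_def by blast
qed

end

end

lemma decomposed_preimage:
  assumes P: "lmod R P" and Q: "lmod R Q" and f: "f \<in> module_hom R P Q" and P0: "P0 \<subseteq> carrier P"
    and F: "finite F" "\<And>j. j \<in> F \<Longrightarrow> e j \<in> carrier R" "\<And>j. j \<in> F \<Longrightarrow> \<exists>p\<in>P0. f p = z j"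
  shows "\<exists>p\<in>carrier P. f p = (\<Oplus>\<^bsub>Q\<^esub>j\<in>F. e j \<odot>\<^bsub>Q\<^esub> z j)"
proof -
  interpret P: lmod R P by fact
  interpret Q: lmod R Q by fact
  obtain p where p: "\<And>j. j \<in> F \<Longrightarrow> p j \<in> P0" "\<And>j. j \<in> F \<Longrightarrow> f (p j) = z j" using F(3) by metis
  let ?p = "\<Oplus>\<^bsub>P\<^esub>j\<in>F. e j \<odot>\<^bsub>P\<^esub> p j"
  have pc: "p j \<in> carrier P" if "j \<in> F" for j using p that P0 by blast
  have "f ?p = (\<Oplus>\<^bsub>Q\<^esub>j\<in>F. f (e j \<odot>\<^bsub>P\<^esub> p j))"
    by (rule module_hom_finsum[OF f P.M.abelian_group_axioms Q.M.abelian_group_axioms F(1)])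
      (use F(2) pc in auto)
  also have "\<dots> = (\<Oplus>\<^bsub>Q\<^esub>j\<in>F. e j \<odot>\<^bsub>Q\<^esub> z j)"
    by (intro Q.M.finsum_cong') (use F(2) pc p(2) in \<open>auto simp: module_homD(1,3)[OF f] p(2)[symmetric] Pi_iff\<close>)
  finally show ?thesis
    using F(2) pc by (intro bexI[of _ ?p]) (auto intro!: P.M.finsum_closed)
qed

lemma induced_surj:
  assumes P: "lmod R P" and Q: "lmod R Q" and f: "f \<in> module_hom R P Q"
    and P0: "P0 \<subseteq> carrier P"
    and e: "\<And>j. j \<in> J \<Longrightarrow> e j \<in> carrier R" and dec: "carrier Q \<subseteq> decomposed Q Q0 J e"
    and surj: "\<And>q. q \<in> Q0 \<Longrightarrow> \<exists>p\<in>P0. f p = q" and q: "q \<in> carrier Q"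
  shows "\<exists>p\<in>carrier P. f p = q"
proof -
  obtain F z where F: "finite F" "F \<subseteq> J" "z \<in> F \<rightarrow> Q0" "q = (\<Oplus>\<^bsub>Q\<^esub>j\<in>F. e j \<odot>\<^bsub>Q\<^esub> z j)"
    using dec q by (auto simp: decomposed_def)
  have ej: "e j \<in> carrier R" if "j \<in> F" for j using that F e by blast
  have pre: "\<exists>p\<in>P0. f p = z j" if "j \<in> F" for j using surj that F(3) by blast
  show ?thesis
    unfolding F(4) by (rule decomposed_preimage[OF P Q f P0 F(1) ej pre])
qed

text \<open>Decompose \<open>q\<close> into translates of elements \<open>z j\<close> of
  \<open>Q0\<close>. The translates of their images under \<open>g\<close> sum to zero in
  \<open>N\<close>, so independence there makes \<open>g\<close> vanish on each \<open>z j\<close>;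
  the preimages of the \<open>z j\<close> in \<open>P0\<close> are then recombined.\<close>

lemma induced_exact:
  assumes P: "lmod R P" and Q: "lmod R Q" and N: "lmod R N"
    and f: "f \<in> module_hom R P Q" and g: "g \<in> module_hom R Q N"
    and P0: "P0 \<subseteq> carrier P" and Q0: "Q0 \<subseteq> carrier Q" and gQ0: "\<And>q. q \<in> Q0 \<Longrightarrow> g q \<in> N0" "N0 \<subseteq> carrier N"
    and e: "\<And>j. j \<in> J \<Longrightarrow> e j \<in> carrier R"
    and dec: "carrier Q \<subseteq> decomposed Q Q0 J e" and ind: "translates_indep N N0 J e"
    and ex: "\<And>q. q \<in> Q0 \<Longrightarrow> g q = \<zero>\<^bsub>N\<^esub> \<Longrightarrow> \<exists>p\<in>P0. f p = q"
    and q: "q \<in> carrier Q" "g q = \<zero>\<^bsub>N\<^esub>"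
  shows "\<exists>p\<in>carrier P. f p = q"
proof -
  interpret Q: lmod R Q by fact
  interpret N: lmod R N by fact
  obtain F z where F: "finite F" "F \<subseteq> J" "z \<in> F \<rightarrow> Q0" "q = (\<Oplus>\<^bsub>Q\<^esub>j\<in>F. e j \<odot>\<^bsub>Q\<^esub> z j)"
    using dec q by (auto simp: decomposed_def)
  have ej: "e j \<in> carrier R" if "j \<in> F" for j using that F e by blast
  have zj: "z j \<in> Q0" "z j \<in> carrier Q" if "j \<in> F" for j using that F Q0 by auto
  have "g q = (\<Oplus>\<^bsub>N\<^esub>j\<in>F. g (e j \<odot>\<^bsub>Q\<^esub> z j))"
    unfolding F(4) by (rule module_hom_finsum[OF g Q.M.abelian_group_axioms N.M.abelian_group_axioms F(1)])
      (use ej zj in auto)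
  also have "\<dots> = (\<Oplus>\<^bsub>N\<^esub>j\<in>F. e j \<odot>\<^bsub>N\<^esub> g (z j))"
    by (intro N.M.finsum_cong') (use ej zj gQ0 in \<open>auto simp: module_homD[OF g] Pi_iff\<close>)
  finally have "(\<Oplus>\<^bsub>N\<^esub>j\<in>F. e j \<odot>\<^bsub>N\<^esub> g (z j)) = \<zero>\<^bsub>N\<^esub>" using q by simp
  moreover have "(\<lambda>j. g (z j)) \<in> F \<rightarrow> N0" using zj gQ0 by auto
  ultimately have gz: "g (z j) = \<zero>\<^bsub>N\<^esub>" if "j \<in> F" for j
    using ind[unfolded translates_indep_def, rule_format, OF F(1,2), of "\<lambda>j. g (z j)"] that by blast
  have pre: "\<exists>p\<in>P0. f p = z j" if "j \<in> F" for j using ex zj gz that by blast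
  show ?thesis
    unfolding F(4) by (rule decomposed_preimage[OF P Q f P0 F(1) ej pre])
qed

text \<open>Makes \<open>decomposed\<close> and \<open>translates_indep\<close>, which speak of
  modules, applicable to the ring itself.\<close>

definition regular_module :: "('r, 'x) ring_scheme \<Rightarrow> ('r, 'r) module"
  where "regular_module R = \<lparr>carrier = carrier R, mult = undefined, one = undefined, zero = \<zero>\<^bsub>R\<^esub>,
    add = add R, smult = mult R\<rparr>"

lemma regular_module_simps [simp]:
  "carrier (regular_module R) = carrier R" "\<zero>\<^bsub>regular_module R\<^esub> = \<zero>\<^bsub>R\<^esub>"
  "add (regular_module R) = add R" "r \<odot>\<^bsub>regular_module R\<^esub> x = r \<otimes>\<^bsub>R\<^esub> x"
  by (simp_all add: regular_module_def)

lemma (in ring) regular_lmod: "lmod R (regular_module R)"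
proof -
  have "abelian_group (regular_module R)"
    by (rule abelian_groupI) (use l_neg in \<open>auto simp: a_ac\<close>)
  then show ?thesis
    by (intro lmod.intro lmod_axioms.intro ring_axioms) (simp_all add: l_distr r_distr m_assoc)
qed

text \<open>\<open>finsum\<close> takes the carrier of its record into account, so agreement of
  addition and zero does not settle the matter by unfolding; the sums are compared by
  induction.\<close>

lemma finsum_restrict:
  assumes "abelian_monoid M'" "abelian_monoid M" and sub: "carrier M' \<subseteq> carrier M"
    and ops: "add M' = add M" "\<zero>\<^bsub>M'\<^esub> = \<zero>\<^bsub>M\<^esub>" and "finite Y" "f \<in> Y \<rightarrow> carrier M'"
  shows "finsum M' f Y = finsum M f Y"
proof -
  interpret M': abelian_monoid M' by fact
  interpret M: abelian_monoid M by fact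
  show ?thesis
    using assms(6,7)
  proof (induction Y rule: finite_induct)
    case (insert y Y)
    then have "f \<in> Y \<rightarrow> carrier M'" "f y \<in> carrier M'" "f \<in> Y \<rightarrow> carrier M" "f y \<in> carrier M"
      using sub by auto
    with insert show ?case by (simp add: ops)
  qed (simp add: ops)
qed

lemma free_ext_restrict:
  assumes "lmod D N'" "lmod R N" and sub: "carrier N' \<subseteq> carrier N"
    and ops: "add N' = add N" "\<zero>\<^bsub>N'\<^esub> = \<zero>\<^bsub>N\<^esub>" "smult N' = smult N" "\<zero>\<^bsub>D\<^esub> = \<zero>\<^bsub>R\<^esub>"
    and b: "b \<in> X \<rightarrow> carrier N'" and f: "f \<in> carrier (free_module D X)"
  shows "free_ext D N' b f = free_ext R N b f"
proof -
  interpret N': lmod D N' by fact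
  interpret N: lmod R N by fact
  have "(\<Oplus>\<^bsub>N'\<^esub>x\<in>{x. f x \<noteq> \<zero>\<^bsub>D\<^esub>}. f x \<odot>\<^bsub>N'\<^esub> b x) = (\<Oplus>\<^bsub>N\<^esub>x\<in>{x. f x \<noteq> \<zero>\<^bsub>D\<^esub>}. f x \<odot>\<^bsub>N'\<^esub> b x)"
    by (rule finsum_restrict[OF N'.M.abelian_monoid_axioms N.M.abelian_monoid_axioms sub ops(1,2)])
      (use b f in \<open>auto simp: free_carrier subset_iff Pi_iff\<close>)
  then show ?thesis by (simp add: free_ext_def ops)
qed

text \<open>The elements \<open>e j\<close> form a basis of \<open>R\<close> as a right module over
  \<open>D\<close>, and \<open>M\<close> is the direct sum of the translates of \<open>M'\<close> by
  the same elements; in this sense \<open>M\<close> stands for the module induced from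
  \<open>M'\<close>.\<close>

locale free_extension = R: lmod R M + D: lmod D M'
  for R :: "('r, 'x) ring_scheme" and M :: "('r, 'm, 'y) module_scheme"
    and D :: "('r, 'x) ring_scheme" and M' :: "('r, 'm, 'y) module_scheme" +
  fixes J :: "'j set" and e :: "'j \<Rightarrow> 'r"
  assumes D_sub: "carrier D \<subseteq> carrier R"
    and D_ops: "add D = add R" "mult D = mult R" "\<zero>\<^bsub>D\<^esub> = \<zero>\<^bsub>R\<^esub>" "\<one>\<^bsub>D\<^esub> = \<one>\<^bsub>R\<^esub>"
    and M'_sub: "carrier M' \<subseteq> carrier M"
    and M'_ops: "add M' = add M" "\<zero>\<^bsub>M'\<^esub> = \<zero>\<^bsub>M\<^esub>" "smult M' = smult M"
    and e: "\<And>j. j \<in> J \<Longrightarrow> e j \<in> carrier R"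
    and decR: "carrier R \<subseteq> decomposed (regular_module R) (carrier D) J e"
    and indR: "translates_indep (regular_module R) (carrier D) J e"
    and decM: "carrier M \<subseteq> decomposed M (carrier M') J e"
    and indM: "translates_indep M (carrier M') J e"
begin

lemma free_sub: "carrier (free_module D X) \<subseteq> carrier (free_module R X)"
proof
  fix f assume "f \<in> carrier (free_module D X)"
  then show "f \<in> carrier (free_module R X)"
    unfolding free_carrier D_ops using D_sub by blast
qed

lemma free_ops:
  "add (free_module D X) = add (free_module R X)" "\<zero>\<^bsub>free_module D X\<^esub> = \<zero>\<^bsub>free_module R X\<^esub>"
  "smult (free_module D X) = smult (free_module R X)"
  by (simp_all add: free_module_def D_ops)

text \<open>Each coefficient of a function on the generators is decomposed in \<open>R\<close>
  separately.\<close>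

lemma free_decomposed:
  "carrier (free_module R X) \<subseteq> decomposed (free_module R X) (carrier (free_module D X)) J e"
proof
  interpret F: lmod R "free_module R X" by (rule R.R.free_lmod)
  interpret FD: lmod D "free_module D X" by (rule D.R.free_lmod)
  have sub: "carrier (free_module D X) \<subseteq> carrier (free_module R X)"
    "\<zero>\<^bsub>free_module R X\<^esub> \<in> carrier (free_module D X)"
    "\<And>f g. f \<in> carrier (free_module D X) \<Longrightarrow> g \<in> carrier (free_module D X) \<Longrightarrow>
      f \<oplus>\<^bsub>free_module R X\<^esub> g \<in> carrier (free_module D X)"
    using free_sub FD.M.zero_closed FD.M.a_closed by (auto simp: free_ops)
  note dec_add = F.decomposed_add[OF sub e]
  have single: "r \<odot>\<^bsub>free_module R X\<^esub> free_gen R x \<in> decomposed (free_module R X) (carrier (free_module D X)) J e"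
    if r: "r \<in> carrier R" and x: "x \<in> X" for r x
  proof -
    obtain G z where G: "finite G" "G \<subseteq> J" "z \<in> G \<rightarrow> carrier D"
        "r = (\<Oplus>\<^bsub>regular_module R\<^esub>j\<in>G. e j \<odot>\<^bsub>regular_module R\<^esub> z j)"
      using decR r unfolding decomposed_def by blast
    have zj: "z j \<in> carrier R" "z j \<in> carrier D" "e j \<in> carrier R" if "j \<in> G" for j
      using G D_sub e that by auto
    let ?g = "free_gen D x"
    have gen: "free_gen R x = ?g" unfolding free_gen_def D_ops by (rule refl)
    have gc: "?g \<in> carrier (free_module R X)" unfolding gen[symmetric] by (rule R.R.free_gen_closed[OF x])
    have h: "(\<lambda>r. r \<odot>\<^bsub>free_module R X\<^esub> ?g) \<in> module_hom R (regular_module R) (free_module R X)"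
      using gc by (intro module_homI) (simp_all add: F.smult_l_distr F.smult_assoc)
    interpret RR: lmod R "regular_module R" by (rule R.R.regular_lmod)
    have "r \<odot>\<^bsub>free_module R X\<^esub> ?g =
        (\<Oplus>\<^bsub>free_module R X\<^esub>j\<in>G. (e j \<odot>\<^bsub>regular_module R\<^esub> z j) \<odot>\<^bsub>free_module R X\<^esub> ?g)"
      unfolding G(4)
      by (rule module_hom_finsum[OF h RR.M.abelian_group_axioms F.M.abelian_group_axioms G(1)])
        (use zj in auto)
    also have "\<dots> = (\<Oplus>\<^bsub>free_module R X\<^esub>j\<in>G. e j \<odot>\<^bsub>free_module R X\<^esub> (z j \<odot>\<^bsub>free_module D X\<^esub> ?g))"
      by (intro F.M.finsum_cong') (use zj gc in \<open>auto simp: F.smult_assoc free_ops\<close>)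
    finally have "r \<odot>\<^bsub>free_module R X\<^esub> ?g =
        (\<Oplus>\<^bsub>free_module R X\<^esub>j\<in>G. e j \<odot>\<^bsub>free_module R X\<^esub> (z j \<odot>\<^bsub>free_module D X\<^esub> ?g))" .
    moreover have "(\<lambda>j. z j \<odot>\<^bsub>free_module D X\<^esub> ?g) \<in> G \<rightarrow> carrier (free_module D X)"
      using zj(2) x by auto
    ultimately show ?thesis
      unfolding decomposed_def gen using G(1,2) by blast
  qed
  fix f assume "f \<in> carrier (free_module R X)"
  then show "f \<in> decomposed (free_module R X) (carrier (free_module D X)) J e"
  proof (induction f rule: R.R.free_induct)
    case zero
    show ?case using F.decomposed_zero[OF sub e] by (simp add: free_simps)
  next
    case (add r x f)
    then show ?case by (intro dec_add single)
  qed
qed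

text \<open>Evaluation at a generator is a linear map to \<open>R\<close>, where independence is
  assumed.\<close>

lemma free_indep: "translates_indep (free_module R X) (carrier (free_module D X)) J e"
  unfolding translates_indep_def
proof (intro allI impI ballI)
  interpret F: lmod R "free_module R X" by (rule R.R.free_lmod)
  interpret RR: lmod R "regular_module R" by (rule R.R.regular_lmod)
  fix G z j
  assume G: "finite G" "G \<subseteq> J" "z \<in> G \<rightarrow> carrier (free_module D X)"
    and sum: "(\<Oplus>\<^bsub>free_module R X\<^esub>j\<in>G. e j \<odot>\<^bsub>free_module R X\<^esub> z j) = \<zero>\<^bsub>free_module R X\<^esub>"
    and j: "j \<in> G"
  have zj: "z j \<in> carrier (free_module R X)" "z j x \<in> carrier D" "e j \<in> carrier R" if "j \<in> G" for j x
  proof -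
    have z: "z j \<in> carrier (free_module D X)" using G that by auto
    then show "z j \<in> carrier (free_module R X)" by (rule subsetD[OF free_sub])
    show "z j x \<in> carrier D" "e j \<in> carrier R" using z e G that by (auto simp: free_carrier)
  qed
  have "z j x = \<zero>\<^bsub>R\<^esub>" for x
  proof -
    have h: "(\<lambda>f. f x) \<in> module_hom R (free_module R X) (regular_module R)"
      by (intro module_homI) (simp_all add: free_simps free_carrier)
    have "(\<Oplus>\<^bsub>regular_module R\<^esub>j\<in>G. (e j \<odot>\<^bsub>free_module R X\<^esub> z j) x) =
        (\<Oplus>\<^bsub>free_module R X\<^esub>j\<in>G. e j \<odot>\<^bsub>free_module R X\<^esub> z j) x"
      by (rule module_hom_finsum[OF h F.M.abelian_group_axioms RR.M.abelian_group_axioms G(1), symmetric])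
        (use zj in auto)
    then have "(\<Oplus>\<^bsub>regular_module R\<^esub>j\<in>G. e j \<odot>\<^bsub>regular_module R\<^esub> z j x) = \<zero>\<^bsub>regular_module R\<^esub>"
      using sum by (simp add: free_simps)
    moreover have "(\<lambda>j. z j x) \<in> G \<rightarrow> carrier D" using zj(2) by blast
    ultimately have "\<forall>j\<in>G. z j x = \<zero>\<^bsub>regular_module R\<^esub>"
      using indR G(1,2) unfolding translates_indep_def by blast
    with j show ?thesis by simp
  qed
  then show "z j = \<zero>\<^bsub>free_module R X\<^esub>" by (auto simp: free_simps)
qed

text \<open>Exactness in degree \<open>n\<close> uses decomposition in degree \<open>n\<close> and
  independence in the target of the map leaving that degree; the target is \<open>M\<close> for
  \<open>n = 0\<close> and a free module otherwise.\<close>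

theorem induced_resolution:
  assumes "free_resolution D M' X bd aug"
  shows "free_resolution R M X bd aug"
proof -
  interpret res: free_resolution D M' X bd aug by fact
  let ?F = "\<lambda>n. free_module R (X n)"
  have F: "lmod R (?F n)" for n by (rule R.R.free_lmod)
  \<comment> \<open>On elements with coefficients in \<open>D\<close> the extensions over
    \<open>D\<close> and over \<open>R\<close> coincide, so cycles and boundaries of the small
    resolution keep their meaning.\<close>
  have extM: "free_ext D M' aug f = free_ext R M aug f" if "f \<in> carrier (res.F 0)" for f
    by (rule free_ext_restrict[OF D.lmod R.lmod M'_sub M'_ops D_ops(3) res.aug that])
  have extF: "free_ext D (res.F n) bd f = free_ext R (?F n) bd f" if "f \<in> carrier (res.F (Suc n))" for n f
    by (rule free_ext_restrict[OF res.F.lmod F free_sub free_ops D_ops(3) res.bd_closed that])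
  have aug: "aug \<in> X 0 \<rightarrow> carrier M" using res.aug M'_sub by blast
  have bdc: "bd \<in> X (Suc n) \<rightarrow> carrier (?F n)" for n using res.bd_closed free_sub by blast
  show ?thesis
  proof (intro free_resolution.intro free_resolution_axioms.intro R.lmod aug)
    fix x n assume "x \<in> X (Suc n)"
    from res.bd[OF this] show "bd x \<in> res_cycles R M X bd aug n"
      using free_sub[of "X n"] extM extF
      by (cases n) (auto simp: res.cyc_0 res.cyc_Suc res_cycles_def M'_ops free_ops subset_iff)
  next
    fix m assume m: "m \<in> carrier M"
    have sj: "\<exists>p\<in>carrier (res.F 0). free_ext R M aug p = q" if "q \<in> carrier M'" for q
      using res.aug_surj[OF that] extM by auto
    show "\<exists>z\<in>carrier (?F 0). free_ext R M aug z = m"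
      by (rule induced_surj[OF F R.lmod R.free_ext_hom[OF aug] free_sub e decM sj m])
  next
    fix z n assume z: "z \<in> res_cycles R M X bd aug n"
    note bd_hom = lmod.free_ext_hom[OF F bdc]
    show "\<exists>w\<in>carrier (?F (Suc n)). free_ext R (?F n) bd w = z"
    proof (cases n)
      case 0
      have M'c: "free_ext R M aug q \<in> carrier M'" if "q \<in> carrier (res.F 0)" for q
        using D.free_ext_closed[OF res.aug that] extM[OF that] by simp
      have ex: "\<exists>p\<in>carrier (res.F (Suc 0)). free_ext R (?F 0) bd p = q"
        if "q \<in> carrier (res.F 0)" "free_ext R M aug q = \<zero>\<^bsub>M\<^esub>" for q
        using res.exact[of q 0] that extM extF[of _ 0] by (auto simp: res.cyc_0 M'_ops)
      have "\<exists>w\<in>carrier (?F (Suc 0)). free_ext R (?F 0) bd w = z"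
        by (rule induced_exact[OF F F R.lmod bd_hom R.free_ext_hom[OF aug] free_sub free_sub M'c M'_sub e
          free_decomposed indM ex]) (use z 0 in \<open>auto simp: res_cycles_def\<close>)
      then show ?thesis using 0 by simp
    next
      case (Suc m)
      have Fc: "free_ext R (?F m) bd q \<in> carrier (res.F m)" if "q \<in> carrier (res.F (Suc m))" for q
        using res.F.free_ext_closed[OF res.bd_closed that] extF[OF that] by simp
      have ex: "\<exists>p\<in>carrier (res.F (Suc (Suc m))). free_ext R (?F (Suc m)) bd p = q"
        if "q \<in> carrier (res.F (Suc m))" "free_ext R (?F m) bd q = \<zero>\<^bsub>?F m\<^esub>" for q
        using res.exact[of q "Suc m"] that extF[of _ "Suc m"] extF[OF that(1)] by (auto simp: res.cyc_Suc free_ops)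
      have "\<exists>w\<in>carrier (?F (Suc (Suc m))). free_ext R (?F (Suc m)) bd w = z"
        by (rule induced_exact[OF F F F bd_hom bd_hom free_sub free_sub Fc free_sub e
          free_decomposed free_indep ex]) (use z Suc in \<open>auto simp: res_cycles_def\<close>)
      then show ?thesis using Suc by simp
    qed
  qed
qed

end

section \<open>\<open>D\<close> as an algebra that acts on \<open>A\<close>\<close>

context module_algebra
begin

sublocale RB: bimodule K B B "mult B" "mult B"
  by (rule B.regular_bimodule)

abbreviation "Be \<equiv> env_alg K B"
abbreviation "Dalg \<equiv> D_alg K H \<Delta> S A act"
abbreviation "Dmod \<equiv> D_module_alg K H \<Delta> A act"
abbreviation "RM \<equiv> regular_env_module K B"

lemma RM_eq: "RM = env_module K B B (mult B) (mult B)"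
  by (simp add: regular_env_module_def)

lemma RM_lmod: "lmod E.TA RM"
  using RB.env_lmod by (simp add: RM_eq env_alg_def)

lemma RM_simps [simp]: "carrier RM = carrier B" "\<zero>\<^bsub>RM\<^esub> = \<zero>\<^bsub>B\<^esub>" "add RM = add B"
  by (simp_all add: RM_eq)

lemma RM_pure: "u \<in> carrier B \<Longrightarrow> y \<in> carrier B \<Longrightarrow> b \<in> carrier B \<Longrightarrow>
    E.pure u y \<odot>\<^bsub>RM\<^esub> b = u \<otimes>\<^bsub>B\<^esub> (b \<otimes>\<^bsub>B\<^esub> y)"
  unfolding RM_eq by (rule RB.env_smult_pure)

lemma RM_hom: "b \<in> carrier B \<Longrightarrow> (\<lambda>t. t \<odot>\<^bsub>RM\<^esub> b) \<in> module_hom K E.T B"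
  unfolding RM_eq by (rule RB.env_smult_hom)

lemma Dalg_simps [simp]:
  "carrier Dalg = D" "add Dalg = add E.T" "\<zero>\<^bsub>Dalg\<^esub> = \<zero>\<^bsub>E.T\<^esub>" "smult Dalg = smult E.T"
  "mult Dalg = mult E.TA" "\<one>\<^bsub>Dalg\<^esub> = \<one>\<^bsub>E.TA\<^esub>"
  by (simp_all add: D_alg_def env_alg_def)

lemma Dmod_simps [simp]:
  "carrier Dmod = \<iota> ` carrier A" "add Dmod = add B" "\<zero>\<^bsub>Dmod\<^esub> = \<zero>\<^bsub>B\<^esub>" "smult Dmod = smult RM"
  by (simp_all add: D_module_alg_def regular_env_module_def env_module_def)

lemma D_subset: "D \<subseteq> carrier E.T"
  using D_closed by blast

lemma Dalg_algebra: "assoc_algebra K Dalg"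
proof (rule assoc_algebraI)
  have "submodule D K E.T"
    by (rule E.T.submoduleI) (auto simp: D_subset D_zero D_minus D_add D_smult)
  then have "module K (E.T\<lparr>carrier := D\<rparr>)" by (rule submodule.submodule_is_module[OF _ EM])
  then show "module K Dalg" by (rule module.update_module) simp_all
  show "monoid Dalg"
    by (rule monoidI) (use D_closed D_mult D_one E.TA.A.m_assoc E.TA.A.l_one E.TA.A.r_one in \<open>auto simp del: E.TA_simps(5)\<close>)
qed (use D_closed in \<open>simp_all add: module_homD[OF E.mult_left_hom] module_homD[OF E.mult_right_hom]\<close>)

lemma restrict_lmod:
  assumes "lmod E.TA N" shows "lmod Dalg N"
proof -
  interpret N: lmod E.TA N by fact
  interpret DA: assoc_algebra K Dalg by (rule Dalg_algebra)
  show ?thesis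
    by (intro lmod.intro lmod_axioms.intro DA.A.ring_axioms N.M.abelian_group_axioms)
      (use D_closed N.smult_l_distr N.smult_r_distr N.smult_assoc N.smult_one in \<open>simp_all\<close>)
qed

text \<open>The generator \<open>dgen a b h\<close> sends \<open>c\<close> to
  \<open>a h_1 c S(h_2) b\<close>, and \<open>iota_act\<close> identifies the middle part with the
  element of \<open>A\<close> obtained by letting \<open>h\<close> act on \<open>c\<close>.\<close>

lemma D_acts:
  assumes t: "t \<in> D" and m: "m \<in> \<iota> ` carrier A"
  shows "t \<odot>\<^bsub>RM\<^esub> m \<in> \<iota> ` carrier A"
proof -
  obtain c where c: "m = \<iota> c" "c \<in> carrier A" using m by blast
  then have mB: "m \<in> carrier B" by simp
  note hm = RM_hom[OF mB]
  show ?thesis using t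
  proof (induction t rule: D_induct)
    case zero
    have "\<zero>\<^bsub>E.T\<^esub> \<odot>\<^bsub>RM\<^esub> m = \<iota> \<zero>\<^bsub>A\<^esub>"
      using module_hom_zero[OF hm E.T.M.abelian_group_axioms B.M.abelian_group_axioms]
        module_hom_zero[OF iota_hom A.M.abelian_group_axioms B.M.abelian_group_axioms] by simp
    then show ?case by (rule image_eqI) simp
  next
    case (add a b h t)
    obtain d where d: "t \<odot>\<^bsub>RM\<^esub> m = \<iota> d" "d \<in> carrier A" using add by blast
    have f: "(\<lambda>z. \<iota> a \<otimes>\<^bsub>B\<^esub> z \<otimes>\<^bsub>B\<^esub> \<iota> b) \<in> module_hom K B B"
      using add by (intro module_homI) (simp_all add: B_linear)
    have "dgen a b h \<odot>\<^bsub>RM\<^esub> m = H.Sw B h (\<lambda>x y. AH.pure a x \<otimes>\<^bsub>B\<^esub> (\<iota> c \<otimes>\<^bsub>B\<^esub> (\<eta> (S y) \<otimes>\<^bsub>B\<^esub> \<iota> b)))"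
      using add c by (simp add: dgen_sw H.sw_hom[OF EM BM hm[unfolded c(1)]] RM_pure H.antipode_simps)
    also have "\<dots> = H.Sw B h (\<lambda>x y. \<iota> a \<otimes>\<^bsub>B\<^esub> (\<eta> x \<otimes>\<^bsub>B\<^esub> \<iota> c \<otimes>\<^bsub>B\<^esub> \<eta> (S y)) \<otimes>\<^bsub>B\<^esub> \<iota> b)"
      using add c by (simp add: mult_iota_eta[symmetric] B.A.m_assoc H.antipode_simps)
    also have "\<dots> = \<iota> a \<otimes>\<^bsub>B\<^esub> \<iota> (act h c) \<otimes>\<^bsub>B\<^esub> \<iota> b"
      using add c by (simp add: H.sw_hom[OF BM BM f, symmetric] H.antipode_simps iota_act)
    also have "\<dots> = \<iota> (a \<otimes>\<^bsub>A\<^esub> act h c \<otimes>\<^bsub>A\<^esub> b)"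
      using add c by (simp add: iota_mult act_simps)
    finally have "(dgen a b h \<oplus>\<^bsub>E.T\<^esub> t) \<odot>\<^bsub>RM\<^esub> m = \<iota> (a \<otimes>\<^bsub>A\<^esub> act h c \<otimes>\<^bsub>A\<^esub> b \<oplus>\<^bsub>A\<^esub> d)"
      using add c d D_closed by (simp add: module_homD(2)[OF hm[unfolded c(1)]] incl_linear act_simps)
    then show ?case by (rule image_eqI) (use add c d in \<open>simp add: act_simps\<close>)
  qed
qed

lemma Dmod_lmod: "lmod Dalg Dmod"
proof -
  interpret RM: lmod E.TA RM by (rule RM_lmod)
  interpret DA: assoc_algebra K Dalg by (rule Dalg_algebra)
  have sub: "\<iota> ` carrier A \<subseteq> carrier B" by auto
  have "submodule (\<iota> ` carrier A) K B" by (rule A.image_submodule[OF BM iota_hom])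
  from submodule.submodule_is_module[OF this BM]
  interpret I: module K "B\<lparr>carrier := \<iota> ` carrier A\<rparr>" .
  have "abelian_group Dmod"
  proof (rule abelian_groupI)
    fix x assume "x \<in> carrier Dmod"
    then show "\<exists>y\<in>carrier Dmod. y \<oplus>\<^bsub>Dmod\<^esub> x = \<zero>\<^bsub>Dmod\<^esub>"
      using I.M.l_neg[of x] I.M.a_inv_closed[of x]
      by (intro bexI[of _ "\<ominus>\<^bsub>B\<lparr>carrier := \<iota> ` carrier A\<rparr>\<^esub> x"]) simp_all
  qed (use I.M.a_closed I.M.zero_closed I.M.a_assoc I.M.a_comm I.M.l_zero in simp_all)
  then show ?thesis
    by (intro lmod.intro lmod_axioms.intro DA.A.ring_axioms)
      (use D_closed sub RM.smult_l_distr RM.smult_r_distr RM.smult_assoc RM.smult_one D_acts in \<open>simp_all add: subset_iff\<close>)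
qed

section \<open>Splitting along a basis of \<open>H\<close>\<close>

context
  fixes J :: "'h set" and coord :: "'h \<Rightarrow> 'h \<Rightarrow> 'k"
  assumes J: "J \<subseteq> carrier H"
    and spans: "\<And>x. x \<in> carrier H \<Longrightarrow> \<exists>f\<in>carrier (free_module K J). free_ext K H (\<lambda>x. x) f = x"
    and coord: "\<And>j x. x \<in> carrier H \<Longrightarrow> coord j x \<in> carrier K"
      "\<And>j x y. x \<in> carrier H \<Longrightarrow> y \<in> carrier H \<Longrightarrow> coord j (x \<oplus>\<^bsub>H\<^esub> y) = coord j x \<oplus>\<^bsub>K\<^esub> coord j y"
      "\<And>j c x. c \<in> carrier K \<Longrightarrow> x \<in> carrier H \<Longrightarrow> coord j (c \<odot>\<^bsub>H\<^esub> x) = c \<otimes>\<^bsub>K\<^esub> coord j x"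
    and dual: "\<And>i j. j \<in> J \<Longrightarrow> coord i j = (if j = i then \<one>\<^bsub>K\<^esub> else \<zero>\<^bsub>K\<^esub>)"
begin

text \<open>For \<open>j\<close> in the basis this is the coefficient at \<open>j\<close> of an
  element of \<open>B\<close>, as an element of the copy of \<open>A\<close>.\<close>

definition pick :: "'h \<Rightarrow> ('k, 'a, 'h) tensor \<Rightarrow> ('k, 'a, 'h) tensor"
  where "pick j = tensor_lift K A H B (\<lambda>a h. coord j h \<odot>\<^bsub>B\<^esub> \<iota> a)"

lemma pick_bilinear: "bilinear K A H B (\<lambda>a h. coord j h \<odot>\<^bsub>B\<^esub> \<iota> a)"
  by (intro bilinearI module_homI)
    (simp_all add: coord incl_linear B.smult_l_distr B.smult_r_distr B.smult_assoc1[symmetric] H.R.m_comm)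

lemma pick_hom: "pick j \<in> module_hom K B B"
  unfolding pick_def by (rule B_lift_hom[OF BM pick_bilinear])

lemma pick_pure: "a \<in> carrier A \<Longrightarrow> h \<in> carrier H \<Longrightarrow> pick j (AH.pure a h) = coord j h \<odot>\<^bsub>B\<^esub> \<iota> a"
  unfolding pick_def by (rule AH.tensor_lift_pure[OF BM pick_bilinear])

text \<open>\<open>pick j\<close> on the second factor, conjugated by the invertible map
  \<open>twist\<close>. It reads off the coefficient in \<open>D\<close> at the translate that
  belongs to \<open>j\<close>.\<close>

definition Epick :: "'h \<Rightarrow> ('k, ('k, 'a, 'h) tensor, ('k, 'a, 'h) tensor) tensor \<Rightarrow>
    ('k, ('k, 'a, 'h) tensor, ('k, 'a, 'h) tensor) tensor"
  where "Epick j t = twist S (tensor_lift K B (op_alg B) E.T (\<lambda>u y. E.pure u (pick j y)) (twist (\<lambda>x. x) t))"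

lemma Epick_bilinear: "bilinear K B (op_alg B) E.T (\<lambda>u y. E.pure u (pick j y))"
  by (intro bilinearI module_homI) (simp_all add: E_linear module_homD[OF pick_hom])

lemma Epick_hom: "Epick j \<in> module_hom K E.T E.T"
  unfolding Epick_def[abs_def]
  by (intro module_hom_comp[OF twist_hom[OF module_hom_id]]
    module_hom_comp[OF E.tensor_lift_hom[OF EM Epick_bilinear]] twist_hom[OF H.antipode_linear])

text \<open>For \<open>dgen a b h\<close> the map \<open>twist\<close> of the identity turns the
  product back into \<open>ah \<otimes> bl\<close>, from whose second factor \<open>pick j\<close>
  extracts \<open>coord j l\<close> times \<open>b\<close>.\<close>

lemma Epick_translate:
  assumes l: "l \<in> carrier H" and t: "t \<in> D"
  shows "Epick j (E.pure \<one>\<^bsub>B\<^esub> (\<eta> l) \<otimes>\<^bsub>E.TA\<^esub> t) = coord j l \<odot>\<^bsub>E.T\<^esub> t"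
  using t
proof (induction t rule: D_induct)
  case zero
  show ?case
    using l coord module_hom_zero[OF Epick_hom E.T.M.abelian_group_axioms E.T.M.abelian_group_axioms]
    by (simp add: E.mult_zero_right)
next
  case (add a b h t)
  have p: "E.pure \<one>\<^bsub>B\<^esub> (\<eta> l) \<in> carrier E.T" using l by simp
  have "E.pure \<one>\<^bsub>B\<^esub> (\<eta> l) \<otimes>\<^bsub>E.TA\<^esub> dgen a b h = twist S (E.pure (AH.pure a h) (AH.pure b l))"
    using add l by (simp add: dgen_def mult_eta_twist[OF H.antipode_linear] mult_iota_eta)
  then have "Epick j (E.pure \<one>\<^bsub>B\<^esub> (\<eta> l) \<otimes>\<^bsub>E.TA\<^esub> dgen a b h) = twist S (E.pure (AH.pure a h) (coord j l \<odot>\<^bsub>B\<^esub> \<iota> b))"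
    using add l by (simp add: Epick_def twist_inverse E.tensor_lift_pure[OF EM Epick_bilinear] pick_pure)
  also have "\<dots> = coord j l \<odot>\<^bsub>E.T\<^esub> dgen a b h"
    using add l by (simp add: dgen_def Epure_linear coord module_homD(3)[OF twist_hom[OF H.antipode_linear]])
  finally show ?case
    using add l D_closed by (simp add: module_homD(2)[OF E.mult_left_hom[OF p]] module_homD(2)[OF Epick_hom]
      E.mult_closed E.T.smult_r_distr coord)
qed

abbreviation "ej j \<equiv> E.pure \<one>\<^bsub>B\<^esub> (\<eta> j)"

lemma ej_closed: "j \<in> J \<Longrightarrow> ej j \<in> carrier E.T"
  using J by auto

text \<open>A projection \<open>p i\<close> that picks the \<open>i\<close>-th term out of a sum of
  translates shows this term to be zero. Linearity over \<open>K\<close> is all that is asked of it,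
  hence the second record \<open>U\<close> for the vector space underlying \<open>N\<close>.\<close>

lemma translates_indepI:
  assumes N: "lmod E.TA N" "module K U" and U: "carrier U = carrier N" "add U = add N" "\<zero>\<^bsub>U\<^esub> = \<zero>\<^bsub>N\<^esub>"
    and N0: "N0 \<subseteq> carrier N" and p: "\<And>i. p i \<in> module_hom K U U"
    and pe: "\<And>i j z. j \<in> J \<Longrightarrow> z \<in> N0 \<Longrightarrow> p i (ej j \<odot>\<^bsub>N\<^esub> z) = coord i j \<odot>\<^bsub>U\<^esub> z"
  shows "translates_indep N N0 J ej"
  unfolding translates_indep_def
proof (intro allI impI ballI)
  interpret N: lmod E.TA N by fact
  interpret U: module K U by fact
  fix F z i
  assume F: "finite F" "F \<subseteq> J" "z \<in> F \<rightarrow> N0" and sum: "(\<Oplus>\<^bsub>N\<^esub>j\<in>F. ej j \<odot>\<^bsub>N\<^esub> z j) = \<zero>\<^bsub>N\<^esub>" and i: "i \<in> F"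
  have zj: "z j \<in> N0" "z j \<in> carrier U" "j \<in> J" if "j \<in> F" for j using F N0 U that by auto
  have c: "(\<lambda>j. ej j \<odot>\<^bsub>N\<^esub> z j) \<in> F \<rightarrow> carrier U"
    using zj ej_closed by (auto simp: U)
  have "(\<Oplus>\<^bsub>U\<^esub>j\<in>F. ej j \<odot>\<^bsub>N\<^esub> z j) = (\<Oplus>\<^bsub>N\<^esub>j\<in>F. ej j \<odot>\<^bsub>N\<^esub> z j)"
    by (rule finsum_restrict[OF U.M.abelian_monoid_axioms N.M.abelian_monoid_axioms _ U(2,3) F(1) c]) (simp add: U)
  then have "p i (\<Oplus>\<^bsub>U\<^esub>j\<in>F. ej j \<odot>\<^bsub>N\<^esub> z j) = \<zero>\<^bsub>U\<^esub>"
    using sum module_hom_zero[OF p U.M.abelian_group_axioms U.M.abelian_group_axioms] by (simp add: U)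
  then have "\<zero>\<^bsub>U\<^esub> = (\<Oplus>\<^bsub>U\<^esub>j\<in>F. p i (ej j \<odot>\<^bsub>N\<^esub> z j))"
    using module_hom_finsum[OF p U.M.abelian_group_axioms U.M.abelian_group_axioms F(1) c] by simp
  also have "\<dots> = (\<Oplus>\<^bsub>U\<^esub>j\<in>F. if i = j then z j else \<zero>\<^bsub>U\<^esub>)"
    by (intro U.M.finsum_cong') (use zj in \<open>auto simp: pe dual\<close>)
  also have "\<dots> = z i"
    by (rule U.M.finsum_singleton[OF i F(1)]) (use zj in auto)
  finally show "z i = \<zero>\<^bsub>N\<^esub>" by (simp add: U)
qed

lemma translates_indep_D: "translates_indep (regular_module E.TA) D J ej"
proof (rule translates_indepI[OF _ EM])
  show "lmod E.TA (regular_module E.TA)" by (rule E.TA.A.regular_lmod)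
  show "Epick i \<in> module_hom K E.T E.T" for i by (rule Epick_hom)
  show "Epick i (ej j \<odot>\<^bsub>regular_module E.TA\<^esub> z) = coord i j \<odot>\<^bsub>E.T\<^esub> z" if "j \<in> J" "z \<in> D" for i j z
    using Epick_translate[of j z i] J that by auto
qed (use D_subset in auto)

lemma ej_iota: "j \<in> carrier H \<Longrightarrow> a \<in> carrier A \<Longrightarrow> ej j \<odot>\<^bsub>RM\<^esub> \<iota> a = AH.pure a j"
  by (simp add: RM_pure mult_iota_eta)

lemma translates_indep_A: "translates_indep RM (\<iota> ` carrier A) J ej"
proof (rule translates_indepI[OF RM_lmod BM])
  show "pick i \<in> module_hom K B B" for i by (rule pick_hom)
  show "pick i (ej j \<odot>\<^bsub>RM\<^esub> z) = coord i j \<odot>\<^bsub>B\<^esub> z" if "j \<in> J" "z \<in> \<iota> ` carrier A" for i j z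
    using J that by (auto simp: ej_iota pick_pure subset_iff)
qed auto

text \<open>\<open>Q\<close> is not assumed to be a subspace: for the sets \<open>decomposed\<close>
  only zero, sums and single translates are available, and scalars are absorbed when the assumption
  \<open>basis\<close> is checked.\<close>

lemma basis_hom_mem:
  assumes U: "module K U" and f: "f \<in> module_hom K H U" and Q: "\<zero>\<^bsub>U\<^esub> \<in> Q"
    "\<And>x y. x \<in> Q \<Longrightarrow> y \<in> Q \<Longrightarrow> x \<oplus>\<^bsub>U\<^esub> y \<in> Q"
    and basis: "\<And>c j. c \<in> carrier K \<Longrightarrow> j \<in> J \<Longrightarrow> c \<odot>\<^bsub>U\<^esub> f j \<in> Q" and l: "l \<in> carrier H"
  shows "f l \<in> Q"
proof -
  interpret U: module K U by fact
  interpret HL: lmod K H by (rule H.is_lmod)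
  interpret UL: lmod K U by (rule U.is_lmod)
  obtain g where g: "g \<in> carrier (free_module K J)" "free_ext K H (\<lambda>x. x) g = l"
    using spans[OF l] by blast
  have JH: "(\<lambda>x. x) \<in> J \<rightarrow> carrier H" using J by auto
  have fJ: "f \<in> J \<rightarrow> carrier U" using J by (auto simp: module_homD(1)[OF f])
  interpret F: lmod K "free_module K J" by (rule H.R.free_lmod)
  note h = UL.free_ext_hom[OF fJ]
  have "f l = free_ext K U f g"
    using HL.free_ext_comp[OF UL.lmod JH f g(1)] g(2) by simp
  moreover have "free_ext K U f g \<in> Q"
    using g(1)
  proof (induction g rule: H.R.free_induct)
    case zero
    have "free_ext K U f \<zero>\<^bsub>free_module K J\<^esub> = \<zero>\<^bsub>U\<^esub>"
      by (rule module_hom_zero[OF h F.M.abelian_group_axioms U.M.abelian_group_axioms])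
    then show ?case using Q(1) by (simp add: free_simps)
  next
    case (add r x g)
    then have "free_ext K U f (r \<odot>\<^bsub>free_module K J\<^esub> free_gen K x \<oplus>\<^bsub>free_module K J\<^esub> g) =
        r \<odot>\<^bsub>U\<^esub> f x \<oplus>\<^bsub>U\<^esub> free_ext K U f g"
      using fJ by (simp add: module_homD[OF h] UL.free_ext_gen Pi_iff)
    then show ?case using add Q(2) basis by simp
  qed
  ultimately show ?thesis by simp
qed

lemma decomposed_A: "carrier RM \<subseteq> decomposed RM (\<iota> ` carrier A) J ej"
proof
  interpret RM: lmod E.TA RM by (rule RM_lmod)
  interpret DM: lmod Dalg Dmod by (rule Dmod_lmod)
  let ?Q = "decomposed RM (\<iota> ` carrier A) J ej"
  have sub: "\<iota> ` carrier A \<subseteq> carrier RM" "\<zero>\<^bsub>RM\<^esub> \<in> \<iota> ` carrier A"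
    "\<And>x y. x \<in> \<iota> ` carrier A \<Longrightarrow> y \<in> \<iota> ` carrier A \<Longrightarrow> x \<oplus>\<^bsub>RM\<^esub> y \<in> \<iota> ` carrier A"
    using DM.M.zero_closed DM.M.a_closed by auto
  have e: "ej j \<in> carrier E.TA" if "j \<in> J" for j using ej_closed that by simp
  have Q: "\<zero>\<^bsub>RM\<^esub> \<in> ?Q" "\<And>x y. x \<in> ?Q \<Longrightarrow> y \<in> ?Q \<Longrightarrow> x \<oplus>\<^bsub>RM\<^esub> y \<in> ?Q"
    "\<And>j z. j \<in> J \<Longrightarrow> z \<in> \<iota> ` carrier A \<Longrightarrow> ej j \<odot>\<^bsub>RM\<^esub> z \<in> ?Q"
    using RM.decomposed_zero[OF sub e] RM.decomposed_add[OF sub e] RM.decomposed_single[OF sub e] by simp_all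
  fix b assume "b \<in> carrier RM"
  then have "b \<in> carrier AH.T" by (simp add: B_simps)
  then show "b \<in> ?Q"
  proof (induction b rule: AH.tensor_induct)
    case zero
    show ?case using Q(1) by (simp add: B_simps)
  next
    case (add a l b)
    have f: "(\<lambda>l. AH.pure a l) \<in> module_hom K H B"
      using add by (intro module_homI) (simp_all add: pure_add_right pure_smult_right)
    have "AH.pure a l \<in> ?Q"
    proof (rule basis_hom_mem[OF BM f _ _ _ add(2)])
      fix c j assume cj: "c \<in> carrier K" "j \<in> J"
      \<comment> \<open>The scalar is moved into \<open>A\<close>, since translates carry no
        coefficient from \<open>K\<close>.\<close>
      then have "c \<odot>\<^bsub>B\<^esub> AH.pure a j = ej j \<odot>\<^bsub>RM\<^esub> \<iota> (c \<odot>\<^bsub>A\<^esub> a)"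
        using add J by (simp add: ej_iota pure_smult_left subset_iff)
      then show "c \<odot>\<^bsub>B\<^esub> AH.pure a j \<in> ?Q"
        using Q(3)[OF cj(2), of "\<iota> (c \<odot>\<^bsub>A\<^esub> a)"] add cj by simp
    qed (use Q(1,2) in simp_all)
    from Q(2)[OF this add.IH] show ?case by (simp add: B_simps)
  qed
qed

text \<open>\<open>twist S\<close> is onto, so its values on \<open>ah \<otimes> bl\<close> suffice.
  By linearity in \<open>l\<close> only basis elements matter, and there the value is the translate
  of \<open>dgen a b h\<close> by that element.\<close>

lemma decomposed_D: "carrier E.TA \<subseteq> decomposed (regular_module E.TA) D J ej"
proof
  interpret RE: lmod E.TA "regular_module E.TA" by (rule E.TA.A.regular_lmod)
  let ?Q = "decomposed (regular_module E.TA) D J ej"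
  have sub: "D \<subseteq> carrier (regular_module E.TA)" "\<zero>\<^bsub>regular_module E.TA\<^esub> \<in> D"
    "\<And>x y. x \<in> D \<Longrightarrow> y \<in> D \<Longrightarrow> x \<oplus>\<^bsub>regular_module E.TA\<^esub> y \<in> D"
    using D_subset D_zero D_add by auto
  have e: "ej j \<in> carrier E.TA" if "j \<in> J" for j using ej_closed that by simp
  have Q0: "\<zero>\<^bsub>E.T\<^esub> \<in> ?Q" and Qadd: "x \<in> ?Q \<Longrightarrow> y \<in> ?Q \<Longrightarrow> x \<oplus>\<^bsub>E.T\<^esub> y \<in> ?Q"
    and Qs: "j \<in> J \<Longrightarrow> z \<in> D \<Longrightarrow> ej j \<otimes>\<^bsub>E.TA\<^esub> z \<in> ?Q" for x y j z
    using RE.decomposed_zero[OF sub e] RE.decomposed_add[OF sub e] RE.decomposed_single[OF sub e]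
    by simp_all
  note tS = twist_hom[OF H.antipode_linear]
  have t0: "twist S \<zero>\<^bsub>E.T\<^esub> = \<zero>\<^bsub>E.T\<^esub>"
    by (rule module_hom_zero[OF tS E.T.M.abelian_group_axioms E.T.M.abelian_group_axioms])
  have gen: "twist S (E.pure (AH.pure a h) (AH.pure b l)) \<in> ?Q"
    if c: "a \<in> carrier A" "h \<in> carrier H" "b \<in> carrier A" "l \<in> carrier H" for a h b l
  proof (rule basis_hom_mem[OF EM _ Q0 Qadd _ c(4)])
    show "(\<lambda>l. twist S (E.pure (AH.pure a h) (AH.pure b l))) \<in> module_hom K H E.T"
      by (rule module_hom_comp[OF _ tS], rule module_homI) (use c in \<open>simp_all add: E_linear\<close>)
    fix k j assume kj: "k \<in> carrier K" "j \<in> J"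
    then have jH: "j \<in> carrier H" using J by auto
    then have p: "ej j \<in> carrier E.T" by simp
    have "k \<odot>\<^bsub>E.T\<^esub> twist S (E.pure (AH.pure a h) (AH.pure b j)) = ej j \<otimes>\<^bsub>E.TA\<^esub> dgen (k \<odot>\<^bsub>A\<^esub> a) b h"
      using c kj jH by (simp add: dgen_def mult_eta_twist[OF H.antipode_linear] mult_iota_eta
        Epure_linear pure_smult_left module_homD(1,3)[OF tS] module_homD(3)[OF E.mult_left_hom[OF p]])
    then show "k \<odot>\<^bsub>E.T\<^esub> twist S (E.pure (AH.pure a h) (AH.pure b j)) \<in> ?Q"
      using Qs[OF kj(2) D_dgen[of "k \<odot>\<^bsub>A\<^esub> a" b h]] c kj by simp
  qed
  have gen2: "twist S (E.pure (AH.pure a h) y) \<in> ?Q" if c: "a \<in> carrier A" "h \<in> carrier H" and y: "y \<in> carrier B" for a h y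
    using y[unfolded B_simps]
  proof (induction y rule: AH.tensor_induct)
    case zero
    have "E.pure (AH.pure a h) \<zero>\<^bsub>B\<^esub> = \<zero>\<^bsub>E.T\<^esub>"
      by (rule module_hom_zero[OF Epure_hom_right B.M.abelian_group_axioms E.T.M.abelian_group_axioms])
        (use c in simp)
    then show ?case using t0 Q0 by (simp add: B_simps)
  next
    case (add b l y)
    then have y: "y \<in> carrier B" by (simp add: B_simps)
    have "twist S (E.pure (AH.pure a h) (AH.pure b l \<oplus>\<^bsub>B\<^esub> y)) =
        twist S (E.pure (AH.pure a h) (AH.pure b l)) \<oplus>\<^bsub>E.T\<^esub> twist S (E.pure (AH.pure a h) y)"
      using c add(1,2) y by (simp add: Epure_linear module_homD(2)[OF tS])
    then show ?case using Qadd[OF gen[OF c add(1,2)] add.IH] by (simp add: B_simps)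
  qed
  have gen3: "twist S (E.pure u y) \<in> ?Q" if u: "u \<in> carrier B" and y: "y \<in> carrier B" for u y
    using u[unfolded B_simps]
  proof (induction u rule: AH.tensor_induct)
    case zero
    have "E.pure \<zero>\<^bsub>B\<^esub> y = \<zero>\<^bsub>E.T\<^esub>"
      by (rule module_hom_zero[OF Epure_hom_left[OF y] B.M.abelian_group_axioms E.T.M.abelian_group_axioms])
    then show ?case using t0 Q0 by (simp add: B_simps)
  next
    case (add a h u)
    then have u: "u \<in> carrier B" by (simp add: B_simps)
    have "twist S (E.pure (AH.pure a h \<oplus>\<^bsub>B\<^esub> u) y) =
        twist S (E.pure (AH.pure a h) y) \<oplus>\<^bsub>E.T\<^esub> twist S (E.pure u y)"
      using y add(1,2) u by (simp add: Epure_linear module_homD(2)[OF tS])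
    then show ?case using Qadd[OF gen2[OF add(1,2) y] add.IH] by (simp add: B_simps)
  qed
  fix t assume "t \<in> carrier E.TA"
  then have t: "t \<in> carrier E.T" by simp
  have "twist S t' \<in> ?Q" if "t' \<in> carrier E.T" for t'
    using that
  proof (induction t' rule: E.tensor_induct)
    case zero
    show ?case using t0 Q0 by simp
  next
    case (add u y t')
    then show ?case using gen3 Qadd by (simp add: module_homD(2)[OF tS])
  qed
  \<comment> \<open>Surjectivity of \<open>twist S\<close>: \<open>t\<close> is its value at
    \<open>twist\<close> of the identity applied to \<open>t\<close>.\<close>
  from this[OF module_homD(1)[OF twist_hom[OF module_hom_id] t]] show "t \<in> ?Q"
    by (simp add: twist_inverse[OF t])
qed

lemma extension_of_basis: "free_extension E.TA RM Dalg Dmod J ej"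
proof -
  have "carrier E.TA \<subseteq> decomposed (regular_module E.TA) (carrier Dalg) J ej"
    "translates_indep (regular_module E.TA) (carrier Dalg) J ej"
    "carrier RM \<subseteq> decomposed RM (carrier Dmod) J ej" "translates_indep RM (carrier Dmod) J ej"
    using decomposed_D translates_indep_D decomposed_A translates_indep_A by simp_all
  then show ?thesis
    by (intro free_extension.intro free_extension_axioms.intro RM_lmod Dmod_lmod)
      (use D_subset ej_closed in \<open>auto simp del: E.TA_simps(5)\<close>)
qed

end

section \<open>Comparison of the two Ext spaces\<close>

theorem Ext_env_iso:
  assumes "field K" and N: "lmod Be N"
  shows "is_module_iso K (Ext Be RM N n) (Ext Dalg Dmod N n)"
proof -
  have "vector_space_record K H"
    by (intro vector_space_record.intro assms(1) H.module_axioms)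
  then obtain J and coord :: "'h \<Rightarrow> 'h \<Rightarrow> 'k" where "J \<subseteq> carrier H"
    and "\<And>x. x \<in> carrier H \<Longrightarrow> \<exists>f\<in>carrier (free_module K J). free_ext K H (\<lambda>x. x) f = x"
    and "\<And>j x. x \<in> carrier H \<Longrightarrow> coord j x \<in> carrier K"
    and "\<And>j x y. x \<in> carrier H \<Longrightarrow> y \<in> carrier H \<Longrightarrow> coord j (x \<oplus>\<^bsub>H\<^esub> y) = coord j x \<oplus>\<^bsub>K\<^esub> coord j y"
    and "\<And>j c x. c \<in> carrier K \<Longrightarrow> x \<in> carrier H \<Longrightarrow> coord j (c \<odot>\<^bsub>H\<^esub> x) = c \<otimes>\<^bsub>K\<^esub> coord j x"
    and "\<And>i j. j \<in> J \<Longrightarrow> coord i j = (if j = i then \<one>\<^bsub>K\<^esub> else \<zero>\<^bsub>K\<^esub>)"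
    by (rule vector_space_record.basis_exists) (rule that)
  from extension_of_basis[OF this]
  interpret X: free_extension E.TA RM Dalg Dmod J "\<lambda>j. E.pure \<one>\<^bsub>B\<^esub> (\<eta> j)" .
  have NE: "lmod E.TA N" using N by (simp add: env_alg_def)
  \<comment> \<open>\<open>gen_aug\<close> also serves as augmentation of the resolution carried
    over from \<open>D\<close>: its values lie in the copy of \<open>A\<close> inside
    \<open>B\<close>, whose translates span \<open>B\<close>.\<close>
  have "ext_transfer K E.TA RM Dalg Dmod N gen_aug"
    by (intro ext_transfer.intro ext_transfer_axioms.intro ext_setting.intro hom_setting.intro
        E.TA_algebra Dalg_algebra RM_lmod Dmod_lmod NE restrict_lmod[OF NE]
        X.induced_resolution[OF X.D.standard_resolution])
      simp_all
  from ext_transfer.Ext_iso[OF this] show ?thesis by (simp add: env_alg_def)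
qed

end

theorem theorem4p3:
  fixes K :: "'k ring" and H :: "('k, 'h) module"
    and \<Delta> :: "'h \<Rightarrow> ('k, 'h, 'h) tensor" and \<epsilon> :: "'h \<Rightarrow> 'k" and S :: "'h \<Rightarrow> 'h"
    and A :: "('k, 'a) module" and act :: "'h \<Rightarrow> 'a \<Rightarrow> 'a"
    and M :: "('k, 'm) module"
    and lact :: "('k, 'a, 'h) tensor \<Rightarrow> 'm \<Rightarrow> 'm" and ract :: "'m \<Rightarrow> ('k, 'a, 'h) tensor \<Rightarrow> 'm"
  defines "B \<equiv> smash K H \<Delta> A act"
  assumes "field K"
    and "hopf_algebra K H \<Delta> \<epsilon> S" and "bij_betw S (carrier H) (carrier H)"
    and "module_algebra K H \<Delta> \<epsilon> S A act"
    and "bimodule K B M lact ract"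
  shows "\<forall>n. is_module_iso K
    (HH K B (env_module K B M lact ract) n)
    (Ext (D_alg K H \<Delta> S A act) (D_module_alg K H \<Delta> A act) (env_module K B M lact ract) n)"
proof
  fix n
  have "lmod (env_alg K B) (env_module K B M lact ract)"
    by (rule bimodule.env_lmod) fact
  then show "is_module_iso K
    (HH K B (env_module K B M lact ract) n)
    (Ext (D_alg K H \<Delta> S A act) (D_module_alg K H \<Delta> A act) (env_module K B M lact ract) n)"
    unfolding HH_def B_def
    by (rule module_algebra.Ext_env_iso[OF assms(5,2)])
qed

end
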